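(* Let $m\ge2$ and, for $\ell\in\mathbb N$, let $T_\ell$ be the $\ell$-th Gaussian eigenfunction on the unit sphere $\mathbb S^m$. Let $M:\mathbb R\to\mathbb R$ be measurable with $\mathbb E[M(Z)^2]<+\infty$, where $Z\sim\mathcal N(0,1)$, and set $S_\ell(M)=\int_{\mathbb S^m}M(T_\ell(x))\,dx$. If $J_2(M):=\mathbb E[M(Z)H_2(Z)]\neq0$, where $H_2(t)=t^2-1$, then, as $\ell\to+\infty$ along even integers, $$d_W\left(\frac{S_\ell(M)-\mathbb E[S_\ell(M)]}{\sqrt{\mathrm{Var}(S_\ell(M))}},\,Z\right)=O(\ell^{-1/2}).$$
   Context: $dx$ is the (unnormalized) surface measure on $\mathbb S^m\subset\mathbb R^{m+1}$. $T_\ell$ is the centered Gaussian random field on $\mathbb S^m$ (with continuous paths) with covariance $\mathbb E[T_\ell(x)T_\ell(y)]=G_{\ell;m}(\cos d(x,y))$, where $d(x,y)$ is the geodesic distance and $G_{\ell;m}$ is the Gegenbauer polynomial normalized by $G_{\ell;m}(1)=1$, i.e. $G_{\ell;m}=P_\ell^{(\frac m2-1,\frac m2-1)}/\binom{\ell+\frac m2-1}{\ell}$ with $P_\ell^{(\alpha,\beta)}$ the Jacobi polynomials. Equivalently $T_\ell=\sum_k a_{\ell,k}Y_{\ell,k}$, where $(Y_{\ell,k})_k$ is a real $L^2(dx)$-orthonormal basis of the eigenspace of the Laplace–Beltrami operator with eigenvalue $-\ell(\ell+m-1)$ and the $a_{\ell,k}$ are i.i.d. centered Gaussian with variance $\mathrm{vol}(\mathbb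 S^m)$ divided by the dimension of the eigenspace. $d_W$ is the Wasserstein distance $d_W(X,Y)=\sup_h|\mathbb E h(X)-\mathbb E h(Y)|$ over functions $h:\mathbb R\to\mathbb R$ with Lipschitz constant at most one. *)

theory Defs
  imports "HOL-Probability.Probability"
begin

(* Unnormalized surface measure on the unit sphere, as the cone measure: a Borel set A of the
   sphere gets d times the volume of the truncated cone over A, where d is the dimension of the
   ambient space. Note that sgn x = x /\<^sub>R norm x is the radial projection. *)
definition sphere_measure :: "'a::euclidean_space measure" where
  "sphere_measure =
     scale_measure (ennreal (real DIM('a)))
       (distr (restrict_space lborel (ball 0 1 - {0})) (restrict_space borel (sphere 0 1)) sgn)"

lemma emeasure_sphere_measure:
  fixes A :: "'a::euclidean_space set"
  assumes "A \<in> sets borel" and "A \<subseteq> sphere 0 1"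
  shows "emeasure sphere_measure A =
           ennreal (real DIM('a)) * emeasure lborel {x \<in> ball 0 1 - {0}. x /\<^sub>R norm x \<in> A}"
proof -
  have m: "sgn \<in> measurable (restrict_space lborel (ball 0 1 - {0::'a}))
             (restrict_space borel (sphere 0 1))"
  proof (rule measurable_restrict_space2)
    show "sgn \<in> space (restrict_space lborel (ball 0 1 - {0::'a})) \<rightarrow> sphere 0 1"
      by (auto simp: space_restrict_space norm_sgn)
    have "sgn = (\<lambda>x::'a. x /\<^sub>R norm x)"
      by (simp add: fun_eq_iff sgn_div_norm)
    then have "(sgn :: 'a \<Rightarrow> 'a) \<in> borel_measurable borel"
      by simp
    then have "(sgn :: 'a \<Rightarrow> 'a) \<in> borel_measurable lborel"
      by simp
    then show "(sgn :: 'a \<Rightarrow> 'a) \<in> borel_measurable (restrict_space lborel (ball 0 1 - {0}))"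
      by (rule measurable_restrict_space1)
  qed
  have A: "A \<in> sets (restrict_space borel (sphere 0 1))"
    using assms by (auto simp: sets_restrict_space_iff)
  have "emeasure (distr (restrict_space lborel (ball 0 1 - {0})) (restrict_space borel (sphere 0 1)) sgn) A
      = emeasure (restrict_space lborel (ball 0 1 - {0}))
          (sgn -` A \<inter> space (restrict_space lborel (ball 0 1 - {0})))"
    by (rule emeasure_distr[OF m A])
  also have "\<dots> = emeasure lborel (sgn -` A \<inter> space (restrict_space lborel (ball 0 1 - {0})))"
    by (rule emeasure_restrict_space) (auto simp: space_restrict_space)
  also have "sgn -` A \<inter> space (restrict_space lborel (ball 0 1 - {0}))
      = {x \<in> ball 0 1 - {0}. x /\<^sub>R norm x \<in> A}"
    by (auto simp: space_restrict_space sgn_div_norm)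
  finally show ?thesis
    by (simp add: sphere_measure_def)
qed

definition geodesic_dist :: "'a::euclidean_space \<Rightarrow> 'a \<Rightarrow> real" where
  "geodesic_dist x y = arccos (x \<bullet> y)"

definition jacobi :: "real \<Rightarrow> real \<Rightarrow> nat \<Rightarrow> real \<Rightarrow> real" where
  "jacobi \<alpha> \<beta> n x =
     (\<Sum>k\<le>n. ((real n + \<alpha>) gchoose (n - k)) * ((real n + \<beta>) gchoose k) *
            ((x - 1) / 2) ^ k * ((x + 1) / 2) ^ (n - k))"

definition gegenbauer :: "nat \<Rightarrow> nat \<Rightarrow> real \<Rightarrow> real" where
  "gegenbauer l m x =
     jacobi (real m / 2 - 1) (real m / 2 - 1) l x / ((real l + real m / 2 - 1) gchoose l)"

lemma gegenbauer_at_1: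
  assumes "m \<ge> 2"
  shows "gegenbauer l m 1 = 1"
proof -
  have "jacobi (real m / 2 - 1) (real m / 2 - 1) l 1
      = (\<Sum>k\<le>l. if k = 0 then (real l + (real m / 2 - 1)) gchoose l else 0)"
    unfolding jacobi_def by (intro sum.cong) auto
  also have "\<dots> = (real l + real m / 2 - 1) gchoose l"
    by (simp add: algebra_simps)
  finally have j: "jacobi (real m / 2 - 1) (real m / 2 - 1) l 1
      = (real l + real m / 2 - 1) gchoose l" .
  have "(real l + real m / 2 - 1) gchoose l \<noteq> 0"
    using assms by (auto simp: gbinomial_prod_rev)
  then show ?thesis
    by (simp add: gegenbauer_def j)
qed

(* Degenerate (zero variance) laws count as Gaussian; normal_density requires positive variance. *)
definition centered_gaussian :: "'w measure \<Rightarrow> ('w \<Rightarrow> real) \<Rightarrow> bool" where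
  "centered_gaussian P X \<longleftrightarrow>
     X \<in> borel_measurable P \<and>
     (distr P borel X = return borel 0 \<or>
      (\<exists>\<sigma>>0. distributed P lborel X (\<lambda>x. ennreal (normal_density 0 \<sigma> x))))"

definition centered_gaussian_field ::
    "'x set \<Rightarrow> 'w measure \<Rightarrow> ('x \<Rightarrow> 'w \<Rightarrow> real) \<Rightarrow> bool" where
  "centered_gaussian_field D P T \<longleftrightarrow>
     (\<forall>I c. finite I \<longrightarrow> I \<subseteq> D \<longrightarrow> centered_gaussian P (\<lambda>\<omega>. \<Sum>x\<in>I. c x * T x \<omega>))"

definition gaussian_eigenfunction ::
    "nat \<Rightarrow> nat \<Rightarrow> 'w measure \<Rightarrow> ('a::euclidean_space \<Rightarrow> 'w \<Rightarrow> real) \<Rightarrow> bool" where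
  "gaussian_eigenfunction m l P T \<longleftrightarrow>
     prob_space P \<and>
     centered_gaussian_field (sphere 0 1) P T \<and>
     (\<forall>\<omega>\<in>space P. continuous_on (sphere 0 1) (\<lambda>x. T x \<omega>)) \<and>
     (\<forall>x\<in>sphere 0 1. \<forall>y\<in>sphere 0 1.
        prob_space.expectation P (\<lambda>\<omega>. T x \<omega> * T y \<omega>)
          = gegenbauer l m (cos (geodesic_dist x y)))"

definition sphere_functional ::
    "(real \<Rightarrow> real) \<Rightarrow> ('a::euclidean_space \<Rightarrow> 'w \<Rightarrow> real) \<Rightarrow> 'w \<Rightarrow> real" where
  "sphere_functional M T \<omega> = (LINT x|sphere_measure. M (T x \<omega>))"

(* Wasserstein distance between the laws of the integrable random variables X on P and Y on Q. *)
definition wasserstein ::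
    "'w measure \<Rightarrow> ('w \<Rightarrow> real) \<Rightarrow> 'z measure \<Rightarrow> ('z \<Rightarrow> real) \<Rightarrow> ennreal" where
  "wasserstein P X Q Y =
     (SUP h\<in>{h :: real \<Rightarrow> real. 1-lipschitz_on UNIV h}.
        ennreal \<bar>prob_space.expectation P (\<lambda>\<omega>. h (X \<omega>)) - prob_space.expectation Q (\<lambda>\<omega>. h (Y \<omega>))\<bar>)"

end

theory Submission
  imports Defs "HOL-Real_Asymp.Real_Asymp"
begin

text \<open>
  A Karhunen--Loeve basis of the first chaos writes \<open>T\<close> as \<open>\<tau> a x = \<Sum>\<phi>\<^sub>k x a\<^sub>k\<close> with \<open>a\<close> a standard
  Gaussian vector; the reproducing property of the Gegenbauer kernel makes \<open>\<phi>\<close> orthogonal on the sphere,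
  so that no spherical harmonics are needed. Split \<open>M\<close> into its Hermite part \<open>\<Phi>\<close> of orders two to four
  and a remainder \<open>\<psi>\<close> of order at least five; the parts of order zero and one contribute only a constant.
  The variance coming from \<open>\<Phi>\<close> is of order \<open>N\<^sub>2\<close>, where \<open>N\<^sub>k\<close> integrates \<open>\<bar>G\<^sub>l (cos \<theta>)\<bar>\<^sup>k sin\<^sup>m\<^sup>-\<^sup>1 \<theta>\<close>,
  while the contribution of \<open>\<psi>\<close> to the variance is at most of order \<open>N\<^sub>5\<close>. The \<open>\<Phi>\<close> part is handled by
  Stein's method: if \<open>t \<xi>' - \<xi>'' = \<Phi>\<close>, Gaussian integration by parts reduces the distance to the normal law
  to the fluctuation of \<open>\<Gamma> = \<Sum>\<^sub>k \<integral>\<Phi>'(\<tau>) \<phi>\<^sub>k \<integral>\<xi>'(\<tau>) \<phi>\<^sub>k\<close>. The terms of \<open>\<Gamma>\<close> containing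
  the second Hermite component fluctuate at the scale \<open>N\<^sub>2\<^sup>1\<^sup>/\<^sup>2\<close>, because they are sums over the many basis
  functions; the remaining ones are at most of order \<open>N\<^sub>3 / N\<^sub>2\<close>.
  Finally \<open>N\<^sub>2 = O(1/l)\<close>, \<open>N\<^sub>3 / N\<^sub>2 = O(l\<^sup>-\<^sup>1\<^sup>/\<^sup>2)\<close> and \<open>N\<^sub>5 / N\<^sub>2 = O(1/l)\<close> by energy estimates for the
  Gegenbauer equation.
\<close>

section \<open>Joint laws from characteristic functions\<close>

text \<open>Orders three and four cannot be left to the remainder. A remainder of order
  \<open>k\<close> is controlled only through its variance, at the cost
  \<open>sqrt (N_k / N_2)\<close>: this is \<open>l^(-1/4)\<close> for \<open>k = 3\<close>, and for
  \<open>k = 4\<close> and \<open>m = 2\<close> a logarithm is left over, so \<open>k = 5\<close> is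
  the first order that meets the rate in every dimension. Conversely, Stein's method needs
  derivatives, and \<open>M\<close> is merely square integrable; hence the polynomial part carries
  all derivatives and the remainder is only measured in L2. For the remainder no Hermite series is
  summed: orthogonality to the powers below \<open>k\<close> cancels the Taylor terms of Mehler's
  exponential below order \<open>k\<close>, and this alone gives correlations of size
  \<open>|\<rho>|^k\<close>. Because each field has a finite expansion, gradient and divergence are
  those of \<open>R^n\<close>; the product law of the coefficients has to be recovered from the laws
  of linear combinations, which are all that the definition of the field provides.\<close>

text \<open>Dividing \<open>W\<close> by its mass \<open>w\<close> turns it into a density; under
  the new probability \<open>X\<close> has the standard normal characteristic function, so Levy
  uniqueness in one dimension gives its law. The weight is what later carries the other
  coordinates.\<close>

lemma weighted_char_std_normal:
  fixes X W :: "'w \<Rightarrow> real"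
  assumes P: "prob_space P" and X [measurable]: "X \<in> borel_measurable P" and W [measurable]: "W \<in> borel_measurable P"
    and W0: "\<And>\<omega>. 0 \<le> W \<omega>" and Wb: "\<And>\<omega>. W \<omega> \<le> b"
    and cs: "\<And>t. (\<integral>\<omega>. W \<omega> * cos (t * X \<omega>) \<partial>P) = w * exp (- t\<^sup>2 / 2)"
    and sn: "\<And>t. (\<integral>\<omega>. W \<omega> * sin (t * X \<omega>) \<partial>P) = 0"
    and B [measurable]: "B \<in> sets borel"
  shows "(\<integral>\<omega>. W \<omega> * indicator B (X \<omega>) \<partial>P) = w * measure std_normal_distribution B"
proof -
  interpret P: prob_space P by fact
  have bnd: "integrable P (\<lambda>\<omega>. W \<omega> * f \<omega>)" if [measurable]: "f \<in> borel_measurable P" and "\<And>\<omega>. \<bar>f \<omega>\<bar> \<le> 1" for f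
  proof (rule P.integrable_const_bound[where B = b])
    have "\<bar>W \<omega> * f \<omega>\<bar> \<le> b * 1" for \<omega>
      unfolding abs_mult by (rule mult_mono) (use W0[of \<omega>] Wb[of \<omega>] that in auto)
    then show "AE x in P. norm (W x * f x) \<le> b" by simp
  qed measurable
  have w: "(\<integral>\<omega>. W \<omega> \<partial>P) = w" using cs[of 0] by simp
  have Wint: "integrable P W" using bnd[of "\<lambda>_. 1"] by simp
  have w0: "w \<ge> 0" unfolding w[symmetric] by (simp add: W0)
  show ?thesis
  \<comment> \<open>Without mass there is nothing to normalise, but then \<open>W\<close> vanishes
    almost everywhere and both sides are 0.\<close>
  proof (cases "w = 0")
    case True
    then have "AE \<omega> in P. W \<omega> = 0"
      using w Wint W0 integral_nonneg_eq_0_iff_AE[of P W] by auto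
    then have "(\<integral>\<omega>. W \<omega> * indicator B (X \<omega>) \<partial>P) = (\<integral>\<omega>. 0 \<partial>P)"
      by (intro integral_cong_AE) auto
    then show ?thesis using True by simp
  next
    case False
    then have wpos: "w > 0" using w0 by simp
    define Q where "Q = density P (\<lambda>\<omega>. ennreal (W \<omega> / w))"
    have "emeasure Q (space Q) = (\<integral>\<^sup>+\<omega>. ennreal (W \<omega> / w) \<partial>P)"
      unfolding Q_def by (subst emeasure_density) (auto intro!: nn_integral_cong)
    also have "\<dots> = ennreal (\<integral>\<omega>. W \<omega> / w \<partial>P)"
      by (rule nn_integral_eq_integral) (use Wint W0 wpos in auto)
    also have "\<dots> = 1" using w wpos by simp
    finally have Q: "prob_space Q" by (intro prob_spaceI)
    have XQ [measurable]: "X \<in> borel_measurable Q" unfolding Q_def by simp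
    define D where "D = distr Q borel X"
    have D: "real_distribution D" unfolding D_def
      by (intro real_distribution.intro prob_space.prob_space_distr Q real_distribution_axioms.intro) auto
    have "char D t = char std_normal_distribution t" for t
    proof -
      have "char D t = (\<integral>\<omega>. (W \<omega> / w) *\<^sub>R iexp (t * X \<omega>) \<partial>P)"
        unfolding char_def D_def
        by (subst integral_distr) (auto simp: Q_def integral_density W0 wpos less_imp_le)
      also have "\<dots> = (\<integral>\<omega>. complex_of_real (W \<omega> * cos (t * X \<omega>) / w) + \<i> * complex_of_real (W \<omega> * sin (t * X \<omega>) / w) \<partial>P)"
        by (intro Bochner_Integration.integral_cong) (auto simp: complex_eq_iff Re_exp Im_exp)
      also have "\<dots> = complex_of_real (\<integral>\<omega>. W \<omega> * cos (t * X \<omega>) / w \<partial>P)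
          + \<i> * complex_of_real (\<integral>\<omega>. W \<omega> * sin (t * X \<omega>) / w \<partial>P)"
        by (subst Bochner_Integration.integral_add)
           (auto intro!: integrable_of_real integrable_mult_right bnd simp del: of_real_mult of_real_divide)
      also have "\<dots> = complex_of_real (exp (- t\<^sup>2 / 2))"
        using cs[of t] sn[of t] wpos by simp
      finally show ?thesis by (simp add: char_std_normal_distribution)
    qed
    then have "D = std_normal_distribution"
      by (intro Levy_uniqueness D real_dist_normal_dist) auto
    then have "measure std_normal_distribution B = measure D B" by simp
    also have "\<dots> = (\<integral>\<omega>. (W \<omega> / w) * indicator B (X \<omega>) \<partial>P)"
    proof -
      have "measure D B = (\<integral>x. indicator B x \<partial>D)" by (simp add: D_def)
      also have "\<dots> = (\<integral>\<omega>. (W \<omega> / w) *\<^sub>R indicator B (X \<omega>) \<partial>P)"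
        unfolding D_def by (subst integral_distr) (auto simp: Q_def integral_density W0 wpos less_imp_le)
      finally show ?thesis by simp
    qed
    also have "\<dots> = (\<integral>\<omega>. W \<omega> * indicator B (X \<omega>) \<partial>P) / w"
      by simp
    finally show ?thesis using wpos by (simp add: field_simps)
  qed
qed

text \<open>Joint independence from one-dimensional uniqueness: the coordinates are treated one at a
  time, and step \<open>j\<close> trades the dependence on \<open>X j\<close> inside the cosine or
  sine for the indicator of \<open>B j\<close>. For \<open>j = 0\<close> the claim is the
  hypothesis, for \<open>j = n\<close> no oscillating factor is left.\<close>

lemma char_std_normal_imp_rect:
  fixes X :: "nat \<Rightarrow> 'w \<Rightarrow> real"
  assumes P: "prob_space P" and X [measurable]: "\<And>k. X k \<in> borel_measurable P"
    and cs: "\<And>c. (\<integral>\<omega>. cos (\<Sum>k<n. c k * X k \<omega>) \<partial>P) = exp (- (\<Sum>k<n. (c k)\<^sup>2) / 2)"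
    and sn: "\<And>c. (\<integral>\<omega>. sin (\<Sum>k<n. c k * X k \<omega>) \<partial>P) = 0"
    and B [measurable]: "\<And>k. B k \<in> sets borel" and "j \<le> n"
  shows "(\<integral>\<omega>. (\<Prod>k<j. indicator (B k) (X k \<omega>)) * cos (\<Sum>k=j..<n. c k * X k \<omega>) \<partial>P)
            = (\<Prod>k<j. measure std_normal_distribution (B k)) * exp (- (\<Sum>k=j..<n. (c k)\<^sup>2) / 2) \<and>
         (\<integral>\<omega>. (\<Prod>k<j. indicator (B k) (X k \<omega>)) * sin (\<Sum>k=j..<n. c k * X k \<omega>) \<partial>P) = 0"
  using \<open>j \<le> n\<close>
proof (induction j arbitrary: c)
  case 0
  then show ?case using cs[of c] sn[of c] by (simp add: lessThan_atLeast0)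
next
  case (Suc j)
  interpret P: prob_space P by fact
  define U where "U \<omega> = (\<Prod>k<j. indicator (B k) (X k \<omega>) :: real)" for \<omega>
  define Y where "Y \<omega> = (\<Sum>k=Suc j..<n. c k * X k \<omega>)" for \<omega>
  define u where "u = (\<Prod>k<j. measure std_normal_distribution (B k))"
  define e where "e = exp (- (\<Sum>k=Suc j..<n. (c k)\<^sup>2) / 2)"
  have U [measurable]: "U \<in> borel_measurable P" unfolding U_def by measurable
  have Y [measurable]: "Y \<in> borel_measurable P" unfolding Y_def by measurable
  have U01: "0 \<le> U \<omega>" "U \<omega> \<le> 1" for \<omega>
    unfolding U_def by (auto intro!: prod_nonneg prod_le_1)
  have bnd: "integrable P (\<lambda>\<omega>. U \<omega> * f \<omega>)" if [measurable]: "f \<in> borel_measurable P" and "\<And>\<omega>. \<bar>f \<omega>\<bar> \<le> 1" for f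
  proof (rule P.integrable_const_bound[where B = 1])
    have "\<bar>U \<omega> * f \<omega>\<bar> \<le> 1 * 1" for \<omega>
      unfolding abs_mult by (rule mult_mono) (use U01[of \<omega>] that in auto)
    then show "AE x in P. norm (U x * f x) \<le> 1" by simp
  qed measurable
  have split: "(\<Sum>k=j..<n. d k) = d j + (\<Sum>k=Suc j..<n. d k)" for d :: "nat \<Rightarrow> real"
    using Suc.prems by (simp add: sum.atLeast_Suc_lessThan)
  \<comment> \<open>The induction hypothesis is applied to the coefficients \<open>t\<close> at
    \<open>j\<close> and \<open>s * c k\<close> beyond. Only \<open>s = 0, 1, -1\<close> occur
    below; the last two are recombined by the addition formulas.\<close>
  have IH: "(\<integral>\<omega>. U \<omega> * cos (t * X j \<omega> + s * Y \<omega>) \<partial>P) = u * exp (- t\<^sup>2 / 2 + - (\<Sum>k=Suc j..<n. (s * c k)\<^sup>2) / 2)"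
           "(\<integral>\<omega>. U \<omega> * sin (t * X j \<omega> + s * Y \<omega>) \<partial>P) = 0" for t s
  proof -
    have ss: "(\<Sum>k=Suc j..<n. (if k = j then t else s * c k) * X k \<omega>) = s * Y \<omega>" for \<omega>
      unfolding Y_def sum_distrib_left by (rule sum.cong) auto
    have ss2: "(\<Sum>k=Suc j..<n. (if k = j then t else s * c k)\<^sup>2) = (\<Sum>k=Suc j..<n. (s * c k)\<^sup>2)"
      by (rule sum.cong) auto
    show "(\<integral>\<omega>. U \<omega> * cos (t * X j \<omega> + s * Y \<omega>) \<partial>P) = u * exp (- t\<^sup>2 / 2 + - (\<Sum>k=Suc j..<n. (s * c k)\<^sup>2) / 2)"
      "(\<integral>\<omega>. U \<omega> * sin (t * X j \<omega> + s * Y \<omega>) \<partial>P) = 0"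
      using Suc.IH[of "\<lambda>k. if k = j then t else s * c k"] Suc.prems
      unfolding split ss ss2 U_def[symmetric] u_def[symmetric] by (auto simp: add_divide_distrib diff_divide_distrib)
  qed
  have c0: "(\<integral>\<omega>. U \<omega> * cos (t * X j \<omega>) \<partial>P) = u * exp (- t\<^sup>2 / 2)" for t using IH(1)[of t 0] by simp
  have s0: "(\<integral>\<omega>. U \<omega> * sin (t * X j \<omega>) \<partial>P) = 0" for t using IH(2)[of t 0] by simp
  have c1: "(\<integral>\<omega>. U \<omega> * cos (t * X j \<omega> + Y \<omega>) \<partial>P) = u * exp (- t\<^sup>2 / 2) * e" for t
    using IH(1)[of t 1] by (simp add: e_def exp_add[symmetric] diff_divide_distrib add_divide_distrib)
  have c2: "(\<integral>\<omega>. U \<omega> * cos (t * X j \<omega> - Y \<omega>) \<partial>P) = u * exp (- t\<^sup>2 / 2) * e" for t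
    using IH(1)[of t "-1"] by (simp add: e_def exp_add[symmetric] diff_divide_distrib add_divide_distrib)
  have s1: "(\<integral>\<omega>. U \<omega> * sin (t * X j \<omega> + Y \<omega>) \<partial>P) = 0" for t using IH(2)[of t 1] by simp
  have s2: "(\<integral>\<omega>. U \<omega> * sin (t * X j \<omega> - Y \<omega>) \<partial>P) = 0" for t using IH(2)[of t "-1"] by simp
  have cc: "(\<integral>\<omega>. U \<omega> * (cos (Y \<omega>) * cos (t * X j \<omega>)) \<partial>P) = u * e * exp (- t\<^sup>2 / 2)" for t
  proof -
    have "(\<integral>\<omega>. U \<omega> * (cos (Y \<omega>) * cos (t * X j \<omega>)) \<partial>P)
        = (\<integral>\<omega>. (U \<omega> * cos (t * X j \<omega> + Y \<omega>) + U \<omega> * cos (t * X j \<omega> - Y \<omega>)) / 2 \<partial>P)"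
      by (intro Bochner_Integration.integral_cong) (auto simp: cos_add cos_diff algebra_simps)
    also have "\<dots> = (u * exp (- t\<^sup>2 / 2) * e + u * exp (- t\<^sup>2 / 2) * e) / 2"
      by (subst integral_divide_zero, subst Bochner_Integration.integral_add) (auto intro!: bnd simp: c1 c2)
    finally show ?thesis by (simp add: algebra_simps)
  qed
  have csn: "(\<integral>\<omega>. U \<omega> * (cos (Y \<omega>) * sin (t * X j \<omega>)) \<partial>P) = 0" for t
  proof -
    have "(\<integral>\<omega>. U \<omega> * (cos (Y \<omega>) * sin (t * X j \<omega>)) \<partial>P)
        = (\<integral>\<omega>. (U \<omega> * sin (t * X j \<omega> + Y \<omega>) + U \<omega> * sin (t * X j \<omega> - Y \<omega>)) / 2 \<partial>P)"
      by (intro Bochner_Integration.integral_cong) (auto simp: sin_add sin_diff algebra_simps)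
    also have "\<dots> = 0"
      by (subst integral_divide_zero, subst Bochner_Integration.integral_add) (auto intro!: bnd simp: s1 s2)
    finally show ?thesis by (simp add: algebra_simps)
  qed
  have sc: "(\<integral>\<omega>. U \<omega> * (sin (Y \<omega>) * cos (t * X j \<omega>)) \<partial>P) = 0" for t
  proof -
    have "(\<integral>\<omega>. U \<omega> * (sin (Y \<omega>) * cos (t * X j \<omega>)) \<partial>P)
        = (\<integral>\<omega>. (U \<omega> * sin (t * X j \<omega> + Y \<omega>) - U \<omega> * sin (t * X j \<omega> - Y \<omega>)) / 2 \<partial>P)"
      by (intro Bochner_Integration.integral_cong) (auto simp: sin_add sin_diff algebra_simps)
    also have "\<dots> = 0"
      by (subst integral_divide_zero, subst Bochner_Integration.integral_diff) (auto intro!: bnd simp: s1 s2)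
    finally show ?thesis by (simp add: algebra_simps)
  qed
  have ssn: "(\<integral>\<omega>. U \<omega> * (sin (Y \<omega>) * sin (t * X j \<omega>)) \<partial>P) = 0" for t
  proof -
    have "(\<integral>\<omega>. U \<omega> * (sin (Y \<omega>) * sin (t * X j \<omega>)) \<partial>P)
        = (\<integral>\<omega>. (U \<omega> * cos (t * X j \<omega> - Y \<omega>) - U \<omega> * cos (t * X j \<omega> + Y \<omega>)) / 2 \<partial>P)"
      by (intro Bochner_Integration.integral_cong) (auto simp: cos_add cos_diff algebra_simps)
    also have "\<dots> = 0"
      by (subst integral_divide_zero, subst Bochner_Integration.integral_diff) (auto intro!: bnd simp: c1 c2)
    finally show ?thesis by (simp add: algebra_simps)
  qed
  let ?g = "measure std_normal_distribution (B j)"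
  \<comment> \<open>\<open>cos (Y \<omega>)\<close> and \<open>sin (Y \<omega>)\<close> change sign
    and cannot serve as weights; \<open>1 + f (Y \<omega>)\<close> can. The surplus 1 is subtracted
    again in \<open>fin\<close>, by means of the case \<open>f = 0\<close>.\<close>
  have key: "(\<integral>\<omega>. U \<omega> * (1 + f (Y \<omega>)) * indicator (B j) (X j \<omega>) \<partial>P) = (u + v) * ?g"
    if [measurable]: "f \<in> borel_measurable borel" and f: "\<And>x. \<bar>f x\<bar> \<le> 1"
      and fc: "\<And>t. (\<integral>\<omega>. U \<omega> * (f (Y \<omega>) * cos (t * X j \<omega>)) \<partial>P) = v * exp (- t\<^sup>2 / 2)"
      and fs: "\<And>t. (\<integral>\<omega>. U \<omega> * (f (Y \<omega>) * sin (t * X j \<omega>)) \<partial>P) = 0" for f v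
  proof (rule weighted_char_std_normal[OF P, where b = 2])
    have f': "\<bar>f x * cos y\<bar> \<le> 1" "\<bar>f x * sin y\<bar> \<le> 1" for x y
      using f[of x] by (auto simp: abs_mult intro!: mult_le_one)
    show "0 \<le> U \<omega> * (1 + f (Y \<omega>))" for \<omega>
      using U01[of \<omega>] f[of "Y \<omega>"] by (auto intro!: mult_nonneg_nonneg)
    have "U \<omega> * (1 + f (Y \<omega>)) \<le> 1 * 2" for \<omega>
      by (rule mult_mono) (use U01[of \<omega>] f[of "Y \<omega>"] in auto)
    then show "U \<omega> * (1 + f (Y \<omega>)) \<le> 2" for \<omega> by simp
    fix t
    have "(\<integral>\<omega>. U \<omega> * (1 + f (Y \<omega>)) * cos (t * X j \<omega>) \<partial>P)
       = (\<integral>\<omega>. U \<omega> * cos (t * X j \<omega>) + U \<omega> * (f (Y \<omega>) * cos (t * X j \<omega>)) \<partial>P)"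
      by (intro Bochner_Integration.integral_cong) (auto simp: algebra_simps)
    also have "\<dots> = u * exp (- t\<^sup>2 / 2) + v * exp (- t\<^sup>2 / 2)"
      by (subst Bochner_Integration.integral_add) (auto intro!: bnd simp: c0 fc f')
    finally show "(\<integral>\<omega>. U \<omega> * (1 + f (Y \<omega>)) * cos (t * X j \<omega>) \<partial>P) = (u + v) * exp (- t\<^sup>2 / 2)"
      by (simp add: algebra_simps)
    have "(\<integral>\<omega>. U \<omega> * (1 + f (Y \<omega>)) * sin (t * X j \<omega>) \<partial>P)
       = (\<integral>\<omega>. U \<omega> * sin (t * X j \<omega>) + U \<omega> * (f (Y \<omega>) * sin (t * X j \<omega>)) \<partial>P)"
      by (intro Bochner_Integration.integral_cong) (auto simp: algebra_simps)
    also have "\<dots> = 0"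
      by (subst Bochner_Integration.integral_add) (auto intro!: bnd simp: s0 fs f')
    finally show "(\<integral>\<omega>. U \<omega> * (1 + f (Y \<omega>)) * sin (t * X j \<omega>) \<partial>P) = 0" .
  qed measurable
  have k0: "(\<integral>\<omega>. U \<omega> * indicator (B j) (X j \<omega>) \<partial>P) = u * ?g"
    using key[of "\<lambda>_. 0" 0] by simp
  have fin: "(\<integral>\<omega>. U \<omega> * indicator (B j) (X j \<omega>) * f (Y \<omega>) \<partial>P) = v * ?g"
    if [measurable]: "f \<in> borel_measurable borel" and f: "\<And>x. \<bar>f x\<bar> \<le> 1"
      and kk: "(\<integral>\<omega>. U \<omega> * (1 + f (Y \<omega>)) * indicator (B j) (X j \<omega>) \<partial>P) = (u + v) * ?g" for f v
  proof -
    have f': "\<bar>indicator (B j) y * f x\<bar> \<le> 1" for x y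
      using f[of x] by (auto simp: abs_mult indicator_def)
    have "(\<integral>\<omega>. U \<omega> * (1 + f (Y \<omega>)) * indicator (B j) (X j \<omega>) \<partial>P)
       = (\<integral>\<omega>. U \<omega> * indicator (B j) (X j \<omega>) + U \<omega> * (indicator (B j) (X j \<omega>) * f (Y \<omega>)) \<partial>P)"
      by (intro Bochner_Integration.integral_cong) (auto simp: algebra_simps)
    also have "\<dots> = u * ?g + (\<integral>\<omega>. U \<omega> * (indicator (B j) (X j \<omega>) * f (Y \<omega>)) \<partial>P)"
      by (subst Bochner_Integration.integral_add) (auto intro!: bnd simp: k0 f' simp del: abs_mult indicator_simps)
    finally show ?thesis using kk by (simp add: algebra_simps)
  qed
  have "(\<integral>\<omega>. U \<omega> * indicator (B j) (X j \<omega>) * cos (Y \<omega>) \<partial>P) = (u * e) * ?g"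
    by (intro fin key) (auto simp: cc csn)
  moreover have "(\<integral>\<omega>. U \<omega> * indicator (B j) (X j \<omega>) * sin (Y \<omega>) \<partial>P) = 0 * ?g"
    by (intro fin key) (auto simp: sc ssn)
  ultimately show ?case
    by (simp add: U_def Y_def u_def e_def algebra_simps)
qed

text \<open>Rectangles generate the product sigma-algebra, and
  \<open>char_std_normal_imp_rect\<close> with \<open>j = n\<close> gives their
  probabilities.\<close>

lemma char_std_normal_imp_PiM:
  fixes X :: "nat \<Rightarrow> 'w \<Rightarrow> real"
  assumes P: "prob_space P" and X [measurable]: "\<And>k. X k \<in> borel_measurable P"
    and cs: "\<And>c. (\<integral>\<omega>. cos (\<Sum>k<n. c k * X k \<omega>) \<partial>P) = exp (- (\<Sum>k<n. (c k)\<^sup>2) / 2)"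
    and sn: "\<And>c. (\<integral>\<omega>. sin (\<Sum>k<n. c k * X k \<omega>) \<partial>P) = 0"
  shows "distr P (PiM {..<n} (\<lambda>_. std_normal_distribution)) (\<lambda>\<omega>. \<lambda>k\<in>{..<n}. X k \<omega>)
     = PiM {..<n} (\<lambda>_. std_normal_distribution)"
proof -
  interpret P: prob_space P by fact
  interpret product_sigma_finite "\<lambda>_::nat. std_normal_distribution"
    by (intro product_sigma_finite.intro prob_space_imp_sigma_finite prob_space_normal_density) simp
  have sets: "sets (PiM {..<n} (\<lambda>_. std_normal_distribution)) = sets (PiM {..<n} (\<lambda>_. borel :: real measure))"
    by (intro sets_PiM_cong) auto
  have m [measurable]: "(\<lambda>\<omega>. \<lambda>k\<in>{..<n}. X k \<omega>) \<in> measurable P (PiM {..<n} (\<lambda>_. std_normal_distribution))"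
    unfolding measurable_cong_sets[OF refl sets] by measurable
  show ?thesis
  proof (rule PiM_eqI)
    fix A :: "nat \<Rightarrow> real set" assume A: "\<And>i. i \<in> {..<n} \<Longrightarrow> A i \<in> sets std_normal_distribution"
    \<comment> \<open>\<open>A\<close> is known to be measurable only at indices below
      \<open>n\<close>; the empty set fills the others.\<close>
    define B where "B k = (if k < n then A k else {})" for k
    have B [measurable]: "B k \<in> sets borel" for k using A by (auto simp: B_def)
    have AB: "Pi\<^sub>E {..<n} A = Pi\<^sub>E {..<n} B" by (intro PiE_cong) (auto simp: B_def)
    have PB: "Pi\<^sub>E {..<n} B \<in> sets (PiM {..<n} (\<lambda>_. std_normal_distribution))"
      by (intro sets_PiM_I_finite) auto
    have "emeasure (distr P (PiM {..<n} (\<lambda>_. std_normal_distribution)) (\<lambda>\<omega>. \<lambda>k\<in>{..<n}. X k \<omega>)) (Pi\<^sub>E {..<n} B)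
        = ennreal (measure P ((\<lambda>\<omega>. \<lambda>k\<in>{..<n}. X k \<omega>) -` (Pi\<^sub>E {..<n} B) \<inter> space P))"
      by (subst emeasure_distr) (auto simp: PB P.emeasure_eq_measure)
    also have "measure P ((\<lambda>\<omega>. \<lambda>k\<in>{..<n}. X k \<omega>) -` (Pi\<^sub>E {..<n} B) \<inter> space P)
        = (\<integral>\<omega>. indicator ((\<lambda>\<omega>. \<lambda>k\<in>{..<n}. X k \<omega>) -` (Pi\<^sub>E {..<n} B) \<inter> space P) \<omega> \<partial>P)"
      using measurable_sets[OF m PB] by simp
    also have "\<dots> = (\<integral>\<omega>. (\<Prod>k<n. indicator (B k) (X k \<omega>)) \<partial>P)"
    proof (intro Bochner_Integration.integral_cong refl)
      fix \<omega> assume "\<omega> \<in> space P"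
      moreover have "(\<Prod>k<i. indicator (B k) (X k \<omega>)) = (of_bool (\<forall>k<i. X k \<omega> \<in> B k) :: real)" for i
        by (induction i) (auto simp: less_Suc_eq indicator_def)
      ultimately show "indicator ((\<lambda>\<omega>. \<lambda>k\<in>{..<n}. X k \<omega>) -` (Pi\<^sub>E {..<n} B) \<inter> space P) \<omega>
          = (\<Prod>k<n. indicator (B k) (X k \<omega>) :: real)"
        by (auto simp: indicator_def PiE_iff)
    qed
    also have "\<dots> = (\<Prod>k<n. measure std_normal_distribution (B k))"
      using char_std_normal_imp_rect[OF P X cs sn B order_refl] by simp
    finally have *: "emeasure (distr P (PiM {..<n} (\<lambda>_. std_normal_distribution)) (\<lambda>\<omega>. \<lambda>k\<in>{..<n}. X k \<omega>)) (Pi\<^sub>E {..<n} B)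
      = ennreal (\<Prod>k<n. measure std_normal_distribution (B k))" .
    show "emeasure (distr P (PiM {..<n} (\<lambda>_. std_normal_distribution)) (\<lambda>\<omega>. \<lambda>k\<in>{..<n}. X k \<omega>)) (Pi\<^sub>E {..<n} A)
      = (\<Prod>i\<in>{..<n}. emeasure std_normal_distribution (A i))"
    proof -
      have "(\<Prod>i\<in>{..<n}. emeasure std_normal_distribution (A i)) = (\<Prod>i<n. ennreal (measure std_normal_distribution (B i)))"
        using prob_space_normal_density[of 1 0]
        by (intro prod.cong) (auto simp: B_def finite_measure.emeasure_eq_measure prob_space_def)
      with * show ?thesis unfolding AB by (simp add: prod_ennreal)
    qed
  qed auto
qed

section \<open>Stein's equation\<close>

lemma integral_lessThan_FTC:
  fixes F f :: "real \<Rightarrow> real"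
  assumes F: "\<And>t. (F has_real_derivative f t) (at t)" and f: "continuous_on UNIV f"
    and int: "integrable lborel f" and lim: "(F \<longlongrightarrow> 0) at_bot"
  shows "(\<integral>t. indicator {..<x} t * f t \<partial>lborel) = F x"
proof -
  have "(LBINT t=-\<infinity>..ereal x. f t) = F x - 0"
  proof (rule interval_integral_FTC_integrable)
    show "((F \<circ> real_of_ereal) \<longlongrightarrow> 0) (at_right (- \<infinity>))"
      using lim by (simp add: ereal_tendsto_simps)
    have "isCont F x" using F[of x] DERIV_isCont by blast
    then have "(F \<longlongrightarrow> F x) (at_left x)" 
      by (simp add: isCont_def filterlim_at_split)
    then show "((F \<circ> real_of_ereal) \<longlongrightarrow> F x) (at_left (ereal x))"
      by (simp add: ereal_tendsto_simps)
    show "set_integrable lborel (einterval (- \<infinity>) (ereal x)) f"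
      unfolding set_integrable_def by (intro integrable_mult_indicator int) auto
    show "isCont f y" for y using f by (simp add: continuous_on_eq_continuous_at)
  qed (use F in \<open>auto simp: has_real_derivative_iff_has_vector_derivative\<close>)
  then show ?thesis
    by (simp add: interval_lebesgue_integral_def set_lebesgue_integral_def einterval_eq)
qed

lemma has_derivative_integral_lessThan:
  fixes f :: "real \<Rightarrow> real"
  assumes f: "continuous_on UNIV f" and int: "integrable lborel f"
  shows "((\<lambda>x. \<integral>t. indicator {..<x} t * f t \<partial>lborel) has_real_derivative f x) (at x)"
proof -
  have si: "set_integrable lborel A f" if "A \<in> sets borel" for A
    unfolding set_integrable_def by (intro integrable_mult_indicator int) (use that in auto)
  have eq: "(\<integral>t. indicator {..<y} t * f t \<partial>lborel) = (LBINT t=-\<infinity>..ereal (x - 1). f t) + (LBINT t=ereal (x-1)..ereal y. f t)" for y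
  proof -
    have "(LBINT t=-\<infinity>..ereal (x - 1). f t) + (LBINT t=ereal (x-1)..ereal y. f t) = (LBINT t=-\<infinity>..ereal y. f t)"
      by (rule interval_integral_sum)
         (auto simp: interval_lebesgue_integrable_def intro!: si)
    then show ?thesis by (simp add: interval_lebesgue_integral_def set_lebesgue_integral_def einterval_eq)
  qed
  have "((\<lambda>u. LBINT t=ereal (x-1)..ereal u. f t) has_vector_derivative f x) (at x within {x-1..x+1})"
    by (rule interval_integral_FTC2[where c="x-1"]) (use f in \<open>auto intro: continuous_on_subset\<close>)
  moreover have "at x within {x-1..x+1} = at x"
    by (rule at_within_Icc_at) auto
  ultimately have "((\<lambda>u. LBINT t=ereal (x-1)..ereal u. f t) has_real_derivative f x) (at x)"
    by (simp add: has_real_derivative_iff_has_vector_derivative)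
  from DERIV_add[OF DERIV_const this, of "LBINT t=-\<infinity>..ereal (x - 1). f t"]
  show ?thesis unfolding eq by simp
qed

lemma integrable_gauss_moment: "integrable lborel (\<lambda>t::real. t ^ k * exp (- t\<^sup>2 / 2))"
proof -
  have "integrable lborel (\<lambda>t::real. sqrt (2 * pi) * (std_normal_density t * t ^ k))"
    using integrable_std_normal_moment by (rule integrable_mult_right)
  then show ?thesis by (simp add: std_normal_density_def field_simps)
qed

lemma integrable_gauss_linear_bound:
  fixes u :: "real \<Rightarrow> real"
  assumes [measurable]: "u \<in> borel_measurable borel" and "\<And>t. \<bar>u t\<bar> \<le> a + b * t\<^sup>2"
  shows "integrable lborel (\<lambda>t. u t * exp (- t\<^sup>2 / 2))"
proof (rule Bochner_Integration.integrable_bound)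
  show "integrable lborel (\<lambda>t. a * (t ^ 0 * exp (- t\<^sup>2 / 2)) + b * (t ^ 2 * exp (- t\<^sup>2 / 2)))"
    by (intro Bochner_Integration.integrable_add integrable_mult_right integrable_gauss_moment)
  show "AE t in lborel. norm (u t * exp (- t\<^sup>2 / 2)) \<le> norm (a * (t ^ 0 * exp (- t\<^sup>2 / 2)) + b * (t ^ 2 * exp (- t\<^sup>2 / 2)))"
  proof (rule AE_I2)
    fix t :: real
    have "\<bar>u t\<bar> * exp (- t\<^sup>2 / 2) \<le> \<bar>a + b * t\<^sup>2\<bar> * exp (- t\<^sup>2 / 2)"
      by (rule mult_right_mono) (use assms(2)[of t] in auto)
    also have "\<dots> = norm ((a + b * t\<^sup>2) * exp (- t\<^sup>2 / 2))" by (simp add: abs_mult)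
    finally show "norm (u t * exp (- t\<^sup>2 / 2)) \<le> norm (a * (t ^ 0 * exp (- t\<^sup>2 / 2)) + b * (t ^ 2 * exp (- t\<^sup>2 / 2)))"
      by (simp add: abs_mult algebra_simps)
  qed
qed measurable

text \<open>With the Gaussian weight \<phi>, \<open>\<phi> x\<close> is the integral of
  \<open>- t * \<phi> t\<close> over \<open>t < x\<close>. The expression is therefore the integral
  of \<open>(x * u t - t * u x) * \<phi> t\<close>, which the Lipschitz bound controls pointwise. In
  terms of Stein's equation it is the derivative of the solution times \<phi>.\<close>

lemma stein_bound_nonpos:
  fixes u :: "real \<Rightarrow> real"
  assumes lip: "\<And>x y. \<bar>u x - u y\<bar> \<le> \<bar>x - y\<bar>" and u0: "\<bar>u 0\<bar> \<le> 1" and "x \<le> 0"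
  shows "\<bar>u x * exp (- x\<^sup>2 / 2) + x * (\<integral>t. indicator {..<x} t * (u t * exp (- t\<^sup>2 / 2)) \<partial>lborel)\<bar>
           \<le> 13 * exp (- x\<^sup>2 / 2)"
proof -
  define \<phi> :: "real \<Rightarrow> real" where "\<phi> = (\<lambda>t. exp (- t\<^sup>2 / 2))"
  have [measurable]: "\<phi> \<in> borel_measurable borel" unfolding \<phi>_def by measurable
  have \<phi>0: "0 < \<phi> t" for t by (simp add: \<phi>_def)
  have d\<phi>: "(\<phi> has_real_derivative - (t * \<phi> t)) (at t)" for t
    unfolding \<phi>_def by (auto intro!: derivative_eq_intros)
  have c\<phi>: "continuous_on UNIV \<phi>" unfolding \<phi>_def by (intro continuous_intros) auto
  let ?I = "\<lambda>t. indicator {..<x} t :: real"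
  have "1-lipschitz_on UNIV u" by (rule lipschitz_onI) (use lip in \<open>auto simp: dist_real_def\<close>)
  then have cu: "continuous_on UNIV u" by (rule lipschitz_on_continuous_on)
  then have [measurable]: "u \<in> borel_measurable borel" by (rule borel_measurable_continuous_onI)
  have ub: "\<bar>u t\<bar> \<le> 1 + \<bar>t\<bar>" for t using lip[of t 0] u0 by linarith
  have sq: "\<bar>t\<bar> \<le> 1 + t\<^sup>2" for t :: real
    using zero_le_power2[of "\<bar>t\<bar> - 1/2"] by (simp add: power2_eq_square algebra_simps)
  have I: "integrable lborel (\<lambda>t. ?I t * f t)" if "integrable lborel f" for f :: "real \<Rightarrow> real"
    using integrable_mult_indicator[of "{..<x}" lborel f] that by simp
  have gm: "integrable lborel (\<lambda>t. t ^ k * \<phi> t)" for k unfolding \<phi>_def by (rule integrable_gauss_moment)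
  have iu: "integrable lborel (\<lambda>t. u t * \<phi> t)"
    unfolding \<phi>_def
  proof (rule integrable_gauss_linear_bound[where a=2 and b=1])
    show "\<bar>u t\<bar> \<le> 2 + 1 * t\<^sup>2" for t using ub[of t] sq[of t] by linarith
  qed measurable
  have i0: "integrable lborel \<phi>" using gm[of 0] by simp
  have i1: "integrable lborel (\<lambda>t. - t * \<phi> t)" using gm[of 1] by simp
  have i2: "integrable lborel (\<lambda>t. - t * (x - t) * \<phi> t)" 
  proof -
    have "integrable lborel (\<lambda>t. (- x) * (t ^ 1 * \<phi> t) + t ^ 2 * \<phi> t)"
      by (intro Bochner_Integration.integrable_add integrable_mult_right gm)
    then show ?thesis by (simp add: algebra_simps power2_eq_square)
  qed
  have lim0: "(\<phi> \<longlongrightarrow> 0) at_bot" unfolding \<phi>_def by real_asymp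
  have lim1: "((\<lambda>t. (x - t) * \<phi> t) \<longlongrightarrow> 0) at_bot" unfolding \<phi>_def by real_asymp
  have e1: "(\<integral>t. ?I t * (- t * \<phi> t) \<partial>lborel) = \<phi> x"
    by (rule integral_lessThan_FTC) (use d\<phi> lim0 i1 in \<open>auto intro!: continuous_intros c\<phi>\<close>)
  \<comment> \<open>Integrating the derivative of \<open>(x - t) * \<phi> t\<close> evaluates the
    integral of \<open>- t * (x - t) * \<phi> t\<close>: it equals the tail integral
    \<open>K\<close>.\<close>
  have e2: "(\<integral>t. ?I t * (- t * (x - t) * \<phi> t - \<phi> t) \<partial>lborel) = (x - x) * \<phi> x"
  proof (rule integral_lessThan_FTC[where F = "\<lambda>t. (x - t) * \<phi> t"])
    show "((\<lambda>t. (x - t) * \<phi> t) has_real_derivative - t * (x - t) * \<phi> t - \<phi> t) (at t)" for t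
    proof (rule DERIV_cong)
      show "((\<lambda>t. (x - t) * \<phi> t) has_real_derivative (0 - 1) * \<phi> t + - (t * \<phi> t) * (x - t)) (at t)"
        by (intro DERIV_mult DERIV_diff DERIV_const DERIV_ident d\<phi>)
    qed (simp add: algebra_simps)
    show "continuous_on UNIV (\<lambda>t. - t * (x - t) * \<phi> t - \<phi> t)" by (intro continuous_intros c\<phi>)
    show "integrable lborel (\<lambda>t. - t * (x - t) * \<phi> t - \<phi> t)" by (rule Bochner_Integration.integrable_diff[OF i2 i0])
    show "((\<lambda>t. (x - t) * \<phi> t) \<longlongrightarrow> 0) at_bot" by (rule lim1)
  qed
  define K where "K = (\<integral>t. ?I t * \<phi> t \<partial>lborel)"
  have e2': "(\<integral>t. ?I t * (- t * (x - t) * \<phi> t) \<partial>lborel) = K"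
  proof -
    have "(\<integral>t. ?I t * (- t * (x - t) * \<phi> t - \<phi> t) \<partial>lborel) = (\<integral>t. ?I t * (- t * (x - t) * \<phi> t) - ?I t * \<phi> t \<partial>lborel)"
      by (simp add: right_diff_distrib)
    also have "\<dots> = (\<integral>t. ?I t * (- t * (x - t) * \<phi> t) \<partial>lborel) - K"
      unfolding K_def by (intro Bochner_Integration.integral_diff I i2 i0)
    finally show ?thesis using e2 by simp
  qed
  \<comment> \<open>For \<open>x <= -1\<close> use \<open>1 <= - t\<close> under the integral; for
    \<open>-1 < x <= 0\<close> the whole mass is \<open>sqrt (2 * pi) <= 3\<close> while
    \<open>\<phi> x >= 1/2\<close>. The 6 makes the final constant
    \<open>2 * 6 + 1 = 13\<close>.\<close>
  have Kle: "K \<le> 6 * \<phi> x"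
  proof (cases "x \<le> -1")
    case True
    have "K \<le> (\<integral>t. ?I t * (- t * \<phi> t) \<partial>lborel)"
      unfolding K_def 
    proof (rule integral_mono[OF I[OF i0] I[OF i1]])
      show "indicator {..<x} t * \<phi> t \<le> indicator {..<x} t * (- t * \<phi> t)" for t
        using True mult_right_mono[of 1 "-t" "\<phi> t"] \<phi>0[of t] by (auto simp: indicator_def)
    qed
    also have "\<dots> \<le> 6 * \<phi> x" unfolding e1 using \<phi>0[of x] by simp
    finally show ?thesis .
  next
    case False
    have "K \<le> (\<integral>t. \<phi> t \<partial>lborel)"
      unfolding K_def by (rule integral_mono[OF I[OF i0] i0]) (use \<phi>0 less_imp_le in \<open>auto simp: indicator_def\<close>)
    also have "\<dots> = (\<integral>t. sqrt (2 * pi) * std_normal_density t \<partial>lborel)"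
      by (simp add: std_normal_density_def \<phi>_def)
    also have "\<dots> = sqrt (2 * pi)" by simp
    also have "\<dots> \<le> 6 * (1 / 2)" 
      by (rule real_le_lsqrt) (use pi_less_4 pi_approx in \<open>auto simp: power2_eq_square\<close>)
    also have "1 / 2 \<le> \<phi> x"
    proof -
      have "x\<^sup>2 \<le> 1" using False \<open>x \<le> 0\<close> by (simp add: abs_square_le_1)
      then have "1/2 \<le> 1 + (- x\<^sup>2 / 2)" by simp
      also have "\<dots> \<le> \<phi> x" unfolding \<phi>_def by (rule exp_ge_add_one_self)
      finally show ?thesis .
    qed
    finally show ?thesis by simp
  qed
  define Q where "Q = u x * \<phi> x + x * (\<integral>t. ?I t * (u t * \<phi> t) \<partial>lborel)"
  have "Q = u x * (\<integral>t. ?I t * (- t * \<phi> t) \<partial>lborel) + x * (\<integral>t. ?I t * (u t * \<phi> t) \<partial>lborel)"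
    unfolding e1 Q_def ..
  also have "\<dots> = (\<integral>t. u x * (?I t * (- t * \<phi> t)) + x * (?I t * (u t * \<phi> t)) \<partial>lborel)"
    using I[OF i1] I[OF iu] by (simp only: Bochner_Integration.integral_add integrable_mult_right integral_mult_right_zero)
  finally have "\<bar>Q\<bar> \<le> (\<integral>t. \<bar>u x * (?I t * (- t * \<phi> t)) + x * (?I t * (u t * \<phi> t))\<bar> \<partial>lborel)"
    by (simp only: integral_abs_bound)
  also have "\<dots> \<le> (\<integral>t. 2 * (?I t * (- t * (x - t) * \<phi> t)) + ?I t * (- t * \<phi> t) \<partial>lborel)"
  proof (rule integral_mono)
    show "integrable lborel (\<lambda>t. \<bar>u x * (?I t * (- t * \<phi> t)) + x * (?I t * (u t * \<phi> t))\<bar>)"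
      by (intro integrable_abs Bochner_Integration.integrable_add integrable_mult_right I i1 iu)
    show "integrable lborel (\<lambda>t. 2 * (?I t * (- t * (x - t) * \<phi> t)) + ?I t * (- t * \<phi> t))"
      by (intro Bochner_Integration.integrable_add integrable_mult_right I i1 i2)
    fix t
    show "\<bar>u x * (?I t * (- t * \<phi> t)) + x * (?I t * (u t * \<phi> t))\<bar> \<le> 2 * (?I t * (- t * (x - t) * \<phi> t)) + ?I t * (- t * \<phi> t)"
    proof (cases "t < x")
      case True
      have "\<bar>x * u t - t * u x\<bar> = \<bar>x * (u t - u x) + (x - t) * u x\<bar>" by (simp add: algebra_simps)
      also have "\<dots> \<le> \<bar>x\<bar> * \<bar>u t - u x\<bar> + \<bar>x - t\<bar> * \<bar>u x\<bar>"
        by (metis abs_mult abs_triangle_ineq)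
      also have "\<dots> \<le> (- x) * (x - t) + (x - t) * (1 - x)"
        by (intro add_mono mult_mono) (use lip[of t x] ub[of x] True \<open>x \<le> 0\<close> in auto)
      also have "\<dots> = 2 * ((- x) * (x - t)) + (x - t)" by (simp add: algebra_simps)
      also have "\<dots> \<le> 2 * ((- t) * (x - t)) + (- t)"
        by (intro add_mono mult_left_mono mult_right_mono) (use True \<open>x \<le> 0\<close> in auto)
      finally have "\<bar>x * u t - t * u x\<bar> * \<phi> t \<le> (2 * ((- t) * (x - t)) + (- t)) * \<phi> t"
        by (rule mult_right_mono) (use \<phi>0 less_imp_le in auto)
      moreover have "\<bar>x * u t - t * u x\<bar> * \<phi> t = \<bar>(x * u t - t * u x) * \<phi> t\<bar>" using \<phi>0[of t] by (simp add: abs_mult)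
      ultimately show ?thesis using True by (simp add: algebra_simps)
    qed simp
  qed
  also have "\<dots> = 2 * K + \<phi> x"
    using I[OF i1] I[OF i2] by (simp only: Bochner_Integration.integral_add integrable_mult_right integral_mult_right_zero e1 e2')
  also have "\<dots> \<le> 13 * \<phi> x" using Kle by simp
  finally show ?thesis unfolding \<phi>_def Q_def .
qed

text \<open>The explicit solution is \<open>exp (x^2/2)\<close> times the integral of
  \<open>u * \<phi>\<close> up to \<open>x\<close>, with \<open>u\<close> the centred
  \<open>h\<close>. Centring makes the total integral 0, so the positive half-line reduces to the
  negative one by reflection. Only the existence of a universal bound matters, not the value
  13.\<close>

lemma stein_solution:
  fixes h :: "real \<Rightarrow> real"
  assumes h: "1-lipschitz_on UNIV h"
  obtains f f' :: "real \<Rightarrow> real" where "\<And>x. (f has_real_derivative f' x) (at x)"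
    "\<And>x. f' x - x * f x = h x - (\<integral>y. h y \<partial>std_normal_distribution)" "\<And>x. \<bar>f' x\<bar> \<le> 13"
proof -
  define \<phi> :: "real \<Rightarrow> real" where "\<phi> = (\<lambda>t. exp (- t\<^sup>2 / 2))"
  have [measurable]: "\<phi> \<in> borel_measurable borel" unfolding \<phi>_def by measurable
  have \<phi>0: "0 < \<phi> t" for t by (simp add: \<phi>_def)
  have d\<phi>: "(\<phi> has_real_derivative - (t * \<phi> t)) (at t)" for t
    unfolding \<phi>_def by (auto intro!: derivative_eq_intros)
  have c\<phi>: "continuous_on UNIV \<phi>" unfolding \<phi>_def by (intro continuous_intros) auto
  interpret G: prob_space std_normal_distribution by (rule prob_space_normal_density) simp
  have G1 [simp]: "measure std_normal_distribution UNIV = 1" using G.prob_space by simp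
  define u where "u x = h x - (\<integral>y. h y \<partial>std_normal_distribution)" for x
  have lip: "\<bar>u x - u y\<bar> \<le> \<bar>x - y\<bar>" for x y
    using lipschitz_onD[OF h, of x y] by (simp add: u_def dist_real_def)
  have ch: "continuous_on UNIV h" using h by (rule lipschitz_on_continuous_on)
  have cu: "continuous_on UNIV u" unfolding u_def by (intro continuous_intros ch)
  have [measurable]: "h \<in> borel_measurable borel" "u \<in> borel_measurable borel"
    using ch cu by (auto intro: borel_measurable_continuous_onI)
  have sq: "\<bar>t\<bar> \<le> (1 + t\<^sup>2) / 2" for t :: real
    using zero_le_power2[of "\<bar>t\<bar> - 1"] by (simp add: power2_eq_square algebra_simps)
  have i1: "integrable std_normal_distribution (\<lambda>t. (1 + t\<^sup>2) / 2)"
    using integrable_std_normal_distribution_moment[of 2] by simp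
  have hx: "\<bar>h x - h 0\<bar> \<le> \<bar>x\<bar>" for x using lipschitz_onD[OF h, of x 0] by (simp add: dist_real_def)
  have ih0: "integrable std_normal_distribution (\<lambda>x. h x - h 0)"
    by (rule Bochner_Integration.integrable_bound[OF i1]) (use order_trans[OF hx sq] in \<open>auto intro!: AE_I2\<close>)
  have ih: "integrable std_normal_distribution h"
    using Bochner_Integration.integrable_add[OF ih0, of "\<lambda>_. h 0"] by simp
  have m2: "(\<integral>t. t\<^sup>2 \<partial>std_normal_distribution) = 1"
    using std_normal_distribution_even_moments(1)[of 1] by simp
  \<comment> \<open>\<open>u 0\<close> is minus the mean of \<open>h - h 0\<close>, hence at most
    \<open>E |Z|\<close> in absolute value; \<open>|t| <= (1 + t^2) / 2\<close> and the unit
    variance bound this by 1, as \<open>stein_bound_nonpos\<close> requires.\<close>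
  have u0: "\<bar>u 0\<bar> \<le> 1"
  proof -
    have "- u 0 = (\<integral>x. h x - h 0 \<partial>std_normal_distribution)"
      using ih by (simp add: u_def)
    then have "\<bar>u 0\<bar> = \<bar>\<integral>x. h x - h 0 \<partial>std_normal_distribution\<bar>" by linarith
    also have "\<dots> \<le> (\<integral>x. \<bar>h x - h 0\<bar> \<partial>std_normal_distribution)" by (rule integral_abs_bound)
    also have "\<dots> \<le> (\<integral>t. (1 + t\<^sup>2) / 2 \<partial>std_normal_distribution)"
      by (rule integral_mono) (use order_trans[OF hx sq] in \<open>auto intro: ih0 i1\<close>)
    also have "\<dots> = 1" using integrable_std_normal_distribution_moment[of 2] m2 by (simp add: add_divide_distrib)
    finally show ?thesis .
  qed
  have ub: "\<bar>u t\<bar> \<le> 2 + 1 * t\<^sup>2" for t using lip[of t 0] u0 sq[of t] zero_le_power2[of t] by (simp; linarith)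
  have iu: "integrable lborel (\<lambda>t. u t * \<phi> t)"
    unfolding \<phi>_def by (rule integrable_gauss_linear_bound[OF _ ub]) measurable
  have iu0: "(\<integral>t. u t * \<phi> t \<partial>lborel) = 0"
  proof -
    have "(\<integral>t. u t \<partial>std_normal_distribution) = 0" unfolding u_def using ih by simp
    then have "(\<integral>t. std_normal_density t * u t \<partial>lborel) = 0" by (simp add: integral_density)
    then have "(\<integral>t. (1 / sqrt (2 * pi)) * (u t * \<phi> t) \<partial>lborel) = 0" by (simp add: std_normal_density_def \<phi>_def mult_ac)
    then show ?thesis by simp
  qed
  define U where "U x = (\<integral>t. indicator {..<x} t * (u t * \<phi> t) \<partial>lborel)" for x
  define f where "f x = exp (x\<^sup>2 / 2) * U x" for x
  define f' where "f' x = x * f x + u x" for x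
  have dU: "(U has_real_derivative u x * \<phi> x) (at x)" for x
    unfolding U_def by (rule has_derivative_integral_lessThan) (auto intro!: continuous_intros cu c\<phi> iu)
  have ee: "exp (x\<^sup>2 / 2) * \<phi> x = 1" for x :: real by (simp add: \<phi>_def exp_add[symmetric])
  have "(f has_real_derivative f' x) (at x)" for x
  proof -
    have "(f has_real_derivative (exp (x\<^sup>2 / 2) * x * U x + exp (x\<^sup>2 / 2) * (u x * \<phi> x))) (at x)"
      unfolding f_def by (auto intro!: derivative_eq_intros dU)
    also have "exp (x\<^sup>2 / 2) * x * U x + exp (x\<^sup>2 / 2) * (u x * \<phi> x) = x * f x + u x * (exp (x\<^sup>2 / 2) * \<phi> x)"
      by (simp add: f_def)
    finally show ?thesis by (simp add: f'_def ee)
  qed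
  moreover have "\<bar>f' x\<bar> \<le> 13" for x
  proof -
    have "\<bar>u x * \<phi> x + x * U x\<bar> \<le> 13 * \<phi> x"
    proof (cases "x \<le> 0")
      case True
      then show ?thesis unfolding U_def using stein_bound_nonpos[OF lip u0 True] by (simp add: \<phi>_def)
    next
      case False
      \<comment> \<open>Since \<open>u * \<phi>\<close> has integral 0, the lower tail is minus the
        upper tail, and \<open>t -> - t\<close> carries the latter to the lower tail at
        \<open>- x\<close> of the reflected function.\<close>
      have "U x = - (\<integral>t. indicator {..<- x} t * (u (- t) * \<phi> t) \<partial>lborel)"
      proof -
        have ind: "indicator {..<x} t * (u t * \<phi> t) = u t * \<phi> t - indicator {x..} t * (u t * \<phi> t)" for t
          by (auto simp: indicator_def)
        have "U x = 0 - (\<integral>t. indicator {x..} t * (u t * \<phi> t) \<partial>lborel)"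
          unfolding U_def ind using integrable_mult_indicator[OF _ iu, of "{x..}"] iu iu0
          by (subst Bochner_Integration.integral_diff) auto
        also have "(\<integral>t. indicator {x..} t * (u t * \<phi> t) \<partial>lborel) = (\<integral>t. indicator {..<- x} t * (u (- t) * \<phi> t) \<partial>lborel)"
        proof -
          have "(\<integral>t. indicator {x..} t * (u t * \<phi> t) \<partial>lborel) = (\<integral>t. indicator {x..} (- t) * (u (- t) * \<phi> t) \<partial>lborel)"
            unfolding \<phi>_def using lborel_integral_real_affine[of "-1" "\<lambda>t. indicator {x..} t * (u t * \<phi> t)" 0] by (simp add: \<phi>_def)
          also have "\<dots> = (\<integral>t. indicator {..<- x} t * (u (- t) * \<phi> t) \<partial>lborel)"
          \<comment> \<open>Reflection yields a closed half-line; it differs from the open one by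
            the null set \<open>{- x}\<close>.\<close>
          proof (rule integral_cong_AE)
            show "AE t in lborel. indicator {x..} (- t) * (u (- t) * \<phi> t) = indicator {..<- x} t * (u (- t) * \<phi> t)"
              using AE_lborel_singleton[of "-x"] by eventually_elim (auto simp: indicator_def)
          qed measurable
          finally show ?thesis .
        qed
        finally show ?thesis by simp
      qed
      moreover have lip': "\<bar>u (- a) - u (- b)\<bar> \<le> \<bar>a - b\<bar>" for a b using lip[of "- a" "- b"] by linarith
      moreover have "\<bar>u (- (- x)) * exp (- (- x)\<^sup>2 / 2) + (- x) * (\<integral>t. indicator {..<- x} t * (u (- t) * exp (- t\<^sup>2 / 2)) \<partial>lborel)\<bar>
           \<le> 13 * exp (- (- x)\<^sup>2 / 2)"
        by (rule stein_bound_nonpos) (use False u0 lip' in auto)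
      ultimately show ?thesis by (simp add: \<phi>_def)
    qed
    then have "exp (x\<^sup>2 / 2) * \<bar>u x * \<phi> x + x * U x\<bar> \<le> exp (x\<^sup>2 / 2) * (13 * \<phi> x)"
      by (rule mult_left_mono) simp
    moreover have "exp (x\<^sup>2 / 2) * (13 * \<phi> x) = 13" using ee[of x] by (simp add: mult_ac)
    moreover have "exp (x\<^sup>2 / 2) * \<bar>u x * \<phi> x + x * U x\<bar> = \<bar>exp (x\<^sup>2 / 2) * (u x * \<phi> x + x * U x)\<bar>"
      by (simp add: abs_mult)
    moreover have "exp (x\<^sup>2 / 2) * (u x * \<phi> x + x * U x) = f' x"
      using ee[of x] by (simp add: f'_def f_def algebra_simps)
    ultimately show ?thesis by linarith
  qed
  moreover have "f' x - x * f x = h x - (\<integral>y. h y \<partial>std_normal_distribution)" for x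
    by (simp add: f'_def u_def)
  ultimately show ?thesis using that by blast
qed

section \<open>Correlation bounds and Gaussian integration by parts\<close>

lemma prob_space_std_normal: "prob_space std_normal_distribution"
  by (rule prob_space_normal_density) simp

text \<open>Up to the factor \<open>sqrt 2\<close>, the product with the standard density is the
  normal density of variance 2.\<close>

lemma integrable_exp_sq: "integrable std_normal_distribution (\<lambda>x. exp (x\<^sup>2 / 4))"
proof -
  have "integrable lborel (\<lambda>x. sqrt 2 * normal_density 0 (sqrt 2) x)" by simp
  also have "(\<lambda>x. sqrt 2 * normal_density 0 (sqrt 2) x) = (\<lambda>x. std_normal_density x * exp (x\<^sup>2 / 4))"
    by (rule ext) (simp add: normal_density_def real_sqrt_mult exp_add[symmetric] field_simps)
  finally show ?thesis by (simp add: integrable_density)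
qed

lemma integrable_exp_abs: "integrable std_normal_distribution (\<lambda>x. exp (c * \<bar>x\<bar>))"
proof (rule Bochner_Integration.integrable_bound)
  show "integrable std_normal_distribution (\<lambda>x. exp (c\<^sup>2) * exp (x\<^sup>2 / 4))"
    by (intro integrable_mult_right integrable_exp_sq)
  show "AE x in std_normal_distribution. norm (exp (c * \<bar>x\<bar>)) \<le> norm (exp (c\<^sup>2) * exp (x\<^sup>2 / 4))"
  proof (rule AE_I2)
    fix x :: real
    have "0 \<le> (c - \<bar>x\<bar> / 2)\<^sup>2" by simp
    then have "c * \<bar>x\<bar> \<le> c\<^sup>2 + x\<^sup>2 / 4" by (simp add: power2_diff power_divide)
    then show "norm (exp (c * \<bar>x\<bar>)) \<le> norm (exp (c\<^sup>2) * exp (x\<^sup>2 / 4))" by (simp add: exp_add[symmetric])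
  qed
qed measurable

lemma power_le_fact_exp: "0 \<le> (x::real) \<Longrightarrow> x ^ n \<le> fact n * exp x"
proof -
  assume x: "0 \<le> x"
  obtain t where "exp x = (\<Sum>m<Suc n. x ^ m / fact m) + (exp t / fact (Suc n)) * x ^ Suc n"
    using Maclaurin_exp_le[of x "Suc n"] by auto
  moreover have "0 \<le> (exp t / fact (Suc n)) * x ^ Suc n" using x by (intro mult_nonneg_nonneg) auto
  moreover have "x ^ n / fact n \<le> (\<Sum>m<Suc n. x ^ m / fact m)"
    by (rule member_le_sum[of n "{..<Suc n}" "\<lambda>m. x ^ m / fact m"]) (use x in auto)
  ultimately have "x ^ n / fact n \<le> exp x" by linarith
  then show ?thesis by (simp add: field_simps)
qed

lemma has_bochner_integral_pair_mult:
  fixes f g :: "_ \<Rightarrow> real"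
  assumes "sigma_finite_measure M1" "sigma_finite_measure M2"
    and f: "integrable M1 f" and g: "integrable M2 g"
  shows "has_bochner_integral (M1 \<Otimes>\<^sub>M M2) (\<lambda>(x, y). f x * g y) (integral\<^sup>L M1 f * integral\<^sup>L M2 g)"
proof -
  interpret pair_sigma_finite M1 M2 using assms(1,2) by (rule pair_sigma_finite.intro)
  have [measurable]: "f \<in> borel_measurable M1" "g \<in> borel_measurable M2" using f g by auto
  have int: "integrable (M1 \<Otimes>\<^sub>M M2) (\<lambda>(x, y). f x * g y)"
    by (rule Fubini_integrable) (use f g in \<open>auto simp: abs_mult\<close>)
  moreover have "integral\<^sup>L (M1 \<Otimes>\<^sub>M M2) (\<lambda>(x, y). f x * g y) = integral\<^sup>L M1 f * integral\<^sup>L M2 g"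
    using integral_fst'[OF int] f g by simp
  ultimately show ?thesis by (simp add: has_bochner_integral_iff)
qed

section \<open>Mehler's kernel and the decay of correlations\<close>

text \<open>Expanding the form leaves products of a power of \<open>x\<close> and a power of
  \<open>y\<close> of total degree \<open>2 * j + p + q < 2 * k\<close>; one of the two exponents is
  below \<open>k\<close>, and \<open>orth\<close> kills that factor. The exponents \<open>p\<close>
  and \<open>q\<close> are carried along for the induction on \<open>j\<close>.\<close>

lemma orthogonal_quadratic_power:
  fixes \<phi> :: "real \<Rightarrow> real"
  assumes int: "\<And>j. integrable std_normal_distribution (\<lambda>x. \<phi> x * x ^ j)"
    and orth: "\<And>j. j < k \<Longrightarrow> (\<integral>x. \<phi> x * x ^ j \<partial>std_normal_distribution) = 0"
    and "2 * j + p + q < 2 * k"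
  shows "has_bochner_integral (std_normal_distribution \<Otimes>\<^sub>M std_normal_distribution)
    (\<lambda>(x, y). \<phi> x * \<phi> y * (x ^ p * y ^ q * (\<alpha> * x * y + \<beta> * (x\<^sup>2 + y\<^sup>2)) ^ j)) 0"
  using assms(3)
proof (induction j arbitrary: p q)
  case 0
  have "has_bochner_integral (std_normal_distribution \<Otimes>\<^sub>M std_normal_distribution)
     (\<lambda>(x, y). (\<phi> x * x ^ p) * (\<phi> y * y ^ q))
     ((\<integral>x. \<phi> x * x ^ p \<partial>std_normal_distribution) * (\<integral>x. \<phi> x * x ^ q \<partial>std_normal_distribution))"
    by (intro has_bochner_integral_pair_mult prob_space_imp_sigma_finite prob_space_std_normal int)
  moreover have "p < k \<or> q < k" using 0 by auto
  ultimately show ?case using orth by (auto simp: mult_ac)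
next
  case (Suc j)
  have "has_bochner_integral (std_normal_distribution \<Otimes>\<^sub>M std_normal_distribution)
    (\<lambda>z. (\<alpha> * (case z of (x, y) \<Rightarrow> \<phi> x * \<phi> y * (x ^ Suc p * y ^ Suc q * (\<alpha> * x * y + \<beta> * (x\<^sup>2 + y\<^sup>2)) ^ j))
       + \<beta> * (case z of (x, y) \<Rightarrow> \<phi> x * \<phi> y * (x ^ Suc (Suc p) * y ^ q * (\<alpha> * x * y + \<beta> * (x\<^sup>2 + y\<^sup>2)) ^ j)))
       + \<beta> * (case z of (x, y) \<Rightarrow> \<phi> x * \<phi> y * (x ^ p * y ^ Suc (Suc q) * (\<alpha> * x * y + \<beta> * (x\<^sup>2 + y\<^sup>2)) ^ j)))
    ((\<alpha> * 0 + \<beta> * 0) + \<beta> * 0)"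
    by (intro has_bochner_integral_add has_bochner_integral_mult_right Suc.IH) (use Suc.prems in auto)
  moreover have "(\<lambda>z. (\<alpha> * (case z of (x, y) \<Rightarrow> \<phi> x * \<phi> y * (x ^ Suc p * y ^ Suc q * (\<alpha> * x * y + \<beta> * (x\<^sup>2 + y\<^sup>2)) ^ j))
       + \<beta> * (case z of (x, y) \<Rightarrow> \<phi> x * \<phi> y * (x ^ Suc (Suc p) * y ^ q * (\<alpha> * x * y + \<beta> * (x\<^sup>2 + y\<^sup>2)) ^ j)))
       + \<beta> * (case z of (x, y) \<Rightarrow> \<phi> x * \<phi> y * (x ^ p * y ^ Suc (Suc q) * (\<alpha> * x * y + \<beta> * (x\<^sup>2 + y\<^sup>2)) ^ j)))
     = (\<lambda>(x, y). \<phi> x * \<phi> y * (x ^ p * y ^ q * (\<alpha> * x * y + \<beta> * (x\<^sup>2 + y\<^sup>2)) ^ Suc j))"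
    by (auto simp: fun_eq_iff power2_eq_square algebra_simps)
  ultimately show ?case by simp
qed

lemma exp_Taylor_bound:
  fixes w :: real
  shows "\<bar>exp w - (\<Sum>j<k. w ^ j / fact j)\<bar> \<le> \<bar>w\<bar> ^ k / fact k * exp \<bar>w\<bar>"
proof -
  obtain t where t: "\<bar>t\<bar> \<le> \<bar>w\<bar>" "exp w = (\<Sum>j<k. w ^ j / fact j) + (exp t / fact k) * w ^ k"
    using Maclaurin_exp_le[of w k] by auto
  have "\<bar>exp w - (\<Sum>j<k. w ^ j / fact j)\<bar> = \<bar>w\<bar> ^ k / fact k * exp t"
    unfolding t(2) by (simp add: abs_mult power_abs)
  also have "\<dots> \<le> \<bar>w\<bar> ^ k / fact k * exp \<bar>w\<bar>"
    using t(1) by (intro mult_left_mono) auto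
  finally show ?thesis .
qed

text \<open>This is the exponent of Mehler's kernel with one factor \<rho> taken out. The numerator
  is at most \<open>(1/2 + 1/16) * (x^2 + y^2)\<close>, and \<open>1 - \<rho>^2 >= 63/64\<close>
  leaves room up to \<open>2/3\<close>.\<close>

lemma mehler_exponent_bound:
  fixes \<rho> x y :: real
  assumes "\<bar>\<rho>\<bar> \<le> 1 / 8"
  shows "\<bar>(x * y - \<rho> * (x\<^sup>2 + y\<^sup>2) / 2) / (1 - \<rho>\<^sup>2)\<bar> \<le> 2 / 3 * (x\<^sup>2 + y\<^sup>2)"
proof -
  have r2: "\<rho>\<^sup>2 \<le> 1 / 64" using power_mono[OF assms, of 2] by (simp add: power2_eq_square)
  have "0 \<le> (\<bar>x\<bar> - \<bar>y\<bar>)\<^sup>2" by simp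
  then have xy: "\<bar>x * y\<bar> \<le> (x\<^sup>2 + y\<^sup>2) / 2" by (simp add: power2_diff abs_mult)
  have "\<bar>\<rho> * (x\<^sup>2 + y\<^sup>2) / 2\<bar> \<le> (1 / 8) * (x\<^sup>2 + y\<^sup>2) / 2"
    using mult_right_mono[OF assms, of "x\<^sup>2 + y\<^sup>2"] by (simp add: abs_mult)
  with xy have "\<bar>x * y - \<rho> * (x\<^sup>2 + y\<^sup>2) / 2\<bar> \<le> 9 / 16 * (x\<^sup>2 + y\<^sup>2)" by linarith
  also have "\<dots> \<le> (2 / 3 * (x\<^sup>2 + y\<^sup>2)) * (1 - \<rho>\<^sup>2)"
  proof -
    have "9 / 16 \<le> 2 / 3 * (1 - \<rho>\<^sup>2)" using r2 by simp
    from mult_right_mono[OF this, of "x\<^sup>2 + y\<^sup>2"]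
    have "9 / 16 * (x\<^sup>2 + y\<^sup>2) \<le> 2 / 3 * (1 - \<rho>\<^sup>2) * (x\<^sup>2 + y\<^sup>2)" by simp
    then show ?thesis by (simp only: mult_ac)
  qed
  finally show ?thesis using r2 by (simp add: abs_divide pos_divide_le_eq)
qed

lemma integrable_mult_L2:
  fixes f g :: "'a \<Rightarrow> real"
  assumes [measurable]: "f \<in> borel_measurable M" "g \<in> borel_measurable M"
    and "integrable M (\<lambda>x. (f x)\<^sup>2)" "integrable M (\<lambda>x. (g x)\<^sup>2)"
  shows "integrable M (\<lambda>x. f x * g x)"
proof (rule Bochner_Integration.integrable_bound)
  show "integrable M (\<lambda>x. (f x)\<^sup>2 + (g x)\<^sup>2)" using assms by simp
  show "AE x in M. norm (f x * g x) \<le> norm ((f x)\<^sup>2 + (g x)\<^sup>2)"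
  proof (rule AE_I2)
    fix x
    have "0 \<le> (\<bar>f x\<bar> - \<bar>g x\<bar>)\<^sup>2" by simp
    then have "2 * (\<bar>f x\<bar> * \<bar>g x\<bar>) \<le> (f x)\<^sup>2 + (g x)\<^sup>2" by (simp add: power2_diff)
    moreover have "0 \<le> \<bar>f x\<bar> * \<bar>g x\<bar>" by simp
    ultimately have "\<bar>f x\<bar> * \<bar>g x\<bar> \<le> (f x)\<^sup>2 + (g x)\<^sup>2" by linarith
    then show "norm (f x * g x) \<le> norm ((f x)\<^sup>2 + (g x)\<^sup>2)" by (simp add: abs_mult)
  qed
qed measurable

text \<open>Mehler's formula: the substitution
  \<open>y = \<rho> * x + sqrt (1 - \<rho>^2) * z\<close> exhibits the density of the correlated
  variable relative to the standard normal law.\<close>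

lemma std_normal_shift_integral:
  fixes \<phi> :: "real \<Rightarrow> real"
  assumes [measurable]: "\<phi> \<in> borel_measurable borel" and \<rho>: "\<bar>\<rho>\<bar> < 1"
  shows "(\<integral>z. \<phi> (\<rho> * x + sqrt (1 - \<rho>\<^sup>2) * z) \<partial>std_normal_distribution)
    = (\<integral>y. \<phi> y * exp (\<rho> * ((x * y - \<rho> * (x\<^sup>2 + y\<^sup>2) / 2) / (1 - \<rho>\<^sup>2))) / sqrt (1 - \<rho>\<^sup>2) \<partial>std_normal_distribution)"
proof -
  define c where "c = sqrt (1 - \<rho>\<^sup>2)"
  have c2: "c\<^sup>2 = 1 - \<rho>\<^sup>2" and c0: "c > 0" using \<rho> abs_square_less_1[of \<rho>] by (auto simp: c_def)
  have "(\<integral>z. \<phi> (\<rho> * x + c * z) \<partial>std_normal_distribution)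
      = (\<integral>z. std_normal_density z * \<phi> (\<rho> * x + c * z) \<partial>lborel)"
    by (subst integral_density) auto
  also have "\<dots> = (1 / c) * (\<integral>y. std_normal_density (- (\<rho> * x / c) + (1 / c) * y) * \<phi> (\<rho> * x + c * (- (\<rho> * x / c) + (1 / c) * y)) \<partial>lborel)"
    using lborel_integral_real_affine[of "1 / c" "\<lambda>z. std_normal_density z * \<phi> (\<rho> * x + c * z)" "- (\<rho> * x / c)"] c0
    by simp
  also have "\<dots> = (\<integral>y. std_normal_density y * (\<phi> y * exp (\<rho> * ((x * y - \<rho> * (x\<^sup>2 + y\<^sup>2) / 2) / c\<^sup>2)) / c) \<partial>lborel)"
    unfolding integral_mult_right_zero[symmetric]
  proof (intro Bochner_Integration.integral_cong refl)
    fix y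
    have 1: "\<rho> * x + c * (- (\<rho> * x / c) + (1 / c) * y) = y" using c0 by (simp add: field_simps)
    have "- (- (\<rho> * x / c) + (1 / c) * y)\<^sup>2 / 2 = - (y - \<rho> * x)\<^sup>2 / (2 * c\<^sup>2)"
      using c0 by (simp add: field_simps power2_eq_square)
    also have "\<dots> = - y\<^sup>2 / 2 + \<rho> * ((x * y - \<rho> * (x\<^sup>2 + y\<^sup>2) / 2) / c\<^sup>2)"
    proof -
      have "- (y - \<rho> * x)\<^sup>2 = - y\<^sup>2 * c\<^sup>2 + 2 * \<rho> * (x * y - \<rho> * (x\<^sup>2 + y\<^sup>2) / 2)"
        unfolding c2 by (simp add: power2_eq_square field_simps)
      then show ?thesis using c0 by (simp add: field_simps)
    qed
    finally have "std_normal_density (- (\<rho> * x / c) + (1 / c) * y)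
       = std_normal_density y * exp (\<rho> * ((x * y - \<rho> * (x\<^sup>2 + y\<^sup>2) / 2) / c\<^sup>2))"
      by (simp only: std_normal_density_def exp_add mult.assoc)
    then show "1 / c * (std_normal_density (- (\<rho> * x / c) + (1 / c) * y) * \<phi> (\<rho> * x + c * (- (\<rho> * x / c) + (1 / c) * y)))
       = std_normal_density y * (\<phi> y * exp (\<rho> * ((x * y - \<rho> * (x\<^sup>2 + y\<^sup>2) / 2) / c\<^sup>2)) / c)"
      unfolding 1 by simp
  qed
  also have "\<dots> = (\<integral>y. \<phi> y * exp (\<rho> * ((x * y - \<rho> * (x\<^sup>2 + y\<^sup>2) / 2) / c\<^sup>2)) / c \<partial>std_normal_distribution)"
    by (subst integral_density) auto
  finally show ?thesis by (simp only: c2[unfolded c_def] c_def)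
qed

text \<open>Expand Mehler's exponential in powers of \<open>\<rho> * b\<close>. The terms of order
  below \<open>k\<close> have degree below \<open>2 * k\<close> in \<open>x\<close> and
  \<open>y\<close> and vanish by \<open>orthogonal_quadratic_power\<close>; the remainder carries
  \<open>|\<rho>|^k\<close>, and its growth is paid for by \<open>exp (x^2/8)\<close>, which is
  square integrable.\<close>

lemma gaussian_kernel_bound:
  fixes \<phi> :: "real \<Rightarrow> real"
  assumes [measurable]: "\<phi> \<in> borel_measurable borel"
    and sq: "integrable std_normal_distribution (\<lambda>x. (\<phi> x)\<^sup>2)"
    and orth: "\<And>j. j < k \<Longrightarrow> (\<integral>x. \<phi> x * x ^ j \<partial>std_normal_distribution) = 0"
  obtains K where "K \<ge> 0"
    "\<And>\<rho>. \<bar>\<rho>\<bar> \<le> 1 / 8 \<Longrightarrow>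
      \<bar>\<integral>x. (\<integral>z. \<phi> x * \<phi> (\<rho> * x + sqrt (1 - \<rho>\<^sup>2) * z) \<partial>std_normal_distribution) \<partial>std_normal_distribution\<bar> \<le> K * \<bar>\<rho>\<bar> ^ k"
proof -
  let ?\<gamma> = std_normal_distribution
  let ?G = "?\<gamma> \<Otimes>\<^sub>M ?\<gamma>"
  interpret G: prob_space ?\<gamma> by (rule prob_space_std_normal)
  interpret GG: pair_sigma_finite ?\<gamma> ?\<gamma> by (intro pair_sigma_finite.intro prob_space_imp_sigma_finite prob_space_std_normal)
  have ij: "integrable ?\<gamma> (\<lambda>x. \<phi> x * x ^ j)" for j
    by (rule integrable_mult_L2[OF _ _ sq])
       (use integrable_std_normal_distribution_moment[of "j * 2"] in \<open>auto simp: power_mult\<close>)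
  \<comment> \<open>\<open>\<phi>\<close> is only square integrable, so the factor beside it must be
    as well: the square of \<open>exp (x^2/8)\<close> is covered by
    \<open>integrable_exp_sq\<close>.\<close>
  define d where "d x = \<bar>\<phi> x\<bar> * exp (x\<^sup>2 / 8)" for x
  have id: "integrable ?\<gamma> d" unfolding d_def
    by (rule integrable_mult_L2)
       (use sq integrable_exp_sq in \<open>auto simp: power2_eq_square exp_add[symmetric]\<close>)
  define I where "I = (\<integral>x. d x \<partial>?\<gamma>)"
  have iD: "has_bochner_integral ?G (\<lambda>(x, y). d x * d y) (I * I)"
    unfolding I_def by (intro has_bochner_integral_pair_mult prob_space_imp_sigma_finite prob_space_std_normal id)
  show ?thesis
  proof (rule that[of "2 * 16 ^ k * (I * I)"])
    show "0 \<le> 2 * 16 ^ k * (I * I)" by simp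
    fix \<rho> :: real assume \<rho>: "\<bar>\<rho>\<bar> \<le> 1 / 8"
    define b where "b x y = (x * y - \<rho> * (x\<^sup>2 + y\<^sup>2) / 2) / (1 - \<rho>\<^sup>2)" for x y :: real
    define c where "c = sqrt (1 - \<rho>\<^sup>2)"
    have r2: "\<rho>\<^sup>2 \<le> 1 / 64" using power_mono[OF \<rho>, of 2] by (simp add: power2_eq_square)
    have c: "1 / 2 \<le> c" unfolding c_def by (rule real_le_rsqrt) (use r2 in \<open>simp add: power2_eq_square\<close>)
    define R where "R x y = exp (\<rho> * b x y) - (\<Sum>j<k. (\<rho> * b x y) ^ j / fact j)" for x y
    have [measurable]: "(\<lambda>p. b (fst p) (snd p)) \<in> borel_measurable (borel \<Otimes>\<^sub>M borel)" "(\<lambda>p. R (fst p) (snd p)) \<in> borel_measurable (borel \<Otimes>\<^sub>M borel)"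
      unfolding R_def b_def by measurable
    have bb: "\<bar>b x y\<bar> \<le> 2 / 3 * (x\<^sup>2 + y\<^sup>2)" for x y
      unfolding b_def by (rule mehler_exponent_bound[OF \<rho>])
    \<comment> \<open>\<open>3/16 = 1/16 + 1/8\<close>: the first share absorbs the power
      \<open>(|b|/16)^k\<close>, the second the exponential of \<open>|\<rho> * b|\<close>. With the
      constant \<open>2/3\<close> of \<open>bb\<close> the outcome is exactly
      \<open>1/8\<close>.\<close>
    have eb: "\<bar>b x y\<bar> * (3 / 16) \<le> x\<^sup>2 / 8 + y\<^sup>2 / 8" for x y using bb[of x y] by simp
    have rb: "\<bar>\<rho> * b x y\<bar> \<le> \<bar>b x y\<bar> / 8" for x y
      using mult_right_mono[OF \<rho>, of "\<bar>b x y\<bar>"] by (simp add: abs_mult)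
    have Rb: "\<bar>R x y\<bar> \<le> \<bar>\<rho>\<bar> ^ k * 16 ^ k * (exp (x\<^sup>2 / 8) * exp (y\<^sup>2 / 8))" for x y
    proof -
      have "\<bar>R x y\<bar> \<le> \<bar>\<rho> * b x y\<bar> ^ k / fact k * exp \<bar>\<rho> * b x y\<bar>"
        unfolding R_def by (rule exp_Taylor_bound)
      also have "\<dots> \<le> \<bar>\<rho> * b x y\<bar> ^ k / fact k * exp (\<bar>b x y\<bar> / 8)"
        by (intro mult_left_mono) (use rb[of x y] in auto)
      also have "\<bar>\<rho> * b x y\<bar> ^ k = \<bar>\<rho>\<bar> ^ k * 16 ^ k * (\<bar>b x y\<bar> / 16) ^ k"
        by (simp add: abs_mult power_mult_distrib power_divide)
      also have "\<bar>\<rho>\<bar> ^ k * 16 ^ k * (\<bar>b x y\<bar> / 16) ^ k / fact k * exp (\<bar>b x y\<bar> / 8)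
          \<le> \<bar>\<rho>\<bar> ^ k * 16 ^ k * (fact k * exp (\<bar>b x y\<bar> / 16)) / fact k * exp (\<bar>b x y\<bar> / 8)"
        by (intro mult_right_mono divide_right_mono mult_left_mono power_le_fact_exp) auto
      also have "\<dots> = \<bar>\<rho>\<bar> ^ k * 16 ^ k * exp (\<bar>b x y\<bar> * (3 / 16))"
        by (simp add: exp_add[symmetric])
      also have "\<dots> \<le> \<bar>\<rho>\<bar> ^ k * 16 ^ k * exp (x\<^sup>2 / 8 + y\<^sup>2 / 8)"
        by (intro mult_left_mono) (use eb[of x y] in auto)
      finally show ?thesis by (simp add: exp_add)
    qed
    have iR: "integrable ?G (\<lambda>(x, y). \<phi> x * \<phi> y * R x y)"
      and bR: "\<bar>\<integral>p. (case p of (x, y) \<Rightarrow> \<phi> x * \<phi> y * R x y) \<partial>?G\<bar> \<le> \<bar>\<rho>\<bar> ^ k * 16 ^ k * (I * I)"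
    proof -
      have pt: "\<bar>case p of (x, y) \<Rightarrow> \<phi> x * \<phi> y * R x y\<bar> \<le> \<bar>\<rho>\<bar> ^ k * 16 ^ k * (case p of (x, y) \<Rightarrow> d x * d y)" for p
      proof (cases p)
        case (Pair x y)
        have "\<bar>\<phi> x * \<phi> y * R x y\<bar> \<le> \<bar>\<phi> x\<bar> * \<bar>\<phi> y\<bar> * (\<bar>\<rho>\<bar> ^ k * 16 ^ k * (exp (x\<^sup>2 / 8) * exp (y\<^sup>2 / 8)))"
          unfolding abs_mult by (rule mult_left_mono[OF Rb]) simp
        then show ?thesis using Pair by (simp add: d_def mult_ac)
      qed
      have iD': "integrable ?G (\<lambda>p. \<bar>\<rho>\<bar> ^ k * 16 ^ k * (case p of (x, y) \<Rightarrow> d x * d y))"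
        using iD by (simp add: has_bochner_integral_iff)
      show i: "integrable ?G (\<lambda>(x, y). \<phi> x * \<phi> y * R x y)"
      proof (rule Bochner_Integration.integrable_bound[OF iD'])
        show "AE p in ?G. norm (case p of (x, y) \<Rightarrow> \<phi> x * \<phi> y * R x y) \<le> norm (\<bar>\<rho>\<bar> ^ k * 16 ^ k * (case p of (x, y) \<Rightarrow> d x * d y))"
          using pt by (intro AE_I2) (auto intro: order_trans[OF _ abs_ge_self])
      qed (unfold R_def b_def, measurable)
      have "\<bar>\<integral>p. (case p of (x, y) \<Rightarrow> \<phi> x * \<phi> y * R x y) \<partial>?G\<bar>
          \<le> (\<integral>p. \<bar>\<rho>\<bar> ^ k * 16 ^ k * (case p of (x, y) \<Rightarrow> d x * d y) \<partial>?G)"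
        by (rule order_trans[OF integral_abs_bound integral_mono[OF integrable_abs[OF i] iD' pt]])
      also have "\<dots> = \<bar>\<rho>\<bar> ^ k * 16 ^ k * (I * I)"
        using iD by (simp add: has_bochner_integral_iff)
      finally show "\<bar>\<integral>p. (case p of (x, y) \<Rightarrow> \<phi> x * \<phi> y * R x y) \<partial>?G\<bar> \<le> \<bar>\<rho>\<bar> ^ k * 16 ^ k * (I * I)" .
    qed
    have poly0: "has_bochner_integral ?G (\<lambda>p. \<Sum>j<k. \<rho> ^ j / fact j * (case p of (x, y) \<Rightarrow> \<phi> x * \<phi> y * b x y ^ j)) (\<Sum>j<k. \<rho> ^ j / fact j * 0)"
    proof (intro has_bochner_integral_sum has_bochner_integral_mult_right)
      fix j assume "j \<in> {..<k}"
      then have "has_bochner_integral ?G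
        (\<lambda>(x, y). \<phi> x * \<phi> y * (x ^ 0 * y ^ 0 * ((1 / (1 - \<rho>\<^sup>2)) * x * y + (- \<rho> / (2 * (1 - \<rho>\<^sup>2))) * (x\<^sup>2 + y\<^sup>2)) ^ j)) 0"
        by (intro orthogonal_quadratic_power[OF ij orth]) auto
      moreover have "(1 / (1 - \<rho>\<^sup>2)) * x * y + (- \<rho> / (2 * (1 - \<rho>\<^sup>2))) * (x\<^sup>2 + y\<^sup>2) = b x y" for x y
        using r2 by (simp add: b_def divide_simps) (simp add: algebra_simps)
      ultimately show "has_bochner_integral ?G (\<lambda>(x, y). \<phi> x * \<phi> y * b x y ^ j) 0" by simp
    qed
    have split: "(case p of (x, y) \<Rightarrow> \<phi> x * (\<phi> y * exp (\<rho> * b x y) / c))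
        = ((\<Sum>j<k. \<rho> ^ j / fact j * (case p of (x, y) \<Rightarrow> \<phi> x * \<phi> y * b x y ^ j))
            + (case p of (x, y) \<Rightarrow> \<phi> x * \<phi> y * R x y)) / c" for p
    proof (cases p)
      case (Pair x y)
      have "(\<Sum>j<k. \<rho> ^ j / fact j * (\<phi> x * \<phi> y * b x y ^ j)) = \<phi> x * \<phi> y * (\<Sum>j<k. (\<rho> * b x y) ^ j / fact j)"
        unfolding sum_distrib_left by (intro sum.cong) (auto simp: power_mult_distrib)
      then show ?thesis using Pair by (simp add: R_def algebra_simps)
    qed
    have iE: "integrable ?G (\<lambda>(x, y). \<phi> x * (\<phi> y * exp (\<rho> * b x y) / c))"
      unfolding split using poly0 iR by (auto simp: has_bochner_integral_iff)
    have "(\<integral>x. (\<integral>z. \<phi> x * \<phi> (\<rho> * x + sqrt (1 - \<rho>\<^sup>2) * z) \<partial>?\<gamma>) \<partial>?\<gamma>)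
        = (\<integral>x. \<phi> x * (\<integral>y. \<phi> y * exp (\<rho> * b x y) / c \<partial>?\<gamma>) \<partial>?\<gamma>)"
    proof (intro Bochner_Integration.integral_cong refl)
      fix x
      have r1: "\<bar>\<rho>\<bar> < 1" using \<rho> by simp
      show "(\<integral>z. \<phi> x * \<phi> (\<rho> * x + sqrt (1 - \<rho>\<^sup>2) * z) \<partial>?\<gamma>) = \<phi> x * (\<integral>y. \<phi> y * exp (\<rho> * b x y) / c \<partial>?\<gamma>)"
        unfolding integral_mult_right_zero b_def c_def by (subst std_normal_shift_integral[OF _ r1]) auto
    qed
    also have "\<dots> = (\<integral>x. (\<integral>y. \<phi> x * (\<phi> y * exp (\<rho> * b x y) / c) \<partial>?\<gamma>) \<partial>?\<gamma>)"
      unfolding integral_mult_right_zero ..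
    also have "\<dots> = (\<integral>p. (case p of (x, y) \<Rightarrow> \<phi> x * (\<phi> y * exp (\<rho> * b x y) / c)) \<partial>?G)"
      using GG.integral_fst'[OF iE] by simp
    also have "\<dots> = (\<integral>p. (case p of (x, y) \<Rightarrow> \<phi> x * \<phi> y * R x y) \<partial>?G) / c"
      unfolding split using poly0 iR by (simp add: has_bochner_integral_iff)
    finally have eq: "(\<integral>x. (\<integral>z. \<phi> x * \<phi> (\<rho> * x + sqrt (1 - \<rho>\<^sup>2) * z) \<partial>?\<gamma>) \<partial>?\<gamma>) = (\<integral>p. (case p of (x, y) \<Rightarrow> \<phi> x * \<phi> y * R x y) \<partial>?G) / c" .
    have "\<bar>(\<integral>p. (case p of (x, y) \<Rightarrow> \<phi> x * \<phi> y * R x y) \<partial>?G) / c\<bar> \<le> (\<bar>\<rho>\<bar> ^ k * 16 ^ k * (I * I)) / (1 / 2)"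
      unfolding abs_divide by (rule frac_le) (use bR c in auto)
    then show "\<bar>\<integral>x. (\<integral>z. \<phi> x * \<phi> (\<rho> * x + sqrt (1 - \<rho>\<^sup>2) * z) \<partial>?\<gamma>) \<partial>?\<gamma>\<bar> \<le> 2 * 16 ^ k * (I * I) * \<bar>\<rho>\<bar> ^ k"
      unfolding eq by (simp add: mult_ac)
  qed
qed

section \<open>Gaussian integration by parts\<close>

text \<open>The fundamental theorem of calculus for density times \<open>u\<close>; the growth bound
  \<open>exp |t|\<close> makes the boundary values vanish and both integrals converge.\<close>

lemma gaussian_integration_by_parts:
  fixes u u' :: "real \<Rightarrow> real"
  assumes u: "\<And>t. (u has_real_derivative u' t) (at t)" and u': "continuous_on UNIV u'"
    and b: "\<And>t. \<bar>u t\<bar> \<le> B * exp \<bar>t\<bar>" "\<And>t. \<bar>u' t\<bar> \<le> B * exp \<bar>t\<bar>"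
  shows "(\<integral>t. t * u t \<partial>std_normal_distribution) = (\<integral>t. u' t \<partial>std_normal_distribution)"
proof -
  have B0: "B \<ge> 0" using b(1)[of 0] by simp
  have cu: "continuous_on UNIV u" using u DERIV_isCont by (auto simp: continuous_on_eq_continuous_at)
  have [measurable]: "u \<in> borel_measurable borel" "u' \<in> borel_measurable borel"
    using cu u' by (auto intro: borel_measurable_continuous_onI)
  have i1: "integrable std_normal_distribution u'"
  proof (rule Bochner_Integration.integrable_bound)
    show "integrable std_normal_distribution (\<lambda>t. B * exp (1 * \<bar>t\<bar>))"
      by (intro integrable_mult_right integrable_exp_abs)
    show "AE t in std_normal_distribution. norm (u' t) \<le> norm (B * exp (1 * \<bar>t\<bar>))"
      using b(2) B0 by (auto intro!: AE_I2)
  qed measurable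
  have i2: "integrable std_normal_distribution (\<lambda>t. t * u t)"
  proof (rule Bochner_Integration.integrable_bound)
    show "integrable std_normal_distribution (\<lambda>t. B * exp (2 * \<bar>t\<bar>))"
      by (intro integrable_mult_right integrable_exp_abs)
    have "\<bar>t * u t\<bar> \<le> B * exp (2 * \<bar>t\<bar>)" for t
    proof -
      have "\<bar>t * u t\<bar> \<le> exp \<bar>t\<bar> * (B * exp \<bar>t\<bar>)"
        unfolding abs_mult using exp_ge_add_one_self[of "\<bar>t\<bar>"] by (intro mult_mono b) linarith+
      moreover have "exp (2 * \<bar>t\<bar>) = exp \<bar>t\<bar> * exp \<bar>t\<bar>" by (simp add: exp_add[symmetric])
      ultimately show ?thesis by (simp only: mult_ac)
    qed
    then show "AE t in std_normal_distribution. norm (t * u t) \<le> norm (B * exp (2 * \<bar>t\<bar>))"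
      using B0 by (auto intro!: AE_I2)
  qed measurable
  let ?n = "std_normal_density"
  let ?f = "\<lambda>t. ?n t * u' t - ?n t * (t * u t)"
  have il: "integrable lborel (\<lambda>t. ?n t * u' t)" "integrable lborel (\<lambda>t. ?n t * (t * u t))"
    using i1 i2 by (auto simp: integrable_density)
  have dn: "(?n has_real_derivative - t * ?n t) (at t)" for t
    
  proof -
    have "((\<lambda>t. 1 / sqrt (2 * pi) * exp (- t\<^sup>2 / 2)) has_real_derivative 1 / sqrt (2 * pi) * (exp (- t\<^sup>2 / 2) * (- t))) (at t)"
      by (intro DERIV_cmult) (auto intro!: derivative_eq_intros)
    then show ?thesis by (simp add: std_normal_density_def[abs_def] mult.commute)
  qed
  have cn: "continuous_on UNIV ?n" unfolding std_normal_density_def[abs_def] by (intro continuous_intros) auto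
  have lim: "((\<lambda>t. ?n t * u t) \<longlongrightarrow> 0) F" if "F = at_top \<or> F = at_bot" for F
  proof (rule Lim_null_comparison)
    show "\<forall>\<^sub>F t in F. norm (?n t * u t) \<le> B * (1 / sqrt (2 * pi) * exp (- t\<^sup>2 / 2) * exp \<bar>t\<bar>)"
    proof (rule always_eventually, rule allI)
      fix t
      have "norm (?n t * u t) = ?n t * \<bar>u t\<bar>" by (simp add: abs_mult)
      also have "\<dots> \<le> ?n t * (B * exp \<bar>t\<bar>)" by (intro mult_left_mono b) auto
      finally show "norm (?n t * u t) \<le> B * (1 / sqrt (2 * pi) * exp (- t\<^sup>2 / 2) * exp \<bar>t\<bar>)"
        by (simp add: std_normal_density_def mult_ac)
    qed
    have "((\<lambda>t::real. exp (- t\<^sup>2 / 2) * exp \<bar>t\<bar>) \<longlongrightarrow> 0) F"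
      using that by (elim disjE) (simp, real_asymp)+
    from tendsto_mult_right_zero[OF this, of "B * (1 / sqrt (2 * pi))"]
    show "((\<lambda>t. B * (1 / sqrt (2 * pi) * exp (- t\<^sup>2 / 2) * exp \<bar>t\<bar>)) \<longlongrightarrow> 0) F" by (simp add: mult_ac)
  qed
  have "(LBINT t=-\<infinity>..\<infinity>. ?f t) = 0 - 0"
  proof (rule interval_integral_FTC_integrable[where F = "\<lambda>t. ?n t * u t"])
    show "((\<lambda>t. ?n t * u t) has_vector_derivative ?f t) (at t)" for t
    proof -
      have "((\<lambda>t. ?n t * u t) has_real_derivative (- t * ?n t) * u t + u' t * ?n t) (at t)"
        by (intro DERIV_mult dn u)
      moreover have "(- t * ?n t) * u t + u' t * ?n t = ?f t" by (simp add: algebra_simps)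
      ultimately show ?thesis by (simp only: has_real_derivative_iff_has_vector_derivative)
    qed
    have "continuous_on UNIV ?f" by (intro continuous_intros cn u' cu)
    then show "isCont ?f t" for t by (simp add: continuous_on_eq_continuous_at)
    show "set_integrable lborel (einterval (- \<infinity>) \<infinity>) ?f"
      unfolding set_integrable_def using il by (intro integrable_mult_indicator) auto
    show "(((\<lambda>t. ?n t * u t) \<circ> real_of_ereal) \<longlongrightarrow> 0) (at_right (- \<infinity>))"
      "(((\<lambda>t. ?n t * u t) \<circ> real_of_ereal) \<longlongrightarrow> 0) (at_left \<infinity>)"
      using lim by (auto simp: ereal_tendsto_simps)
  qed simp
  then have "(\<integral>t. ?f t \<partial>lborel) = 0"
    by (simp add: interval_lebesgue_integral_def set_lebesgue_integral_def)
  then have "(\<integral>t. ?n t * u' t \<partial>lborel) = (\<integral>t. ?n t * (t * u t) \<partial>lborel)"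
    using il by simp
  then show ?thesis by (simp add: integral_density)
qed

abbreviation std_gaussian :: "nat \<Rightarrow> (nat \<Rightarrow> real) measure" where
  "std_gaussian n \<equiv> PiM {..<n} (\<lambda>_. std_normal_distribution)"

lemma product_sigma_finite_std_normal: "product_sigma_finite (\<lambda>_::nat. std_normal_distribution)"
  by (intro product_sigma_finite.intro prob_space_imp_sigma_finite prob_space_std_normal)

lemma prob_space_std_gaussian: "prob_space (std_gaussian n)"
  by (intro prob_space_PiM prob_space_std_normal)

lemma integrable_exp_sum_abs: "integrable (std_gaussian n) (\<lambda>a. exp (c * (\<Sum>i<n. \<bar>a i\<bar>)))"
proof -
  interpret product_sigma_finite "\<lambda>_::nat. std_normal_distribution" by (rule product_sigma_finite_std_normal)
  have "integrable (std_gaussian n) (\<lambda>a. \<Prod>i<n. exp (c * \<bar>a i\<bar>))"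
    by (intro product_integrable_prod integrable_exp_abs) auto
  then show ?thesis by (simp add: exp_sum sum_distrib_left)
qed

lemma integrable_exp_growth:
  fixes U :: "(nat \<Rightarrow> real) \<Rightarrow> real"
  assumes "U \<in> borel_measurable (std_gaussian n)" and "\<And>a. \<bar>U a\<bar> \<le> B * exp (c * (\<Sum>i<n. \<bar>a i\<bar>))"
  shows "integrable (std_gaussian n) U"
proof (rule Bochner_Integration.integrable_bound)
  show "integrable (std_gaussian n) (\<lambda>a. B * exp (c * (\<Sum>i<n. \<bar>a i\<bar>)))"
    by (intro integrable_mult_right integrable_exp_sum_abs)
  show "AE a in std_gaussian n. norm (U a) \<le> norm (B * exp (c * (\<Sum>i<n. \<bar>a i\<bar>)))"
    using assms(2) by (auto intro!: AE_I2 intro: order_trans[OF _ abs_ge_self])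
qed fact

text \<open>Fubini isolates the coordinate \<open>k\<close>. The exponential of the sum splits into
  \<open>exp |t|\<close> and a constant depending on the other coordinates, as the one-dimensional
  statement requires.\<close>

lemma std_gaussian_integration_by_parts:
  fixes U U' :: "(nat \<Rightarrow> real) \<Rightarrow> real"
  assumes k: "k < n" and [measurable]: "U \<in> borel_measurable (std_gaussian n)" "U' \<in> borel_measurable (std_gaussian n)"
    and d: "\<And>a t. ((\<lambda>t. U (a(k := t))) has_real_derivative U' (a(k := t))) (at t)"
    and c: "\<And>a. continuous_on UNIV (\<lambda>t. U' (a(k := t)))"
    and b: "\<And>a. \<bar>U a\<bar> \<le> B * exp (\<Sum>i<n. \<bar>a i\<bar>)" "\<And>a. \<bar>U' a\<bar> \<le> B * exp (\<Sum>i<n. \<bar>a i\<bar>)"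
  shows "(\<integral>a. a k * U a \<partial>std_gaussian n) = (\<integral>a. U' a \<partial>std_gaussian n)"
proof -
  interpret product_sigma_finite "\<lambda>_::nat. std_normal_distribution" by (rule product_sigma_finite_std_normal)
  have B0: "B \<ge> 0" using b(1)[of "\<lambda>_. 0"] by simp
  have i1: "integrable (std_gaussian n) U'"
    by (rule integrable_exp_growth[where B = B and c = 1]) (use b in auto)
  have [measurable]: "(\<lambda>a. a k) \<in> borel_measurable (std_gaussian n)"
    using measurable_component_singleton[of k "{..<n}" "\<lambda>_. std_normal_distribution"] k by simp
  have i2: "integrable (std_gaussian n) (\<lambda>a. a k * U a)"
  proof (rule integrable_exp_growth[where B = B and c = 2])
    fix a :: "nat \<Rightarrow> real"
    have "\<bar>a k\<bar> \<le> (\<Sum>i<n. \<bar>a i\<bar>)" by (rule member_le_sum) (use k in auto)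
    then have "\<bar>a k * U a\<bar> \<le> exp (\<Sum>i<n. \<bar>a i\<bar>) * (B * exp (\<Sum>i<n. \<bar>a i\<bar>))"
      unfolding abs_mult using exp_ge_add_one_self[of "\<Sum>i<n. \<bar>a i\<bar>"] by (intro mult_mono b) linarith+
    moreover have "exp (2 * (\<Sum>i<n. \<bar>a i\<bar>)) = exp (\<Sum>i<n. \<bar>a i\<bar>) * exp (\<Sum>i<n. \<bar>a i\<bar>)" by (simp only: exp_add[symmetric] mult_2)
    ultimately show "\<bar>a k * U a\<bar> \<le> B * exp (2 * (\<Sum>i<n. \<bar>a i\<bar>))"
      by (simp only: mult_ac)
  qed measurable
  have ins: "{..<n} = insert k ({..<n} - {k})" using k by auto
  have fin: "finite ({..<n} - {k})" and nin: "k \<notin> {..<n} - {k}" by auto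
  have "(\<integral>a. a k * U a \<partial>std_gaussian n)
      = (\<integral>a. (\<integral>t. (a(k := t)) k * U (a(k := t)) \<partial>std_normal_distribution) \<partial>PiM ({..<n} - {k}) (\<lambda>_. std_normal_distribution))"
    using i2 product_integral_insert[OF fin nin, of "\<lambda>a. a k * U a"] unfolding ins[symmetric] by simp
  also have "\<dots> = (\<integral>a. (\<integral>t. U' (a(k := t)) \<partial>std_normal_distribution) \<partial>PiM ({..<n} - {k}) (\<lambda>_. std_normal_distribution))"
  proof (rule Bochner_Integration.integral_cong[OF refl])
    fix a :: "nat \<Rightarrow> real"
    have s: "(\<Sum>i<n. \<bar>(a(k := t)) i\<bar>) = \<bar>t\<bar> + (\<Sum>i\<in>{..<n} - {k}. \<bar>a i\<bar>)" for t
    proof -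
      have "(\<Sum>i<n. \<bar>(a(k := t)) i\<bar>) = \<bar>(a(k := t)) k\<bar> + (\<Sum>i\<in>{..<n} - {k}. \<bar>(a(k := t)) i\<bar>)"
        by (rule sum.remove) (use k in auto)
      also have "(\<Sum>i\<in>{..<n} - {k}. \<bar>(a(k := t)) i\<bar>) = (\<Sum>i\<in>{..<n} - {k}. \<bar>a i\<bar>)"
        by (rule sum.cong) auto
      finally show ?thesis by simp
    qed
    have "(\<integral>t. t * U (a(k := t)) \<partial>std_normal_distribution) = (\<integral>t. U' (a(k := t)) \<partial>std_normal_distribution)"
      by (rule gaussian_integration_by_parts[where B = "B * exp (\<Sum>i\<in>{..<n} - {k}. \<bar>a i\<bar>)"])
         (use d c b[of "a(k := _)", unfolded s] in \<open>auto simp: exp_add mult_ac\<close>)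
    then show "(\<integral>t. (a(k := t)) k * U (a(k := t)) \<partial>std_normal_distribution) = (\<integral>t. U' (a(k := t)) \<partial>std_normal_distribution)"
      by simp
  qed
  also have "\<dots> = (\<integral>a. U' a \<partial>std_gaussian n)"
    using i1 product_integral_insert[OF fin nin, of U'] unfolding ins[symmetric] by simp
  finally show ?thesis .
qed

section \<open>L2 inequalities and second moments of integrals\<close>

lemma Cauchy_Schwarz_integral:
  fixes X Y :: "'a \<Rightarrow> real"
  assumes [measurable]: "X \<in> borel_measurable M" "Y \<in> borel_measurable M"
    and X: "integrable M (\<lambda>x. (X x)\<^sup>2)" and Y: "integrable M (\<lambda>x. (Y x)\<^sup>2)"
  shows "\<bar>\<integral>x. X x * Y x \<partial>M\<bar> \<le> sqrt (\<integral>x. (X x)\<^sup>2 \<partial>M) * sqrt (\<integral>x. (Y x)\<^sup>2 \<partial>M)"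
proof -
  define a b where "a = sqrt (\<integral>x. (X x)\<^sup>2 \<partial>M)" and "b = sqrt (\<integral>x. (Y x)\<^sup>2 \<partial>M)"
  have a2: "a\<^sup>2 = (\<integral>x. (X x)\<^sup>2 \<partial>M)" and b2: "b\<^sup>2 = (\<integral>x. (Y x)\<^sup>2 \<partial>M)" and ab: "a \<ge> 0" "b \<ge> 0"
    unfolding a_def b_def by auto
  have iXY: "integrable M (\<lambda>x. X x * Y x)" by (rule integrable_mult_L2) (use X Y in auto)
  \<comment> \<open>Expands the integral of \<open>(s * X - t * Y)^2\<close>; the choices
    \<open>(b, a)\<close> and \<open>(b, - a)\<close> for \<open>(s, t)\<close> give the two
    signs.\<close>
  have key: "2 * s * t * (\<integral>x. X x * Y x \<partial>M) \<le> s\<^sup>2 * a\<^sup>2 + t\<^sup>2 * b\<^sup>2" for s t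
  proof -
    have "0 \<le> (\<integral>x. (s * X x - t * Y x)\<^sup>2 \<partial>M)" by simp
    also have "\<dots> = (\<integral>x. s\<^sup>2 * (X x)\<^sup>2 + t\<^sup>2 * (Y x)\<^sup>2 - (2 * s * t) * (X x * Y x) \<partial>M)"
      by (intro Bochner_Integration.integral_cong) (auto simp: power2_eq_square algebra_simps)
    also have "\<dots> = s\<^sup>2 * a\<^sup>2 + t\<^sup>2 * b\<^sup>2 - 2 * s * t * (\<integral>x. X x * Y x \<partial>M)"
      unfolding a2 b2 using X Y iXY by simp
    finally show ?thesis by simp
  qed
  show ?thesis
  proof (cases "a = 0 \<or> b = 0")
    case True
    then have "AE x in M. X x * Y x = 0"
      using X Y a2 b2 integral_nonneg_eq_0_iff_AE[OF X] integral_nonneg_eq_0_iff_AE[OF Y] by auto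
    then have "(\<integral>x. X x * Y x \<partial>M) = (\<integral>x. 0 \<partial>M)" by (intro integral_cong_AE) auto
    then show ?thesis by simp
  next
    case False
    then have "0 < a * b" using ab by simp
    define J where "J = (\<integral>x. X x * Y x \<partial>M)"
    have "(a * b) * J \<le> (a * b) * (a * b)" "(a * b) * (- J) \<le> (a * b) * (a * b)"
      using key[of b a] key[of b "- a"] unfolding J_def[symmetric] by (simp_all add: power2_eq_square algebra_simps)
    then have 1: "J \<le> a * b" and 2: "- J \<le> a * b" using \<open>0 < a * b\<close> mult_le_cancel_left_pos by blast+
    from 1 2 show ?thesis unfolding a_def[symmetric] b_def[symmetric] J_def[symmetric] by linarith
  qed
qed

lemma (in prob_space) expectation_abs_le_sqrt:
  fixes X :: "'a \<Rightarrow> real"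
  assumes [measurable]: "X \<in> borel_measurable M" and X: "integrable M (\<lambda>x. (X x)\<^sup>2)"
  shows "integrable M X" "(\<integral>x. \<bar>X x\<bar> \<partial>M) \<le> sqrt (\<integral>x. (X x)\<^sup>2 \<partial>M)"
proof -
  show "integrable M X" using integrable_mult_L2[of X M "\<lambda>_. 1"] X by simp
  have "\<bar>\<integral>x. \<bar>X x\<bar> * 1 \<partial>M\<bar> \<le> sqrt (\<integral>x. \<bar>X x\<bar>\<^sup>2 \<partial>M) * sqrt (\<integral>x. 1\<^sup>2 \<partial>M)"
    by (rule Cauchy_Schwarz_integral) (use X in auto)
  then show "(\<integral>x. \<bar>X x\<bar> \<partial>M) \<le> sqrt (\<integral>x. (X x)\<^sup>2 \<partial>M)" by (simp add: prob_space)
qed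

lemma L2_triangle:
  fixes X Y :: "'a \<Rightarrow> real"
  assumes [measurable]: "X \<in> borel_measurable M" "Y \<in> borel_measurable M"
    and X: "integrable M (\<lambda>x. (X x)\<^sup>2)" and Y: "integrable M (\<lambda>x. (Y x)\<^sup>2)"
  shows "integrable M (\<lambda>x. (X x + Y x)\<^sup>2)"
    "sqrt (\<integral>x. (X x + Y x)\<^sup>2 \<partial>M) \<le> sqrt (\<integral>x. (X x)\<^sup>2 \<partial>M) + sqrt (\<integral>x. (Y x)\<^sup>2 \<partial>M)"
proof -
  define a b where "a = sqrt (\<integral>x. (X x)\<^sup>2 \<partial>M)" and "b = sqrt (\<integral>x. (Y x)\<^sup>2 \<partial>M)"
  have a2: "a\<^sup>2 = (\<integral>x. (X x)\<^sup>2 \<partial>M)" and b2: "b\<^sup>2 = (\<integral>x. (Y x)\<^sup>2 \<partial>M)" and ab: "a \<ge> 0" "b \<ge> 0"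
    unfolding a_def b_def by auto
  have iXY: "integrable M (\<lambda>x. X x * Y x)" by (rule integrable_mult_L2) (use X Y in auto)
  have eq: "(X x + Y x)\<^sup>2 = (X x)\<^sup>2 + 2 * (X x * Y x) + (Y x)\<^sup>2" for x by (simp add: power2_sum)
  show "integrable M (\<lambda>x. (X x + Y x)\<^sup>2)" unfolding eq using X Y iXY by simp
  have "(\<integral>x. (X x + Y x)\<^sup>2 \<partial>M) = a\<^sup>2 + 2 * (\<integral>x. X x * Y x \<partial>M) + b\<^sup>2"
    unfolding eq a2 b2 using X Y iXY by simp
  also have "\<dots> \<le> (a + b)\<^sup>2"
    using Cauchy_Schwarz_integral[OF assms] by (simp add: power2_sum a_def[symmetric] b_def[symmetric])
  finally show "sqrt (\<integral>x. (X x + Y x)\<^sup>2 \<partial>M) \<le> sqrt (\<integral>x. (X x)\<^sup>2 \<partial>M) + sqrt (\<integral>x. (Y x)\<^sup>2 \<partial>M)"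
    unfolding a_def[symmetric] b_def[symmetric] using ab by (intro real_le_lsqrt) auto
qed

text \<open>Fubini for one and for two copies of \<sigma>: the uniform second moment makes
  \<open>V x a\<close> and, by the inequality of means, \<open>V x a * V y a\<close> absolutely
  integrable over the products.\<close>

lemma second_moment_integral:
  fixes V :: "'x \<Rightarrow> 'a \<Rightarrow> real"
  assumes fin: "finite_measure \<sigma>" and prob: "prob_space \<mu>"
    and V [measurable]: "case_prod V \<in> borel_measurable (\<sigma> \<Otimes>\<^sub>M \<mu>)"
    and sq: "\<And>x. x \<in> space \<sigma> \<Longrightarrow> integrable \<mu> (\<lambda>a. (V x a)\<^sup>2)"
    and bd: "\<And>x. x \<in> space \<sigma> \<Longrightarrow> (\<integral>a. (V x a)\<^sup>2 \<partial>\<mu>) \<le> B"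
  shows "AE a in \<mu>. integrable \<sigma> (\<lambda>x. V x a)"
    "(\<lambda>a. \<integral>x. V x a \<partial>\<sigma>) \<in> borel_measurable \<mu>"
    "integrable \<mu> (\<lambda>a. \<integral>x. V x a \<partial>\<sigma>)"
    "(\<integral>a. (\<integral>x. V x a \<partial>\<sigma>) \<partial>\<mu>) = (\<integral>x. (\<integral>a. V x a \<partial>\<mu>) \<partial>\<sigma>)"
    "integrable \<mu> (\<lambda>a. (\<integral>x. V x a \<partial>\<sigma>)\<^sup>2)"
    "integrable (\<sigma> \<Otimes>\<^sub>M \<sigma>) (\<lambda>(x, y). \<integral>a. V x a * V y a \<partial>\<mu>)"
    "(\<integral>a. (\<integral>x. V x a \<partial>\<sigma>)\<^sup>2 \<partial>\<mu>) = (\<integral>(x, y). (\<integral>a. V x a * V y a \<partial>\<mu>) \<partial>(\<sigma> \<Otimes>\<^sub>M \<sigma>))"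
proof -
  interpret s: finite_measure \<sigma> by fact
  interpret m: prob_space \<mu> by fact
  interpret sm: pair_sigma_finite \<sigma> \<mu> ..
  interpret ss: pair_sigma_finite \<sigma> \<sigma> ..
  interpret ssf: finite_measure "\<sigma> \<Otimes>\<^sub>M \<sigma>" by (rule finite_measure_pair_measure) unfold_locales
  interpret ssm: pair_sigma_finite "\<sigma> \<Otimes>\<^sub>M \<sigma>" \<mu> ..
  have [measurable]: "(\<lambda>p. V (fst p) (snd p)) \<in> borel_measurable (\<sigma> \<Otimes>\<^sub>M \<mu>)"
    using V by (simp add: case_prod_unfold)
  have Vx [measurable]: "V x \<in> borel_measurable \<mu>" if "x \<in> space \<sigma>" for x
    using measurable_compose[OF measurable_Pair1'[OF that] V] by simp
  have amgm: "\<bar>u * v\<bar> \<le> (u\<^sup>2 + v\<^sup>2) / 2" for u v :: real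
  proof -
    have "0 \<le> (\<bar>u\<bar> - \<bar>v\<bar>)\<^sup>2" by simp
    then show ?thesis by (simp add: power2_diff abs_mult)
  qed
  have ixy: "integrable \<mu> (\<lambda>a. V x a * V y a)" "(\<integral>a. \<bar>V x a * V y a\<bar> \<partial>\<mu>) \<le> B" if "x \<in> space \<sigma>" "y \<in> space \<sigma>" for x y
  proof -
    show i: "integrable \<mu> (\<lambda>a. V x a * V y a)"
      by (rule integrable_mult_L2) (use sq that Vx in auto)
    have "(\<integral>a. \<bar>V x a * V y a\<bar> \<partial>\<mu>) \<le> (\<integral>a. ((V x a)\<^sup>2 + (V y a)\<^sup>2) / 2 \<partial>\<mu>)"
      by (rule integral_mono) (use i sq that amgm in auto)
    also have "\<dots> = ((\<integral>a. (V x a)\<^sup>2 \<partial>\<mu>) + (\<integral>a. (V y a)\<^sup>2 \<partial>\<mu>)) / 2" using sq that by simp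
    also have "\<dots> \<le> B" using bd[OF that(1)] bd[OF that(2)] by simp
    finally show "(\<integral>a. \<bar>V x a * V y a\<bar> \<partial>\<mu>) \<le> B" .
  qed
  have iV1: "integrable \<mu> (V x)" "(\<integral>a. \<bar>V x a\<bar> \<partial>\<mu>) \<le> sqrt B" if "x \<in> space \<sigma>" for x
  proof -
    show "integrable \<mu> (V x)" by (rule m.expectation_abs_le_sqrt(1)) (use sq that Vx in auto)
    have "(\<integral>a. \<bar>V x a\<bar> \<partial>\<mu>) \<le> sqrt (\<integral>a. (V x a)\<^sup>2 \<partial>\<mu>)"
      by (rule m.expectation_abs_le_sqrt(2)) (use sq that Vx in auto)
    also have "\<dots> \<le> sqrt B" using bd[OF that] by simp
    finally show "(\<integral>a. \<bar>V x a\<bar> \<partial>\<mu>) \<le> sqrt B" .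
  qed
  have intV: "integrable (\<sigma> \<Otimes>\<^sub>M \<mu>) (case_prod V)"
  proof (rule sm.Fubini_integrable)
    show "integrable \<sigma> (\<lambda>x. \<integral>a. norm (case (x, a) of (x, a) \<Rightarrow> V x a) \<partial>\<mu>)"
    proof (rule s.integrable_const_bound[where B = "sqrt B"])
      show "AE x in \<sigma>. norm (\<integral>a. norm (case (x, a) of (x, a) \<Rightarrow> V x a) \<partial>\<mu>) \<le> sqrt B"
        using iV1(2) by (intro AE_I2) simp
    qed measurable
    show "AE x in \<sigma>. integrable \<mu> (\<lambda>a. case (x, a) of (x, a) \<Rightarrow> V x a)"
      using iV1(1) by (intro AE_I2) simp
  qed fact
  show ae: "AE a in \<mu>. integrable \<sigma> (\<lambda>x. V x a)" using sm.AE_integrable_snd[OF intV] .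
  show [measurable]: "(\<lambda>a. \<integral>x. V x a \<partial>\<sigma>) \<in> borel_measurable \<mu>"
    by (rule s.borel_measurable_lebesgue_integral) (simp add: case_prod_unfold)
  show "integrable \<mu> (\<lambda>a. \<integral>x. V x a \<partial>\<sigma>)" using sm.integrable_snd[OF intV] .
  show "(\<integral>a. (\<integral>x. V x a \<partial>\<sigma>) \<partial>\<mu>) = (\<integral>x. (\<integral>a. V x a \<partial>\<mu>) \<partial>\<sigma>)"
    by (rule sm.Fubini_integral[OF intV])
  define H where "H p a = V (fst p) a * V (snd p) a" for p a
  have [measurable]: "case_prod H \<in> borel_measurable ((\<sigma> \<Otimes>\<^sub>M \<sigma>) \<Otimes>\<^sub>M \<mu>)"
    unfolding H_def case_prod_unfold by measurable
  have intH: "integrable ((\<sigma> \<Otimes>\<^sub>M \<sigma>) \<Otimes>\<^sub>M \<mu>) (case_prod H)"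
  proof (rule ssm.Fubini_integrable)
    have [measurable]: "(\<lambda>x. H (fst x) (snd x)) \<in> borel_measurable ((\<sigma> \<Otimes>\<^sub>M \<sigma>) \<Otimes>\<^sub>M \<mu>)"
      unfolding H_def by measurable
    show "integrable (\<sigma> \<Otimes>\<^sub>M \<sigma>) (\<lambda>p. \<integral>a. norm (case (p, a) of (p, a) \<Rightarrow> H p a) \<partial>\<mu>)"
    proof (rule ssf.integrable_const_bound[where B = B])
      show "AE p in \<sigma> \<Otimes>\<^sub>M \<sigma>. norm (\<integral>a. norm (case (p, a) of (p, a) \<Rightarrow> H p a) \<partial>\<mu>) \<le> B"
        using ixy(2) by (intro AE_I2) (auto simp: space_pair_measure H_def)
    qed measurable
    show "AE p in \<sigma> \<Otimes>\<^sub>M \<sigma>. integrable \<mu> (\<lambda>a. case (p, a) of (p, a) \<Rightarrow> H p a)"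
      using ixy(1) by (intro AE_I2) (auto simp: space_pair_measure H_def)
  qed fact
  \<comment> \<open>Writing the squared integral as a double integral requires an integrable
    section, which is available only for almost every \<open>a\<close>.\<close>
  have sqH: "AE a in \<mu>. (\<integral>p. H p a \<partial>(\<sigma> \<Otimes>\<^sub>M \<sigma>)) = (\<integral>x. V x a \<partial>\<sigma>)\<^sup>2"
    using ae
  proof eventually_elim
    case (elim a)
    have "has_bochner_integral (\<sigma> \<Otimes>\<^sub>M \<sigma>) (\<lambda>(x, y). V x a * V y a) ((\<integral>x. V x a \<partial>\<sigma>) * (\<integral>x. V x a \<partial>\<sigma>))"
      by (rule has_bochner_integral_pair_mult) (use elim in \<open>auto intro: s.sigma_finite_measure_axioms\<close>)
    then show ?case by (simp add: H_def case_prod_unfold has_bochner_integral_iff power2_eq_square)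
  qed
  have iH: "integrable \<mu> (\<lambda>a. \<integral>p. H p a \<partial>(\<sigma> \<Otimes>\<^sub>M \<sigma>))" using ssm.integrable_snd[OF intH] .
  have [measurable]: "(\<lambda>a. \<integral>p. H p a \<partial>(\<sigma> \<Otimes>\<^sub>M \<sigma>)) \<in> borel_measurable \<mu>" using iH by auto
  show "integrable \<mu> (\<lambda>a. (\<integral>x. V x a \<partial>\<sigma>)\<^sup>2)"
    by (rule integrable_cong_AE_imp[OF iH]) (use sqH in auto)
  show "integrable (\<sigma> \<Otimes>\<^sub>M \<sigma>) (\<lambda>(x, y). \<integral>a. V x a * V y a \<partial>\<mu>)"
    using ssm.integrable_fst[OF intH] by (simp add: H_def case_prod_unfold)
  have "(\<integral>a. (\<integral>x. V x a \<partial>\<sigma>)\<^sup>2 \<partial>\<mu>) = (\<integral>a. (\<integral>p. H p a \<partial>(\<sigma> \<Otimes>\<^sub>M \<sigma>)) \<partial>\<mu>)"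
    by (rule integral_cong_AE) (use sqH in auto)
  also have "\<dots> = (\<integral>p. (\<integral>a. H p a \<partial>\<mu>) \<partial>(\<sigma> \<Otimes>\<^sub>M \<sigma>))" by (rule ssm.Fubini_integral[OF intH])
  finally show "(\<integral>a. (\<integral>x. V x a \<partial>\<sigma>)\<^sup>2 \<partial>\<mu>) = (\<integral>(x, y). (\<integral>a. V x a * V y a \<partial>\<mu>) \<partial>(\<sigma> \<Otimes>\<^sub>M \<sigma>))"
    by (simp add: H_def case_prod_unfold)
qed

lemma poly_exp_bound:
  fixes p :: "real poly"
  obtains B where "B \<ge> 0" "\<And>t. \<bar>poly p t\<bar> \<le> B * exp (\<bar>t\<bar> / 4)"
proof -
  define B where "B = (\<Sum>i\<le>degree p. \<bar>coeff p i\<bar> * (4 ^ i * fact i))"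
  have "\<bar>poly p t\<bar> \<le> B * exp (\<bar>t\<bar> / 4)" for t
  proof -
    have "\<bar>poly p t\<bar> \<le> (\<Sum>i\<le>degree p. \<bar>coeff p i * t ^ i\<bar>)"
      unfolding poly_altdef by (rule sum_abs)
    also have "\<dots> \<le> (\<Sum>i\<le>degree p. \<bar>coeff p i\<bar> * (4 ^ i * fact i) * exp (\<bar>t\<bar> / 4))"
    proof (rule sum_mono)
      fix i
      have "\<bar>t\<bar> ^ i = 4 ^ i * (\<bar>t\<bar> / 4) ^ i" by (simp add: power_divide)
      also have "\<dots> \<le> 4 ^ i * (fact i * exp (\<bar>t\<bar> / 4))" by (intro mult_left_mono power_le_fact_exp) auto
      finally have "\<bar>coeff p i\<bar> * \<bar>t\<bar> ^ i \<le> \<bar>coeff p i\<bar> * (4 ^ i * (fact i * exp (\<bar>t\<bar> / 4)))"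
        by (rule mult_left_mono) simp
      then show "\<bar>coeff p i * t ^ i\<bar> \<le> \<bar>coeff p i\<bar> * (4 ^ i * fact i) * exp (\<bar>t\<bar> / 4)"
        by (simp add: abs_mult power_abs mult_ac)
    qed
    finally show ?thesis by (simp add: B_def sum_distrib_right)
  qed
  moreover have "B \<ge> 0" unfolding B_def by (intro sum_nonneg) auto
  ultimately show ?thesis using that by blast
qed

section \<open>Bounded weights\<close>

text \<open>A class closed under sums, products and polynomials and, for finite measures, contained
  in the integrable functions, so that integrability of every polynomial functional follows
  structurally.\<close>

definition bounded_meas :: "'x measure \<Rightarrow> ('x \<Rightarrow> real) \<Rightarrow> bool" where
  "bounded_meas \<sigma> u \<longleftrightarrow> u \<in> borel_measurable \<sigma> \<and> (\<exists>B. \<forall>x\<in>space \<sigma>. \<bar>u x\<bar> \<le> B)"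

lemma bounded_meas_const [simp]: "bounded_meas \<sigma> (\<lambda>_. c)"
  unfolding bounded_meas_def by auto

lemma bounded_meas_add [intro]: "bounded_meas \<sigma> u \<Longrightarrow> bounded_meas \<sigma> v \<Longrightarrow> bounded_meas \<sigma> (\<lambda>x. u x + v x)"
  unfolding bounded_meas_def
  by (auto, metis abs_triangle_ineq add_mono order_trans)

lemma bounded_meas_mult [intro]: "bounded_meas \<sigma> u \<Longrightarrow> bounded_meas \<sigma> v \<Longrightarrow> bounded_meas \<sigma> (\<lambda>x. u x * v x)"
  unfolding bounded_meas_def
  by (auto simp: abs_mult, metis abs_ge_zero mult_mono' )

lemma bounded_meas_poly [intro]: "bounded_meas \<sigma> u \<Longrightarrow> bounded_meas \<sigma> (\<lambda>x. poly p (u x))"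
  by (induction p) auto

lemma bounded_meas_sum [intro]: "(\<And>i. i \<in> I \<Longrightarrow> bounded_meas \<sigma> (u i)) \<Longrightarrow> bounded_meas \<sigma> (\<lambda>x. \<Sum>i\<in>I. u i x)"
  by (induction I rule: infinite_finite_induct) auto

lemma bounded_meas_integrable: "finite_measure \<sigma> \<Longrightarrow> bounded_meas \<sigma> u \<Longrightarrow> integrable \<sigma> u"
  unfolding bounded_meas_def by (auto intro!: finite_measure.integrable_const_bound AE_I2)

text \<open>Induction on \<open>p\<close> with \<open>w\<close> arbitrary: the factor
  \<open>u + t * v\<close> that \<open>pCons\<close> splits off is moved into the weight, and the
  product rule does the rest. No limit is taken under the integral.\<close>

lemma has_derivative_integral_poly:
  fixes u v w :: "'x \<Rightarrow> real"
  assumes fin: "finite_measure \<sigma>" and u: "bounded_meas \<sigma> u" and v: "bounded_meas \<sigma> v" and w: "bounded_meas \<sigma> w"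
  shows "((\<lambda>t. \<integral>x. poly p (u x + t * v x) * w x \<partial>\<sigma>) has_real_derivative
    (\<integral>x. poly (pderiv p) (u x + t * v x) * (v x * w x) \<partial>\<sigma>)) (at t)"
  using w
proof (induction p arbitrary: w)
  case 0
  then show ?case by simp
next
  case (pCons c q)
  note bi = bounded_meas_integrable[OF fin]
  have *: "(\<integral>x. poly (pCons c q) (u x + t * v x) * w x \<partial>\<sigma>)
     = c * (\<integral>x. w x \<partial>\<sigma>) + (\<integral>x. poly q (u x + t * v x) * (u x * w x) \<partial>\<sigma>) + t * (\<integral>x. poly q (u x + t * v x) * (v x * w x) \<partial>\<sigma>)" for t
  proof -
    have i: "integrable \<sigma> (\<lambda>x. c * w x)" "integrable \<sigma> (\<lambda>x. poly q (u x + t * v x) * (u x * w x))"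
      "integrable \<sigma> (\<lambda>x. t * (poly q (u x + t * v x) * (v x * w x)))"
      by (intro bi integrable_mult_right integrable_mult_left bounded_meas_mult bounded_meas_poly bounded_meas_add bounded_meas_const u v pCons.prems)+
    have "(\<integral>x. poly (pCons c q) (u x + t * v x) * w x \<partial>\<sigma>)
       = (\<integral>x. c * w x + poly q (u x + t * v x) * (u x * w x) + t * (poly q (u x + t * v x) * (v x * w x)) \<partial>\<sigma>)"
      by (intro Bochner_Integration.integral_cong) (auto simp: algebra_simps)
    also have "\<dots> = c * (\<integral>x. w x \<partial>\<sigma>) + (\<integral>x. poly q (u x + t * v x) * (u x * w x) \<partial>\<sigma>) + t * (\<integral>x. poly q (u x + t * v x) * (v x * w x) \<partial>\<sigma>)"
      using i by (simp only: Bochner_Integration.integral_add Bochner_Integration.integrable_add integral_mult_right_zero)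
    finally show ?thesis .
  qed
  have uw: "bounded_meas \<sigma> (\<lambda>x. u x * w x)" and vw: "bounded_meas \<sigma> (\<lambda>x. v x * w x)" using u v pCons.prems by auto
  have "((\<lambda>t. c * (\<integral>x. w x \<partial>\<sigma>) + (\<integral>x. poly q (u x + t * v x) * (u x * w x) \<partial>\<sigma>) + t * (\<integral>x. poly q (u x + t * v x) * (v x * w x) \<partial>\<sigma>))
     has_real_derivative
     0 + (\<integral>x. poly (pderiv q) (u x + t * v x) * (v x * (u x * w x)) \<partial>\<sigma>)
     + (1 * (\<integral>x. poly q (u x + t * v x) * (v x * w x) \<partial>\<sigma>) + (\<integral>x. poly (pderiv q) (u x + t * v x) * (v x * (v x * w x)) \<partial>\<sigma>) * t)) (at t)"
    by (intro DERIV_add DERIV_mult DERIV_const DERIV_ident pCons.IH uw vw)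
  also have "0 + (\<integral>x. poly (pderiv q) (u x + t * v x) * (v x * (u x * w x)) \<partial>\<sigma>)
     + (1 * (\<integral>x. poly q (u x + t * v x) * (v x * w x) \<partial>\<sigma>) + (\<integral>x. poly (pderiv q) (u x + t * v x) * (v x * (v x * w x)) \<partial>\<sigma>) * t)
     = (\<integral>x. poly (pderiv (pCons c q)) (u x + t * v x) * (v x * w x) \<partial>\<sigma>)"
  proof -
    have i: "integrable \<sigma> (\<lambda>x. poly (pderiv q) (u x + t * v x) * (v x * (u x * w x)))"
      "integrable \<sigma> (\<lambda>x. poly q (u x + t * v x) * (v x * w x))"
      "integrable \<sigma> (\<lambda>x. poly (pderiv q) (u x + t * v x) * (v x * (v x * w x)) * t)"
      by (intro bi integrable_mult_right integrable_mult_left bounded_meas_mult bounded_meas_poly bounded_meas_add bounded_meas_const u v pCons.prems)+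
    have "(\<integral>x. poly (pderiv (pCons c q)) (u x + t * v x) * (v x * w x) \<partial>\<sigma>)
      = (\<integral>x. poly (pderiv q) (u x + t * v x) * (v x * (u x * w x)) + (poly q (u x + t * v x) * (v x * w x)
          + poly (pderiv q) (u x + t * v x) * (v x * (v x * w x)) * t) \<partial>\<sigma>)"
      by (intro Bochner_Integration.integral_cong) (auto simp: pderiv_pCons algebra_simps)
    then show ?thesis
      using i by (simp only: Bochner_Integration.integral_add Bochner_Integration.integrable_add integral_mult_left_zero)
  qed
  finally show ?case unfolding * .
qed

section \<open>Functionals of finite Gaussian expansions\<close>

text \<open>The clause with \<open>8 ^ k\<close> covers correlations \<open>\<bar>\<rho>\<bar> \<ge> 1 / 8\<close>, where the kernel estimate is not available.\<close>

definition corr_bound :: "(real \<Rightarrow> real) \<Rightarrow> nat \<Rightarrow> real \<Rightarrow> bool" where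
  "corr_bound \<psi> k K \<longleftrightarrow> \<psi> \<in> borel_measurable borel \<and> integrable std_normal_distribution (\<lambda>x. (\<psi> x)\<^sup>2) \<and> 0 \<le> K \<and>
     8 ^ k * (\<integral>x. (\<psi> x)\<^sup>2 \<partial>std_normal_distribution) \<le> K \<and>
     (\<forall>\<rho>. \<bar>\<rho>\<bar> \<le> 1 / 8 \<longrightarrow>
      \<bar>\<integral>x. (\<integral>z. \<psi> x * \<psi> (\<rho> * x + sqrt (1 - \<rho>\<^sup>2) * z) \<partial>std_normal_distribution) \<partial>std_normal_distribution\<bar> \<le> K * \<bar>\<rho>\<bar> ^ k)"

lemma corr_bound_exists:
  assumes "\<psi> \<in> borel_measurable borel" "integrable std_normal_distribution (\<lambda>x. (\<psi> x)\<^sup>2)"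
    and "\<And>j. j < k \<Longrightarrow> (\<integral>x. \<psi> x * x ^ j \<partial>std_normal_distribution) = 0"
  obtains K where "corr_bound \<psi> k K"
proof -
  obtain K where K: "K \<ge> 0"
    "\<And>\<rho>. \<bar>\<rho>\<bar> \<le> 1 / 8 \<Longrightarrow>
      \<bar>\<integral>x. (\<integral>z. \<psi> x * \<psi> (\<rho> * x + sqrt (1 - \<rho>\<^sup>2) * z) \<partial>std_normal_distribution) \<partial>std_normal_distribution\<bar> \<le> K * \<bar>\<rho>\<bar> ^ k"
    using gaussian_kernel_bound[OF assms] by blast
  define L where "L = 8 ^ k * (\<integral>x. (\<psi> x)\<^sup>2 \<partial>std_normal_distribution)"
  have "L \<ge> 0" unfolding L_def by simp
  have "K * \<bar>\<rho>\<bar> ^ k \<le> (K + L) * \<bar>\<rho>\<bar> ^ k" for \<rho> :: real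
    using \<open>L \<ge> 0\<close> by (intro mult_right_mono) auto
  then have "corr_bound \<psi> k (K + L)"
    unfolding corr_bound_def using assms K \<open>L \<ge> 0\<close> by (auto simp: L_def intro: order_trans)
  then show ?thesis using that by blast
qed

lemma corr_bound_mono: "corr_bound \<psi> k K \<Longrightarrow> K \<le> K' \<Longrightarrow> corr_bound \<psi> k K'"
  unfolding corr_bound_def by (auto intro: order_trans[OF _ mult_right_mono[of K K']])

lemma measurable_std_gaussian_component:
  "k < n \<Longrightarrow> (\<lambda>a. a k) \<in> borel_measurable (std_gaussian n)"
  using measurable_component_singleton[of k "{..<n}" "\<lambda>_. std_normal_distribution"] by simp

definition lin :: "nat \<Rightarrow> (nat \<Rightarrow> real) \<Rightarrow> (nat \<Rightarrow> real) \<Rightarrow> real" where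
  "lin n d a = (\<Sum>k<n. d k * a k)"

lemma lin_measurable [measurable]: "lin n d \<in> borel_measurable (std_gaussian n)"
  unfolding lin_def[abs_def] by (intro borel_measurable_sum borel_measurable_times measurable_std_gaussian_component) auto

lemma std_gaussian_char:
  shows "(\<integral>a. cos (lin n d a) \<partial>std_gaussian n) = exp (- (\<Sum>k<n. (d k)\<^sup>2) / 2)"
    and "(\<integral>a. sin (lin n d a) \<partial>std_gaussian n) = 0"
proof -
  interpret product_sigma_finite "\<lambda>_::nat. std_normal_distribution" by (rule product_sigma_finite_std_normal)
  interpret G: prob_space "std_gaussian n" by (rule prob_space_std_gaussian)
  interpret S: prob_space std_normal_distribution by (rule prob_space_std_normal)
  have ic: "integrable (std_gaussian n) (\<lambda>a. complex_of_real (cos (lin n d a)))"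
    "integrable (std_gaussian n) (\<lambda>a. complex_of_real (sin (lin n d a)))"
    by (intro integrable_of_real G.integrable_const_bound[where B = 1]; force intro!: AE_I2)+
  have "complex_of_real (\<integral>a. cos (lin n d a) \<partial>std_gaussian n) + \<i> * complex_of_real (\<integral>a. sin (lin n d a) \<partial>std_gaussian n)
      = (\<integral>a. complex_of_real (cos (lin n d a)) + \<i> * complex_of_real (sin (lin n d a)) \<partial>std_gaussian n)"
    using ic by simp
  also have "\<dots> = (\<integral>a. (\<Prod>k<n. iexp (d k * a k)) \<partial>std_gaussian n)"
    by (intro Bochner_Integration.integral_cong)
       (auto simp: lin_def exp_sum[symmetric] complex_eq_iff Re_exp Im_exp)
  also have "\<dots> = (\<Prod>k<n. (\<integral>x. iexp (d k * x) \<partial>std_normal_distribution))"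
    by (rule product_integral_prod) (auto intro!: S.integrable_const_bound[where B = 1] AE_I2)
  also have "\<dots> = (\<Prod>k<n. complex_of_real (exp (- (d k)\<^sup>2 / 2)))"
    using char_std_normal_distribution by (auto simp: char_def fun_eq_iff intro!: prod.cong)
  also have "\<dots> = complex_of_real (exp (- (\<Sum>k<n. (d k)\<^sup>2) / 2))"
    by (simp add: exp_sum sum_negf[symmetric] sum_divide_distrib flip: of_real_prod)
  finally show "(\<integral>a. cos (lin n d a) \<partial>std_gaussian n) = exp (- (\<Sum>k<n. (d k)\<^sup>2) / 2)"
    "(\<integral>a. sin (lin n d a) \<partial>std_gaussian n) = 0"
    by (auto simp: complex_eq_iff)
qed

text \<open>The case of the constant weight 1 in \<open>weighted_char_std_normal\<close>.\<close>

lemma distr_lin: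
  assumes "(\<Sum>k<n. (d k)\<^sup>2) = 1"
  shows "distr (std_gaussian n) borel (lin n d) = std_normal_distribution"
proof (rule measure_eqI)
  interpret G: prob_space "std_gaussian n" by (rule prob_space_std_gaussian)
  interpret S: prob_space std_normal_distribution by (rule prob_space_std_normal)
  fix B :: "real set" assume "B \<in> sets (distr (std_gaussian n) borel (lin n d))"
  then have B [measurable]: "B \<in> sets borel" by simp
  have eq: "lin n (\<lambda>k. t * d k) a = t * lin n d a" for t a
    by (simp add: lin_def sum_distrib_left mult_ac)
  have eq2: "(\<Sum>k<n. (t * d k)\<^sup>2) = t\<^sup>2" for t
    using assms by (simp add: power_mult_distrib sum_distrib_left[symmetric])
  have "(\<integral>a. 1 * indicator B (lin n d a) \<partial>std_gaussian n) = 1 * measure std_normal_distribution B"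
    by (rule weighted_char_std_normal[OF prob_space_std_gaussian, where b = 1])
       (use std_gaussian_char[of n "\<lambda>k. _ * d k", unfolded eq eq2] in auto)
  moreover have "(\<integral>a. indicator B (lin n d a) \<partial>std_gaussian n) = measure (distr (std_gaussian n) borel (lin n d)) B"
    using integral_distr[of "lin n d" "std_gaussian n" borel "indicator B :: real \<Rightarrow> real"] by simp
  ultimately have "measure (distr (std_gaussian n) borel (lin n d)) B = measure std_normal_distribution B" by simp
  moreover have "prob_space (distr (std_gaussian n) borel (lin n d))" by (rule G.prob_space_distr) simp
  ultimately show "emeasure (distr (std_gaussian n) borel (lin n d)) B = emeasure std_normal_distribution B"
    by (simp add: finite_measure.emeasure_eq_measure prob_space_def S.emeasure_eq_measure)
qed simp

lemma integral_lin:
  fixes f :: "real \<Rightarrow> real"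
  assumes "(\<Sum>k<n. (d k)\<^sup>2) = 1" and [measurable]: "f \<in> borel_measurable borel"
  shows "(\<integral>a. f (lin n d a) \<partial>std_gaussian n) = (\<integral>x. f x \<partial>std_normal_distribution)"
    "integrable (std_gaussian n) (\<lambda>a. f (lin n d a)) \<longleftrightarrow> integrable std_normal_distribution f"
  using integral_distr[of "lin n d" "std_gaussian n" borel f] integrable_distr_eq[of "lin n d" "std_gaussian n" borel f]
  by (simp_all add: distr_lin[OF assms(1)])

text \<open>Beyond \<open>1/8\<close> Cauchy-Schwarz suffices, because
  \<open>1 <= 8 * |\<rho>|\<close>. Otherwise the second variable is \<rho> times the first plus a
  multiple of an independent standard normal, and the expectation is the kernel integral of
  \<open>corr_bound\<close>.\<close>

lemma correlation_bound:
  assumes cb: "corr_bound \<psi> k K"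
    and d: "(\<Sum>k<n. (d k)\<^sup>2) = 1" and e: "(\<Sum>k<n. (e k)\<^sup>2) = 1"
  shows "\<bar>\<integral>a. \<psi> (lin n d a) * \<psi> (lin n e a) \<partial>std_gaussian n\<bar> \<le> K * \<bar>\<Sum>k<n. d k * e k\<bar> ^ k"
proof -
  define \<rho> where "\<rho> = (\<Sum>k<n. d k * e k)"
  define s2 where "s2 = (\<integral>x. (\<psi> x)\<^sup>2 \<partial>std_normal_distribution)"
  have [measurable]: "\<psi> \<in> borel_measurable borel" and sq: "integrable std_normal_distribution (\<lambda>x. (\<psi> x)\<^sup>2)"
    and K: "0 \<le> K" "8 ^ k * s2 \<le> K"
    and kb: "\<And>\<rho>. \<bar>\<rho>\<bar> \<le> 1 / 8 \<Longrightarrow>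
      \<bar>\<integral>x. (\<integral>z. \<psi> x * \<psi> (\<rho> * x + sqrt (1 - \<rho>\<^sup>2) * z) \<partial>std_normal_distribution) \<partial>std_normal_distribution\<bar> \<le> K * \<bar>\<rho>\<bar> ^ k"
    using cb by (auto simp: corr_bound_def s2_def)
  have i: "integrable (std_gaussian n) (\<lambda>a. (\<psi> (lin n d a))\<^sup>2)" "(\<integral>a. (\<psi> (lin n d a))\<^sup>2 \<partial>std_gaussian n) = s2"
    if "(\<Sum>k<n. (d k)\<^sup>2) = 1" for d
    using integral_lin[OF that, of "\<lambda>x. (\<psi> x)\<^sup>2"] sq by (auto simp: s2_def)
  have ii: "integrable (std_gaussian n) (\<lambda>a. \<psi> (lin n d a) * \<psi> (lin n e a))"
    by (rule integrable_mult_L2) (use i d e in auto)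
  show ?thesis
  proof (cases "\<bar>\<rho>\<bar> \<le> 1 / 8")
    case False
    have s20: "s2 \<ge> 0" unfolding s2_def by simp
    have "\<bar>\<integral>a. \<psi> (lin n d a) * \<psi> (lin n e a) \<partial>std_gaussian n\<bar> \<le> sqrt s2 * sqrt s2"
      using Cauchy_Schwarz_integral[of "\<lambda>a. \<psi> (lin n d a)" "std_gaussian n" "\<lambda>a. \<psi> (lin n e a)"] i[OF d] i[OF e] by simp
    also have "\<dots> = s2 * 1 ^ k" using s20 by simp
    also have "\<dots> \<le> s2 * (8 * \<bar>\<rho>\<bar>) ^ k" using False s20 by (intro mult_left_mono power_mono) auto
    also have "\<dots> = (8 ^ k * s2) * \<bar>\<rho>\<bar> ^ k" by (simp add: power_mult_distrib mult_ac)
    also have "\<dots> \<le> K * \<bar>\<rho>\<bar> ^ k" using K by (intro mult_right_mono) auto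
    finally show ?thesis by (simp add: \<rho>_def)
  next
    case True
    define c where "c = sqrt (1 - \<rho>\<^sup>2)"
    have r2: "\<rho>\<^sup>2 \<le> 1 / 64" using power_mono[OF True, of 2] by (simp add: power2_eq_square)
    have c0: "c > 0" and c2: "c\<^sup>2 = 1 - \<rho>\<^sup>2" unfolding c_def using r2 by auto
    \<comment> \<open>The normalised Gram-Schmidt remainder of \<open>e\<close> along
      \<open>d\<close>. By \<open>norm\<close> it forms an orthonormal pair with
      \<open>lin n d\<close>, so the joint characteristic function makes the two independent
      standard normals.\<close>
    define Z where "Z = lin n (\<lambda>k. (e k - \<rho> * d k) / c)"
    have eZ: "lin n e a = \<rho> * lin n d a + c * Z a" for a
      unfolding Z_def lin_def sum_distrib_left sum.distrib[symmetric]
      using c0 by (intro sum.cong) (auto simp: field_simps)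
    interpret product_sigma_finite "\<lambda>_::nat. std_normal_distribution" by (rule product_sigma_finite_std_normal)
    define X where "X k = (if k = 0 then lin n d else Z)" for k :: nat
    have [measurable]: "X k \<in> borel_measurable (std_gaussian n)" for k by (simp add: X_def Z_def)
    have two: "{..<2} = {0, 1::nat}" by auto
    have comb: "(\<Sum>k<2. t k * X k a) = lin n (\<lambda>k. t 0 * d k + t 1 * ((e k - \<rho> * d k) / c)) a" for t a
      unfolding two by (simp add: X_def Z_def lin_def sum_distrib_left sum.distrib[symmetric] algebra_simps)
    have norm: "(\<Sum>k<n. (t 0 * d k + t 1 * ((e k - \<rho> * d k) / c))\<^sup>2) = (\<Sum>k<2. (t k)\<^sup>2)" for t :: "nat \<Rightarrow> real"
    proof -
      have "(\<Sum>k<n. (t 0 * d k + t 1 * ((e k - \<rho> * d k) / c))\<^sup>2)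
          = (\<Sum>k<n. (t 0 - t 1 * \<rho> / c)\<^sup>2 * (d k)\<^sup>2 + 2 * (t 0 - t 1 * \<rho> / c) * (t 1 / c) * (d k * e k) + (t 1 / c)\<^sup>2 * (e k)\<^sup>2)"
        by (intro sum.cong refl) (use c0 in \<open>simp add: power2_eq_square field_simps\<close>)
      also have "\<dots> = (t 0 - t 1 * \<rho> / c)\<^sup>2 + 2 * (t 0 - t 1 * \<rho> / c) * (t 1 / c) * \<rho> + (t 1 / c)\<^sup>2"
        unfolding sum.distrib sum_distrib_left[symmetric] d e \<rho>_def by simp
      also have "\<dots> = (t 0)\<^sup>2 + (t 1)\<^sup>2 * ((1 - \<rho>\<^sup>2) / c\<^sup>2)"
        using c0 by (simp add: power2_eq_square field_simps)
      also have "(1 - \<rho>\<^sup>2) / c\<^sup>2 = 1" using c0 unfolding c2[symmetric] by simp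
      also have "(t 0)\<^sup>2 + (t 1)\<^sup>2 * 1 = (\<Sum>k<2. (t k)\<^sup>2)" by (simp add: two)
      finally show ?thesis .
    qed
    have law: "distr (std_gaussian n) (std_gaussian 2) (\<lambda>a. \<lambda>k\<in>{..<2}. X k a) = std_gaussian 2"
    proof (rule char_std_normal_imp_PiM[OF prob_space_std_gaussian])
      fix t :: "nat \<Rightarrow> real"
      show "(\<integral>a. cos (\<Sum>k<2. t k * X k a) \<partial>std_gaussian n) = exp (- (\<Sum>k<2. (t k)\<^sup>2) / 2)"
        "(\<integral>a. sin (\<Sum>k<2. t k * X k a) \<partial>std_gaussian n) = 0"
        unfolding comb norm[symmetric] by (rule std_gaussian_char)+
    qed measurable
    have sets2: "sets (std_gaussian 2) = sets (PiM {..<2} (\<lambda>_. borel :: real measure))"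
      by (intro sets_PiM_cong) auto
    have m [measurable]: "(\<lambda>a. \<lambda>k\<in>{..<2}. X k a) \<in> measurable (std_gaussian n) (std_gaussian 2)"
      unfolding measurable_cong_sets[OF refl sets2] by measurable
    interpret S: sigma_finite_measure std_normal_distribution
      by (rule prob_space_imp_sigma_finite[OF prob_space_std_normal])
    define J where "J u = (\<integral>y. \<psi> u * \<psi> (\<rho> * u + c * y) \<partial>std_normal_distribution)" for u
    have [measurable]: "J \<in> borel_measurable borel" unfolding J_def[abs_def] by measurable
    define f where "f b = \<psi> (b 0) * \<psi> (\<rho> * b 0 + c * b 1)" for b :: "nat \<Rightarrow> real"
    have [measurable]: "(\<lambda>b. b 0) \<in> borel_measurable (std_gaussian 2)" "(\<lambda>b. b 1) \<in> borel_measurable (std_gaussian 2)"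
      by (auto intro: measurable_std_gaussian_component)
    have [measurable]: "f \<in> borel_measurable (std_gaussian 2)" unfolding f_def by measurable
    have fX: "f (\<lambda>k\<in>{..<2}. X k a) = \<psi> (lin n d a) * \<psi> (lin n e a)" for a
      by (simp add: f_def X_def eZ)
    have if2: "integrable (std_gaussian 2) f"
      using integrable_distr_eq[OF m, of f] ii unfolding law fX by simp
    have "(\<integral>a. \<psi> (lin n d a) * \<psi> (lin n e a) \<partial>std_gaussian n) = (\<integral>b. f b \<partial>std_gaussian 2)"
      using integral_distr[OF m, of f] unfolding law fX by simp
    also have "\<dots> = (\<integral>b. f b \<partial>PiM (insert 1 {0}) (\<lambda>_. std_normal_distribution))"
      by (simp add: two insert_commute)
    also have "\<dots> = (\<integral>x. (\<integral>y. f (x(1 := y)) \<partial>std_normal_distribution) \<partial>PiM {0} (\<lambda>_. std_normal_distribution))"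
      by (rule product_integral_insert) (use if2 in \<open>auto simp: two insert_commute\<close>)
    also have "\<dots> = (\<integral>x. J (x 0) \<partial>PiM {0::nat} (\<lambda>_. std_normal_distribution))"
      by (simp add: f_def J_def fun_upd_def)
    also have "\<dots> = (\<integral>u. J u \<partial>std_normal_distribution)"
      by (rule product_integral_singleton) simp
    finally show ?thesis using kb[OF True] by (simp add: c_def \<rho>_def J_def)
  qed
qed

section \<open>Finite expansions: second moments and gradients\<close>

text \<open>\<kappa> is the one non-zero eigenvalue of the covariance kernel. Each
  \<open>\<phi> k\<close> has squared norm \<kappa> rather than 1, so that the coefficients are
  standard normal; \<open>unit\<close> gives the field variance 1 and \<open>mean\<close> gives it
  integral 0.\<close>

locale gaussian_expansion =
  fixes \<sigma> :: "'x measure" and n :: nat and \<phi> :: "nat \<Rightarrow> 'x \<Rightarrow> real" and \<kappa> :: real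
  assumes fin: "finite_measure \<sigma>"
    and meas [measurable]: "\<And>k. \<phi> k \<in> borel_measurable \<sigma>"
    and unit: "\<And>x. x \<in> space \<sigma> \<Longrightarrow> (\<Sum>k<n. (\<phi> k x)\<^sup>2) = 1"
    and orth: "\<And>j k. j < n \<Longrightarrow> k < n \<Longrightarrow> (\<integral>x. \<phi> j x * \<phi> k x \<partial>\<sigma>) = (if j = k then \<kappa> else 0)"
    and mean: "\<And>k. k < n \<Longrightarrow> (\<integral>x. \<phi> k x \<partial>\<sigma>) = 0"
    and kappa: "\<kappa> > 0"
begin

sublocale s: finite_measure \<sigma> by (rule fin)
sublocale ss: pair_sigma_finite \<sigma> \<sigma> ..
sublocale ssf: finite_measure "\<sigma> \<Otimes>\<^sub>M \<sigma>" by (rule finite_measure_pair_measure) unfold_locales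
sublocale G: prob_space "std_gaussian n" by (rule prob_space_std_gaussian)

abbreviation \<mu> where "\<mu> \<equiv> std_gaussian n"

definition \<tau> :: "(nat \<Rightarrow> real) \<Rightarrow> 'x \<Rightarrow> real" where "\<tau> a x = (\<Sum>k<n. \<phi> k x * a k)"

definition cov :: "'x \<Rightarrow> 'x \<Rightarrow> real" where "cov x y = (\<Sum>k<n. \<phi> k x * \<phi> k y)"

definition I :: "nat \<Rightarrow> real" where "I j = (\<integral>p. \<bar>cov (fst p) (snd p)\<bar> ^ j \<partial>(\<sigma> \<Otimes>\<^sub>M \<sigma>))"

text \<open>Differentiation in the coordinate \<open>a k\<close> multiplies the integrand by
  \<open>\<phi> k\<close>; the weight \<open>w\<close> keeps the family closed under it.\<close>

definition A :: "real poly \<Rightarrow> ('x \<Rightarrow> real) \<Rightarrow> (nat \<Rightarrow> real) \<Rightarrow> real" where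
  "A p w a = (\<integral>x. poly p (\<tau> a x) * w x \<partial>\<sigma>)"

lemma tau_lin: "\<tau> a x = lin n (\<lambda>k. \<phi> k x) a" by (simp add: \<tau>_def lin_def)

lemma phi_le_1: assumes "x \<in> space \<sigma>" "k < n" shows "\<bar>\<phi> k x\<bar> \<le> 1"
proof -
  have "(\<phi> k x)\<^sup>2 \<le> (\<Sum>k<n. (\<phi> k x)\<^sup>2)" by (rule member_le_sum) (use assms in auto)
  then show ?thesis using unit[OF assms(1)] by (simp add: abs_square_le_1)
qed

lemma phi_bounded: "k < n \<Longrightarrow> bounded_meas \<sigma> (\<phi> k)"
  unfolding bounded_meas_def using phi_le_1 by auto

lemma tau_bound: "x \<in> space \<sigma> \<Longrightarrow> \<bar>\<tau> a x\<bar> \<le> (\<Sum>k<n. \<bar>a k\<bar>)"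
  unfolding \<tau>_def
proof (rule order_trans[OF sum_abs sum_mono])
  fix k assume "x \<in> space \<sigma>" "k \<in> {..<n}"
  then show "\<bar>\<phi> k x * a k\<bar> \<le> \<bar>a k\<bar>"
    using mult_right_mono[OF phi_le_1[of x k], of "\<bar>a k\<bar>"] by (simp add: abs_mult)
qed

lemma tau_bounded: "bounded_meas \<sigma> (\<tau> a)"
  unfolding \<tau>_def[abs_def] by (intro bounded_meas_sum bounded_meas_mult phi_bounded bounded_meas_const) auto

lemma tau_measurable [measurable]: "(\<lambda>p. \<tau> (snd p) (fst p)) \<in> borel_measurable (\<sigma> \<Otimes>\<^sub>M \<mu>)"
  unfolding \<tau>_def
  by (intro borel_measurable_sum borel_measurable_times measurable_compose[OF measurable_fst meas]
      measurable_compose[OF measurable_snd measurable_std_gaussian_component]) auto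

lemma tau_measurable' [measurable]: "(\<lambda>p. \<tau> (fst p) (snd p)) \<in> borel_measurable (\<mu> \<Otimes>\<^sub>M \<sigma>)"
  unfolding \<tau>_def
  by (intro borel_measurable_sum borel_measurable_times measurable_compose[OF measurable_snd meas]
      measurable_compose[OF measurable_fst measurable_std_gaussian_component]) auto

lemma cov_measurable [measurable]: "(\<lambda>p. cov (fst p) (snd p)) \<in> borel_measurable (\<sigma> \<Otimes>\<^sub>M \<sigma>)"
  unfolding cov_def by measurable

lemma cov_le_1: assumes "x \<in> space \<sigma>" "y \<in> space \<sigma>" shows "\<bar>cov x y\<bar> \<le> 1"
proof -
  have "\<bar>cov x y\<bar> \<le> (\<Sum>k<n. ((\<phi> k x)\<^sup>2 + (\<phi> k y)\<^sup>2) / 2)"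
    unfolding cov_def
  proof (rule order_trans[OF sum_abs sum_mono])
    fix k
    have "0 \<le> (\<bar>\<phi> k x\<bar> - \<bar>\<phi> k y\<bar>)\<^sup>2" by simp
    then show "\<bar>\<phi> k x * \<phi> k y\<bar> \<le> ((\<phi> k x)\<^sup>2 + (\<phi> k y)\<^sup>2) / 2" by (simp add: power2_diff abs_mult)
  qed
  also have "\<dots> = 1" using unit assms by (simp add: sum.distrib sum_divide_distrib[symmetric])
  finally show ?thesis .
qed

lemma cov_power_integrable: "integrable (\<sigma> \<Otimes>\<^sub>M \<sigma>) (\<lambda>p. \<bar>cov (fst p) (snd p)\<bar> ^ j)"
  by (rule ssf.integrable_const_bound[where B = 1])
     (use cov_le_1 in \<open>auto intro!: AE_I2 power_le_one simp: space_pair_measure\<close>)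

lemma total_mass: "measure \<sigma> (space \<sigma>) = real n * \<kappa>"
proof -
  have "measure \<sigma> (space \<sigma>) = (\<integral>x. 1 \<partial>\<sigma>)" by simp
  also have "\<dots> = (\<integral>x. (\<Sum>k<n. \<phi> k x * \<phi> k x) \<partial>\<sigma>)"
    by (rule Bochner_Integration.integral_cong) (use unit in \<open>auto simp: power2_eq_square\<close>)
  also have "\<dots> = (\<Sum>k<n. \<integral>x. \<phi> k x * \<phi> k x \<partial>\<sigma>)"
    by (rule Bochner_Integration.integral_sum) (auto intro!: bounded_meas_integrable[OF fin] bounded_meas_mult phi_bounded)
  also have "\<dots> = real n * \<kappa>" using orth by simp
  finally show ?thesis .
qed

text \<open>The squared Hilbert-Schmidt norm of the covariance kernel, which has \<open>n\<close>
  eigenvalues \<kappa>.\<close>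

lemma I2: "I 2 = real n * \<kappa>\<^sup>2"
proof -
  have hb: "has_bochner_integral (\<sigma> \<Otimes>\<^sub>M \<sigma>) (\<lambda>(x, y). (\<phi> j x * \<phi> k x) * (\<phi> j y * \<phi> k y))
    ((\<integral>x. \<phi> j x * \<phi> k x \<partial>\<sigma>) * (\<integral>x. \<phi> j x * \<phi> k x \<partial>\<sigma>))" if "j < n" "k < n" for j k
    using that by (intro has_bochner_integral_pair_mult s.sigma_finite_measure_axioms)
       (auto intro!: bounded_meas_integrable[OF fin] bounded_meas_mult phi_bounded)
  have "has_bochner_integral (\<sigma> \<Otimes>\<^sub>M \<sigma>) (\<lambda>p. \<Sum>j<n. \<Sum>k<n. (case p of (x, y) \<Rightarrow> (\<phi> j x * \<phi> k x) * (\<phi> j y * \<phi> k y)))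
     (\<Sum>j<n. \<Sum>k<n. (\<integral>x. \<phi> j x * \<phi> k x \<partial>\<sigma>) * (\<integral>x. \<phi> j x * \<phi> k x \<partial>\<sigma>))"
    by (intro has_bochner_integral_sum hb) auto
  moreover have "(\<Sum>j<n. \<Sum>k<n. (case p of (x, y) \<Rightarrow> (\<phi> j x * \<phi> k x) * (\<phi> j y * \<phi> k y))) = \<bar>cov (fst p) (snd p)\<bar> ^ 2" for p
    by (simp add: cov_def power2_eq_square sum_product case_prod_unfold mult_ac)
  moreover have "(\<Sum>j<n. \<Sum>k<n. (\<integral>x. \<phi> j x * \<phi> k x \<partial>\<sigma>) * (\<integral>x. \<phi> j x * \<phi> k x \<partial>\<sigma>)) = real n * \<kappa>\<^sup>2"
  proof -
    have "(\<Sum>j<n. \<Sum>k<n. (\<integral>x. \<phi> j x * \<phi> k x \<partial>\<sigma>) * (\<integral>x. \<phi> j x * \<phi> k x \<partial>\<sigma>)) = (\<Sum>j<n. \<Sum>k<n. if j = k then \<kappa>\<^sup>2 else 0)"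
      by (intro sum.cong) (auto simp: orth power2_eq_square)
    then show ?thesis by simp
  qed
  ultimately show ?thesis unfolding I_def by (simp add: has_bochner_integral_iff)
qed

context
  fixes \<psi> :: "real \<Rightarrow> real" and k :: nat and K :: real
  assumes cb: "corr_bound \<psi> k K"
begin

lemma psi_measurable [measurable]: "\<psi> \<in> borel_measurable borel" using cb by (simp add: corr_bound_def)

lemma corr_tau: "x \<in> space \<sigma> \<Longrightarrow> y \<in> space \<sigma> \<Longrightarrow> \<bar>\<integral>a. \<psi> (\<tau> a x) * \<psi> (\<tau> a y) \<partial>\<mu>\<bar> \<le> K * \<bar>cov x y\<bar> ^ k"
  unfolding tau_lin cov_def by (rule correlation_bound[OF cb]) (auto intro: unit)

lemma sq_tau:
  assumes "x \<in> space \<sigma>"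
  shows "integrable \<mu> (\<lambda>a. (\<psi> (\<tau> a x))\<^sup>2)" "(\<integral>a. (\<psi> (\<tau> a x))\<^sup>2 \<partial>\<mu>) = (\<integral>x. (\<psi> x)\<^sup>2 \<partial>std_normal_distribution)"
  using integral_lin[OF unit[OF assms], of "\<lambda>x. (\<psi> x)\<^sup>2"] cb by (auto simp: tau_lin corr_bound_def)

text \<open>Instance of \<open>second_moment_integral\<close> for
  \<open>\<psi> (\<tau> a x) * w x\<close>; the second moments are uniformly bounded because every
  \<open>\<tau> a x\<close> is standard normal.\<close>

lemma functional_second_moment:
  assumes [measurable]: "w \<in> borel_measurable \<sigma>" and w: "\<And>x. x \<in> space \<sigma> \<Longrightarrow> \<bar>w x\<bar> \<le> 1"
  shows "AE a in \<mu>. integrable \<sigma> (\<lambda>x. \<psi> (\<tau> a x) * w x)"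
    "(\<lambda>a. \<integral>x. \<psi> (\<tau> a x) * w x \<partial>\<sigma>) \<in> borel_measurable \<mu>"
    "integrable \<mu> (\<lambda>a. \<integral>x. \<psi> (\<tau> a x) * w x \<partial>\<sigma>)"
    "(\<integral>a. (\<integral>x. \<psi> (\<tau> a x) * w x \<partial>\<sigma>) \<partial>\<mu>) = (\<integral>t. \<psi> t \<partial>std_normal_distribution) * (\<integral>x. w x \<partial>\<sigma>)"
    "integrable \<mu> (\<lambda>a. (\<integral>x. \<psi> (\<tau> a x) * w x \<partial>\<sigma>)\<^sup>2)"
    "integrable (\<sigma> \<Otimes>\<^sub>M \<sigma>) (\<lambda>p. w (fst p) * w (snd p) * (\<integral>a. \<psi> (\<tau> a (fst p)) * \<psi> (\<tau> a (snd p)) \<partial>\<mu>))"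
    "(\<integral>a. (\<integral>x. \<psi> (\<tau> a x) * w x \<partial>\<sigma>)\<^sup>2 \<partial>\<mu>) = (\<integral>p. w (fst p) * w (snd p) * (\<integral>a. \<psi> (\<tau> a (fst p)) * \<psi> (\<tau> a (snd p)) \<partial>\<mu>) \<partial>(\<sigma> \<Otimes>\<^sub>M \<sigma>))"
proof -
  define V where "V x a = \<psi> (\<tau> a x) * w x" for x a
  have m: "case_prod V \<in> borel_measurable (\<sigma> \<Otimes>\<^sub>M \<mu>)" unfolding V_def case_prod_unfold by measurable
  have w2: "(w x)\<^sup>2 \<le> 1" if "x \<in> space \<sigma>" for x using w[OF that] by (simp add: abs_square_le_1)
  have sq: "integrable \<mu> (\<lambda>a. (V x a)\<^sup>2)" if "x \<in> space \<sigma>" for x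
    unfolding V_def power_mult_distrib using sq_tau[OF that] by (intro integrable_mult_left) auto
  have bd: "(\<integral>a. (V x a)\<^sup>2 \<partial>\<mu>) \<le> (\<integral>x. (\<psi> x)\<^sup>2 \<partial>std_normal_distribution)" if "x \<in> space \<sigma>" for x
  proof -
    have "(\<integral>a. (V x a)\<^sup>2 \<partial>\<mu>) = (\<integral>x. (\<psi> x)\<^sup>2 \<partial>std_normal_distribution) * (w x)\<^sup>2"
      unfolding V_def power_mult_distrib using sq_tau[OF that] by simp
    also have "\<dots> \<le> (\<integral>x. (\<psi> x)\<^sup>2 \<partial>std_normal_distribution) * 1"
      by (intro mult_left_mono w2 that) simp
    finally show ?thesis by simp
  qed
  note R = second_moment_integral[OF fin prob_space_std_gaussian m sq bd]
  show "AE a in \<mu>. integrable \<sigma> (\<lambda>x. \<psi> (\<tau> a x) * w x)"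
    "(\<lambda>a. \<integral>x. \<psi> (\<tau> a x) * w x \<partial>\<sigma>) \<in> borel_measurable \<mu>"
    "integrable \<mu> (\<lambda>a. \<integral>x. \<psi> (\<tau> a x) * w x \<partial>\<sigma>)"
    "integrable \<mu> (\<lambda>a. (\<integral>x. \<psi> (\<tau> a x) * w x \<partial>\<sigma>)\<^sup>2)"
    using R(1,2,3,5) by (simp_all add: V_def)
  have "(\<integral>x. (\<integral>a. V x a \<partial>\<mu>) \<partial>\<sigma>) = (\<integral>x. (\<integral>t. \<psi> t \<partial>std_normal_distribution) * w x \<partial>\<sigma>)"
    by (rule Bochner_Integration.integral_cong) (auto simp: V_def tau_lin integral_lin(1) unit)
  then show "(\<integral>a. (\<integral>x. \<psi> (\<tau> a x) * w x \<partial>\<sigma>) \<partial>\<mu>) = (\<integral>t. \<psi> t \<partial>std_normal_distribution) * (\<integral>x. w x \<partial>\<sigma>)"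
    using R(4) by (simp add: V_def)
  have eq: "(\<integral>a. V x a * V y a \<partial>\<mu>) = w x * w y * (\<integral>a. \<psi> (\<tau> a x) * \<psi> (\<tau> a y) \<partial>\<mu>)" for x y
  proof -
    have "(\<integral>a. V x a * V y a \<partial>\<mu>) = (\<integral>a. (w x * w y) * (\<psi> (\<tau> a x) * \<psi> (\<tau> a y)) \<partial>\<mu>)"
      by (rule Bochner_Integration.integral_cong) (auto simp: V_def)
    then show ?thesis by simp
  qed
  show "integrable (\<sigma> \<Otimes>\<^sub>M \<sigma>) (\<lambda>p. w (fst p) * w (snd p) * (\<integral>a. \<psi> (\<tau> a (fst p)) * \<psi> (\<tau> a (snd p)) \<partial>\<mu>))"
    using R(6) unfolding eq by (simp add: case_prod_unfold)
  show "(\<integral>a. (\<integral>x. \<psi> (\<tau> a x) * w x \<partial>\<sigma>)\<^sup>2 \<partial>\<mu>) = (\<integral>p. w (fst p) * w (snd p) * (\<integral>a. \<psi> (\<tau> a (fst p)) * \<psi> (\<tau> a (snd p)) \<partial>\<mu>) \<partial>(\<sigma> \<Otimes>\<^sub>M \<sigma>))"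
    using R(7) unfolding eq by (simp add: case_prod_unfold V_def)
qed

text \<open>Each pair of points contributes at most \<open>K * |cov|^k\<close>, by
  \<open>corr_tau\<close>.\<close>

lemma functional_variance_bound: "(\<integral>a. (\<integral>x. \<psi> (\<tau> a x) \<partial>\<sigma>)\<^sup>2 \<partial>\<mu>) \<le> K * I k"
proof -
  have "(\<integral>a. (\<integral>x. \<psi> (\<tau> a x) \<partial>\<sigma>)\<^sup>2 \<partial>\<mu>) = (\<integral>p. (\<integral>a. \<psi> (\<tau> a (fst p)) * \<psi> (\<tau> a (snd p)) \<partial>\<mu>) \<partial>(\<sigma> \<Otimes>\<^sub>M \<sigma>))"
    using functional_second_moment(7)[of "\<lambda>_. 1"] by simp
  also have "\<dots> \<le> (\<integral>p. K * \<bar>cov (fst p) (snd p)\<bar> ^ k \<partial>(\<sigma> \<Otimes>\<^sub>M \<sigma>))"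
  proof (rule integral_mono)
    show "integrable (\<sigma> \<Otimes>\<^sub>M \<sigma>) (\<lambda>p. \<integral>a. \<psi> (\<tau> a (fst p)) * \<psi> (\<tau> a (snd p)) \<partial>\<mu>)"
      using functional_second_moment(6)[of "\<lambda>_. 1"] by simp
    show "integrable (\<sigma> \<Otimes>\<^sub>M \<sigma>) (\<lambda>p. K * \<bar>cov (fst p) (snd p)\<bar> ^ k)"
      by (intro integrable_mult_right cov_power_integrable)
    fix p assume "p \<in> space (\<sigma> \<Otimes>\<^sub>M \<sigma>)"
    then show "(\<integral>a. \<psi> (\<tau> a (fst p)) * \<psi> (\<tau> a (snd p)) \<partial>\<mu>) \<le> K * \<bar>cov (fst p) (snd p)\<bar> ^ k"
      using corr_tau[of "fst p" "snd p"] by (auto simp: space_pair_measure)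
  qed
  also have "\<dots> = K * I k" by (simp add: I_def)
  finally show ?thesis .
qed

text \<open>Summing \<open>\<phi> j x * \<phi> j y\<close> over \<open>j\<close> produces one more
  factor \<open>cov x y\<close>. This is why gradients are governed by \<open>I (Suc k)\<close>, in
  the end by \<open>I 3\<close>.\<close>

lemma functional_gradient_bound: "(\<integral>a. (\<Sum>j<n. (\<integral>x. \<psi> (\<tau> a x) * \<phi> j x \<partial>\<sigma>)\<^sup>2) \<partial>\<mu>) \<le> K * I (Suc k)"
proof -
  let ?C = "\<lambda>p. \<integral>a. \<psi> (\<tau> a (fst p)) * \<psi> (\<tau> a (snd p)) \<partial>\<mu>"
  have w: "\<And>x. x \<in> space \<sigma> \<Longrightarrow> \<bar>\<phi> j x\<bar> \<le> 1" if "j < n" for j using phi_le_1 that by auto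
  have "(\<integral>a. (\<Sum>j<n. (\<integral>x. \<psi> (\<tau> a x) * \<phi> j x \<partial>\<sigma>)\<^sup>2) \<partial>\<mu>)
      = (\<Sum>j<n. (\<integral>a. (\<integral>x. \<psi> (\<tau> a x) * \<phi> j x \<partial>\<sigma>)\<^sup>2 \<partial>\<mu>))"
    by (rule Bochner_Integration.integral_sum) (use functional_second_moment(5)[OF meas w] in auto)
  also have "\<dots> = (\<Sum>j<n. (\<integral>p. \<phi> j (fst p) * \<phi> j (snd p) * ?C p \<partial>(\<sigma> \<Otimes>\<^sub>M \<sigma>)))"
    by (intro sum.cong refl functional_second_moment(7)[OF meas w]) auto
  also have "\<dots> = (\<integral>p. (\<Sum>j<n. \<phi> j (fst p) * \<phi> j (snd p) * ?C p) \<partial>(\<sigma> \<Otimes>\<^sub>M \<sigma>))"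
    by (rule Bochner_Integration.integral_sum[symmetric]) (use functional_second_moment(6)[OF meas w] in auto)
  also have "\<dots> \<le> (\<integral>p. K * \<bar>cov (fst p) (snd p)\<bar> ^ Suc k \<partial>(\<sigma> \<Otimes>\<^sub>M \<sigma>))"
  proof (rule integral_mono)
    show "integrable (\<sigma> \<Otimes>\<^sub>M \<sigma>) (\<lambda>p. \<Sum>j<n. \<phi> j (fst p) * \<phi> j (snd p) * ?C p)"
      by (intro Bochner_Integration.integrable_sum) (use functional_second_moment(6)[OF meas w] in auto)
    show "integrable (\<sigma> \<Otimes>\<^sub>M \<sigma>) (\<lambda>p. K * \<bar>cov (fst p) (snd p)\<bar> ^ Suc k)"
      by (intro integrable_mult_right cov_power_integrable)
    fix p assume "p \<in> space (\<sigma> \<Otimes>\<^sub>M \<sigma>)"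
    then have "\<bar>?C p\<bar> \<le> K * \<bar>cov (fst p) (snd p)\<bar> ^ k"
      using corr_tau[of "fst p" "snd p"] by (auto simp: space_pair_measure)
    then have "\<bar>cov (fst p) (snd p)\<bar> * \<bar>?C p\<bar> \<le> \<bar>cov (fst p) (snd p)\<bar> * (K * \<bar>cov (fst p) (snd p)\<bar> ^ k)"
      by (rule mult_left_mono) simp
    moreover have "(\<Sum>j<n. \<phi> j (fst p) * \<phi> j (snd p) * ?C p) = cov (fst p) (snd p) * ?C p"
      by (simp add: cov_def sum_distrib_right)
    moreover have "cov (fst p) (snd p) * ?C p \<le> \<bar>cov (fst p) (snd p)\<bar> * \<bar>?C p\<bar>"
      unfolding abs_mult[symmetric] by (rule abs_ge_self)
    ultimately show "(\<Sum>j<n. \<phi> j (fst p) * \<phi> j (snd p) * ?C p) \<le> K * \<bar>cov (fst p) (snd p)\<bar> ^ Suc k"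
      by (simp add: mult_ac)
  qed
  also have "\<dots> = K * I (Suc k)" by (simp add: I_def)
  finally show ?thesis .
qed

end

lemma A_measurable [measurable]: "w \<in> borel_measurable \<sigma> \<Longrightarrow> A p w \<in> borel_measurable \<mu>"
proof -
  assume [measurable]: "w \<in> borel_measurable \<sigma>"
  have [measurable]: "(\<lambda>t. poly p t) \<in> borel_measurable borel"
    by (intro borel_measurable_continuous_onI continuous_intros)
  show ?thesis unfolding A_def[abs_def]
    by (rule s.borel_measurable_lebesgue_integral) (unfold case_prod_unfold, measurable)
qed

lemma A_growth:
  assumes w: "bounded_meas \<sigma> w"
  obtains B where "B \<ge> 0" "\<And>a. \<bar>A p w a\<bar> \<le> B * exp ((\<Sum>i<n. \<bar>a i\<bar>) / 4)"
proof -
  obtain Bp where Bp: "Bp \<ge> 0" "\<And>t. \<bar>poly p t\<bar> \<le> Bp * exp (\<bar>t\<bar> / 4)" using poly_exp_bound[of p] by blast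
  have iw: "integrable \<sigma> w" by (rule bounded_meas_integrable[OF fin w])
  have "\<bar>A p w a\<bar> \<le> (Bp * (\<integral>x. \<bar>w x\<bar> \<partial>\<sigma>)) * exp ((\<Sum>i<n. \<bar>a i\<bar>) / 4)" for a
  proof -
    have "\<bar>A p w a\<bar> \<le> (\<integral>x. \<bar>poly p (\<tau> a x) * w x\<bar> \<partial>\<sigma>)"
      unfolding A_def by (rule integral_abs_bound)
    also have "\<dots> \<le> (\<integral>x. (Bp * exp ((\<Sum>i<n. \<bar>a i\<bar>) / 4)) * \<bar>w x\<bar> \<partial>\<sigma>)"
    proof (rule integral_mono)
      show "integrable \<sigma> (\<lambda>x. \<bar>poly p (\<tau> a x) * w x\<bar>)"
        by (intro integrable_abs bounded_meas_integrable[OF fin] bounded_meas_mult bounded_meas_poly tau_bounded w)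
      show "integrable \<sigma> (\<lambda>x. (Bp * exp ((\<Sum>i<n. \<bar>a i\<bar>) / 4)) * \<bar>w x\<bar>)" using iw by simp
      fix x assume x: "x \<in> space \<sigma>"
      have "\<bar>poly p (\<tau> a x)\<bar> \<le> Bp * exp (\<bar>\<tau> a x\<bar> / 4)" by (rule Bp)
      also have "\<dots> \<le> Bp * exp ((\<Sum>i<n. \<bar>a i\<bar>) / 4)" using tau_bound[OF x, of a] Bp(1) by (intro mult_left_mono) auto
      finally show "\<bar>poly p (\<tau> a x) * w x\<bar> \<le> (Bp * exp ((\<Sum>i<n. \<bar>a i\<bar>) / 4)) * \<bar>w x\<bar>"
        unfolding abs_mult by (rule mult_right_mono) simp
    qed
    finally show ?thesis by (simp add: mult_ac)
  qed
  then show ?thesis using that[of "Bp * (\<integral>x. \<bar>w x\<bar> \<partial>\<sigma>)"] Bp(1) by simp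
qed

text \<open>\<open>\<tau>\<close> is affine in each coordinate, with slope
  \<open>\<phi> k\<close>.\<close>

lemma A_derivative:
  assumes w: "bounded_meas \<sigma> w" and k: "k < n"
  shows "((\<lambda>t. A p w (a(k := t))) has_real_derivative A (pderiv p) (\<lambda>x. \<phi> k x * w x) (a(k := t))) (at t)"
proof -
  have "\<tau> (a(k := t)) x = \<tau> (a(k := 0)) x + t * \<phi> k x" for t x
  proof -
    have "\<tau> (a(k := t)) x = \<phi> k x * (a(k := t)) k + (\<Sum>i\<in>{..<n} - {k}. \<phi> i x * (a(k := t)) i)" for t
      unfolding \<tau>_def by (rule sum.remove) (use k in auto)
    moreover have "(\<Sum>i\<in>{..<n} - {k}. \<phi> i x * (a(k := t)) i) = (\<Sum>i\<in>{..<n} - {k}. \<phi> i x * a i)" for t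
      by (intro sum.cong) auto
    ultimately show ?thesis by (simp add: mult.commute)
  qed
  then have eq: "\<tau> (a(k := s)) = (\<lambda>x. \<tau> (a(k := 0)) x + s * \<phi> k x)" for s by (intro ext)
  have 1: "A q w' (a(k := s)) = (\<integral>x. poly q (\<tau> (a(k := 0)) x + s * \<phi> k x) * w' x \<partial>\<sigma>)" for q w' s
    unfolding A_def by (subst eq[of s]) (rule refl)
  show ?thesis
    by (simp only: 1 has_derivative_integral_poly[OF fin tau_bounded phi_bounded[OF k] w])
qed

end

lemma linear_growth_of_bounded_derivative:
  fixes f f' :: "real \<Rightarrow> real"
  assumes df: "\<And>x. (f has_real_derivative f' x) (at x)" and b: "\<And>x. \<bar>f' x\<bar> \<le> C"
  shows "\<bar>f x\<bar> \<le> \<bar>f 0\<bar> + C * \<bar>x\<bar>"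
proof -
  have "\<bar>f x - f 0\<bar> \<le> C * \<bar>x\<bar>"
  proof (cases "x = 0")
    case False
    then consider "x < 0" | "0 < x" by linarith
    then show ?thesis
    proof cases
      case 1
      then obtain z where "f 0 - f x = (0 - x) * f' z" using MVT2[of x 0 f f'] df by blast
      then have "\<bar>f x - f 0\<bar> = \<bar>x\<bar> * \<bar>f' z\<bar>" by (metis abs_minus_commute abs_mult diff_0 abs_minus_cancel)
      then show ?thesis using mult_left_mono[OF b[of z], of "\<bar>x\<bar>"] by (simp add: mult.commute)
    next
      case 2
      then obtain z where "f x - f 0 = (x - 0) * f' z" using MVT2[of 0 x f f'] df by blast
      then have "\<bar>f x - f 0\<bar> = \<bar>x\<bar> * \<bar>f' z\<bar>" by (simp add: abs_mult)
      then show ?thesis using mult_left_mono[OF b[of z], of "\<bar>x\<bar>"] by (simp add: mult.commute)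
    qed
  qed simp
  then show ?thesis by linarith
qed

section \<open>Divergence form and integration by parts for functionals\<close>

context gaussian_expansion
begin

lemma one_bounded: "bounded_meas \<sigma> (\<lambda>_. 1)" by simp

lemma A_integrand_integrable: "bounded_meas \<sigma> w \<Longrightarrow> integrable \<sigma> (\<lambda>x. poly p (\<tau> a x) * w x)"
  by (intro bounded_meas_integrable[OF fin] bounded_meas_mult bounded_meas_poly tau_bounded)

text \<open>Pointwise this is the definition of \<tau> together with \<open>unit\<close>. It
  presents the functional as the Gaussian divergence of the vector field with components
  \<open>A (pderiv \<xi>) (\<phi> k)\<close>.\<close>

lemma A_divergence:
  "A ([:0, 1:] * pderiv \<xi> - pderiv (pderiv \<xi>)) (\<lambda>_. 1) a
     = (\<Sum>k<n. a k * A (pderiv \<xi>) (\<phi> k) a - A (pderiv (pderiv \<xi>)) (\<lambda>x. \<phi> k x * \<phi> k x) a)"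
proof -
  have i: "integrable \<sigma> (\<lambda>x. a k * (poly (pderiv \<xi>) (\<tau> a x) * \<phi> k x))"
    "integrable \<sigma> (\<lambda>x. poly (pderiv (pderiv \<xi>)) (\<tau> a x) * (\<phi> k x * \<phi> k x))" if "k < n" for k
    using that by (intro integrable_mult_right A_integrand_integrable bounded_meas_mult phi_bounded; simp)+
  have "A ([:0, 1:] * pderiv \<xi> - pderiv (pderiv \<xi>)) (\<lambda>_. 1) a
     = (\<integral>x. (\<Sum>k<n. a k * (poly (pderiv \<xi>) (\<tau> a x) * \<phi> k x) - poly (pderiv (pderiv \<xi>)) (\<tau> a x) * (\<phi> k x * \<phi> k x)) \<partial>\<sigma>)"
    unfolding A_def
  proof (rule Bochner_Integration.integral_cong[OF refl])
    fix x assume x: "x \<in> space \<sigma>"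
    have "(\<Sum>k<n. a k * (poly (pderiv \<xi>) (\<tau> a x) * \<phi> k x) - poly (pderiv (pderiv \<xi>)) (\<tau> a x) * (\<phi> k x * \<phi> k x))
       = poly (pderiv \<xi>) (\<tau> a x) * (\<Sum>k<n. \<phi> k x * a k) - poly (pderiv (pderiv \<xi>)) (\<tau> a x) * (\<Sum>k<n. (\<phi> k x)\<^sup>2)"
      by (simp add: sum_subtractf sum_distrib_left power2_eq_square mult_ac)
    then show "poly ([:0, 1:] * pderiv \<xi> - pderiv (pderiv \<xi>)) (\<tau> a x) * 1
       = (\<Sum>k<n. a k * (poly (pderiv \<xi>) (\<tau> a x) * \<phi> k x) - poly (pderiv (pderiv \<xi>)) (\<tau> a x) * (\<phi> k x * \<phi> k x))"
      unfolding unit[OF x] \<tau>_def[symmetric] by (simp add: mult.commute)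
  qed
  also have "\<dots> = (\<Sum>k<n. (\<integral>x. a k * (poly (pderiv \<xi>) (\<tau> a x) * \<phi> k x) - poly (pderiv (pderiv \<xi>)) (\<tau> a x) * (\<phi> k x * \<phi> k x) \<partial>\<sigma>))"
    by (rule Bochner_Integration.integral_sum) (use i in auto)
  also have "\<dots> = (\<Sum>k<n. a k * A (pderiv \<xi>) (\<phi> k) a - A (pderiv (pderiv \<xi>)) (\<lambda>x. \<phi> k x * \<phi> k x) a)"
    by (intro sum.cong refl) (use i in \<open>simp add: A_def\<close>)
  finally show ?thesis .
qed

text \<open>Integrating each term of the divergence by parts produces the derivative of the
  component, which cancels the second term of the divergence, and the chain rule for
  \<open>f (F a)\<close>, which remains. The result pairs the gradient of \<open>F\<close> with the
  vector field of \<open>A_divergence\<close>.\<close>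

lemma functional_integration_by_parts:
  fixes f f' :: "real \<Rightarrow> real" and \<xi> :: "real poly" and D C :: real
  assumes df: "\<And>x. (f has_real_derivative f' x) (at x)" and cf: "continuous_on UNIV f'"
    and bf: "\<And>x. \<bar>f' x\<bar> \<le> C" and D: "D > 0"
  defines "\<Phi> \<equiv> [:0, 1:] * pderiv \<xi> - pderiv (pderiv \<xi>)"
  defines "F \<equiv> \<lambda>a. A \<Phi> (\<lambda>_. 1) a / D"
  shows "(\<integral>a. F a * f (F a) \<partial>\<mu>)
    = (\<integral>a. f' (F a) * ((\<Sum>k<n. A (pderiv \<Phi>) (\<phi> k) a * A (pderiv \<xi>) (\<phi> k) a) / D\<^sup>2) \<partial>\<mu>)"
proof -
  define s where "s a = (\<Sum>i<n. \<bar>a i\<bar>)" for a :: "nat \<Rightarrow> real"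
  have s0: "0 \<le> s a" for a unfolding s_def by (rule sum_nonneg) simp
  have C0: "C \<ge> 0" using bf[of 0] by simp
  define Q where "Q k = A (pderiv \<xi>) (\<phi> k)" for k
  define R where "R k = A (pderiv (pderiv \<xi>)) (\<lambda>x. \<phi> k x * \<phi> k x)" for k
  define Pd where "Pd k = A (pderiv \<Phi>) (\<phi> k)" for k
  have [measurable]: "Q k \<in> borel_measurable \<mu>" "R k \<in> borel_measurable \<mu>" "Pd k \<in> borel_measurable \<mu>" "F \<in> borel_measurable \<mu>" for k
    unfolding Q_def R_def Pd_def F_def by measurable
  have cff: "continuous_on UNIV f" using df DERIV_isCont by (auto simp: continuous_on_eq_continuous_at)
  have [measurable]: "f \<in> borel_measurable borel" "f' \<in> borel_measurable borel"
    using cf cff by (auto intro: borel_measurable_continuous_onI)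
  obtain BF where BF: "BF \<ge> 0" "\<And>a. \<bar>A \<Phi> (\<lambda>_. 1) a\<bar> \<le> BF * exp (s a / 4)"
    using A_growth[OF one_bounded, of \<Phi>] unfolding s_def by blast
  \<comment> \<open>A bounded \<open>f'\<close> makes \<open>f\<close> grow at most linearly, so
    \<open>f (F a)\<close> inherits the growth of \<open>F\<close>.\<close>
  define Bf where "Bf = \<bar>f 0\<bar> + C * (BF / D)"
  have Bf: "Bf \<ge> 0" "\<bar>f (F a)\<bar> \<le> Bf * exp (s a / 4)" for a
  proof -
    show "Bf \<ge> 0" unfolding Bf_def using C0 BF D by simp
    have "\<bar>f (F a)\<bar> \<le> \<bar>f 0\<bar> + C * \<bar>F a\<bar>" by (rule linear_growth_of_bounded_derivative[OF df bf])
    also have "\<bar>F a\<bar> \<le> (BF / D) * exp (s a / 4)"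
      using BF(2)[of a] D by (simp add: F_def abs_divide divide_right_mono)
    then have "\<bar>f 0\<bar> + C * \<bar>F a\<bar> \<le> \<bar>f 0\<bar> * exp (s a / 4) + C * ((BF / D) * exp (s a / 4))"
      using C0 s0[of a] by (intro add_mono mult_left_mono) (auto simp: mult_le_cancel_left1)
    finally show "\<bar>f (F a)\<bar> \<le> Bf * exp (s a / 4)" by (simp add: Bf_def algebra_simps)
  qed
  have e12: "exp (s a / 4) * exp (s a / 4) \<le> exp (s a)" for a
    unfolding exp_add[symmetric] using s0[of a] by simp
  have prod2: "\<bar>u * v\<bar> \<le> (b * c) * exp (s a)" if "\<bar>u\<bar> \<le> b * exp (s a / 4)" "\<bar>v\<bar> \<le> c * exp (s a / 4)" "b \<ge> 0" "c \<ge> 0" for u v b c a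
  proof -
    have "\<bar>u * v\<bar> \<le> (b * exp (s a / 4)) * (c * exp (s a / 4))"
      unfolding abs_mult by (rule mult_mono) (use that in auto)
    also have "\<dots> = (b * c) * (exp (s a / 4) * exp (s a / 4))" by (simp add: mult_ac)
    also have "\<dots> \<le> (b * c) * exp (s a)" using that e12 by (intro mult_left_mono) auto
    finally show ?thesis .
  qed
  have key: "integrable \<mu> (\<lambda>a. a k * (Q k a * f (F a)))" "integrable \<mu> (\<lambda>a. R k a * f (F a))"
    "integrable \<mu> (\<lambda>a. f' (F a) * (Q k a * Pd k a) / D)"
    "(\<integral>a. a k * (Q k a * f (F a)) \<partial>\<mu>) = (\<integral>a. R k a * f (F a) \<partial>\<mu>) + (\<integral>a. f' (F a) * (Q k a * Pd k a) / D \<partial>\<mu>)"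
    if k: "k < n" for k
  proof -
    obtain BQ where BQ: "BQ \<ge> 0" "\<And>a. \<bar>Q k a\<bar> \<le> BQ * exp (s a / 4)"
      using A_growth[OF phi_bounded[OF k], of "pderiv \<xi>"] unfolding s_def Q_def by blast
    obtain BP where BP: "BP \<ge> 0" "\<And>a. \<bar>Pd k a\<bar> \<le> BP * exp (s a / 4)"
      using A_growth[OF phi_bounded[OF k], of "pderiv \<Phi>"] unfolding s_def Pd_def by blast
    obtain BR where BR: "BR \<ge> 0" "\<And>a. \<bar>R k a\<bar> \<le> BR * exp (s a / 4)"
      using A_growth[OF bounded_meas_mult[OF phi_bounded[OF k] phi_bounded[OF k]], of "pderiv (pderiv \<xi>)"] unfolding s_def R_def by blast
    define U where "U a = Q k a * f (F a)" for a
    define U1 where "U1 a = R k a * f (F a)" for a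
    define U2 where "U2 a = f' (F a) * (Q k a * Pd k a) / D" for a
    define U' where "U' a = U1 a + U2 a" for a
    have [measurable]: "U \<in> borel_measurable \<mu>" "U' \<in> borel_measurable \<mu>" "U1 \<in> borel_measurable \<mu>" "U2 \<in> borel_measurable \<mu>"
      unfolding U_def U'_def U1_def U2_def by measurable
    have [measurable]: "(\<lambda>a. a k) \<in> borel_measurable \<mu>" by (rule measurable_std_gaussian_component[OF k])
    have bU: "\<bar>U a\<bar> \<le> (BQ * Bf) * exp (s a)" for a unfolding U_def by (rule prod2) (use BQ Bf in auto)
    have bU1: "\<bar>U1 a\<bar> \<le> (BR * Bf) * exp (s a)" for a unfolding U1_def by (rule prod2) (use BR Bf in auto)
    have bU2: "\<bar>U2 a\<bar> \<le> (C * (BQ * BP) / D) * exp (s a)" for a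
    proof -
      have "\<bar>f' (F a) * (Q k a * Pd k a)\<bar> \<le> C * ((BQ * BP) * exp (s a))"
        unfolding abs_mult[of "f' (F a)"] by (intro mult_mono bf prod2) (use BQ BP C0 in auto)
      then show ?thesis using D by (simp add: U2_def abs_divide divide_right_mono mult.assoc)
    qed
    define B where "B = BQ * Bf + BR * Bf + C * (BQ * BP) / D"
    have nn: "0 \<le> BQ * Bf" "0 \<le> BR * Bf" "0 \<le> C * (BQ * BP) / D" using BQ BR BP Bf C0 D by auto
    have "\<bar>U a\<bar> \<le> B * exp (\<Sum>i<n. \<bar>a i\<bar>)" for a
      using order_trans[OF bU mult_right_mono[of _ B "exp (s a)"]] nn by (simp add: B_def s_def)
    moreover have "\<bar>U' a\<bar> \<le> B * exp (\<Sum>i<n. \<bar>a i\<bar>)" for a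
    proof -
      have "\<bar>U' a\<bar> \<le> \<bar>U1 a\<bar> + \<bar>U2 a\<bar>" unfolding U'_def by (rule abs_triangle_ineq)
      also have "\<dots> \<le> (BR * Bf + C * (BQ * BP) / D) * exp (s a)"
        using bU1[of a] bU2[of a] by (simp only: distrib_right)
      also have "\<dots> \<le> B * exp (s a)" using nn by (intro mult_right_mono) (auto simp: B_def)
      finally show ?thesis by (simp add: s_def)
    qed
    moreover have dU: "((\<lambda>t. U (a(k := t))) has_real_derivative U' (a(k := t))) (at t)" for a t
    proof -
      have dQ: "((\<lambda>t. Q k (a(k := t))) has_real_derivative R k (a(k := t))) (at t)"
        unfolding Q_def R_def by (rule A_derivative[OF phi_bounded[OF k] k])
      have dF: "((\<lambda>t. F (a(k := t))) has_real_derivative Pd k (a(k := t)) / D) (at t)"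
        unfolding F_def Pd_def using DERIV_cdivide[OF A_derivative[OF one_bounded k, of \<Phi> a t], of D] by simp
      have "((\<lambda>t. f (F (a(k := t)))) has_real_derivative f' (F (a(k := t))) * (Pd k (a(k := t)) / D)) (at t)"
        by (rule DERIV_chain2[OF df dF])
      from DERIV_mult[OF dQ this] show ?thesis
        unfolding U_def U'_def U1_def U2_def by (simp add: mult_ac)
    qed
    moreover have "continuous_on UNIV (\<lambda>t. U' (a(k := t)))" for a
    proof -
      have cA: "continuous_on UNIV (\<lambda>t. A p w (a(k := t)))" if "bounded_meas \<sigma> w" for p w
        using A_derivative[OF that k, of p a] DERIV_isCont by (auto simp: continuous_on_eq_continuous_at)
      have 1: "continuous_on UNIV (\<lambda>t. Q k (a(k := t)))" "continuous_on UNIV (\<lambda>t. R k (a(k := t)))"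
        "continuous_on UNIV (\<lambda>t. Pd k (a(k := t)))" "continuous_on UNIV (\<lambda>t. F (a(k := t)))"
        unfolding Q_def R_def Pd_def F_def
        by (intro cA continuous_on_divide continuous_on_const phi_bounded bounded_meas_mult k one_bounded; use D in simp)+
      show ?thesis unfolding U'_def U1_def U2_def
        by (intro continuous_intros 1 continuous_on_compose2[OF cff 1(4)] continuous_on_compose2[OF cf 1(4)]) (use D in auto)
    qed
    ultimately have ibp: "(\<integral>a. a k * U a \<partial>\<mu>) = (\<integral>a. U' a \<partial>\<mu>)"
      by (intro std_gaussian_integration_by_parts[OF k, where B = B]) auto
    show i1: "integrable \<mu> (\<lambda>a. R k a * f (F a))"
    proof -
      have "integrable \<mu> U1" by (rule integrable_exp_growth[where B = "BR * Bf" and c = 1]) (use bU1 in \<open>auto simp: s_def\<close>)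
      then show ?thesis unfolding U1_def[abs_def] .
    qed
    show i2: "integrable \<mu> (\<lambda>a. f' (F a) * (Q k a * Pd k a) / D)"
    proof -
      have "integrable \<mu> U2" by (rule integrable_exp_growth[where B = "C * (BQ * BP) / D" and c = 1]) (use bU2 in \<open>auto simp: s_def\<close>)
      then show ?thesis unfolding U2_def[abs_def] .
    qed
    show "integrable \<mu> (\<lambda>a. a k * (Q k a * f (F a)))"
    proof (rule integrable_exp_growth[where B = "BQ * Bf" and c = 2])
      fix a :: "nat \<Rightarrow> real"
      have "\<bar>a k\<bar> \<le> s a" unfolding s_def by (rule member_le_sum) (use k in auto)
      also have "\<dots> \<le> exp (s a)" using exp_ge_add_one_self[of "s a"] by linarith
      finally have "\<bar>a k * U a\<bar> \<le> exp (s a) * ((BQ * Bf) * exp (s a))"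
        unfolding abs_mult by (intro mult_mono bU) auto
      also have "\<dots> = (BQ * Bf) * (exp (s a) * exp (s a))" by (simp only: mult_ac)
      also have "exp (s a) * exp (s a) = exp (2 * s a)" by (simp only: mult_2 exp_add)
      finally show "\<bar>a k * (Q k a * f (F a))\<bar> \<le> (BQ * Bf) * exp (2 * (\<Sum>i<n. \<bar>a i\<bar>))"
        by (simp add: U_def s_def)
    qed measurable
    show "(\<integral>a. a k * (Q k a * f (F a)) \<partial>\<mu>) = (\<integral>a. R k a * f (F a) \<partial>\<mu>) + (\<integral>a. f' (F a) * (Q k a * Pd k a) / D \<partial>\<mu>)"
      using ibp i1 i2 by (simp add: U_def U'_def U1_def U2_def)
  qed
  have "F a * f (F a) = (\<Sum>k<n. (a k * (Q k a * f (F a)) - R k a * f (F a)) / D)" for a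
  proof -
    have "F a = (\<Sum>k<n. a k * Q k a - R k a) / D"
      unfolding F_def \<Phi>_def A_divergence Q_def R_def ..
    then have "F a * f (F a) = (\<Sum>k<n. a k * Q k a - R k a) / D * f (F a)" by simp
    also have "\<dots> = (\<Sum>k<n. (a k * (Q k a * f (F a)) - R k a * f (F a)) / D)"
      unfolding sum_divide_distrib sum_distrib_right by (intro sum.cong refl) (simp add: left_diff_distrib diff_divide_distrib)
    finally show ?thesis .
  qed
  then have "(\<integral>a. F a * f (F a) \<partial>\<mu>) = (\<integral>a. (\<Sum>k<n. (a k * (Q k a * f (F a)) - R k a * f (F a)) / D) \<partial>\<mu>)" by simp
  also have "\<dots> = (\<Sum>k<n. (\<integral>a. (a k * (Q k a * f (F a)) - R k a * f (F a)) / D \<partial>\<mu>))"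
    by (rule Bochner_Integration.integral_sum) (use key in auto)
  also have "\<dots> = (\<Sum>k<n. (\<integral>a. f' (F a) * (Q k a * Pd k a) / D \<partial>\<mu>) / D)"
    by (intro sum.cong refl) (use key in simp)
  also have "\<dots> = (\<Sum>k<n. (\<integral>a. f' (F a) * (Q k a * Pd k a) / D / D \<partial>\<mu>))" by simp
  also have "\<dots> = (\<integral>a. (\<Sum>k<n. f' (F a) * (Q k a * Pd k a) / D / D) \<partial>\<mu>)"
    by (rule Bochner_Integration.integral_sum[symmetric]) (intro integrable_divide key(3), simp)
  also have "\<dots> = (\<integral>a. f' (F a) * ((\<Sum>k<n. Pd k a * Q k a) / D\<^sup>2) \<partial>\<mu>)"
    by (simp add: sum_distrib_left sum_divide_distrib power2_eq_square mult_ac)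
  finally show ?thesis by (simp add: Pd_def Q_def)
qed

end

text \<open>The polynomial \<open>\<xi>\<close> inverts the Ornstein--Uhlenbeck operator: \<open>\<xi>' = c2 H\<^sub>1 + c3 H\<^sub>2 + c4 H\<^sub>3\<close>.\<close>

definition xi_poly :: "real \<Rightarrow> real \<Rightarrow> real \<Rightarrow> real poly" where
  "xi_poly c2 c3 c4 = [:3 * c4 / 4 - c2 / 2, - c3, c2 / 2 - 3 * c4 / 2, c3 / 3, c4 / 4:]"

definition Phi_poly :: "real \<Rightarrow> real \<Rightarrow> real \<Rightarrow> real poly" where
  "Phi_poly c2 c3 c4 = [:0, 1:] * pderiv (xi_poly c2 c3 c4) - pderiv (pderiv (xi_poly c2 c3 c4))"

lemma poly_pderiv_xi: "poly (pderiv (xi_poly c2 c3 c4)) t = c2 * t + c3 * (t\<^sup>2 - 1) + c4 * (t ^ 3 - 3 * t)"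
  by (simp add: xi_poly_def pderiv_pCons algebra_simps power2_eq_square power3_eq_cube)

lemma poly_Phi: "poly (Phi_poly c2 c3 c4) t = c2 * (t\<^sup>2 - 1) + c3 * (t ^ 3 - 3 * t) + c4 * (t ^ 4 - 6 * t\<^sup>2 + 3)"
  by (simp add: Phi_poly_def xi_poly_def pderiv_pCons algebra_simps power2_eq_square power3_eq_cube power4_eq_xxxx)

lemma poly_pderiv_Phi: "poly (pderiv (Phi_poly c2 c3 c4)) t = 2 * c2 * t + 3 * c3 * (t\<^sup>2 - 1) + 4 * c4 * (t ^ 3 - 3 * t)"
  by (simp add: Phi_poly_def xi_poly_def pderiv_pCons algebra_simps power2_eq_square power3_eq_cube power4_eq_xxxx)

context gaussian_expansion
begin

lemma poly_integral_integrable: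
  "integrable \<sigma> (\<lambda>x. poly p (\<tau> a x) * \<phi> k x)" if "k < n"
  by (rule A_integrand_integrable[OF phi_bounded[OF that]])

lemma tau_integral_zero: "(\<integral>x. \<tau> a x \<partial>\<sigma>) = 0"
proof -
  have "(\<integral>x. \<tau> a x \<partial>\<sigma>) = (\<Sum>k<n. (\<integral>x. \<phi> k x * a k \<partial>\<sigma>))"
    unfolding \<tau>_def by (rule Bochner_Integration.integral_sum) (auto intro!: bounded_meas_integrable[OF fin] phi_bounded)
  also have "\<dots> = 0" using mean by (auto intro!: sum.neutral)
  finally show ?thesis .
qed

text \<open>Orthogonality of the \<open>\<phi> j\<close> singles out one coordinate. The leading
  part of \<Gamma> thereby becomes an explicit sum of squares.\<close>

lemma A_linear: assumes "k < n" shows "A [:0, 1:] (\<phi> k) a = \<kappa> * a k"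
proof -
  have "A [:0, 1:] (\<phi> k) a = (\<integral>x. (\<Sum>j<n. a j * (\<phi> j x * \<phi> k x)) \<partial>\<sigma>)"
    unfolding A_def \<tau>_def by (rule Bochner_Integration.integral_cong) (auto simp: sum_distrib_left sum_distrib_right mult_ac)
  also have "\<dots> = (\<Sum>j<n. (\<integral>x. a j * (\<phi> j x * \<phi> k x) \<partial>\<sigma>))"
    by (rule Bochner_Integration.integral_sum)
       (use assms in \<open>auto intro!: bounded_meas_integrable[OF fin] bounded_meas_mult phi_bounded\<close>)
  also have "\<dots> = (\<Sum>j<n. if j = k then \<kappa> * a k else 0)"
    by (intro sum.cong refl) (use assms in \<open>auto simp: orth\<close>)
  finally show ?thesis using assms by simp
qed

text \<open>The sum over the basis rebuilds \<tau> under the integral. The mixed terms of \<Gamma>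
  thus become single integrals, to which a variance bound applies directly.\<close>

lemma sum_component_functional:
  "(\<Sum>k<n. a k * A p (\<phi> k) a) = (\<integral>x. poly p (\<tau> a x) * \<tau> a x \<partial>\<sigma>)"
proof -
  have "(\<Sum>k<n. a k * A p (\<phi> k) a) = (\<Sum>k<n. (\<integral>x. a k * (poly p (\<tau> a x) * \<phi> k x) \<partial>\<sigma>))"
    by (simp add: A_def)
  also have "\<dots> = (\<integral>x. (\<Sum>k<n. a k * (poly p (\<tau> a x) * \<phi> k x)) \<partial>\<sigma>)"
    by (rule Bochner_Integration.integral_sum[symmetric]) (auto intro!: poly_integral_integrable)
  also have "\<dots> = (\<integral>x. poly p (\<tau> a x) * \<tau> a x \<partial>\<sigma>)"
  proof (rule Bochner_Integration.integral_cong[OF refl])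
    fix x show "(\<Sum>k<n. a k * (poly p (\<tau> a x) * \<phi> k x)) = poly p (\<tau> a x) * \<tau> a x"
      by (subst (2) \<tau>_def) (simp add: sum_distrib_left mult_ac)
  qed
  finally show ?thesis .
qed

section \<open>The quantity \<Gamma> and the normal approximation\<close>

text \<open>Order 2 is enough for all three polynomials: their variances are compared with
  \<open>I 2\<close>, and the gradients with \<open>I 3\<close>. \<open>t^4 - 3 * t^2\<close> is
  \<open>t\<close> times the third Hermite polynomial and arises from the mixed terms of
  \<Gamma>.\<close>

context
  fixes c2 c3 c4 K :: real
  assumes mass: "measure \<sigma> (space \<sigma>) > 0" and c2: "c2 \<noteq> 0"
    and cb2: "corr_bound (\<lambda>t. t\<^sup>2 - 1) 2 K" and cb3: "corr_bound (\<lambda>t. t ^ 3 - 3 * t) 2 K"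
    and cb4: "corr_bound (\<lambda>t. t ^ 4 - 3 * t\<^sup>2) 2 K"
begin

definition vol where "vol = measure \<sigma> (space \<sigma>)"
text \<open>Standard deviation of the second-order part: the integral of
  \<open>c2 * (t^2 - 1)\<close> at \<tau> has variance \<open>2 * c2^2 * I 2\<close>, and
  \<open>I 2 = \<kappa> * vol\<close>. Dividing by it rather than by the full deviation makes the
  leading term of \<Gamma> equal to 1.\<close>

definition D where "D = \<bar>c2\<bar> * sqrt (2 * \<kappa> * vol)"
definition F where "F a = A (Phi_poly c2 c3 c4) (\<lambda>_. 1) a / D"
text \<open>In Malliavin terms, the pairing of the gradient of \<open>F\<close> with minus the
  gradient of the inverse Ornstein-Uhlenbeck generator applied to \<open>F\<close>; its mean is the
  variance of \<open>F\<close>.\<close>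

definition \<Gamma> where "\<Gamma> a = (\<Sum>k<n. A (pderiv (Phi_poly c2 c3 c4)) (\<phi> k) a * A (pderiv (xi_poly c2 c3 c4)) (\<phi> k) a) / D\<^sup>2"
text \<open>The first summand collects the terms that reduce to a single integral, of size
  \<open>sqrt (I 2)\<close>; the second collects those quadratic in \<open>A\<close> at the second
  and third Hermite polynomials, of size \<open>I 3\<close>, all relative to
  \<open>\<kappa> * vol\<close>.\<close>

definition \<delta> where "\<delta> = sqrt (K * \<kappa> / vol) * (1 + 6 * (\<bar>c3\<bar> + \<bar>c4\<bar>) / \<bar>c2\<bar>)
    + 4 * K * (c3\<^sup>2 + \<bar>c3 * c4\<bar> + c4\<^sup>2) / c2\<^sup>2 * (I 3 / (\<kappa> * vol))"

lemma vol_pos: "vol > 0" using mass by (simp add: vol_def)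

lemma vol_eq: "vol = real n * \<kappa>" by (simp add: vol_def total_mass)

lemma D_pos: "D > 0" unfolding D_def using c2 kappa vol_pos by simp

lemma D_square: "D\<^sup>2 = 2 * c2\<^sup>2 * \<kappa> * vol"
  unfolding D_def using kappa vol_pos by (simp add: power_mult_distrib)

text \<open>The derivative of the Hermite polynomial of order \<open>k\<close> is \<open>k\<close>
  times that of order \<open>k - 1\<close>, whence the factors 2, 3, 4 in the second line.\<close>

lemma Phi_xi_components:
  assumes "k < n"
  defines "B \<equiv> A [:-1, 0, 1:] (\<phi> k)" and "C \<equiv> A [:0, -3, 0, 1:] (\<phi> k)"
  shows "A (pderiv (xi_poly c2 c3 c4)) (\<phi> k) a = c2 * (\<kappa> * a k) + c3 * B a + c4 * C a"
    "A (pderiv (Phi_poly c2 c3 c4)) (\<phi> k) a = 2 * c2 * (\<kappa> * a k) + 3 * c3 * B a + 4 * c4 * C a"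
proof -
  have i: "integrable \<sigma> (\<lambda>x. poly [:0, 1:] (\<tau> a x) * \<phi> k x)" "integrable \<sigma> (\<lambda>x. poly [:-1, 0, 1:] (\<tau> a x) * \<phi> k x)"
    "integrable \<sigma> (\<lambda>x. poly [:0, -3, 0, 1:] (\<tau> a x) * \<phi> k x)"
    by (rule poly_integral_integrable[OF assms(1)])+
  have gen: "(\<integral>x. (u * poly [:0, 1:] (\<tau> a x) + v * poly [:-1, 0, 1:] (\<tau> a x) + w * poly [:0, -3, 0, 1:] (\<tau> a x)) * \<phi> k x \<partial>\<sigma>)
     = u * (\<kappa> * a k) + v * B a + w * C a" for u v w
  proof -
    have "(\<integral>x. (u * poly [:0, 1:] (\<tau> a x) + v * poly [:-1, 0, 1:] (\<tau> a x) + w * poly [:0, -3, 0, 1:] (\<tau> a x)) * \<phi> k x \<partial>\<sigma>)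
      = (\<integral>x. u * (poly [:0, 1:] (\<tau> a x) * \<phi> k x) + v * (poly [:-1, 0, 1:] (\<tau> a x) * \<phi> k x) + w * (poly [:0, -3, 0, 1:] (\<tau> a x) * \<phi> k x) \<partial>\<sigma>)"
      by (simp only: distrib_right mult.assoc)
    also have "\<dots> = u * A [:0, 1:] (\<phi> k) a + v * B a + w * C a"
      using i by (simp only: Bochner_Integration.integral_add Bochner_Integration.integrable_add integrable_mult_right integral_mult_right_zero A_def B_def C_def)
    finally show ?thesis unfolding A_linear[OF assms(1)] .
  qed
  have p: "poly [:-1, 0, 1:] t = t\<^sup>2 - 1" "poly [:0, -3, 0, 1:] t = t ^ 3 - 3 * t" "poly [:0, 1:] t = t" for t :: real
    by (simp_all add: power2_eq_square power3_eq_cube algebra_simps)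
  show "A (pderiv (xi_poly c2 c3 c4)) (\<phi> k) a = c2 * (\<kappa> * a k) + c3 * B a + c4 * C a"
    using gen[of c2 c3 c4] unfolding p by (simp only: A_def poly_pderiv_xi)
  show "A (pderiv (Phi_poly c2 c3 c4)) (\<phi> k) a = 2 * c2 * (\<kappa> * a k) + 3 * c3 * B a + 4 * c4 * C a"
    using gen[of "2 * c2" "3 * c3" "4 * c4"] unfolding p by (simp only: A_def poly_pderiv_Phi)
qed

text \<open>Multiply out the two lines of \<open>Phi_xi_components\<close>. The linear parts give
  \<open>T a + vol\<close>, whose constant cancels the 1; linear times higher gives \<open>X\<close>
  and \<open>Y\<close>, which like \<open>T\<close> have second moment at most
  \<open>K * I 2\<close>; what is left are quadratic sums with mean at most
  \<open>K * I 3\<close>.\<close>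

lemma Gamma_bound:
  shows "integrable \<mu> \<Gamma>" "(\<integral>a. \<bar>1 - \<Gamma> a\<bar> \<partial>\<mu>) \<le> \<delta>"
proof -
  define B where "B k = A [:-1, 0, 1:] (\<phi> k)" for k
  define C where "C k = A [:0, -3, 0, 1:] (\<phi> k)" for k
  define T where "T a = (\<integral>x. (\<tau> a x)\<^sup>2 - 1 \<partial>\<sigma>)" for a
  define X where "X a = (\<integral>x. \<tau> a x ^ 3 - 3 * \<tau> a x \<partial>\<sigma>)" for a
  define Y where "Y a = (\<integral>x. \<tau> a x ^ 4 - 3 * (\<tau> a x)\<^sup>2 \<partial>\<sigma>)" for a
  define SB where "SB a = (\<Sum>k<n. (B k a)\<^sup>2)" for a
  define SC where "SC a = (\<Sum>k<n. (C k a)\<^sup>2)" for a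
  define SBC where "SBC a = (\<Sum>k<n. B k a * C k a)" for a
  have n0: "real n > 0" using vol_pos kappa by (simp add: vol_eq zero_less_mult_iff)
  have p: "poly [:-1, 0, 1:] t = t\<^sup>2 - 1" "poly [:0, -3, 0, 1:] t = t ^ 3 - 3 * t" "poly [:0, 1:] t = t" for t :: real
    by (simp_all add: power2_eq_square power3_eq_cube algebra_simps)
  have pint: "integrable \<sigma> (\<lambda>x. poly q (\<tau> a x))" for q a
    using A_integrand_integrable[OF one_bounded, of q a] by simp
  \<comment> \<open>\<open>t * (t^2 - 1) = (t^3 - 3 * t) + 2 * t\<close>, and the linear part
    integrates to 0.\<close>
  have Xk: "(\<Sum>k<n. a k * B k a) = X a" for a
  proof -
    have "(\<Sum>k<n. a k * B k a) = (\<integral>x. ((\<tau> a x)\<^sup>2 - 1) * \<tau> a x \<partial>\<sigma>)"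
      unfolding B_def sum_component_functional p ..
    also have "\<dots> = (\<integral>x. (\<tau> a x ^ 3 - 3 * \<tau> a x) + 2 * \<tau> a x \<partial>\<sigma>)"
      by (intro Bochner_Integration.integral_cong) (auto simp: power2_eq_square power3_eq_cube algebra_simps)
    also have "\<dots> = X a + 2 * (\<integral>x. \<tau> a x \<partial>\<sigma>)"
      using pint[of "[:0, -3, 0, 1:]" a] pint[of "[:0, 1:]" a] unfolding p X_def
      by (simp only: Bochner_Integration.integral_add integrable_mult_right integral_mult_right_zero)
    finally show ?thesis by (simp add: tau_integral_zero)
  qed
  have Yk: "(\<Sum>k<n. a k * C k a) = Y a" for a
    unfolding C_def sum_component_functional p Y_def
    by (intro Bochner_Integration.integral_cong) (auto simp: power2_eq_square power3_eq_cube power4_eq_xxxx algebra_simps)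
  have S2: "\<kappa> * (\<Sum>k<n. (a k)\<^sup>2) = T a + vol" for a
  proof -
    have "\<kappa> * (\<Sum>k<n. (a k)\<^sup>2) = (\<Sum>k<n. a k * A [:0, 1:] (\<phi> k) a)"
      by (simp add: A_linear sum_distrib_left power2_eq_square mult_ac)
    also have "\<dots> = (\<integral>x. ((\<tau> a x)\<^sup>2 - 1) + 1 \<partial>\<sigma>)"
      unfolding sum_component_functional p by (simp add: power2_eq_square)
    also have "\<dots> = T a + vol"
      using Bochner_Integration.integral_add[of \<sigma> "\<lambda>x. (\<tau> a x)\<^sup>2 - 1" "\<lambda>_. 1"] pint[of "[:-1, 0, 1:]" a]
      unfolding p T_def by (simp add: vol_def)
    finally show ?thesis .
  qed
  \<comment> \<open>The factors 5, 6, 7 are \<open>2 + 3\<close>, \<open>2 + 4\<close>,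
    \<open>3 + 4\<close>: each mixed product occurs twice, once with the factor of either component
    of the derivative of \<open>Phi_poly\<close>.\<close>
  have PQ: "\<Gamma> a * D\<^sup>2 = 2 * c2\<^sup>2 * \<kappa> * (T a + vol) + 5 * (c2 * c3) * \<kappa> * X a + 6 * (c2 * c4) * \<kappa> * Y a
      + 3 * c3\<^sup>2 * SB a + 7 * (c3 * c4) * SBC a + 4 * c4\<^sup>2 * SC a" for a
  proof -
    have "\<Gamma> a * D\<^sup>2 = (\<Sum>k<n. (2 * c2 * (\<kappa> * a k) + 3 * c3 * B k a + 4 * c4 * C k a) * (c2 * (\<kappa> * a k) + c3 * B k a + c4 * C k a))"
      unfolding \<Gamma>_def B_def C_def using D_pos by simp (intro sum.cong refl, simp add: Phi_xi_components)
    also have "\<dots> = (\<Sum>k<n. (2 * c2\<^sup>2 * \<kappa>) * (\<kappa> * (a k)\<^sup>2) + (5 * (c2 * c3) * \<kappa>) * (a k * B k a) + (6 * (c2 * c4) * \<kappa>) * (a k * C k a)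
        + (3 * c3\<^sup>2) * (B k a)\<^sup>2 + (7 * (c3 * c4)) * (B k a * C k a) + (4 * c4\<^sup>2) * (C k a)\<^sup>2)"
      by (intro sum.cong refl) (simp add: power2_eq_square algebra_simps)
    also have "\<dots> = (2 * c2\<^sup>2 * \<kappa>) * (\<kappa> * (\<Sum>k<n. (a k)\<^sup>2)) + (5 * (c2 * c3) * \<kappa>) * (\<Sum>k<n. a k * B k a) + (6 * (c2 * c4) * \<kappa>) * (\<Sum>k<n. a k * C k a)
        + (3 * c3\<^sup>2) * SB a + (7 * (c3 * c4)) * SBC a + (4 * c4\<^sup>2) * SC a"
      by (simp only: sum.distrib sum_distrib_left SB_def SC_def SBC_def)
    finally show ?thesis by (simp only: S2 Xk Yk)
  qed
  have SBCb: "\<bar>SBC a\<bar> \<le> (SB a + SC a) / 2" for a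
  proof -
    have "\<bar>SBC a\<bar> \<le> (\<Sum>k<n. ((B k a)\<^sup>2 + (C k a)\<^sup>2) / 2)"
      unfolding SBC_def
    proof (rule order_trans[OF sum_abs sum_mono])
      fix k
      have "0 \<le> (\<bar>B k a\<bar> - \<bar>C k a\<bar>)\<^sup>2" by simp
      then show "\<bar>B k a * C k a\<bar> \<le> ((B k a)\<^sup>2 + (C k a)\<^sup>2) / 2" by (simp add: power2_diff abs_mult)
    qed
    then show ?thesis by (simp add: SB_def SC_def sum.distrib sum_divide_distrib add_divide_distrib)
  qed
  have SB0: "SB a \<ge> 0" "SC a \<ge> 0" for a unfolding SB_def SC_def by (auto intro: sum_nonneg)
  define N where "N a = 2 * c2\<^sup>2 * \<kappa> * \<bar>T a\<bar> + 5 * \<bar>c2 * c3\<bar> * \<kappa> * \<bar>X a\<bar> + 6 * \<bar>c2 * c4\<bar> * \<kappa> * \<bar>Y a\<bar>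
      + (3 * c3\<^sup>2 + 4 * \<bar>c3 * c4\<bar>) * SB a + (4 * \<bar>c3 * c4\<bar> + 4 * c4\<^sup>2) * SC a" for a
  have pt: "\<bar>1 - \<Gamma> a\<bar> \<le> N a / D\<^sup>2" for a
  proof -
    have "(1 - \<Gamma> a) * D\<^sup>2 = D\<^sup>2 - \<Gamma> a * D\<^sup>2" by (simp add: left_diff_distrib)
    also have "\<dots> = - (2 * c2\<^sup>2 * \<kappa> * T a) - 5 * (c2 * c3) * \<kappa> * X a - 6 * (c2 * c4) * \<kappa> * Y a
      - 3 * c3\<^sup>2 * SB a - 7 * (c3 * c4) * SBC a - 4 * c4\<^sup>2 * SC a"
      using PQ[of a] D_square by (simp add: algebra_simps)
    finally have eq: "(1 - \<Gamma> a) * D\<^sup>2 = - (2 * c2\<^sup>2 * \<kappa> * T a) - 5 * (c2 * c3) * \<kappa> * X a - 6 * (c2 * c4) * \<kappa> * Y a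
      - 3 * c3\<^sup>2 * SB a - 7 * (c3 * c4) * SBC a - 4 * c4\<^sup>2 * SC a" .
    have "\<bar>7 * (c3 * c4) * SBC a\<bar> \<le> 7 * \<bar>c3 * c4\<bar> * ((SB a + SC a) / 2)"
      using mult_left_mono[OF SBCb[of a], of "7 * \<bar>c3 * c4\<bar>"] by (simp add: abs_mult mult_ac)
    \<comment> \<open>\<open>7 / 2\<close> is rounded up to 4.\<close>
    also have "\<dots> \<le> 4 * \<bar>c3 * c4\<bar> * SB a + 4 * \<bar>c3 * c4\<bar> * SC a"
      using mult_nonneg_nonneg[OF abs_ge_zero[of "c3 * c4"] SB0(1)[of a]] mult_nonneg_nonneg[OF abs_ge_zero[of "c3 * c4"] SB0(2)[of a]]
      by (simp add: algebra_simps)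
    finally have 1: "\<bar>7 * (c3 * c4) * SBC a\<bar> \<le> 4 * \<bar>c3 * c4\<bar> * SB a + 4 * \<bar>c3 * c4\<bar> * SC a" .
    have 2: "\<bar>2 * c2\<^sup>2 * \<kappa> * T a\<bar> = 2 * c2\<^sup>2 * \<kappa> * \<bar>T a\<bar>" "\<bar>5 * (c2 * c3) * \<kappa> * X a\<bar> = 5 * \<bar>c2 * c3\<bar> * \<kappa> * \<bar>X a\<bar>"
      "\<bar>6 * (c2 * c4) * \<kappa> * Y a\<bar> = 6 * \<bar>c2 * c4\<bar> * \<kappa> * \<bar>Y a\<bar>" "\<bar>3 * c3\<^sup>2 * SB a\<bar> = 3 * c3\<^sup>2 * SB a"
      "\<bar>4 * c4\<^sup>2 * SC a\<bar> = 4 * c4\<^sup>2 * SC a"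
      using kappa SB0[of a] by (simp_all add: abs_mult)
    have "\<bar>(1 - \<Gamma> a) * D\<^sup>2\<bar> \<le> N a"
    proof -
      have six: "\<bar>- a - b - c - d - e - f\<bar> \<le> A + B + C + D + E + F" if "\<bar>a\<bar> \<le> A" "\<bar>b\<bar> \<le> B" "\<bar>c\<bar> \<le> C" "\<bar>d\<bar> \<le> D" "\<bar>e\<bar> \<le> E" "\<bar>f\<bar> \<le> F"
        for a b c d e f A B C D E F :: real using that unfolding abs_le_iff by linarith
      show ?thesis unfolding eq N_def
        by (rule order_trans[OF six[OF eq_refl[OF 2(1)] eq_refl[OF 2(2)] eq_refl[OF 2(3)] eq_refl[OF 2(4)] 1 eq_refl[OF 2(5)]]])
           (simp add: distrib_right)
    qed
    then have "\<bar>1 - \<Gamma> a\<bar> * D\<^sup>2 \<le> N a" by (simp add: abs_mult)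
    then show ?thesis using D_pos by (simp add: pos_le_divide_eq)
  qed
  have E1: "integrable \<mu> (\<lambda>a. \<bar>T a\<bar>)" "(\<integral>a. \<bar>T a\<bar> \<partial>\<mu>) \<le> sqrt (K * (real n * \<kappa>\<^sup>2))"
    and E2: "integrable \<mu> (\<lambda>a. \<bar>X a\<bar>)" "(\<integral>a. \<bar>X a\<bar> \<partial>\<mu>) \<le> sqrt (K * (real n * \<kappa>\<^sup>2))"
    and E3: "integrable \<mu> (\<lambda>a. \<bar>Y a\<bar>)" "(\<integral>a. \<bar>Y a\<bar> \<partial>\<mu>) \<le> sqrt (K * (real n * \<kappa>\<^sup>2))"
  proof -
    have gen: "integrable \<mu> (\<lambda>a. \<bar>\<integral>x. \<psi> (\<tau> a x) \<partial>\<sigma>\<bar>)" "(\<integral>a. \<bar>\<integral>x. \<psi> (\<tau> a x) \<partial>\<sigma>\<bar> \<partial>\<mu>) \<le> sqrt (K * (real n * \<kappa>\<^sup>2))"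
      if cb: "corr_bound \<psi> 2 K" for \<psi>
    proof -
      note fs = functional_second_moment[OF cb, of "\<lambda>_. 1", simplified]
      show "integrable \<mu> (\<lambda>a. \<bar>\<integral>x. \<psi> (\<tau> a x) \<partial>\<sigma>\<bar>)" using fs(3) by simp
      have "(\<integral>a. \<bar>\<integral>x. \<psi> (\<tau> a x) \<partial>\<sigma>\<bar> \<partial>\<mu>) \<le> sqrt (\<integral>a. (\<integral>x. \<psi> (\<tau> a x) \<partial>\<sigma>)\<^sup>2 \<partial>\<mu>)"
        by (rule G.expectation_abs_le_sqrt(2)[OF fs(2,5)])
      also have "\<dots> \<le> sqrt (K * I 2)" using functional_variance_bound[OF cb] by simp
      finally show "(\<integral>a. \<bar>\<integral>x. \<psi> (\<tau> a x) \<partial>\<sigma>\<bar> \<partial>\<mu>) \<le> sqrt (K * (real n * \<kappa>\<^sup>2))" by (simp add: I2)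
    qed
    show "integrable \<mu> (\<lambda>a. \<bar>T a\<bar>)" "(\<integral>a. \<bar>T a\<bar> \<partial>\<mu>) \<le> sqrt (K * (real n * \<kappa>\<^sup>2))"
      "integrable \<mu> (\<lambda>a. \<bar>X a\<bar>)" "(\<integral>a. \<bar>X a\<bar> \<partial>\<mu>) \<le> sqrt (K * (real n * \<kappa>\<^sup>2))"
      "integrable \<mu> (\<lambda>a. \<bar>Y a\<bar>)" "(\<integral>a. \<bar>Y a\<bar> \<partial>\<mu>) \<le> sqrt (K * (real n * \<kappa>\<^sup>2))"
      unfolding T_def X_def Y_def by (rule gen[OF cb2] gen[OF cb3] gen[OF cb4])+
  qed
  have w: "\<bar>\<phi> k x\<bar> \<le> 1" if "k < n" "x \<in> space \<sigma>" for k x using phi_le_1 that by auto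
  have E4: "integrable \<mu> SB" "(\<integral>a. SB a \<partial>\<mu>) \<le> K * I 3"
  proof -
    show "integrable \<mu> SB" unfolding SB_def[abs_def] B_def A_def p
      by (intro Bochner_Integration.integrable_sum functional_second_moment(5)[OF cb2 meas w]) auto
    show "(\<integral>a. SB a \<partial>\<mu>) \<le> K * I 3"
      using functional_gradient_bound[OF cb2] unfolding SB_def B_def A_def p by (simp add: eval_nat_numeral)
  qed
  have E5: "integrable \<mu> SC" "(\<integral>a. SC a \<partial>\<mu>) \<le> K * I 3"
  proof -
    show "integrable \<mu> SC" unfolding SC_def[abs_def] C_def A_def p
      by (intro Bochner_Integration.integrable_sum functional_second_moment(5)[OF cb3 meas w]) auto
    show "(\<integral>a. SC a \<partial>\<mu>) \<le> K * I 3"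
      using functional_gradient_bound[OF cb3] unfolding SC_def C_def A_def p by (simp add: eval_nat_numeral)
  qed
  have iN: "integrable \<mu> (\<lambda>a. N a / D\<^sup>2)" unfolding N_def
    using E1(1) E2(1) E3(1) E4(1) E5(1) by auto
  have [measurable]: "\<Gamma> \<in> borel_measurable \<mu>" unfolding \<Gamma>_def[abs_def] by measurable
  have i1G: "integrable \<mu> (\<lambda>a. 1 - \<Gamma> a)"
    
  proof (rule Bochner_Integration.integrable_bound[OF iN])
    show "AE a in \<mu>. norm (1 - \<Gamma> a) \<le> norm (N a / D\<^sup>2)"
      using order_trans[OF pt abs_ge_self] by (intro AE_I2) (simp only: real_norm_def)
  qed measurable
  have "integrable \<mu> (\<lambda>a. 1 - (1 - \<Gamma> a))" by (rule Bochner_Integration.integrable_diff) (use i1G in auto)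
  then show "integrable \<mu> \<Gamma>" by simp
  have "(\<integral>a. \<bar>1 - \<Gamma> a\<bar> \<partial>\<mu>) \<le> (\<integral>a. N a / D\<^sup>2 \<partial>\<mu>)"
    by (rule integral_mono[OF integrable_abs[OF i1G] iN pt])
  also have "\<dots> = (2 * c2\<^sup>2 * \<kappa> * (\<integral>a. \<bar>T a\<bar> \<partial>\<mu>) + 5 * \<bar>c2 * c3\<bar> * \<kappa> * (\<integral>a. \<bar>X a\<bar> \<partial>\<mu>) + 6 * \<bar>c2 * c4\<bar> * \<kappa> * (\<integral>a. \<bar>Y a\<bar> \<partial>\<mu>)
      + (3 * c3\<^sup>2 + 4 * \<bar>c3 * c4\<bar>) * (\<integral>a. SB a \<partial>\<mu>) + (4 * \<bar>c3 * c4\<bar> + 4 * c4\<^sup>2) * (\<integral>a. SC a \<partial>\<mu>)) / D\<^sup>2"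
    unfolding N_def integral_divide_zero
    using E1(1) E2(1) E3(1) E4(1) E5(1)
    by (simp only: Bochner_Integration.integral_add Bochner_Integration.integrable_add integrable_mult_right integral_mult_right_zero)
  also have "\<dots> \<le> (2 * c2\<^sup>2 * \<kappa> * sqrt (K * (real n * \<kappa>\<^sup>2)) + 5 * \<bar>c2 * c3\<bar> * \<kappa> * sqrt (K * (real n * \<kappa>\<^sup>2)) + 6 * \<bar>c2 * c4\<bar> * \<kappa> * sqrt (K * (real n * \<kappa>\<^sup>2))
      + (3 * c3\<^sup>2 + 4 * \<bar>c3 * c4\<bar>) * (K * I 3) + (4 * \<bar>c3 * c4\<bar> + 4 * c4\<^sup>2) * (K * I 3)) / D\<^sup>2"
    by (intro divide_right_mono add_mono mult_left_mono E1(2) E2(2) E3(2) E4(2) E5(2)) (use kappa in auto)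
  also have "\<dots> \<le> \<delta>"
  proof -
    define q where "q = sqrt (K * \<kappa> / vol)"
    \<comment> \<open>\<open>n * \<kappa>^2 = vol^2 * (\<kappa> / vol)\<close> because
      \<open>vol = n * \<kappa>\<close>; relative to \<open>vol\<close> the fluctuation is thus
      \<open>sqrt (K * \<kappa> / vol)\<close>, which is small together with \<kappa>.\<close>
    have sq: "sqrt (K * (real n * \<kappa>\<^sup>2)) = vol * q"
    proof -
      have "K * (real n * \<kappa>\<^sup>2) = vol\<^sup>2 * (K * \<kappa> / vol)"
        using vol_pos by (simp add: power2_eq_square vol_eq)
      then have "sqrt (K * (real n * \<kappa>\<^sup>2)) = sqrt (vol\<^sup>2) * sqrt (K * \<kappa> / vol)" by (simp only: real_sqrt_mult)
      then show ?thesis using vol_pos by (simp add: q_def)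
    qed
    have q0: "q \<ge> 0" unfolding q_def using cb2 kappa vol_pos by (simp add: corr_bound_def)
    have KI: "K * I 3 \<ge> 0" using E4(2) Bochner_Integration.integral_nonneg[of \<mu> SB] SB0 by (meson order_trans)
    have "2 * c2\<^sup>2 * \<kappa> * (vol * q) + 5 * \<bar>c2 * c3\<bar> * \<kappa> * (vol * q) + 6 * \<bar>c2 * c4\<bar> * \<kappa> * (vol * q)
      + (3 * c3\<^sup>2 + 4 * \<bar>c3 * c4\<bar>) * (K * I 3) + (4 * \<bar>c3 * c4\<bar> + 4 * c4\<^sup>2) * (K * I 3)
      \<le> (2 * c2\<^sup>2 + 12 * \<bar>c2\<bar> * (\<bar>c3\<bar> + \<bar>c4\<bar>)) * (\<kappa> * (vol * q)) + 8 * (c3\<^sup>2 + \<bar>c3 * c4\<bar> + c4\<^sup>2) * (K * I 3)"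
    proof -
      have "0 \<le> \<bar>c2 * c3\<bar> * (\<kappa> * (vol * q))" "0 \<le> \<bar>c2 * c4\<bar> * (\<kappa> * (vol * q))"
        "0 \<le> c3\<^sup>2 * (K * I 3)" "0 \<le> c4\<^sup>2 * (K * I 3)" "0 \<le> \<bar>c3 * c4\<bar> * (K * I 3)"
        using kappa vol_pos q0 KI by (auto intro!: mult_nonneg_nonneg)
      then show ?thesis by (simp add: algebra_simps abs_mult)
    qed
    also have "\<dots> = \<delta> * D\<^sup>2"
    proof -
      have gen: "(2 * c\<^sup>2 + 12 * c * u) * (\<kappa> * (vol * q)) + 8 * v * (K * I 3)
        = (q * (1 + 6 * u / c) + 4 * K * v / c\<^sup>2 * (I 3 / (\<kappa> * vol))) * (2 * c\<^sup>2 * \<kappa> * vol)" if "c > 0" for c u v :: real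
        using that kappa vol_pos by (simp add: field_simps power2_eq_square)
      have "\<bar>c2\<bar> > 0" using c2 by simp
      then show ?thesis unfolding \<delta>_def q_def[symmetric] D_square 
        by (rule gen[of "\<bar>c2\<bar>" "\<bar>c3\<bar> + \<bar>c4\<bar>" "c3\<^sup>2 + \<bar>c3 * c4\<bar> + c4\<^sup>2", unfolded power2_abs])
    qed
    finally show ?thesis unfolding sq using D_pos by (simp add: pos_divide_le_eq)
  qed
  finally show "(\<integral>a. \<bar>1 - \<Gamma> a\<bar> \<partial>\<mu>) \<le> \<delta>" .
qed

lemma F_measurable [measurable]: "F \<in> borel_measurable \<mu>"
  unfolding F_def[abs_def] by measurable

lemma F_square_integrable: "integrable \<mu> (\<lambda>a. (F a)\<^sup>2)"
proof -
  obtain B where B: "B \<ge> 0" "\<And>a. \<bar>A (Phi_poly c2 c3 c4) (\<lambda>_. 1) a\<bar> \<le> B * exp ((\<Sum>i<n. \<bar>a i\<bar>) / 4)"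
    using A_growth[OF one_bounded] by blast
  show ?thesis
  proof (rule integrable_exp_growth[where B = "(B / D)\<^sup>2" and c = "1 / 2"])
    fix a :: "nat \<Rightarrow> real"
    have "\<bar>F a\<bar> \<le> (B / D) * exp ((\<Sum>i<n. \<bar>a i\<bar>) / 4)"
      using B(2)[of a] D_pos by (simp add: F_def abs_divide divide_right_mono)
    then have "\<bar>F a\<bar>\<^sup>2 \<le> ((B / D) * exp ((\<Sum>i<n. \<bar>a i\<bar>) / 4))\<^sup>2"
      by (rule power_mono) simp
    also have "\<dots> = (B / D)\<^sup>2 * (exp ((\<Sum>i<n. \<bar>a i\<bar>) / 4))\<^sup>2" by (simp only: power_mult_distrib)
    also have "(exp ((\<Sum>i<n. \<bar>a i\<bar>) / 4))\<^sup>2 = exp (1 / 2 * (\<Sum>i<n. \<bar>a i\<bar>))"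
      by (simp only: power2_eq_square exp_add[symmetric]) simp
    finally show "\<bar>(F a)\<^sup>2\<bar> \<le> (B / D)\<^sup>2 * exp (1 / 2 * (\<Sum>i<n. \<bar>a i\<bar>))" by simp
  qed measurable
qed

lemma stein_identity:
  assumes "\<And>x. (f has_real_derivative f' x) (at x)" and "continuous_on UNIV f'" and "\<And>x. \<bar>f' x\<bar> \<le> C"
  shows "(\<integral>a. F a * f (F a) \<partial>\<mu>) = (\<integral>a. f' (F a) * \<Gamma> a \<partial>\<mu>)"
  using functional_integration_by_parts[OF assms D_pos, of "xi_poly c2 c3 c4"]
  unfolding F_def \<Gamma>_def Phi_poly_def by simp

lemma F_mean: "(\<integral>a. F a \<partial>\<mu>) = 0"
  using stein_identity[of "\<lambda>_. 1" "\<lambda>_. 0" 0] by simp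

text \<open>The choice \<open>f x = x\<close> in the Stein identity gives
  \<open>E F^2 = E \<Gamma>\<close>. The root \<open>r\<close> is no further from 1 than its square,
  since \<open>r + 1 >= 1\<close>.\<close>

lemma F_second_moment: "\<bar>sqrt (\<integral>a. (F a)\<^sup>2 \<partial>\<mu>) - 1\<bar> \<le> \<delta>"
proof -
  have "(\<integral>a. (F a)\<^sup>2 \<partial>\<mu>) = (\<integral>a. \<Gamma> a \<partial>\<mu>)"
    using stein_identity[of "\<lambda>x. x" "\<lambda>_. 1" 1] by (simp add: power2_eq_square)
  then have "\<bar>(\<integral>a. (F a)\<^sup>2 \<partial>\<mu>) - 1\<bar> = \<bar>\<integral>a. 1 - \<Gamma> a \<partial>\<mu>\<bar>"
    using Gamma_bound(1) by (simp add: G.prob_space abs_minus_commute)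
  also have "\<dots> \<le> \<delta>" by (rule order_trans[OF integral_abs_bound Gamma_bound(2)])
  finally have 1: "\<bar>(\<integral>a. (F a)\<^sup>2 \<partial>\<mu>) - 1\<bar> \<le> \<delta>" .
  define r where "r = sqrt (\<integral>a. (F a)\<^sup>2 \<partial>\<mu>)"
  have r: "r \<ge> 0" "r\<^sup>2 = (\<integral>a. (F a)\<^sup>2 \<partial>\<mu>)" by (auto simp: r_def)
  have "\<bar>r - 1\<bar> * 1 \<le> \<bar>r - 1\<bar> * \<bar>r + 1\<bar>" using r by (intro mult_left_mono) auto
  also have "\<dots> = \<bar>r\<^sup>2 - 1\<bar>" by (simp add: abs_mult[symmetric] power2_eq_square algebra_simps)
  finally show ?thesis using 1 unfolding r(2)[symmetric] by (simp add: r_def)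
qed

text \<open>Stein's equation and \<open>stein_identity\<close> turn the difference into the mean of
  \<open>f' (F a) * (1 - \<Gamma> a)\<close>.\<close>

lemma stein_bound:
  assumes h: "1-lipschitz_on UNIV h"
  shows "\<bar>(\<integral>a. h (F a) \<partial>\<mu>) - (\<integral>x. h x \<partial>std_normal_distribution)\<bar> \<le> 13 * \<delta>"
proof -
  obtain f f' where f: "\<And>x. (f has_real_derivative f' x) (at x)"
    "\<And>x. f' x - x * f x = h x - (\<integral>y. h y \<partial>std_normal_distribution)" "\<And>x. \<bar>f' x\<bar> \<le> 13"
    using stein_solution[OF h] by blast
  have ch: "continuous_on UNIV h" using h by (rule lipschitz_on_continuous_on)
  have cff: "continuous_on UNIV f" using f(1) DERIV_isCont by (auto simp: continuous_on_eq_continuous_at)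
  have f'eq: "f' = (\<lambda>x. x * f x + (h x - (\<integral>y. h y \<partial>std_normal_distribution)))"
    using f(2) by (auto simp: fun_eq_iff algebra_simps)
  have cf': "continuous_on UNIV f'" unfolding f'eq by (intro continuous_intros cff ch)
  have [measurable]: "h \<in> borel_measurable borel" "f \<in> borel_measurable borel" "f' \<in> borel_measurable borel"
    using ch cff cf' by (auto intro: borel_measurable_continuous_onI)
  have iF: "integrable \<mu> F" by (rule G.expectation_abs_le_sqrt(1)[OF F_measurable F_square_integrable])
  have "integrable \<mu> (\<lambda>a. h (F a) - h 0)"
  proof (rule Bochner_Integration.integrable_bound[OF iF])
    show "AE a in \<mu>. norm (h (F a) - h 0) \<le> norm (F a)"
      using lipschitz_onD[OF h, of _ 0] by (auto simp: dist_real_def)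
  qed measurable
  from Bochner_Integration.integrable_add[OF this, of "\<lambda>_. h 0"] have ih: "integrable \<mu> (\<lambda>a. h (F a))" by simp
  have i': "integrable \<mu> (\<lambda>a. f' (F a))"
    by (rule G.integrable_const_bound[where B = 13]) (use f(3) in auto)
  have i1: "integrable \<mu> (\<lambda>a. f' (F a) * (1 - \<Gamma> a))"
  proof (rule Bochner_Integration.integrable_bound)
    show "integrable \<mu> (\<lambda>a. 13 * (1 - \<Gamma> a))" using Gamma_bound(1) by auto
    show "AE a in \<mu>. norm (f' (F a) * (1 - \<Gamma> a)) \<le> norm (13 * (1 - \<Gamma> a))"
      unfolding norm_mult using f(3) by (intro AE_I2 mult_right_mono) auto
  qed (use Gamma_bound(1) in measurable)
  have iG: "integrable \<mu> (\<lambda>a. f' (F a) * \<Gamma> a)"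
    using Bochner_Integration.integrable_diff[OF i' i1] by (simp add: algebra_simps)
  have "(\<integral>a. h (F a) \<partial>\<mu>) - (\<integral>x. h x \<partial>std_normal_distribution) = (\<integral>a. h (F a) - (\<integral>x. h x \<partial>std_normal_distribution) \<partial>\<mu>)"
    using ih by (simp add: G.prob_space)
  also have "\<dots> = (\<integral>a. f' (F a) - F a * f (F a) \<partial>\<mu>)" unfolding f(2) ..
  also have "\<dots> = (\<integral>a. f' (F a) \<partial>\<mu>) - (\<integral>a. F a * f (F a) \<partial>\<mu>)"
  proof (rule Bochner_Integration.integral_diff[OF i'])
    have "integrable \<mu> (\<lambda>a. f' (F a) - (h (F a) - (\<integral>x. h x \<partial>std_normal_distribution)))"
      using ih i' by auto
    then show "integrable \<mu> (\<lambda>a. F a * f (F a))" unfolding f(2)[symmetric] by simp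
  qed
  also have "\<dots> = (\<integral>a. f' (F a) * (1 - \<Gamma> a) \<partial>\<mu>)"
    unfolding stein_identity[OF f(1) cf' f(3)] using i' iG by (simp add: right_diff_distrib)
  finally have eq: "(\<integral>a. h (F a) \<partial>\<mu>) - (\<integral>x. h x \<partial>std_normal_distribution) = (\<integral>a. f' (F a) * (1 - \<Gamma> a) \<partial>\<mu>)" .
  have "\<bar>\<integral>a. f' (F a) * (1 - \<Gamma> a) \<partial>\<mu>\<bar> \<le> (\<integral>a. \<bar>f' (F a) * (1 - \<Gamma> a)\<bar> \<partial>\<mu>)" by (rule integral_abs_bound)
  also have "\<dots> \<le> (\<integral>a. 13 * \<bar>1 - \<Gamma> a\<bar> \<partial>\<mu>)"
    by (rule integral_mono[OF integrable_abs[OF i1]]) (use Gamma_bound(1) f(3) in \<open>auto simp: abs_mult intro!: mult_right_mono\<close>)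
  also have "\<dots> \<le> 13 * \<delta>" using Gamma_bound(2) by simp
  finally show ?thesis unfolding eq .
qed

text \<open>Almost everywhere \<open>S\<close> is a constant plus \<open>D * X\<close> with
  \<open>X = F + R\<close>. Replacing \<open>X / z\<close> by \<open>F\<close> costs
  \<open>|1 - z| + r\<close>, and \<open>|1 - z| <= \<delta> + r\<close> by the triangle inequality
  in L2; with the \<open>13 * \<delta>\<close> of \<open>stein_bound\<close> this makes
  \<open>14 * \<delta> + 2 * r\<close>.\<close>

lemma functional_normal_approximation:
  fixes M \<psi> h :: "real \<Rightarrow> real"
  assumes cb5: "corr_bound \<psi> 5 K" and psi0: "(\<integral>t. \<psi> t \<partial>std_normal_distribution) = 0"
    and M: "\<And>t. M t = m0 + m1 * t + poly (Phi_poly c2 c3 c4) t + \<psi> t"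
    and h: "1-lipschitz_on UNIV h"
  defines "S \<equiv> \<lambda>a. \<integral>x. M (\<tau> a x) \<partial>\<sigma>"
  shows "\<bar>(\<integral>a. h ((S a - (\<integral>a. S a \<partial>\<mu>)) / sqrt (\<integral>a. (S a - (\<integral>a. S a \<partial>\<mu>))\<^sup>2 \<partial>\<mu>)) \<partial>\<mu>)
     - (\<integral>x. h x \<partial>std_normal_distribution)\<bar> \<le> 14 * \<delta> + 2 * sqrt (K * I 5 / (2 * c2\<^sup>2 * \<kappa> * vol))"
proof -
  define R where "R a = (\<integral>x. \<psi> (\<tau> a x) \<partial>\<sigma>) / D" for a
  define X where "X a = F a + R a" for a
  define r where "r = sqrt (\<integral>a. (R a)\<^sup>2 \<partial>\<mu>)"
  define z where "z = sqrt (\<integral>a. (X a)\<^sup>2 \<partial>\<mu>)"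
  note fs = functional_second_moment[OF cb5, of "\<lambda>_. 1", simplified]
  have psim [measurable]: "\<psi> \<in> borel_measurable borel" by (rule psi_measurable[OF cb5])
  have [measurable]: "(\<lambda>t. poly p t) \<in> borel_measurable borel" for p :: "real poly"
    by (intro borel_measurable_continuous_onI continuous_intros)
  have [measurable]: "M \<in> borel_measurable borel" unfolding M[abs_def] by measurable
  have [measurable]: "S \<in> borel_measurable \<mu>" unfolding S_def
    by (rule s.borel_measurable_lebesgue_integral) (unfold case_prod_unfold, measurable)
  have Rm [measurable]: "R \<in> borel_measurable \<mu>" unfolding R_def[abs_def] using fs(2) by measurable
  have Xm [measurable]: "X \<in> borel_measurable \<mu>" unfolding X_def[abs_def] by measurable
  have R2: "integrable \<mu> (\<lambda>a. (R a)\<^sup>2)" unfolding R_def power_divide using fs(5) by simp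
  have R0: "(\<integral>a. R a \<partial>\<mu>) = 0" unfolding R_def using fs(4) psi0 by simp
  have X2: "integrable \<mu> (\<lambda>a. (X a)\<^sup>2)" unfolding X_def
    by (rule L2_triangle(1)[OF F_measurable Rm F_square_integrable R2])
  have iF: "integrable \<mu> F" by (rule G.expectation_abs_le_sqrt(1)[OF F_measurable F_square_integrable])
  have iR: "integrable \<mu> R" by (rule G.expectation_abs_le_sqrt(1)[OF Rm R2])
  have iX: "integrable \<mu> X" "(\<integral>a. \<bar>X a\<bar> \<partial>\<mu>) \<le> z" unfolding z_def by (rule G.expectation_abs_le_sqrt[OF Xm X2])+
  have r_le: "r \<le> sqrt (K * I 5 / (2 * c2\<^sup>2 * \<kappa> * vol))"
  proof -
    have "(\<integral>a. (R a)\<^sup>2 \<partial>\<mu>) = (\<integral>a. (\<integral>x. \<psi> (\<tau> a x) \<partial>\<sigma>)\<^sup>2 \<partial>\<mu>) / D\<^sup>2" by (simp add: R_def power_divide)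
    also have "\<dots> \<le> K * I 5 / D\<^sup>2" by (intro divide_right_mono functional_variance_bound[OF cb5]) simp
    finally show ?thesis unfolding r_def D_square by simp
  qed
  \<comment> \<open>The linear part \<open>m1 * \<tau>\<close> drops out because every
    \<open>\<phi> k\<close> has integral 0.\<close>
  have AES: "AE a in \<mu>. S a = m0 * vol + D * X a"
    using fs(1)
  proof eventually_elim
    case (elim a)
    have i: "integrable \<sigma> (\<lambda>x. m1 * \<tau> a x)" "integrable \<sigma> (\<lambda>x. poly (Phi_poly c2 c3 c4) (\<tau> a x))"
      using A_integrand_integrable[OF one_bounded, of "[:0, 1:]" a] A_integrand_integrable[OF one_bounded, of "Phi_poly c2 c3 c4" a] by auto
    have "S a = (\<integral>x. ((m0 + m1 * \<tau> a x) + poly (Phi_poly c2 c3 c4) (\<tau> a x)) + \<psi> (\<tau> a x) \<partial>\<sigma>)"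
      unfolding S_def M ..
    also have "\<dots> = (((\<integral>x. m0 \<partial>\<sigma>) + (\<integral>x. m1 * \<tau> a x \<partial>\<sigma>)) + (\<integral>x. poly (Phi_poly c2 c3 c4) (\<tau> a x) \<partial>\<sigma>)) + (\<integral>x. \<psi> (\<tau> a x) \<partial>\<sigma>)"
      using i elim by (simp only: Bochner_Integration.integral_add Bochner_Integration.integrable_add s.integrable_const)
    also have "\<dots> = m0 * vol + D * X a"
      using D_pos by (simp add: tau_integral_zero vol_def X_def F_def R_def A_def field_simps)
    finally show ?case .
  qed
  have ES: "(\<integral>a. S a \<partial>\<mu>) = m0 * vol"
  proof -
    have "(\<integral>a. S a \<partial>\<mu>) = (\<integral>a. m0 * vol + D * X a \<partial>\<mu>)" by (rule integral_cong_AE) (use AES in auto)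
    also have "\<dots> = m0 * vol + D * ((\<integral>a. F a \<partial>\<mu>) + (\<integral>a. R a \<partial>\<mu>))"
      using iX iF iR by (simp add: G.prob_space X_def)
    finally show ?thesis by (simp add: F_mean R0)
  qed
  have "(\<integral>a. (S a - m0 * vol)\<^sup>2 \<partial>\<mu>) = (\<integral>a. D\<^sup>2 * (X a)\<^sup>2 \<partial>\<mu>)"
    by (rule integral_cong_AE) (use AES in \<open>auto simp: power_mult_distrib\<close>)
  then have sd: "sqrt (\<integral>a. (S a - m0 * vol)\<^sup>2 \<partial>\<mu>) = D * z"
    using D_pos by (simp add: real_sqrt_mult z_def)
  have ch: "continuous_on UNIV h" using h by (rule lipschitz_on_continuous_on)
  have [measurable]: "h \<in> borel_measurable borel" using ch by (rule borel_measurable_continuous_onI)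
  have hl: "\<bar>h x - h y\<bar> \<le> \<bar>x - y\<bar>" for x y using lipschitz_onD[OF h, of x y] by (simp add: dist_real_def)
  have ih: "integrable \<mu> (\<lambda>a. h (Y a))" if iY: "integrable \<mu> Y" for Y
  proof -
    have [measurable]: "Y \<in> borel_measurable \<mu>" using iY by auto
    have "integrable \<mu> (\<lambda>a. h (Y a) - h 0)"
    proof (rule Bochner_Integration.integrable_bound[OF iY])
      show "AE a in \<mu>. norm (h (Y a) - h 0) \<le> norm (Y a)" using hl[of _ 0] by auto
    qed measurable
    from Bochner_Integration.integrable_add[OF this, of "\<lambda>_. h 0"] show ?thesis by simp
  qed
  have E1: "(\<integral>a. h ((S a - m0 * vol) / (D * z)) \<partial>\<mu>) = (\<integral>a. h (X a / z) \<partial>\<mu>)"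
    by (rule integral_cong_AE) (use AES D_pos in auto)
  have z0: "z \<ge> 0" by (simp add: z_def)
  have zb: "\<bar>1 - z\<bar> \<le> \<delta> + r"
  proof -
    have 1: "z \<le> sqrt (\<integral>a. (F a)\<^sup>2 \<partial>\<mu>) + r" unfolding z_def r_def X_def
      by (rule L2_triangle(2)[OF F_measurable Rm F_square_integrable R2])
    have mR: "integrable \<mu> (\<lambda>a. (- R a)\<^sup>2)" using R2 by simp
    have "sqrt (\<integral>a. (X a + - R a)\<^sup>2 \<partial>\<mu>) \<le> z + sqrt (\<integral>a. (- R a)\<^sup>2 \<partial>\<mu>)" unfolding z_def
      by (rule L2_triangle(2)[OF Xm _ X2 mR]) measurable
    then have 2: "sqrt (\<integral>a. (F a)\<^sup>2 \<partial>\<mu>) \<le> z + r" by (simp add: X_def r_def)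
    show ?thesis using 1 2 F_second_moment by linarith
  qed
  have iXz: "integrable \<mu> (\<lambda>a. X a / z)" using iX by simp
  have "\<bar>(\<integral>a. h (X a / z) \<partial>\<mu>) - (\<integral>a. h (F a) \<partial>\<mu>)\<bar> = \<bar>\<integral>a. h (X a / z) - h (F a) \<partial>\<mu>\<bar>"
    using ih[OF iXz] ih[OF iF] by simp
  also have "\<dots> \<le> (\<integral>a. \<bar>h (X a / z) - h (F a)\<bar> \<partial>\<mu>)" by (rule integral_abs_bound)
  also have "\<dots> \<le> (\<integral>a. \<bar>1 / z - 1\<bar> * \<bar>X a\<bar> + \<bar>R a\<bar> \<partial>\<mu>)"
  proof (rule integral_mono)
    show "integrable \<mu> (\<lambda>a. \<bar>h (X a / z) - h (F a)\<bar>)" using ih[OF iXz] ih[OF iF] by simp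
    show "integrable \<mu> (\<lambda>a. \<bar>1 / z - 1\<bar> * \<bar>X a\<bar> + \<bar>R a\<bar>)" using iX iR by simp
    fix a
    have "\<bar>h (X a / z) - h (F a)\<bar> \<le> \<bar>X a / z - F a\<bar>" by (rule hl)
    also have "X a / z - F a = (1 / z - 1) * X a + R a" by (simp add: X_def algebra_simps add_divide_distrib)
    also have "\<bar>(1 / z - 1) * X a + R a\<bar> \<le> \<bar>1 / z - 1\<bar> * \<bar>X a\<bar> + \<bar>R a\<bar>"
      unfolding abs_mult[symmetric] by (rule abs_triangle_ineq)
    finally show "\<bar>h (X a / z) - h (F a)\<bar> \<le> \<bar>1 / z - 1\<bar> * \<bar>X a\<bar> + \<bar>R a\<bar>" .
  qed
  also have "\<dots> = \<bar>1 / z - 1\<bar> * (\<integral>a. \<bar>X a\<bar> \<partial>\<mu>) + (\<integral>a. \<bar>R a\<bar> \<partial>\<mu>)" using iX iR by simp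
  also have "\<dots> \<le> \<bar>1 / z - 1\<bar> * z + r"
    unfolding r_def by (intro add_mono mult_left_mono iX(2) G.expectation_abs_le_sqrt(2)[OF Rm R2]) simp
  also have "\<bar>1 / z - 1\<bar> * z \<le> \<bar>1 - z\<bar>"
  \<comment> \<open>For \<open>z = 0\<close> the convention \<open>1 / 0 = 0\<close> still leaves 0
    on the left.\<close>
  proof (cases "z = 0")
    case False
    then have "\<bar>1 / z - 1\<bar> * z = \<bar>(1 / z - 1) * z\<bar>" using z0 by (simp add: abs_mult)
    also have "(1 / z - 1) * z = 1 - z" using False by (simp add: field_simps)
    finally show ?thesis by simp
  qed simp
  finally have E2: "\<bar>(\<integral>a. h (X a / z) \<partial>\<mu>) - (\<integral>a. h (F a) \<partial>\<mu>)\<bar> \<le> \<bar>1 - z\<bar> + r" by simp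
  show ?thesis unfolding ES sd E1
    using E2 zb r_le stein_bound[OF h] by linarith
qed

end

end

section \<open>Gegenbauer polynomials\<close>

definition jcoef :: "real \<Rightarrow> nat \<Rightarrow> nat \<Rightarrow> real" where
  "jcoef a n k = ((real n + a) gchoose (n - k)) * ((real n + a) gchoose k)"

lemma gbinomial_Suc_mult: "real (Suc k) * (x gchoose Suc k) = (x - real k) * (x gchoose k)" for x :: real
  using gbinomial_mult_1[of x k] by (simp add: algebra_simps)

text \<open>Passing from \<open>k\<close> to \<open>k + 1\<close> changes each of the two binomial
  coefficients by one step, and the two ratios combine. The recursion is the coefficient form of the
  partial differential equation in \<open>jacobi_ode\<close>.\<close>

lemma jcoef_Suc:
  assumes "k < n"
  shows "real (Suc k) * (real (Suc k) + a) * jcoef a n (Suc k) = real (n - k) * (real (n - k) + a) * jcoef a n k"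
proof -
  obtain j where j: "n - k = Suc j" using assms by (metis Suc_diff_Suc)
  then have j': "n - Suc k = j" and nk: "real n = real k + real (Suc j)" using assms by linarith+
  have 1: "real (Suc k) * ((real n + a) gchoose Suc k) = (real (n - k) + a) * ((real n + a) gchoose k)"
    unfolding gbinomial_Suc_mult j using nk by simp
  have 2: "real (n - k) * ((real n + a) gchoose (n - k)) = (real (Suc k) + a) * ((real n + a) gchoose (n - Suc k))"
    unfolding j j' gbinomial_Suc_mult using nk by simp
  have "real (Suc k) * (real (Suc k) + a) * jcoef a n (Suc k)
     = ((real (Suc k) + a) * ((real n + a) gchoose (n - Suc k))) * (real (Suc k) * ((real n + a) gchoose Suc k))"
    by (simp add: jcoef_def)
  also have "\<dots> = real (n - k) * (real (n - k) + a) * jcoef a n k"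
    unfolding 1 2[symmetric] by (simp add: jcoef_def)
  finally show ?thesis .
qed

text \<open>As a bivariate form in \<open>u = (x - 1) / 2\<close> and \<open>v = (x + 1) / 2\<close> the symmetric Jacobi polynomial \<open>p\<close> satisfies
  \<open>u p\<^sub>u\<^sub>u + (a + 1) p\<^sub>u = v p\<^sub>v\<^sub>v + (a + 1) p\<^sub>v\<close>; with Euler's relations this is the Gegenbauer equation.\<close>

lemma jacobi_ode:
  fixes a x :: real and n :: nat
  defines "u \<equiv> (x - 1) / 2" and "v \<equiv> (x + 1) / 2" and "c \<equiv> jcoef a n"
  defines "P \<equiv> \<Sum>k\<le>n. c k * (u ^ k * v ^ (n - k))"
    and "Pu \<equiv> \<Sum>k\<le>n. c k * (real k * u ^ (k - 1) * v ^ (n - k))"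
    and "Pv \<equiv> \<Sum>k\<le>n. c k * (real (n - k) * u ^ k * v ^ (n - k - 1))"
    and "Puu \<equiv> \<Sum>k\<le>n. c k * (real k * real (k - 1) * u ^ (k - 2) * v ^ (n - k))"
    and "Puv \<equiv> \<Sum>k\<le>n. c k * (real k * real (n - k) * u ^ (k - 1) * v ^ (n - k - 1))"
    and "Pvv \<equiv> \<Sum>k\<le>n. c k * (real (n - k) * real (n - k - 1) * u ^ k * v ^ (n - k - 2))"
  shows "(1 - x\<^sup>2) * ((Puu + 2 * Puv + Pvv) / 4) - (2 * a + 2) * x * ((Pu + Pv) / 2) + real n * (real n + 2 * a + 1) * P = 0"
proof -
  \<comment> \<open>Subtraction of naturals truncates at 0, but then the numerical prefactor
    vanishes as well.\<close>
  have pw: "real k * (u * u ^ (k - 1)) = real k * u ^ k" "real (n - k) * (v * v ^ (n - k - 1)) = real (n - k) * v ^ (n - k)"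
    "real (k - 1) * (u * u ^ (k - 2)) = real (k - 1) * u ^ (k - 1)"
    "real (n - k - 1) * (v * v ^ (n - k - 2)) = real (n - k - 1) * v ^ (n - k - 1)" for k
  proof -
    have gen: "real j * (w * w ^ (j - 1)) = real j * w ^ j" for j and w :: real by (cases j) auto
    show "real k * (u * u ^ (k - 1)) = real k * u ^ k" "real (n - k) * (v * v ^ (n - k - 1)) = real (n - k) * v ^ (n - k)"
      "real (k - 1) * (u * u ^ (k - 2)) = real (k - 1) * u ^ (k - 1)"
      "real (n - k - 1) * (v * v ^ (n - k - 2)) = real (n - k - 1) * v ^ (n - k - 1)"
      using gen[of k u] gen[of "n - k" v] gen[of "k - 1" u] gen[of "n - k - 1" v] by (simp_all add: numeral_2_eq_2)
  qed
  \<comment> \<open>Euler's relation for the form of degree \<open>n\<close>; \<open>E2\<close> and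
    \<open>E3\<close> are the same for its two partial derivatives, of degree
    \<open>n - 1\<close>.\<close>
  have E1: "u * Pu + v * Pv = real n * P"
  proof -
    have "u * Pu + v * Pv = (\<Sum>k\<le>n. c k * ((real k * (u * u ^ (k - 1))) * v ^ (n - k) + u ^ k * (real (n - k) * (v * v ^ (n - k - 1)))))"
      unfolding Pu_def Pv_def sum_distrib_left sum.distrib[symmetric] by (intro sum.cong refl) (simp add: algebra_simps)
    also have "\<dots> = (\<Sum>k\<le>n. real n * (c k * (u ^ k * v ^ (n - k))))"
      unfolding pw by (intro sum.cong refl) (auto simp: algebra_simps of_nat_diff)
    finally show ?thesis by (simp add: P_def sum_distrib_left)
  qed
  have E2: "u * Puu + v * Puv = (real n - 1) * Pu"
  proof -
    have "u * Puu + v * Puv = (\<Sum>k\<le>n. c k * (real k * (real (k - 1) * (u * u ^ (k - 2))) * v ^ (n - k) + real k * u ^ (k - 1) * (real (n - k) * (v * v ^ (n - k - 1)))))"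
      unfolding Puu_def Puv_def sum_distrib_left sum.distrib[symmetric] by (intro sum.cong refl) (simp add: algebra_simps)
    also have "\<dots> = (\<Sum>k\<le>n. (real n - 1) * (c k * (real k * u ^ (k - 1) * v ^ (n - k))))"
      unfolding pw
    proof (intro sum.cong refl)
      fix k assume "k \<in> {..n}"
      then show "c k * (real k * (real (k - 1) * u ^ (k - 1)) * v ^ (n - k) + real k * u ^ (k - 1) * (real (n - k) * v ^ (n - k)))
        = (real n - 1) * (c k * (real k * u ^ (k - 1) * v ^ (n - k)))"
        by (cases k) (auto simp: algebra_simps of_nat_diff)
    qed
    finally show ?thesis by (simp add: Pu_def sum_distrib_left)
  qed
  have E3: "u * Puv + v * Pvv = (real n - 1) * Pv"
  proof -
    have "u * Puv + v * Pvv = (\<Sum>k\<le>n. c k * (real (n - k) * (real k * (u * u ^ (k - 1))) * v ^ (n - k - 1) + real (n - k) * u ^ k * (real (n - k - 1) * (v * v ^ (n - k - 2)))))"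
      unfolding Puv_def Pvv_def sum_distrib_left sum.distrib[symmetric] by (intro sum.cong refl) (simp add: algebra_simps)
    also have "\<dots> = (\<Sum>k\<le>n. (real n - 1) * (c k * (real (n - k) * u ^ k * v ^ (n - k - 1))))"
      unfolding pw
    proof (intro sum.cong refl)
      fix k assume k: "k \<in> {..n}"
      show "c k * (real (n - k) * (real k * u ^ k) * v ^ (n - k - 1) + real (n - k) * u ^ k * (real (n - k - 1) * v ^ (n - k - 1)))
        = (real n - 1) * (c k * (real (n - k) * u ^ k * v ^ (n - k - 1)))"
      proof (cases "k = n")
        case False
        then have "real (n - k - 1) = real n - real k - 1" using k by (simp add: of_nat_diff)
        then show ?thesis by (simp add: algebra_simps)
      qed simp
    qed
    finally show ?thesis by (simp add: Pv_def sum_distrib_left)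
  qed
  have PDE: "u * Puu + (a + 1) * Pu = v * Pvv + (a + 1) * Pv"
  proof -
    have "u * Puu + (a + 1) * Pu = (\<Sum>k\<le>n. c k * (real k * (real (k - 1) * (u * u ^ (k - 2))) * v ^ (n - k) + (a + 1) * real k * u ^ (k - 1) * v ^ (n - k)))"
      unfolding Puu_def Pu_def sum_distrib_left sum.distrib[symmetric] by (intro sum.cong refl) (simp add: algebra_simps)
    also have "\<dots> = (\<Sum>k\<le>n. real k * (real k + a) * c k * (u ^ (k - 1) * v ^ (n - k)))"
      unfolding pw
    proof (intro sum.cong refl)
      fix k
      show "c k * (real k * (real (k - 1) * u ^ (k - 1)) * v ^ (n - k) + (a + 1) * real k * u ^ (k - 1) * v ^ (n - k))
        = real k * (real k + a) * c k * (u ^ (k - 1) * v ^ (n - k))"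
        by (cases k) (auto simp: algebra_simps)
    qed
    also have "\<dots> = (\<Sum>k<Suc n. real k * (real k + a) * c k * (u ^ (k - 1) * v ^ (n - k)))"
      by (simp add: lessThan_Suc_atMost)
    \<comment> \<open>The term \<open>k = 0\<close> vanishes, so the index can be shifted;
      \<open>jcoef_Suc\<close> then exchanges the roles of \<open>u\<close> and \<open>v\<close>,
      and the vanishing term \<open>k = n\<close> is put back.\<close>
    also have "\<dots> = (\<Sum>k<n. real (Suc k) * (real (Suc k) + a) * c (Suc k) * (u ^ k * v ^ (n - Suc k)))"
      by (subst sum.lessThan_Suc_shift) simp
    also have "\<dots> = (\<Sum>k<n. real (n - k) * (real (n - k) + a) * c k * (u ^ k * v ^ (n - k - 1)))"
      unfolding c_def by (intro sum.cong refl) (use jcoef_Suc[of _ n a] in auto)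
    also have "\<dots> = (\<Sum>k<Suc n. real (n - k) * (real (n - k) + a) * c k * (u ^ k * v ^ (n - k - 1)))"
      by simp
    also have "\<dots> = (\<Sum>k\<le>n. real (n - k) * (real (n - k) + a) * c k * (u ^ k * v ^ (n - k - 1)))"
      by (simp only: lessThan_Suc_atMost)
    also have "\<dots> = (\<Sum>k\<le>n. c k * (real (n - k) * u ^ k * (real (n - k - 1) * (v * v ^ (n - k - 2))) + (a + 1) * real (n - k) * u ^ k * v ^ (n - k - 1)))"
      unfolding pw
    proof (intro sum.cong refl)
      fix k assume k: "k \<in> {..n}"
      show "real (n - k) * (real (n - k) + a) * c k * (u ^ k * v ^ (n - k - 1))
        = c k * (real (n - k) * u ^ k * (real (n - k - 1) * v ^ (n - k - 1)) + (a + 1) * real (n - k) * u ^ k * v ^ (n - k - 1))"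
      proof (cases "k = n")
        case False
        then have "real (n - k - 1) = real (n - k) - 1" using k by (simp add: of_nat_diff)
        then show ?thesis by (simp add: algebra_simps)
      qed simp
    qed
    also have "\<dots> = v * Pvv + (a + 1) * Pv"
      unfolding Pvv_def Pv_def sum_distrib_left sum.distrib[symmetric] by (intro sum.cong refl) (simp add: algebra_simps)
    finally show ?thesis .
  qed
  have vu: "v = u + 1" and x: "x = 2 * u + 1" unfolding u_def v_def by (simp_all add: field_simps)
  \<comment> \<open>Subtract \<open>E3\<close> from \<open>E2\<close>, insert \<open>PDE\<close>,
    and use \<open>v - u = 1\<close>.\<close>
  have Puv: "Puv = (real n + a) * (Pu - Pv)"
    using E2 E3 PDE unfolding vu by (simp add: algebra_simps)
  have S: "u * v * (Puu + 2 * Puv + Pvv) = (real n - 1) * (v * Pu + u * Pv) - Puv"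
  proof -
    have "u * v * (Puu + 2 * Puv + Pvv) = v * (u * Puu + v * Puv) + u * (u * Puv + v * Pvv) - (v - u)\<^sup>2 * Puv"
      by (simp add: power2_eq_square algebra_simps)
    then show ?thesis unfolding E2 E3 by (simp add: vu algebra_simps)
  qed
  have x2: "1 - x\<^sup>2 = - 4 * (u * v)" unfolding x vu by (simp add: power2_eq_square algebra_simps)
  have "(1 - x\<^sup>2) * ((Puu + 2 * Puv + Pvv) / 4) = - ((real n - 1) * (v * Pu + u * Pv) - Puv)"
    unfolding x2 S[symmetric] by simp
  moreover have "real n * (real n + 2 * a + 1) * P = (real n + 2 * a + 1) * (u * Pu + v * Pv)"
    unfolding E1 by simp
  ultimately show ?thesis unfolding Puv x vu by (simp add: field_simps)
qed

text \<open>As a \<open>real poly\<close> the function gains formal derivatives, a degree and roots;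
  \<open>poly_gegenbauer\<close> links it to \<open>gegenbauer\<close>.\<close>

definition gegenbauer_poly :: "nat \<Rightarrow> nat \<Rightarrow> real poly" where
  "gegenbauer_poly l m = smult (1 / ((real l + real m / 2 - 1) gchoose l))
     (\<Sum>k\<le>l. smult (jcoef (real m / 2 - 1) l k) ([:- 1 / 2, 1 / 2:] ^ k * [:1 / 2, 1 / 2:] ^ (l - k)))"

lemma poly_gegenbauer: "poly (gegenbauer_poly l m) x = gegenbauer l m x"
  by (simp add: gegenbauer_poly_def gegenbauer_def jacobi_def jcoef_def poly_sum poly_power algebra_simps diff_divide_distrib add_divide_distrib)

text \<open>This is \<open>jacobi_ode\<close> with \<open>a = m/2 - 1\<close>, for which
  \<open>2 * a + 2 = m\<close>. The work lies in identifying its formal sums with actual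
  derivatives, each derivative in \<open>x\<close> bringing a factor \<open>1/2\<close>.\<close>

lemma gegenbauer_ode:
  "(1 - x\<^sup>2) * poly (pderiv (pderiv (gegenbauer_poly l m))) x - real m * x * poly (pderiv (gegenbauer_poly l m)) x
     + real l * (real l + real m - 1) * poly (gegenbauer_poly l m) x = 0"
proof -
  define a where "a = real m / 2 - 1"
  define b where "b = 1 / ((real l + real m / 2 - 1) gchoose l)"
  define c where "c = jcoef a l"
  define P where "P y = (\<Sum>k\<le>l. c k * (((y - 1) / 2) ^ k * ((y + 1) / 2) ^ (l - k)))" for y :: real
  define P1 where "P1 y = ((\<Sum>k\<le>l. c k * (real k * ((y - 1) / 2) ^ (k - 1) * ((y + 1) / 2) ^ (l - k)))
      + (\<Sum>k\<le>l. c k * (real (l - k) * ((y - 1) / 2) ^ k * ((y + 1) / 2) ^ (l - k - 1)))) / 2" for y :: real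
  define P2 where "P2 y = ((\<Sum>k\<le>l. c k * (real k * real (k - 1) * ((y - 1) / 2) ^ (k - 2) * ((y + 1) / 2) ^ (l - k)))
      + 2 * (\<Sum>k\<le>l. c k * (real k * real (l - k) * ((y - 1) / 2) ^ (k - 1) * ((y + 1) / 2) ^ (l - k - 1)))
      + (\<Sum>k\<le>l. c k * (real (l - k) * real (l - k - 1) * ((y - 1) / 2) ^ k * ((y + 1) / 2) ^ (l - k - 2)))) / 4" for y :: real
  have dp: "((\<lambda>y. ((y - 1) / 2) ^ k) has_real_derivative real k * ((y - 1) / 2) ^ (k - 1) * (1 / 2)) (at y)"
    "((\<lambda>y. ((y + 1) / 2) ^ k) has_real_derivative real k * ((y + 1) / 2) ^ (k - 1) * (1 / 2)) (at y)" for k and y :: real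
    by (auto intro!: derivative_eq_intros)
  have dP: "(P has_real_derivative P1 y) (at y)" for y
  proof -
    have "(P has_real_derivative (\<Sum>k\<le>l. c k * ((real k * ((y - 1) / 2) ^ (k - 1) * (1 / 2)) * ((y + 1) / 2) ^ (l - k)
       + (real (l - k) * ((y + 1) / 2) ^ (l - k - 1) * (1 / 2)) * ((y - 1) / 2) ^ k))) (at y)"
      unfolding P_def by (intro DERIV_sum DERIV_cmult DERIV_mult dp)
    moreover have "(\<Sum>k\<le>l. c k * ((real k * ((y - 1) / 2) ^ (k - 1) * (1 / 2)) * ((y + 1) / 2) ^ (l - k)
       + (real (l - k) * ((y + 1) / 2) ^ (l - k - 1) * (1 / 2)) * ((y - 1) / 2) ^ k)) = P1 y"
      unfolding P1_def sum.distrib[symmetric] sum_divide_distrib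
      by (rule sum.cong[OF refl]) (simp only: distrib_left add_divide_distrib, simp add: mult_ac)
    ultimately show ?thesis by simp
  qed
  have dP1: "(P1 has_real_derivative P2 y) (at y)" for y
  proof -
    have "(P1 has_real_derivative
       ((\<Sum>k\<le>l. c k * ((0 * ((y - 1) / 2) ^ (k - 1) + (real (k - 1) * ((y - 1) / 2) ^ (k - 1 - 1) * (1 / 2)) * real k) * ((y + 1) / 2) ^ (l - k)
           + (real (l - k) * ((y + 1) / 2) ^ (l - k - 1) * (1 / 2)) * (real k * ((y - 1) / 2) ^ (k - 1))))
       + (\<Sum>k\<le>l. c k * ((0 * ((y - 1) / 2) ^ k + (real k * ((y - 1) / 2) ^ (k - 1) * (1 / 2)) * real (l - k)) * ((y + 1) / 2) ^ (l - k - 1)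
           + (real (l - k - 1) * ((y + 1) / 2) ^ (l - k - 1 - 1) * (1 / 2)) * (real (l - k) * ((y - 1) / 2) ^ k)))) / 2) (at y)"
      unfolding P1_def by (intro DERIV_cdivide DERIV_add DERIV_sum DERIV_cmult DERIV_mult DERIV_const dp)
    moreover have "((\<Sum>k\<le>l. c k * ((0 * ((y - 1) / 2) ^ (k - 1) + (real (k - 1) * ((y - 1) / 2) ^ (k - 1 - 1) * (1 / 2)) * real k) * ((y + 1) / 2) ^ (l - k)
           + (real (l - k) * ((y + 1) / 2) ^ (l - k - 1) * (1 / 2)) * (real k * ((y - 1) / 2) ^ (k - 1))))
       + (\<Sum>k\<le>l. c k * ((0 * ((y - 1) / 2) ^ k + (real k * ((y - 1) / 2) ^ (k - 1) * (1 / 2)) * real (l - k)) * ((y + 1) / 2) ^ (l - k - 1)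
           + (real (l - k - 1) * ((y + 1) / 2) ^ (l - k - 1 - 1) * (1 / 2)) * (real (l - k) * ((y - 1) / 2) ^ k)))) / 2 = P2 y"
    proof -
      have e: "k - 1 - 1 = k - 2" "l - k - 1 - 1 = l - k - 2" for k by auto
      show ?thesis unfolding P2_def sum_distrib_left sum.distrib[symmetric] sum_divide_distrib e
        by (rule sum.cong[OF refl]) (simp only: distrib_left distrib_right add_divide_distrib, simp add: mult_ac)
    qed
    ultimately show ?thesis by simp
  qed
  let ?p = "gegenbauer_poly l m"
  have p0: "poly ?p = (\<lambda>y. b * P y)"
    by (rule ext) (simp add: gegenbauer_poly_def b_def P_def c_def a_def poly_sum poly_power diff_divide_distrib add_divide_distrib add.commute)
  have p1: "poly (pderiv ?p) = (\<lambda>y. b * P1 y)"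
    by (rule ext) (rule DERIV_unique[OF poly_DERIV], unfold p0, rule DERIV_cmult[OF dP])
  have p2: "poly (pderiv (pderiv ?p)) = (\<lambda>y. b * P2 y)"
    by (rule ext) (rule DERIV_unique[OF poly_DERIV], unfold p1, rule DERIV_cmult[OF dP1])
  have "(1 - x\<^sup>2) * P2 x - (2 * a + 2) * x * P1 x + real l * (real l + 2 * a + 1) * P x = 0"
    using jacobi_ode[of x a l] unfolding P_def P1_def P2_def c_def .
  then have "b * ((1 - x\<^sup>2) * P2 x - real m * x * P1 x + real l * (real l + real m - 1) * P x) = 0"
    by (simp add: a_def algebra_simps)
  then show ?thesis unfolding p0 p1 p2 by (simp add: algebra_simps)
qed

lemma gegenbauer_poly_at_1: "m \<ge> 2 \<Longrightarrow> poly (gegenbauer_poly l m) 1 = 1"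
  by (simp add: poly_gegenbauer gegenbauer_at_1)

text \<open>The Liouville transform \<open>w = sin\<^sup>\<nu> H\<close> removes the first-order term; \<open>E = w\<^sup>2 + w'\<^sup>2 / L\<^sup>2\<close> is its energy.\<close>

locale gegenbauer_angle =
  fixes m l :: nat
  assumes m: "m \<ge> 2" and l: "l \<ge> 1"
begin

definition \<nu> where "\<nu> = (real m - 1) / 2"
definition L where "L = real l + \<nu>"
definition lam where "lam = real l * (real l + real m - 1)"
definition y where "y = gegenbauer_poly l m"
definition H where "H \<theta> = poly y (cos \<theta>)"
definition H1 where "H1 \<theta> = - (sin \<theta> * poly (pderiv y) (cos \<theta>))"
text \<open>With \<open>w = sin^\<nu> * H\<close> one has \<open>w' = sin^\<nu> * q\<close>; in the
  energy only the integral power \<open>2 * \<nu> = m - 1\<close> of the sine survives.\<close>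

definition q where "q \<theta> = H1 \<theta> + \<nu> * cot \<theta> * H \<theta>"
definition E where "E \<theta> = sin \<theta> ^ (m - 1) * ((H \<theta>)\<^sup>2 + (q \<theta>)\<^sup>2 / L\<^sup>2)"
text \<open>The transformed equation is
  \<open>w'' + (L^2 + (\<nu> - \<nu>^2) / sin^2) * w = 0\<close>; \<open>c\<close> measures its
  potential, whose sign depends on \<open>m\<close>.\<close>

definition c where "c = \<bar>\<nu> - \<nu>\<^sup>2\<bar>"

lemma nu: "\<nu> \<ge> 1 / 2" "2 * \<nu> = real m - 1" using m by (auto simp: \<nu>_def)
lemma m_eq: "real m = 2 * \<nu> + 1" using nu(2) by simp
lemma L_ge: "L \<ge> 3 / 2" "L > 0" "L \<ge> real l" using nu l by (auto simp: L_def)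
lemma lam_pos: "lam > 0" using m l by (auto simp: lam_def)
lemma L_square: "L\<^sup>2 = lam + \<nu>\<^sup>2"
  unfolding L_def lam_def m_eq by (simp add: power2_eq_square algebra_simps)
lemma c_nonneg: "c \<ge> 0" by (simp add: c_def)

lemma dH: "(H has_real_derivative H1 \<theta>) (at \<theta>)"
  unfolding H_def[abs_def] H1_def by (auto intro!: derivative_eq_intros DERIV_chain2[OF poly_DERIV] simp: mult.commute)

lemma dH1: "(H1 has_real_derivative (- lam * H \<theta> + (real m - 1) * (cos \<theta> * poly (pderiv y) (cos \<theta>)))) (at \<theta>)"
proof -
  have "(H1 has_real_derivative - (cos \<theta> * poly (pderiv y) (cos \<theta>) + (poly (pderiv (pderiv y)) (cos \<theta>) * (- sin \<theta>)) * sin \<theta>)) (at \<theta>)"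
    unfolding H1_def[abs_def] by (intro DERIV_minus DERIV_mult DERIV_sin DERIV_chain2[OF poly_DERIV] DERIV_cos)
  moreover have "- (cos \<theta> * poly (pderiv y) (cos \<theta>) + (poly (pderiv (pderiv y)) (cos \<theta>) * (- sin \<theta>)) * sin \<theta>)
     = - lam * H \<theta> + (real m - 1) * (cos \<theta> * poly (pderiv y) (cos \<theta>))"
  proof -
    have "- (cos \<theta> * poly (pderiv y) (cos \<theta>) + (poly (pderiv (pderiv y)) (cos \<theta>) * (- sin \<theta>)) * sin \<theta>)
      = - (cos \<theta> * poly (pderiv y) (cos \<theta>)) + (1 - (cos \<theta>)\<^sup>2) * poly (pderiv (pderiv y)) (cos \<theta>)"
      unfolding sin_squared_eq[symmetric] by (simp add: power2_eq_square)
    then show ?thesis using gegenbauer_ode[of "cos \<theta>" l m] by (simp add: H_def lam_def y_def left_diff_distrib)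
  qed
  ultimately show ?thesis by simp
qed

text \<open>In the angle the equation reads \<open>H'' + (m - 1) * cot * H' + lam * H = 0\<close>,
  an oscillator whose damping is nonnegative up to \<open>pi / 2\<close>; its energy starts at 1.
  This controls the neighbourhood of the pole, where the potential of the Liouville form is
  singular.\<close>

lemma first_energy:
  assumes "0 \<le> \<theta>" "\<theta> \<le> pi / 2"
  shows "(H \<theta>)\<^sup>2 + (H1 \<theta>)\<^sup>2 / lam \<le> 1"
proof -
  have "(H \<theta>)\<^sup>2 + (H1 \<theta>)\<^sup>2 / lam \<le> (H 0)\<^sup>2 + (H1 0)\<^sup>2 / lam"
  proof (rule DERIV_nonpos_imp_nonincreasing[OF assms(1)])
    fix t assume t: "0 \<le> t" "t \<le> \<theta>"
    define z where "z = poly (pderiv y) (cos t)"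
    have "((\<lambda>t. (H t)\<^sup>2 + (H1 t)\<^sup>2 / lam) has_real_derivative
       (2 * H t * H1 t + 2 * H1 t * (- lam * H t + (real m - 1) * (cos t * z)) / lam)) (at t)"
      unfolding z_def using lam_pos by (auto intro!: derivative_eq_intros dH dH1)
    moreover have "2 * H t * H1 t + 2 * H1 t * (- lam * H t + (real m - 1) * (cos t * z)) / lam \<le> 0"
    proof -
      have "2 * H t * H1 t + 2 * H1 t * (- lam * H t + (real m - 1) * (cos t * z)) / lam
         = - (2 * (real m - 1) / lam) * (cos t * sin t * z\<^sup>2)"
        using lam_pos by (simp add: H1_def z_def[symmetric] field_simps power2_eq_square)
      also have "\<dots> \<le> 0"
        using t assms m lam_pos by (intro mult_nonpos_nonneg mult_nonneg_nonneg cos_ge_zero sin_ge_zero) auto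
      finally show ?thesis .
    qed
    ultimately show "\<exists>d. ((\<lambda>t. (H t)\<^sup>2 + (H1 t)\<^sup>2 / lam) has_real_derivative d) (at t) \<and> d \<le> 0" by blast
  qed
  also have "\<dots> = 1" using gegenbauer_poly_at_1[OF m] by (simp add: H_def H1_def y_def)
  finally show ?thesis .
qed

lemma first_energy_bounds:
  assumes "0 \<le> \<theta>" "\<theta> \<le> pi / 2"
  shows "\<bar>H \<theta>\<bar> \<le> 1" "\<bar>H1 \<theta>\<bar> \<le> L"
proof -
  have "0 \<le> (H1 \<theta>)\<^sup>2 / lam" using lam_pos by simp
  then have "(H \<theta>)\<^sup>2 \<le> 1" using first_energy[OF assms] by linarith
  then show "\<bar>H \<theta>\<bar> \<le> 1" by (simp add: abs_square_le_1)
  have "(H1 \<theta>)\<^sup>2 / lam \<le> 1" using first_energy[OF assms] zero_le_power2[of "H \<theta>"] by linarith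
  then have "(H1 \<theta>)\<^sup>2 \<le> lam" using lam_pos by (simp add: pos_divide_le_eq)
  also have "\<dots> \<le> L\<^sup>2" using L_square by simp
  finally show "\<bar>H1 \<theta>\<bar> \<le> L" using L_ge by (simp add: abs_le_square_iff[symmetric])
qed

text \<open>With the first-order term gone, the energy changes only through the potential. The
  second formula is the derivative of \<open>w * w'\<close>; integrated, it compares the mean of
  \<open>w^2\<close> with that of \<open>w'^2\<close>.\<close>

lemma dE:
  assumes "0 < \<theta>" "\<theta> < pi"
  shows "(E has_real_derivative - 2 * (\<nu> - \<nu>\<^sup>2) / (L\<^sup>2 * (sin \<theta>)\<^sup>2) * (sin \<theta> ^ (m - 1) * (H \<theta> * q \<theta>))) (at \<theta>)"
    "((\<lambda>\<theta>. sin \<theta> ^ (m - 1) * (H \<theta> * q \<theta>)) has_real_derivative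
        (sin \<theta> ^ (m - 1) * ((q \<theta>)\<^sup>2 - (H \<theta>)\<^sup>2 * (L\<^sup>2 + (\<nu> - \<nu>\<^sup>2) / (sin \<theta>)\<^sup>2)))) (at \<theta>)"
proof -
  have s: "sin \<theta> > 0" using assms by (rule sin_gt_zero)
  define z where "z = poly (pderiv y) (cos \<theta>)"
  have cz: "cos \<theta> * z = - cot \<theta> * H1 \<theta>" using s by (simp add: z_def H1_def cot_def)
  have dq: "(q has_real_derivative - (\<nu> * cot \<theta> * q \<theta>) - H \<theta> * (L\<^sup>2 + (\<nu> - \<nu>\<^sup>2) / (sin \<theta>)\<^sup>2)) (at \<theta>)"
  proof -
    have "(q has_real_derivative (- lam * H \<theta> + (real m - 1) * (cos \<theta> * z)) + ((0 * cot \<theta> + (- inverse ((sin \<theta>)\<^sup>2)) * \<nu>) * H \<theta> + H1 \<theta> * (\<nu> * cot \<theta>))) (at \<theta>)"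
      unfolding q_def[abs_def] z_def by (intro DERIV_add DERIV_mult dH dH1 DERIV_cot DERIV_const) (use s in auto)
    moreover have "(- lam * H \<theta> + (real m - 1) * (cos \<theta> * z)) + ((0 * cot \<theta> + (- inverse ((sin \<theta>)\<^sup>2)) * \<nu>) * H \<theta> + H1 \<theta> * (\<nu> * cot \<theta>))
        = - (\<nu> * cot \<theta> * q \<theta>) - H \<theta> * (L\<^sup>2 + (\<nu> - \<nu>\<^sup>2) / (sin \<theta>)\<^sup>2)"
    proof -
      have cot2: "(cot \<theta>)\<^sup>2 = 1 / (sin \<theta>)\<^sup>2 - 1"
        using s by (simp add: cot_def power_divide cos_squared_eq field_simps)
      have "\<nu> * cot \<theta> * q \<theta> = \<nu> * cot \<theta> * H1 \<theta> + \<nu>\<^sup>2 * (cot \<theta>)\<^sup>2 * H \<theta>"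
        by (simp add: q_def power2_eq_square algebra_simps)
      then show ?thesis unfolding cz cot2 L_square nu(2)[symmetric]
        by (simp add: algebra_simps divide_inverse)
    qed
    ultimately show ?thesis by simp
  qed
  have dsin: "((\<lambda>\<theta>. sin \<theta> ^ (m - 1)) has_real_derivative 2 * \<nu> * cot \<theta> * sin \<theta> ^ (m - 1)) (at \<theta>)"
  proof -
    have "((\<lambda>\<theta>. sin \<theta> ^ (m - 1)) has_real_derivative real (m - 1) * sin \<theta> ^ (m - 1 - 1) * cos \<theta>) (at \<theta>)"
      by (auto intro!: derivative_eq_intros)
    moreover have "real (m - 1) * sin \<theta> ^ (m - 1 - 1) * cos \<theta> = 2 * \<nu> * cot \<theta> * sin \<theta> ^ (m - 1)"
    proof -
      obtain k where k: "m = Suc (Suc k)" using m by (metis add_2_eq_Suc le_Suc_ex)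
      have "2 * \<nu> = real (m - 1)" using nu(2) m by simp
      then show ?thesis using s unfolding k by (simp add: cot_def)
    qed
    ultimately show ?thesis by simp
  qed
  have q1: "H1 \<theta> = q \<theta> - \<nu> * cot \<theta> * H \<theta>" by (simp add: q_def)
  have "(E has_real_derivative (2 * \<nu> * cot \<theta> * sin \<theta> ^ (m - 1)) * ((H \<theta>)\<^sup>2 + (q \<theta>)\<^sup>2 / L\<^sup>2)
     + (2 * H \<theta> * H1 \<theta> + 2 * q \<theta> * (- (\<nu> * cot \<theta> * q \<theta>) - H \<theta> * (L\<^sup>2 + (\<nu> - \<nu>\<^sup>2) / (sin \<theta>)\<^sup>2)) / L\<^sup>2) * sin \<theta> ^ (m - 1)) (at \<theta>)"
  proof -
    have dsq: "((\<lambda>x. (f x)\<^sup>2) has_real_derivative 2 * f \<theta> * f') (at \<theta>)" if "(f has_real_derivative f') (at \<theta>)" for f f'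
      using that by (auto intro!: derivative_eq_intros)
    show ?thesis unfolding E_def[abs_def]
      by (intro DERIV_mult DERIV_add dsin dsq[OF dH] DERIV_cdivide[OF dsq[OF dq]])
  qed
  moreover have "(2 * \<nu> * cot \<theta> * sin \<theta> ^ (m - 1)) * ((H \<theta>)\<^sup>2 + (q \<theta>)\<^sup>2 / L\<^sup>2)
     + (2 * H \<theta> * H1 \<theta> + 2 * q \<theta> * (- (\<nu> * cot \<theta> * q \<theta>) - H \<theta> * (L\<^sup>2 + (\<nu> - \<nu>\<^sup>2) / (sin \<theta>)\<^sup>2)) / L\<^sup>2) * sin \<theta> ^ (m - 1)
     = - 2 * (\<nu> - \<nu>\<^sup>2) / (L\<^sup>2 * (sin \<theta>)\<^sup>2) * (sin \<theta> ^ (m - 1) * (H \<theta> * q \<theta>))"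
  proof -
    have eq: "(2 * q \<theta> * (- (\<nu> * cot \<theta> * q \<theta>) - H \<theta> * (L\<^sup>2 + (\<nu> - \<nu>\<^sup>2) / (sin \<theta>)\<^sup>2)) / L\<^sup>2)
       = - 2 * \<nu> * cot \<theta> * (q \<theta>)\<^sup>2 / L\<^sup>2 - 2 * q \<theta> * H \<theta> - 2 * q \<theta> * H \<theta> * ((\<nu> - \<nu>\<^sup>2) / (L\<^sup>2 * (sin \<theta>)\<^sup>2))"
    proof -
      define t where "t = (\<nu> - \<nu>\<^sup>2) / (sin \<theta>)\<^sup>2"
      have eq: "(2 * q \<theta> * (- (\<nu> * cot \<theta> * q \<theta>) - H \<theta> * (L\<^sup>2 + t)) / L\<^sup>2)
       = - 2 * \<nu> * cot \<theta> * (q \<theta>)\<^sup>2 / L\<^sup>2 - 2 * q \<theta> * H \<theta> - 2 * q \<theta> * H \<theta> * (t / L\<^sup>2)"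
        using L_ge(2) by (simp add: field_simps power2_eq_square)
      moreover have "t / L\<^sup>2 = (\<nu> - \<nu>\<^sup>2) / (L\<^sup>2 * (sin \<theta>)\<^sup>2)" by (simp add: t_def mult.commute)
      ultimately show ?thesis by (simp add: t_def)
    qed
    show ?thesis unfolding eq q1 by (simp add: algebra_simps power2_eq_square add_divide_distrib diff_divide_distrib)
  qed
  ultimately show "(E has_real_derivative - 2 * (\<nu> - \<nu>\<^sup>2) / (L\<^sup>2 * (sin \<theta>)\<^sup>2) * (sin \<theta> ^ (m - 1) * (H \<theta> * q \<theta>))) (at \<theta>)" by simp
  have "((\<lambda>\<theta>. sin \<theta> ^ (m - 1) * (H \<theta> * q \<theta>)) has_real_derivative
     (2 * \<nu> * cot \<theta> * sin \<theta> ^ (m - 1)) * (H \<theta> * q \<theta>) + (H1 \<theta> * q \<theta> + (- (\<nu> * cot \<theta> * q \<theta>) - H \<theta> * (L\<^sup>2 + (\<nu> - \<nu>\<^sup>2) / (sin \<theta>)\<^sup>2)) * H \<theta>) * sin \<theta> ^ (m - 1)) (at \<theta>)"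
    by (intro DERIV_mult dsin dH dq)
  moreover have "(2 * \<nu> * cot \<theta> * sin \<theta> ^ (m - 1)) * (H \<theta> * q \<theta>) + (H1 \<theta> * q \<theta> + (- (\<nu> * cot \<theta> * q \<theta>) - H \<theta> * (L\<^sup>2 + (\<nu> - \<nu>\<^sup>2) / (sin \<theta>)\<^sup>2)) * H \<theta>) * sin \<theta> ^ (m - 1)
     = sin \<theta> ^ (m - 1) * ((q \<theta>)\<^sup>2 - (H \<theta>)\<^sup>2 * (L\<^sup>2 + (\<nu> - \<nu>\<^sup>2) / (sin \<theta>)\<^sup>2))"
    unfolding q1 by (simp add: algebra_simps power2_eq_square)
  ultimately show "((\<lambda>\<theta>. sin \<theta> ^ (m - 1) * (H \<theta> * q \<theta>)) has_real_derivative
        (sin \<theta> ^ (m - 1) * ((q \<theta>)\<^sup>2 - (H \<theta>)\<^sup>2 * (L\<^sup>2 + (\<nu> - \<nu>\<^sup>2) / (sin \<theta>)\<^sup>2)))) (at \<theta>)" by simp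
qed

lemma Hq_bound:
  assumes "0 < \<theta>" "\<theta> < pi"
  shows "\<bar>sin \<theta> ^ (m - 1) * (H \<theta> * q \<theta>)\<bar> \<le> L / 2 * E \<theta>" "E \<theta> \<ge> 0"
proof -
  have s: "sin \<theta> > 0" using assms by (rule sin_gt_zero)
  show "E \<theta> \<ge> 0" unfolding E_def using s by (intro mult_nonneg_nonneg) auto
  have am: "h * r \<le> (h\<^sup>2 + r\<^sup>2) / 2" for h r :: real
    using zero_le_power2[of "h - r"] by (simp add: power2_diff)
  have "\<bar>H \<theta>\<bar> * (\<bar>q \<theta>\<bar> / L) \<le> ((H \<theta>)\<^sup>2 + (q \<theta>)\<^sup>2 / L\<^sup>2) / 2"
    using am[of "\<bar>H \<theta>\<bar>" "\<bar>q \<theta>\<bar> / L"] by (simp only: power_divide power2_abs)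
  then have "\<bar>H \<theta> * q \<theta>\<bar> \<le> L / 2 * ((H \<theta>)\<^sup>2 + (q \<theta>)\<^sup>2 / L\<^sup>2)"
    using L_ge(2) by (simp add: abs_mult field_simps)
  then have "sin \<theta> ^ (m - 1) * \<bar>H \<theta> * q \<theta>\<bar> \<le> sin \<theta> ^ (m - 1) * (L / 2 * ((H \<theta>)\<^sup>2 + (q \<theta>)\<^sup>2 / L\<^sup>2))"
    using s by (intro mult_left_mono) auto
  then show "\<bar>sin \<theta> ^ (m - 1) * (H \<theta> * q \<theta>)\<bar> \<le> L / 2 * E \<theta>"
    using s by (simp add: E_def abs_mult mult_ac)
qed

text \<open>Gronwall: \<open>|w * w'| <= L / 2 * E\<close> gives
  \<open>|E'| <= c / L * E / sin^2\<close>, and \<open>- cot\<close> is a primitive of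
  \<open>1 / sin^2\<close>. Each direction has its own exponential factor.\<close>

lemma energy_monotone:
  assumes "0 < \<alpha>" "\<alpha> \<le> \<beta>" "\<beta> < pi"
  shows "E \<beta> * exp (c / L * cot \<beta>) \<le> E \<alpha> * exp (c / L * cot \<alpha>)"
    "E \<alpha> * exp (- (c / L * cot \<alpha>)) \<le> E \<beta> * exp (- (c / L * cot \<beta>))"
proof -
  define E' where "E' t = - 2 * (\<nu> - \<nu>\<^sup>2) / (L\<^sup>2 * (sin t)\<^sup>2) * (sin t ^ (m - 1) * (H t * q t))" for t
  have E': "\<bar>E' t\<bar> \<le> c / L * inverse ((sin t)\<^sup>2) * E t" if "0 < t" "t < pi" for t
  proof -
    have s: "sin t > 0" using that by (rule sin_gt_zero)
    have "\<bar>E' t\<bar> = 2 * c / (L\<^sup>2 * (sin t)\<^sup>2) * \<bar>sin t ^ (m - 1) * (H t * q t)\<bar>"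
      
    proof -
      have "\<bar>- 2 * d / (L\<^sup>2 * (sin t)\<^sup>2) * X\<bar> = 2 * \<bar>d\<bar> / (L\<^sup>2 * (sin t)\<^sup>2) * \<bar>X\<bar>" for d X
        by (simp add: abs_mult abs_divide)
      then show ?thesis unfolding E'_def c_def .
    qed
    also have "\<dots> \<le> 2 * c / (L\<^sup>2 * (sin t)\<^sup>2) * (L / 2 * E t)"
      using Hq_bound(1)[OF that] c_nonneg by (intro mult_left_mono) auto
    also have "\<dots> = c / L * inverse ((sin t)\<^sup>2) * E t"
      using L_ge(2) by (simp add: field_simps power2_eq_square)
    finally show ?thesis .
  qed
  have dE': "(E has_real_derivative E' t) (at t)" if "0 < t" "t < pi" for t
    unfolding E'_def by (rule dE(1)[OF that])
  have dex: "((\<lambda>t. exp (k * cot t)) has_real_derivative exp (k * cot t) * (k * - inverse ((sin t)\<^sup>2))) (at t)"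
    if "0 < t" "t < pi" for t k
    using sin_gt_zero[OF that] by (intro DERIV_fun_exp DERIV_cmult DERIV_cot) auto
  show "E \<beta> * exp (c / L * cot \<beta>) \<le> E \<alpha> * exp (c / L * cot \<alpha>)"
  proof (rule DERIV_nonpos_imp_nonincreasing[OF assms(2)])
    fix t assume "\<alpha> \<le> t" "t \<le> \<beta>"
    then have t: "0 < t" "t < pi" using assms by auto
    have "((\<lambda>t. E t * exp (c / L * cot t)) has_real_derivative E' t * exp (c / L * cot t) + exp (c / L * cot t) * (c / L * - inverse ((sin t)\<^sup>2)) * E t) (at t)"
      by (intro DERIV_mult dE' dex t)
    moreover have "E' t * exp (c / L * cot t) + exp (c / L * cot t) * (c / L * - inverse ((sin t)\<^sup>2)) * E t
       = exp (c / L * cot t) * (E' t - c / L * inverse ((sin t)\<^sup>2) * E t)" by (simp add: algebra_simps)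
    moreover have "exp (c / L * cot t) * (E' t - c / L * inverse ((sin t)\<^sup>2) * E t) \<le> 0"
      using E'[OF t] by (intro mult_nonneg_nonpos) auto
    ultimately show "\<exists>d. ((\<lambda>t. E t * exp (c / L * cot t)) has_real_derivative d) (at t) \<and> d \<le> 0" by auto
  qed
  have "E \<alpha> * exp (- (c / L) * cot \<alpha>) \<le> E \<beta> * exp (- (c / L) * cot \<beta>)"
  proof (rule DERIV_nonneg_imp_nondecreasing[OF assms(2)])
    fix t assume "\<alpha> \<le> t" "t \<le> \<beta>"
    then have t: "0 < t" "t < pi" using assms by auto
    have "((\<lambda>t. E t * exp (- (c / L) * cot t)) has_real_derivative E' t * exp (- (c / L) * cot t) + exp (- (c / L) * cot t) * (- (c / L) * - inverse ((sin t)\<^sup>2)) * E t) (at t)"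
      by (intro DERIV_mult dE' dex t)
    moreover have "E' t * exp (- (c / L) * cot t) + exp (- (c / L) * cot t) * (- (c / L) * - inverse ((sin t)\<^sup>2)) * E t
       = exp (- (c / L) * cot t) * (E' t + c / L * inverse ((sin t)\<^sup>2) * E t)" by (simp add: algebra_simps)
    moreover have "exp (- (c / L) * cot t) * (E' t + c / L * inverse ((sin t)\<^sup>2) * E t) \<ge> 0"
      using E'[OF t] by (intro mult_nonneg_nonneg) auto
    ultimately show "\<exists>d. ((\<lambda>t. E t * exp (- (c / L) * cot t)) has_real_derivative d) (at t) \<and> d \<ge> 0" by auto
  qed
  then show "E \<alpha> * exp (- (c / L * cot \<alpha>)) \<le> E \<beta> * exp (- (c / L * cot \<beta>))" by simp
qed

text \<open>About one wavelength from the pole: \<open>L * \<theta>0 = 1/2\<close> keeps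
  \<open>H\<close> at least \<open>1/2\<close> there, while \<open>cot\<close> is at most
  \<open>2 * L\<close>, so that the exponents \<open>c / L * cot\<close> stay bounded in
  \<open>l\<close>.\<close>

definition \<theta>0 where "\<theta>0 = 1 / (2 * L)"

lemma theta0: "0 < \<theta>0" "\<theta>0 \<le> 1 / 3" "\<theta>0 < pi / 4" "L * \<theta>0 = 1 / 2"
proof -
  show "0 < \<theta>0" "L * \<theta>0 = 1 / 2" using L_ge by (auto simp: \<theta>0_def)
  show "\<theta>0 \<le> 1 / 3" using L_ge by (simp add: \<theta>0_def field_simps)
  then show "\<theta>0 < pi / 4" using pi_gt3 by linarith
qed

lemma cot_bound:
  assumes "\<theta>0 \<le> \<theta>" "\<theta> \<le> pi - \<theta>0"
  shows "\<bar>cot \<theta>\<bar> \<le> 2 * L"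
proof -
  have *: "cot t \<le> 2 * L" if t: "\<theta>0 \<le> t" "t \<le> pi - \<theta>0" for t
  proof (cases "t < pi / 2")
    case True
    have "\<theta>0 \<le> t" by (rule t)
    also have "t \<le> tan t" using abs_tan_ge[of t] tan_gt_zero[of t] True t theta0 by simp
    finally have "1 / tan t \<le> 1 / \<theta>0" using theta0 by (intro divide_left_mono) auto
    then show ?thesis by (simp add: \<theta>0_def tan_def cot_def)
  next
    case False
    then have "cos t \<le> 0" using t theta0 pi_gt3 cos_monotone_0_pi_le[of "pi / 2" t] by simp
    moreover have "sin t > 0" using t theta0 False pi_gt3 by (intro sin_gt_zero) auto
    ultimately have "cot t \<le> 0" by (simp add: cot_def divide_nonpos_pos)
    then show ?thesis using L_ge(2) by simp
  qed
  have "- cot \<theta> = cot (pi - \<theta>)" by (simp add: cot_def)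
  then show ?thesis using *[of \<theta>] *[of "pi - \<theta>"] assms by (simp add: abs_le_iff)
qed

text \<open>Both cotangents are at most \<open>2 * L\<close> in absolute value, so the exponents in
  \<open>energy_monotone\<close> differ by at most \<open>4 * c\<close>, a quantity independent of
  \<open>l\<close>.\<close>

lemma energy_comparison:
  assumes "\<theta>0 \<le> \<theta>" "\<theta> \<le> pi - \<theta>0"
  shows "E \<theta> \<le> E \<theta>0 * exp (4 * c)" "E \<theta>0 * exp (- (4 * c)) \<le> E \<theta>"
proof -
  have r: "\<theta>0 \<le> \<theta>0" "\<theta>0 \<le> pi - \<theta>0" using theta0 by auto
  have tp: "0 < \<theta>" "\<theta> < pi" using assms theta0 by auto
  have E0: "E \<theta>0 \<ge> 0" "E \<theta> \<ge> 0" by (rule Hq_bound(2); use theta0 tp in auto)+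
  have d: "\<bar>c / L * cot \<theta>0 - c / L * cot \<theta>\<bar> \<le> 4 * c"
  proof -
    have "\<bar>c / L * cot \<theta>0 - c / L * cot \<theta>\<bar> = c / L * \<bar>cot \<theta>0 - cot \<theta>\<bar>"
      unfolding right_diff_distrib[symmetric] abs_mult using c_nonneg L_ge(2) by simp
    also have "\<dots> \<le> c / L * (4 * L)"
      using cot_bound[OF r] cot_bound[OF assms] c_nonneg L_ge(2) by (intro mult_left_mono) auto
    finally show ?thesis using L_ge(2) by simp
  qed
  have "E \<theta> = E \<theta> * exp (c / L * cot \<theta>) * exp (- (c / L * cot \<theta>))" by (simp add: mult.assoc exp_add[symmetric])
  also have "\<dots> \<le> E \<theta>0 * exp (c / L * cot \<theta>0) * exp (- (c / L * cot \<theta>))"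
    by (intro mult_right_mono energy_monotone(1)) (use theta0 assms tp in auto)
  also have "\<dots> = E \<theta>0 * exp (c / L * cot \<theta>0 - c / L * cot \<theta>)" by (simp add: mult.assoc exp_add[symmetric])
  also have "\<dots> \<le> E \<theta>0 * exp (4 * c)" using d E0 by (intro mult_left_mono) auto
  finally show "E \<theta> \<le> E \<theta>0 * exp (4 * c)" .
  have "E \<theta>0 * exp (- (4 * c)) \<le> E \<theta>0 * exp (- (c / L * cot \<theta>0 - c / L * cot \<theta>))"
    using d E0 by (intro mult_left_mono) auto
  also have "\<dots> = E \<theta>0 * exp (- (c / L * cot \<theta>0)) * exp (c / L * cot \<theta>)" by (simp add: mult.assoc exp_add[symmetric])
  also have "\<dots> \<le> E \<theta> * exp (- (c / L * cot \<theta>)) * exp (c / L * cot \<theta>)"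
    by (intro mult_right_mono energy_monotone(2)) (use theta0 assms tp in auto)
  also have "\<dots> = E \<theta>" by (simp add: mult.assoc exp_add[symmetric])
  finally show "E \<theta>0 * exp (- (4 * c)) \<le> E \<theta>" .
qed

text \<open>Above, \<open>first_energy_bounds\<close> and \<open>cot_bound\<close> give
  \<open>|q| <= L + \<nu> * 2 * L = m * L\<close>. Below, the mean value theorem with
  \<open>|H1| <= L\<close> gives \<open>H \<theta>0 >= 1/2\<close>, and
  \<open>sin \<theta>0 >= \<theta>0 / 2\<close>.\<close>

lemma E_theta0:
  shows "E \<theta>0 \<le> (1 + (real m)\<^sup>2) * (1 / L) ^ (m - 1)" "(1 / 4) * (1 / (4 * L)) ^ (m - 1) \<le> E \<theta>0"
proof -
  have s0: "sin \<theta>0 > 0" using theta0 by (intro sin_gt_zero) auto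
  have sl: "sin \<theta>0 \<le> 1 / L"
  proof -
    have "sin \<theta>0 \<le> \<theta>0" using theta0 by (intro sin_x_le_x) auto
    also have "\<dots> \<le> 1 / L" using L_ge(2) by (simp add: \<theta>0_def field_simps)
    finally show ?thesis .
  qed
  have hb: "\<bar>H \<theta>0\<bar> \<le> 1" "\<bar>H1 \<theta>0\<bar> \<le> L" using theta0 by (intro first_energy_bounds; simp)+
  have "\<bar>q \<theta>0\<bar> \<le> L + \<nu> * (2 * L) * 1"
  proof -
    have "\<bar>q \<theta>0\<bar> \<le> \<bar>H1 \<theta>0\<bar> + \<nu> * \<bar>cot \<theta>0\<bar> * \<bar>H \<theta>0\<bar>"
      unfolding q_def using nu(1) abs_triangle_ineq[of "H1 \<theta>0" "\<nu> * cot \<theta>0 * H \<theta>0"] by (simp add: abs_mult)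
    also have "\<dots> \<le> L + \<nu> * (2 * L) * 1"
      using cot_bound[of \<theta>0] theta0 nu(1) L_ge(2) by (intro add_mono mult_mono hb) auto
    finally show ?thesis .
  qed
  also have "\<dots> = real m * L" by (simp add: m_eq algebra_simps)
  finally have "(q \<theta>0)\<^sup>2 \<le> (real m * L)\<^sup>2" using L_ge(2) by (simp add: abs_le_square_iff[symmetric])
  then have "(q \<theta>0)\<^sup>2 / L\<^sup>2 \<le> (real m)\<^sup>2" using L_ge(2) by (simp add: pos_divide_le_eq power_mult_distrib)
  moreover have "(H \<theta>0)\<^sup>2 \<le> 1" using hb(1) by (simp add: abs_square_le_1)
  ultimately have "(H \<theta>0)\<^sup>2 + (q \<theta>0)\<^sup>2 / L\<^sup>2 \<le> 1 + (real m)\<^sup>2" by simp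
  then have "E \<theta>0 \<le> (1 / L) ^ (m - 1) * (1 + (real m)\<^sup>2)"
    unfolding E_def using s0 sl L_ge(2) by (intro mult_mono power_mono) auto
  then show "E \<theta>0 \<le> (1 + (real m)\<^sup>2) * (1 / L) ^ (m - 1)" by (simp add: mult.commute)
  have H2: "H \<theta>0 \<ge> 1 / 2"
  proof -
    have "\<exists>z>0. z < \<theta>0 \<and> H \<theta>0 - H 0 = (\<theta>0 - 0) * H1 z"
      using MVT2[of 0 \<theta>0 H H1] dH theta0 by blast
    then obtain z where z: "0 < z" "z < \<theta>0" "H \<theta>0 - H 0 = \<theta>0 * H1 z" by auto
    have "\<bar>H \<theta>0 - H 0\<bar> \<le> \<theta>0 * L"
      unfolding z(3) abs_mult using first_energy_bounds(2)[of z] z theta0 by (simp add: mult_left_mono)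
    moreover have "H 0 = 1" using gegenbauer_poly_at_1[OF m] by (simp add: H_def y_def)
    ultimately show ?thesis using theta0(4) unfolding abs_le_iff mult.commute[of \<theta>0 L] by linarith
  qed
  have sg: "sin \<theta>0 \<ge> 1 / (4 * L)"
  proof -
    have "\<theta>0 - \<theta>0 ^ 3 / 6 \<le> sin \<theta>0"
    proof -
      have "\<bar>sin \<theta>0 - (\<Sum>k<3. sin_coeff k * \<theta>0 ^ k)\<bar> \<le> inverse (fact 3) * \<bar>\<theta>0\<bar> ^ 3" by (rule Maclaurin_sin_bound)
      moreover have "(\<Sum>k<3. sin_coeff k * \<theta>0 ^ k) = \<theta>0" by (simp add: sin_coeff_def eval_nat_numeral)
      moreover have "inverse (fact 3) * \<bar>\<theta>0\<bar> ^ 3 = \<theta>0 ^ 3 / 6" using theta0 by (simp add: eval_nat_numeral field_simps)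
      ultimately show ?thesis by (simp only: abs_le_iff) linarith
    qed
    moreover have "\<theta>0 ^ 3 / 6 \<le> \<theta>0 / 2"
    proof -
      have "\<theta>0\<^sup>2 \<le> 1\<^sup>2" using theta0 by (intro power_mono) auto
      then have "\<theta>0 * \<theta>0\<^sup>2 \<le> \<theta>0 * 1" using theta0 by (intro mult_left_mono) auto
      then show ?thesis using theta0 by (simp add: eval_nat_numeral)
    qed
    ultimately show ?thesis by (simp add: \<theta>0_def)
  qed
  have "(1 / (4 * L)) ^ (m - 1) * (1 / 4) \<le> sin \<theta>0 ^ (m - 1) * ((H \<theta>0)\<^sup>2 + (q \<theta>0)\<^sup>2 / L\<^sup>2)"
  proof (intro mult_mono power_mono)
    have "(1 / 2)\<^sup>2 \<le> (H \<theta>0)\<^sup>2" using H2 by (intro power_mono) auto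
    then show "1 / 4 \<le> (H \<theta>0)\<^sup>2 + (q \<theta>0)\<^sup>2 / L\<^sup>2" by (simp add: power2_eq_square add_increasing2)
  qed (use sg L_ge(2) s0 in auto)
  then show "(1 / 4) * (1 / (4 * L)) ^ (m - 1) \<le> E \<theta>0" by (simp add: E_def mult.commute)
qed

end

section \<open>Moments of Gegenbauer polynomials\<close>

lemma sin_ge_half:
  assumes "0 \<le> t" "t \<le> pi / 2"
  shows "t / 2 \<le> sin t"
proof -
  have "\<bar>sin t - (\<Sum>k<3. sin_coeff k * t ^ k)\<bar> \<le> inverse (fact 3) * \<bar>t\<bar> ^ 3" by (rule Maclaurin_sin_bound)
  moreover have "(\<Sum>k<3. sin_coeff k * t ^ k) = t" by (simp add: sin_coeff_def eval_nat_numeral)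
  moreover have "inverse (fact 3) * \<bar>t\<bar> ^ 3 \<le> t / 2"
  proof -
    have "t \<le> 8 / 5" using assms pi_approx by simp
    then have "t * t \<le> 8 / 5 * (8 / 5)" using assms by (intro mult_mono) auto
    then have "t * t \<le> 3" by simp
    then have "t * (t * t) \<le> t * 3" using assms by (intro mult_left_mono) auto
    then show ?thesis using assms by (simp add: eval_nat_numeral)
  qed
  ultimately show ?thesis by (simp only: abs_le_iff) linarith
qed

text \<open>Up to a constant, \<open>b t\<close> will majorise the polynomial near one pole and
  \<open>b (pi - t)\<close> near the other. Both primitives are explicit; the first integral is of
  order \<open>l^(-1/2)\<close>, the second of order \<open>1 / l\<close>.\<close>

lemma integral_inverse_sqrt_bounds:
  fixes l :: real
  assumes "l \<ge> 1"
  defines "b \<equiv> \<lambda>t. 1 / sqrt (1 + l * t / 2)"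
  shows "((\<lambda>t. b t + b (pi - t)) has_integral (8 / l * (sqrt (1 + l * pi / 2) - 1))) {0..pi}"
    "((\<lambda>t. b t ^ 3 + b (pi - t) ^ 3) has_integral (8 / l * (1 - 1 / sqrt (1 + l * pi / 2)))) {0..pi}"
proof -
  have pos: "1 + l * t / 2 > 0" if "t \<ge> 0" for t using that assms by (simp add: add_pos_nonneg)
  define g where "g t = 1 + l * t / 2" for t
  have dg: "(g has_real_derivative l / 2) (at t within A)" for t A
    unfolding g_def[abs_def] by (auto intro!: derivative_eq_intros)
  have dg': "((\<lambda>t. g (pi - t)) has_real_derivative - (l / 2)) (at t within A)" for t A
    unfolding g_def[abs_def] by (auto intro!: derivative_eq_intros)
  have gp: "g t > 0" "g (pi - t) > 0" if "t \<in> {0..pi}" for t using pos that by (auto simp: g_def)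
  have sq: "((\<lambda>t. sqrt (f t)) has_real_derivative f' / (2 * sqrt (f t))) (at t within A)"
    if "(f has_real_derivative f') (at t within A)" "f t > 0" for f f' t A
    using DERIV_chain[OF DERIV_real_sqrt[OF that(2)] that(1)] by (simp add: o_def field_simps)
  have isq: "((\<lambda>t. 1 / sqrt (f t)) has_real_derivative - f' / 2 * (1 / sqrt (f t)) ^ 3) (at t within A)"
    if "(f has_real_derivative f') (at t within A)" "f t > 0" for f f' t A
  proof -
    have "((\<lambda>t. 1 / sqrt (f t)) has_real_derivative (0 * sqrt (f t) - 1 * (f' / (2 * sqrt (f t)))) / (sqrt (f t) * sqrt (f t))) (at t within A)"
      by (intro DERIV_divide sq that DERIV_const) (use that in auto)
    moreover have "(0 * sqrt (f t) - 1 * (f' / (2 * sqrt (f t)))) / (sqrt (f t) * sqrt (f t)) = - f' / 2 * (1 / sqrt (f t)) ^ 3"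
      by (simp add: eval_nat_numeral field_simps)
    ultimately show ?thesis by (rule DERIV_cong)
  qed
  have l0: "l \<noteq> 0" using assms by simp
  have "((\<lambda>t. 1 / sqrt (g t) + 1 / sqrt (g (pi - t))) has_integral
      ((4 / l * sqrt (g pi) - 4 / l * sqrt (g (pi - pi))) - (4 / l * sqrt (g 0) - 4 / l * sqrt (g (pi - 0))))) {0..pi}"
  proof (rule fundamental_theorem_of_calculus)
    fix t assume t: "t \<in> {0..pi}"
    have "((\<lambda>t. 4 / l * sqrt (g t) - 4 / l * sqrt (g (pi - t))) has_real_derivative
       (4 / l * (l / 2 / (2 * sqrt (g t))) - 4 / l * (- (l / 2) / (2 * sqrt (g (pi - t)))))) (at t within {0..pi})"
      by (intro DERIV_diff DERIV_cmult sq dg dg' gp[OF t])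
    moreover have "4 / l * (l / 2 / (2 * sqrt (g t))) - 4 / l * (- (l / 2) / (2 * sqrt (g (pi - t)))) = 1 / sqrt (g t) + 1 / sqrt (g (pi - t))"
      using l0 by simp
    ultimately show "((\<lambda>t. 4 / l * sqrt (g t) - 4 / l * sqrt (g (pi - t))) has_vector_derivative 1 / sqrt (g t) + 1 / sqrt (g (pi - t))) (at t within {0..pi})"
      by (simp add: has_real_derivative_iff_has_vector_derivative)
  qed simp
  then show "((\<lambda>t. b t + b (pi - t)) has_integral (8 / l * (sqrt (1 + l * pi / 2) - 1))) {0..pi}"
    by (simp add: b_def g_def right_diff_distrib)
  have "((\<lambda>t. (1 / sqrt (g t)) ^ 3 + (1 / sqrt (g (pi - t))) ^ 3) has_integral
      ((4 / l * (1 / sqrt (g (pi - pi))) - 4 / l * (1 / sqrt (g pi))) - (4 / l * (1 / sqrt (g (pi - 0))) - 4 / l * (1 / sqrt (g 0))))) {0..pi}"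
  proof (rule fundamental_theorem_of_calculus)
    fix t assume t: "t \<in> {0..pi}"
    have "((\<lambda>t. 4 / l * (1 / sqrt (g (pi - t))) - 4 / l * (1 / sqrt (g t))) has_real_derivative
       (4 / l * (- (- (l / 2)) / 2 * (1 / sqrt (g (pi - t))) ^ 3) - 4 / l * (- (l / 2) / 2 * (1 / sqrt (g t)) ^ 3))) (at t within {0..pi})"
      by (intro DERIV_diff DERIV_cmult isq dg dg' gp[OF t])
    moreover have "4 / l * (- (- (l / 2)) / 2 * (1 / sqrt (g (pi - t))) ^ 3) - 4 / l * (- (l / 2) / 2 * (1 / sqrt (g t)) ^ 3) = (1 / sqrt (g t)) ^ 3 + (1 / sqrt (g (pi - t))) ^ 3"
      using l0 by simp
    ultimately show "((\<lambda>t. 4 / l * (1 / sqrt (g (pi - t))) - 4 / l * (1 / sqrt (g t))) has_vector_derivative (1 / sqrt (g t)) ^ 3 + (1 / sqrt (g (pi - t))) ^ 3) (at t within {0..pi})"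
      by (simp add: has_real_derivative_iff_has_vector_derivative)
  qed simp
  then show "((\<lambda>t. b t ^ 3 + b (pi - t) ^ 3) has_integral (8 / l * (1 - 1 / sqrt (1 + l * pi / 2)))) {0..pi}"
    by (simp add: b_def g_def right_diff_distrib)
qed

context gegenbauer_angle
begin

definition N where "N k = integral {0..pi} (\<lambda>\<theta>. \<bar>H \<theta>\<bar> ^ k * sin \<theta> ^ (m - 1))"
text \<open>\<open>C1\<close> and \<open>c1\<close> depend on \<open>m\<close> alone, which makes
  the bounds below uniform in \<open>l\<close>.\<close>

definition C1 where "C1 = (1 + (real m)\<^sup>2) * exp (4 * c)"
definition c1 where "c1 = (1 / 4) * (1 / 4) ^ (m - 1) * exp (- (4 * c))"

lemma C1_ge: "C1 \<ge> 1"
proof -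
  have "1 * 1 \<le> (1 + (real m)\<^sup>2) * exp (4 * c)" using c_nonneg by (intro mult_mono) auto
  then show ?thesis by (simp add: C1_def)
qed

lemma c1_pos: "c1 > 0" by (simp add: c1_def)

lemma H_continuous: "continuous_on A H"
  unfolding H_def[abs_def] by (intro continuous_intros)

lemma N_integrable: "(\<lambda>\<theta>. \<bar>H \<theta>\<bar> ^ k * sin \<theta> ^ (m - 1)) integrable_on {a..b}"
  by (intro integrable_continuous_interval continuous_intros H_continuous)

context
  assumes bounded: "\<And>t. \<bar>t\<bar> \<le> 1 \<Longrightarrow> \<bar>poly y t\<bar> \<le> 1"
begin

text \<open>\<open>first_energy\<close> stops at \<open>pi / 2\<close>; the assumed bound covers the
  other pole too. It is later supplied by \<open>gegenbauer_abs_le_1\<close> from the covariance of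
  the field.\<close>

lemma H_le_1: "\<bar>H \<theta>\<bar> \<le> 1" unfolding H_def by (rule bounded) simp

text \<open>Between the two caps of angle \<open>\<theta>0\<close> this is the energy bound; inside
  them \<open>sin \<theta> <= \<theta>0 <= 1 / L\<close> and \<open>|H| <= 1\<close>
  suffice.\<close>

lemma weighted_upper:
  assumes "0 \<le> \<theta>" "\<theta> \<le> pi"
  shows "(H \<theta>)\<^sup>2 * sin \<theta> ^ (m - 1) \<le> C1 * (1 / L) ^ (m - 1)"
proof -
  have s: "0 \<le> sin \<theta>" using assms by (rule sin_ge_zero)
  show ?thesis
  proof (cases "\<theta>0 \<le> \<theta> \<and> \<theta> \<le> pi - \<theta>0")
    case True
    then have t: "0 < \<theta>" "\<theta> < pi" using theta0 by auto
    have "(H \<theta>)\<^sup>2 * sin \<theta> ^ (m - 1) \<le> E \<theta>"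
      unfolding E_def using s by (simp add: algebra_simps)
    also have "\<dots> \<le> E \<theta>0 * exp (4 * c)" using energy_comparison(1) True by auto
    also have "\<dots> \<le> ((1 + (real m)\<^sup>2) * (1 / L) ^ (m - 1)) * exp (4 * c)" by (intro mult_right_mono E_theta0) auto
    finally show ?thesis by (simp add: C1_def mult_ac)
  next
    case False
    have "sin \<theta> \<le> \<theta>0"
    proof (cases "\<theta> < \<theta>0")
      case True
      then show ?thesis using sin_x_le_x[of \<theta>] assms by linarith
    next
      case F: False
      then have "pi - \<theta> \<le> \<theta>0" using False by auto
      then show ?thesis using sin_x_le_x[of "pi - \<theta>"] assms by simp
    qed
    also have "\<theta>0 \<le> 1 / L" using L_ge(2) by (simp add: \<theta>0_def field_simps)
    finally have "sin \<theta> ^ (m - 1) \<le> (1 / L) ^ (m - 1)" using s by (intro power_mono)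
    moreover have "(H \<theta>)\<^sup>2 \<le> C1" using H_le_1[of \<theta>] C1_ge abs_square_le_1[of "H \<theta>"] by simp
    ultimately show ?thesis using s C1_ge L_ge(2) by (intro mult_mono) auto
  qed
qed

text \<open>Dividing \<open>weighted_upper\<close> by the sine power gives decay
  \<open>(L * sin \<theta>)^(1 - m)\<close>. One factor of it is kept, which is legitimate as
  \<open>m >= 2\<close>; the 1 in the denominator covers the region
  \<open>l * sin \<theta> <= 1\<close>.\<close>

lemma H_square_bound:
  assumes "0 \<le> \<theta>" "\<theta> \<le> pi"
  shows "(H \<theta>)\<^sup>2 \<le> 2 * C1 / (1 + real l * sin \<theta>)"
proof -
  have s: "0 \<le> sin \<theta>" using assms by (rule sin_ge_zero)
  then have ls: "0 \<le> real l * sin \<theta>" by simp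
  show ?thesis
  proof (cases "real l * sin \<theta> \<le> 1")
    case True
    have "(H \<theta>)\<^sup>2 * (1 + real l * sin \<theta>) \<le> 1 * 2"
      using True ls H_le_1[of \<theta>] abs_square_le_1[of "H \<theta>"] by (intro mult_mono) auto
    also have "\<dots> \<le> 2 * C1" using C1_ge by simp
    finally show ?thesis using ls by (simp add: pos_le_divide_eq)
  next
    case False
    then have s0: "sin \<theta> > 0" using s by (cases "sin \<theta> = 0") auto
    have Ls: "real l * sin \<theta> \<le> L * sin \<theta>" using L_ge(3) s by (intro mult_right_mono) auto
    have "(H \<theta>)\<^sup>2 * (L * sin \<theta>) ^ (m - 1) = ((H \<theta>)\<^sup>2 * sin \<theta> ^ (m - 1)) * L ^ (m - 1)"
      by (simp add: power_mult_distrib)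
    also have "\<dots> \<le> (C1 * (1 / L) ^ (m - 1)) * L ^ (m - 1)"
      using weighted_upper[OF assms] L_ge(2) by (intro mult_right_mono) auto
    also have "\<dots> = C1" using L_ge(2) by (simp add: power_divide)
    finally have 1: "(H \<theta>)\<^sup>2 * (L * sin \<theta>) ^ (m - 1) \<le> C1" .
    have "real l * sin \<theta> \<le> (L * sin \<theta>) ^ 1" using Ls by simp
    also have "\<dots> \<le> (L * sin \<theta>) ^ (m - 1)" using Ls False m by (intro power_increasing) auto
    finally have "(H \<theta>)\<^sup>2 * (real l * sin \<theta>) \<le> C1" using 1 by (meson mult_left_mono order_trans zero_le_power2)
    moreover have "(H \<theta>)\<^sup>2 \<le> C1" using H_le_1[of \<theta>] C1_ge abs_square_le_1[of "H \<theta>"] by simp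
    ultimately have "(H \<theta>)\<^sup>2 * (1 + real l * sin \<theta>) \<le> 2 * C1" by (simp add: distrib_left)
    then show ?thesis using ls by (simp add: pos_le_divide_eq)
  qed
qed

text \<open>With \<open>t\<close> the distance to the nearer pole,
  \<open>sin \<theta> >= t / 2\<close>. Adding the terms of both poles avoids splitting the
  integrals.\<close>

lemma H_pointwise:
  assumes "0 \<le> \<theta>" "\<theta> \<le> pi"
  defines "b \<equiv> \<lambda>t. 1 / sqrt (1 + real l * t / 2)"
  shows "\<bar>H \<theta>\<bar> \<le> sqrt (2 * C1) * (b \<theta> + b (pi - \<theta>))" "\<bar>H \<theta>\<bar> ^ 3 \<le> sqrt (2 * C1) ^ 3 * (b \<theta> ^ 3 + b (pi - \<theta>) ^ 3)"
proof -
  have b0: "b t \<ge> 0" if "t \<ge> 0" for t using that by (simp add: b_def)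
  have "\<bar>H \<theta>\<bar> \<le> sqrt (2 * C1) * b \<theta> \<or> \<bar>H \<theta>\<bar> \<le> sqrt (2 * C1) * b (pi - \<theta>)"
  proof -
    define t where "t = (if \<theta> \<le> pi / 2 then \<theta> else pi - \<theta>)"
    have t: "0 \<le> t" "t \<le> pi / 2" "sin t = sin \<theta>" using assms by (auto simp: t_def)
    have p0: "0 < 1 + real l * t / 2" using t(1) by (simp add: add_pos_nonneg)
    have "1 + real l * t / 2 \<le> 1 + real l * sin \<theta>"
      using mult_left_mono[OF sin_ge_half[OF t(1,2)], of "real l"] t(3) by simp
    then have "2 * C1 / (1 + real l * sin \<theta>) \<le> 2 * C1 / (1 + real l * t / 2)"
      using C1_ge p0 by (intro divide_left_mono mult_pos_pos) linarith+
    then have "(H \<theta>)\<^sup>2 \<le> 2 * C1 / (1 + real l * t / 2)" using H_square_bound[OF assms(1,2)] by linarith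
    then have "sqrt ((H \<theta>)\<^sup>2) \<le> sqrt (2 * C1 / (1 + real l * t / 2))" by (rule real_sqrt_le_mono)
    then have "\<bar>H \<theta>\<bar> \<le> sqrt (2 * C1) * b t" by (simp add: real_sqrt_divide b_def)
    then show ?thesis by (auto simp: t_def split: if_splits)
  qed
  moreover have "b \<theta> \<ge> 0" "b (pi - \<theta>) \<ge> 0" using b0 assms by auto
  moreover have "sqrt (2 * C1) \<ge> 0" using C1_ge by simp
  ultimately show "\<bar>H \<theta>\<bar> \<le> sqrt (2 * C1) * (b \<theta> + b (pi - \<theta>))" "\<bar>H \<theta>\<bar> ^ 3 \<le> sqrt (2 * C1) ^ 3 * (b \<theta> ^ 3 + b (pi - \<theta>) ^ 3)"
  proof -
    have nn: "0 \<le> sqrt (2 * C1) * b \<theta>" "0 \<le> sqrt (2 * C1) * b (pi - \<theta>)" "0 \<le> sqrt (2 * C1) ^ 3 * b \<theta> ^ 3" "0 \<le> sqrt (2 * C1) ^ 3 * b (pi - \<theta>) ^ 3"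
      using \<open>b \<theta> \<ge> 0\<close> \<open>b (pi - \<theta>) \<ge> 0\<close> C1_ge by auto
    consider "\<bar>H \<theta>\<bar> \<le> sqrt (2 * C1) * b \<theta>" | "\<bar>H \<theta>\<bar> \<le> sqrt (2 * C1) * b (pi - \<theta>)"
      using \<open>\<bar>H \<theta>\<bar> \<le> sqrt (2 * C1) * b \<theta> \<or> \<bar>H \<theta>\<bar> \<le> sqrt (2 * C1) * b (pi - \<theta>)\<close> by blast
    then have "\<bar>H \<theta>\<bar> \<le> sqrt (2 * C1) * (b \<theta> + b (pi - \<theta>)) \<and> \<bar>H \<theta>\<bar> ^ 3 \<le> sqrt (2 * C1) ^ 3 * (b \<theta> ^ 3 + b (pi - \<theta>) ^ 3)"
    proof cases
      case 1
      from power_mono[OF 1, of 3] 1 show ?thesis using nn by (simp add: distrib_left power_mult_distrib)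
    next
      case 2
      from power_mono[OF 2, of 3] 2 show ?thesis using nn by (simp add: distrib_left power_mult_distrib)
    qed
    then show "\<bar>H \<theta>\<bar> \<le> sqrt (2 * C1) * (b \<theta> + b (pi - \<theta>))" "\<bar>H \<theta>\<bar> ^ 3 \<le> sqrt (2 * C1) ^ 3 * (b \<theta> ^ 3 + b (pi - \<theta>) ^ 3)" by auto
  qed
qed

lemma N2_upper: "N 2 \<le> pi * C1 * (1 / L) ^ (m - 1)"
proof -
  have "N 2 \<le> integral {0..pi} (\<lambda>\<theta>. C1 * (1 / L) ^ (m - 1))"
    unfolding N_def by (rule integral_le[OF N_integrable]) (use weighted_upper in auto)
  then show ?thesis by (simp add: mult_ac)
qed

text \<open>Two of the three factors \<open>H\<close> are spent, together with the sine power, on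
  the uniform \<open>weighted_upper\<close>; the third is integrated by means of
  \<open>H_pointwise\<close>. For \<open>N 5\<close> three factors remain for the
  integration.\<close>

lemma N3_upper: "N 3 \<le> 16 * C1 * sqrt (2 * C1) * (1 / L) ^ (m - 1) / sqrt (real l)"
proof -
  define b where "b t = 1 / sqrt (1 + real l * t / 2)" for t
  define A where "A = C1 * (1 / L) ^ (m - 1) * sqrt (2 * C1)"
  have A0: "A \<ge> 0" using C1_ge L_ge(2) by (simp add: A_def)
  have l1: "real l \<ge> 1" using l by simp
  note hi = integral_inverse_sqrt_bounds(1)[OF l1, folded b_def]
  have "N 3 \<le> integral {0..pi} (\<lambda>\<theta>. A * (b \<theta> + b (pi - \<theta>)))"
    unfolding N_def
  proof (rule integral_le[OF N_integrable])
    show "(\<lambda>\<theta>. A * (b \<theta> + b (pi - \<theta>))) integrable_on {0..pi}" using has_integral_mult_right[OF hi] by blast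
    fix \<theta> assume t: "\<theta> \<in> {0..pi}"
    then have s: "0 \<le> sin \<theta>" by (intro sin_ge_zero) auto
    have "\<bar>H \<theta>\<bar> ^ 3 * sin \<theta> ^ (m - 1) = ((H \<theta>)\<^sup>2 * sin \<theta> ^ (m - 1)) * \<bar>H \<theta>\<bar>" by (simp add: eval_nat_numeral)
    also have "\<dots> \<le> (C1 * (1 / L) ^ (m - 1)) * (sqrt (2 * C1) * (b \<theta> + b (pi - \<theta>)))"
      using t s C1_ge L_ge(2) unfolding b_def by (intro mult_mono weighted_upper H_pointwise) auto
    finally show "\<bar>H \<theta>\<bar> ^ 3 * sin \<theta> ^ (m - 1) \<le> A * (b \<theta> + b (pi - \<theta>))" by (simp add: A_def mult.assoc)
  qed
  also have "\<dots> = A * (8 / real l * (sqrt (1 + real l * pi / 2) - 1))"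
    by (rule integral_unique[OF has_integral_mult_right[OF hi]])
  also have "\<dots> \<le> A * (16 / sqrt (real l))"
  proof (rule mult_left_mono[OF _ A0])
    have "real l * pi \<le> real l * 4" using pi_less_4 by (intro mult_left_mono) auto
    then have "1 + real l * pi / 2 \<le> 4 * real l" using l1 by linarith
    then have "sqrt (1 + real l * pi / 2) \<le> sqrt (4 * real l)" by (rule real_sqrt_le_mono)
    also have "\<dots> = 2 * sqrt (real l)" by (simp add: real_sqrt_mult)
    finally have "8 / real l * (sqrt (1 + real l * pi / 2) - 1) \<le> 8 / real l * (2 * sqrt (real l))" by (intro mult_left_mono) auto
    also have "\<dots> = 16 / sqrt (real l)" using l1 by (simp add: field_simps)
    finally show "8 / real l * (sqrt (1 + real l * pi / 2) - 1) \<le> 16 / sqrt (real l)" .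
  qed
  finally show ?thesis by (simp add: A_def mult_ac)
qed

lemma N5_upper: "N 5 \<le> 8 * C1 * sqrt (2 * C1) ^ 3 * (1 / L) ^ (m - 1) / real l"
proof -
  define b where "b t = 1 / sqrt (1 + real l * t / 2)" for t
  define A where "A = C1 * (1 / L) ^ (m - 1) * sqrt (2 * C1) ^ 3"
  have A0: "A \<ge> 0" using C1_ge L_ge(2) by (simp add: A_def)
  have l1: "real l \<ge> 1" using l by simp
  note hi = integral_inverse_sqrt_bounds(2)[OF l1, folded b_def]
  have "N 5 \<le> integral {0..pi} (\<lambda>\<theta>. A * (b \<theta> ^ 3 + b (pi - \<theta>) ^ 3))"
    unfolding N_def
  proof (rule integral_le[OF N_integrable])
    show "(\<lambda>\<theta>. A * (b \<theta> ^ 3 + b (pi - \<theta>) ^ 3)) integrable_on {0..pi}" using has_integral_mult_right[OF hi] by blast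
    fix \<theta> assume t: "\<theta> \<in> {0..pi}"
    then have s: "0 \<le> sin \<theta>" by (intro sin_ge_zero) auto
    have "\<bar>H \<theta>\<bar> ^ 5 * sin \<theta> ^ (m - 1) = ((H \<theta>)\<^sup>2 * sin \<theta> ^ (m - 1)) * \<bar>H \<theta>\<bar> ^ 3"
      by (simp add: eval_nat_numeral)
    also have "\<dots> \<le> (C1 * (1 / L) ^ (m - 1)) * (sqrt (2 * C1) ^ 3 * (b \<theta> ^ 3 + b (pi - \<theta>) ^ 3))"
      using t s C1_ge L_ge(2) unfolding b_def by (intro mult_mono weighted_upper H_pointwise) auto
    finally show "\<bar>H \<theta>\<bar> ^ 5 * sin \<theta> ^ (m - 1) \<le> A * (b \<theta> ^ 3 + b (pi - \<theta>) ^ 3)" by (simp add: A_def mult.assoc)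
  qed
  also have "\<dots> = A * (8 / real l * (1 - 1 / sqrt (1 + real l * pi / 2)))"
    by (rule integral_unique) (use has_integral_mult_right[OF hi, of A] in \<open>simp add: b_def\<close>)
  also have "\<dots> \<le> A * (8 / real l * 1)"
    using l1 by (intro mult_left_mono A0) auto
  finally show ?thesis by (simp add: A_def mult_ac)
qed

text \<open>Equipartition on the middle interval: the derivative of \<open>w * w' / L^2\<close> is
  the energy minus a bounded multiple of \<open>w^2\<close>, and its integral is a boundary term
  smaller by \<open>1 / L\<close>. Hence \<open>w^2\<close> keeps a fixed share of the energy, which
  is bounded below.\<close>

lemma N2_lower:
  assumes "L \<ge> C1 / c1"
  shows "c1 / (4 + 4 * c) * (1 / L) ^ (m - 1) \<le> N 2"
proof -
  define W where "W \<theta> = \<bar>H \<theta>\<bar> ^ 2 * sin \<theta> ^ (m - 1)" for \<theta>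
  define B where "B \<theta> = sin \<theta> ^ (m - 1) * (H \<theta> * q \<theta>)" for \<theta>
  define B' where "B' \<theta> = sin \<theta> ^ (m - 1) * ((q \<theta>)\<^sup>2 - (H \<theta>)\<^sup>2 * (L\<^sup>2 + (\<nu> - \<nu>\<^sup>2) / (sin \<theta>)\<^sup>2))" for \<theta>
  define e where "e = c1 * (1 / L) ^ (m - 1)"
  define J where "J = {pi / 4..3 * pi / 4}"
  have inJ: "0 < \<theta>" "\<theta> < pi" "\<theta>0 \<le> \<theta>" "\<theta> \<le> pi - \<theta>0" "(sin \<theta>)\<^sup>2 \<ge> 1 / 2" if "\<theta> \<in> J" for \<theta>
  proof -
    show "0 < \<theta>" "\<theta> < pi" "\<theta>0 \<le> \<theta>" "\<theta> \<le> pi - \<theta>0" using that theta0(3) pi_gt_zero unfolding J_def atLeastAtMost_iff by linarith+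
    have "\<bar>cos \<theta>\<bar> \<le> sqrt 2 / 2"
    proof -
      have "cos \<theta> \<le> cos (pi / 4)" using that by (intro cos_monotone_0_pi_le) (auto simp: J_def)
      moreover have "- cos \<theta> \<le> cos (pi / 4)"
        using that cos_monotone_0_pi_le[of "pi / 4" "pi - \<theta>"] by (auto simp: J_def)
      ultimately show ?thesis by (simp add: cos_45 abs_le_iff)
    qed
    then have "\<bar>cos \<theta>\<bar>\<^sup>2 \<le> (sqrt 2 / 2)\<^sup>2" by (rule power_mono) simp
    then have "(cos \<theta>)\<^sup>2 \<le> 1 / 2" by (simp add: power_divide)
    then show "(sin \<theta>)\<^sup>2 \<ge> 1 / 2" unfolding sin_squared_eq by simp
  qed
  have L2: "L\<^sup>2 \<ge> 1" using L_ge(1) by (simp add: one_le_power)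
  have Elow: "e \<le> E \<theta>" if "\<theta> \<in> J" for \<theta>
  proof -
    have "e = ((1 / 4) * (1 / (4 * L)) ^ (m - 1)) * exp (- (4 * c))"
      by (simp add: e_def c1_def power_mult_distrib power_divide)
    also have "\<dots> \<le> E \<theta>0 * exp (- (4 * c))" by (intro mult_right_mono E_theta0) simp
    also have "\<dots> \<le> E \<theta>" using energy_comparison(2) inJ[OF that] by blast
    finally show ?thesis .
  qed
  have pt: "e - (2 + 2 * c) * W \<theta> \<le> B' \<theta> / L\<^sup>2" if "\<theta> \<in> J" for \<theta>
  proof -
    have s: "sin \<theta> > 0" using inJ[OF that] by (intro sin_gt_zero)
    have W0: "W \<theta> \<ge> 0" unfolding W_def using s by simp
    define t where "t = (\<nu> - \<nu>\<^sup>2) / (L\<^sup>2 * (sin \<theta>)\<^sup>2)"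
    \<comment> \<open>On \<open>J\<close> the squared sine is at least \<open>1/2\<close> and
      \<open>L^2 >= 1\<close>, so the potential, divided by \<open>L^2\<close>, is at most
      \<open>2 * c\<close>.\<close>
    have t1: "\<bar>t\<bar> \<le> 2 * c"
    proof -
      have "1 * (1 / 2) \<le> L\<^sup>2 * (sin \<theta>)\<^sup>2" using L2 inJ(5)[OF that] by (intro mult_mono) auto
      then have "\<bar>t\<bar> \<le> c / (1 / 2)" unfolding t_def abs_divide c_def by (intro frac_le) auto
      then show ?thesis by simp
    qed
    have "B' \<theta> / L\<^sup>2 = E \<theta> - W \<theta> * (2 + t)"
    proof -
      have "(q2 - h2 * (L\<^sup>2 + w)) / L\<^sup>2 = q2 / L\<^sup>2 - h2 * (1 + w / L\<^sup>2)" for q2 h2 w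
        using L_ge(2) by (simp add: field_simps)
      then have "B' \<theta> / L\<^sup>2 = sin \<theta> ^ (m - 1) * ((q \<theta>)\<^sup>2 / L\<^sup>2 - (H \<theta>)\<^sup>2 * (1 + t))"
        by (simp add: B'_def t_def times_divide_eq_right[symmetric] mult.commute del: times_divide_eq_right)
      then show ?thesis by (simp add: E_def W_def algebra_simps)
    qed
    moreover have "W \<theta> * (2 + t) \<le> W \<theta> * (2 + 2 * c)" using W0 t1 by (intro mult_left_mono) auto
    ultimately show ?thesis using Elow[OF that] by (simp add: mult.commute)
  qed
  have ft: "((\<lambda>\<theta>. B' \<theta> / L\<^sup>2) has_integral (B (3 * pi / 4) / L\<^sup>2 - B (pi / 4) / L\<^sup>2)) J"
    unfolding J_def
  proof (rule fundamental_theorem_of_calculus)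
    fix t assume "t \<in> {pi / 4..3 * pi / 4}"
    then have t: "0 < t" "t < pi" using inJ[of t] by (auto simp: J_def)
    have "((\<lambda>\<theta>. B \<theta> / L\<^sup>2) has_real_derivative B' t / L\<^sup>2) (at t)"
      unfolding B_def B'_def by (intro DERIV_cdivide dE(2)[OF t])
    then show "((\<lambda>\<theta>. B \<theta> / L\<^sup>2) has_vector_derivative B' t / L\<^sup>2) (at t within {pi / 4..3 * pi / 4})"
      by (auto simp: has_real_derivative_iff_has_vector_derivative intro: has_vector_derivative_at_within)
  qed simp
  have Wi: "W integrable_on {a..b}" for a b
    using N_integrable[of 2 a b] by (simp add: W_def[abs_def])
  have Bb: "\<bar>B \<theta>\<bar> \<le> L / 2 * (C1 * (1 / L) ^ (m - 1))" if "\<theta> \<in> J" for \<theta>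
  proof -
    have "\<bar>B \<theta>\<bar> \<le> L / 2 * E \<theta>" unfolding B_def using Hq_bound(1) inJ[OF that] by blast
    also have "E \<theta> \<le> E \<theta>0 * exp (4 * c)" using energy_comparison(1) inJ[OF that] by blast
    also have "\<dots> \<le> ((1 + (real m)\<^sup>2) * (1 / L) ^ (m - 1)) * exp (4 * c)" by (intro mult_right_mono E_theta0) auto
    also have "\<dots> = C1 * (1 / L) ^ (m - 1)" by (simp add: C1_def)
    finally show ?thesis using L_ge(2) by (simp add: mult_left_mono)
  qed
  have "integral J (\<lambda>\<theta>. e - (2 + 2 * c) * W \<theta>) \<le> B (3 * pi / 4) / L\<^sup>2 - B (pi / 4) / L\<^sup>2"
  proof (rule has_integral_le[OF integrable_integral ft])
    show "(\<lambda>\<theta>. e - (2 + 2 * c) * W \<theta>) integrable_on J"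
      unfolding J_def by (intro integrable_diff integrable_const_ivl integrable_on_mult_right Wi)
  qed (use pt in auto)
  also have "\<dots> \<le> (L / 2 * (C1 * (1 / L) ^ (m - 1)) + L / 2 * (C1 * (1 / L) ^ (m - 1))) / L\<^sup>2"
    unfolding diff_divide_distrib[symmetric]
  proof (rule divide_right_mono)
    have "3 * pi / 4 \<in> J" "pi / 4 \<in> J" by (auto simp: J_def)
    from Bb[OF this(1)] Bb[OF this(2)]
    show "B (3 * pi / 4) - B (pi / 4) \<le> L / 2 * (C1 * (1 / L) ^ (m - 1)) + L / 2 * (C1 * (1 / L) ^ (m - 1))"
      unfolding abs_le_iff by linarith
  qed simp
  also have "\<dots> = C1 * (1 / L) ^ (m - 1) / L" using L_ge(2) by (simp add: field_simps power2_eq_square)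
  \<comment> \<open>The threshold on \<open>L\<close> lets the boundary term use up at most
    \<open>e\<close> of the available \<open>pi / 2 * e\<close>.\<close>
  also have "\<dots> \<le> c1 * (1 / L) ^ (m - 1)"
  proof -
    have "C1 / L \<le> c1" using assms c1_pos L_ge(2) by (simp add: field_simps)
    from mult_right_mono[OF this, of "(1 / L) ^ (m - 1)"] show ?thesis using L_ge(2) by simp
  qed
  also have "integral J (\<lambda>\<theta>. e - (2 + 2 * c) * W \<theta>) = pi / 2 * e - (2 + 2 * c) * integral J W"
    unfolding J_def by (subst Henstock_Kurzweil_Integration.integral_diff)
      (auto intro!: integrable_on_mult_right Wi simp: content_real)
  finally have "pi / 2 * e - e \<le> (2 + 2 * c) * integral J W" by (simp add: e_def)
  moreover have "e / 2 \<le> pi / 2 * e - e"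
  proof -
    have "3 / 2 * e \<le> pi / 2 * e" using pi_gt3 c1_pos L_ge(2) by (intro mult_right_mono) (auto simp: e_def)
    then show ?thesis by simp
  qed
  moreover have "integral J W \<le> N 2"
    unfolding N_def J_def W_def[symmetric]
    by (rule integral_subset_le) (auto intro!: Wi simp: W_def sin_ge_zero zero_le_power)
  ultimately have "e / 2 \<le> (2 + 2 * c) * N 2" using c_nonneg by (meson add_nonneg_nonneg mult_left_mono order_trans zero_le_numeral mult_nonneg_nonneg)
  then have "c1 * (1 / L) ^ (m - 1) \<le> N 2 * (4 + 4 * c)" unfolding e_def by (simp only: algebra_simps)
  moreover have "0 < 4 + 4 * c" using c_nonneg by simp
  ultimately show ?thesis by (simp only: times_divide_eq_left pos_divide_le_eq)
qed

end

end

definition gegenbauer_moment :: "nat \<Rightarrow> nat \<Rightarrow> nat \<Rightarrow> real" where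
  "gegenbauer_moment l m k = integral {0..pi} (\<lambda>\<theta>. \<bar>gegenbauer l m (cos \<theta>)\<bar> ^ k * sin \<theta> ^ (m - 1))"

text \<open>All the moments share the factor \<open>(1 / L)^(m - 1)\<close>, which
  \<open>N2_lower\<close> converts back into \<open>N 2\<close>.\<close>

theorem gegenbauer_integral_bounds:
  assumes "m \<ge> 2"
  obtains C :: real and l0 :: nat where "C > 0" "l0 \<ge> 1"
    "\<And>l. l \<ge> l0 \<Longrightarrow> (\<And>t. \<bar>t\<bar> \<le> 1 \<Longrightarrow> \<bar>gegenbauer l m t\<bar> \<le> 1) \<Longrightarrow>
       0 < gegenbauer_moment l m 2 \<and>
       gegenbauer_moment l m 2 \<le> C / real l \<and>
       gegenbauer_moment l m 3
         \<le> C / sqrt (real l) * gegenbauer_moment l m 2 \<and>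
       gegenbauer_moment l m 5
         \<le> C / real l * gegenbauer_moment l m 2"
proof -
  \<comment> \<open>The instance \<open>l = 1\<close> serves to name the constants, which
    \<open>eqs\<close> shows to be the same for every \<open>l\<close>.\<close>
  interpret G0: gegenbauer_angle m 1 using assms by unfold_locales auto
  define C1 c1 c where "C1 = G0.C1" and "c1 = G0.c1" and "c = G0.c"
  have C1: "C1 \<ge> 1" and c1: "c1 > 0" and c: "c \<ge> 0"
    using G0.C1_ge G0.c1_pos G0.c_nonneg by (auto simp: C1_def c1_def c_def)
  define D where "D = (4 + 4 * c) / c1"
  have D: "D > 0" using c1 c by (simp add: D_def)
  define C where "C = pi * C1 + 16 * C1 * sqrt (2 * C1) * D + 8 * C1 * sqrt (2 * C1) ^ 3 * D"
  define l0 where "l0 = max 1 (nat \<lceil>C1 / c1\<rceil>)"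
  show ?thesis
  proof (rule that[of C l0])
    show "C > 0" unfolding C_def using C1 D by (intro add_pos_nonneg) auto
    show "l0 \<ge> 1" by (simp add: l0_def)
    fix l assume l: "l \<ge> l0" and bd: "\<And>t. \<bar>t\<bar> \<le> 1 \<Longrightarrow> \<bar>gegenbauer l m t\<bar> \<le> 1"
    interpret G: gegenbauer_angle m l using assms l by unfold_locales (auto simp: l0_def)
    have eqs: "G.C1 = C1" "G.c1 = c1" "G.c = c"
      by (simp_all add: C1_def c1_def c_def G.C1_def G0.C1_def G.c1_def G0.c1_def G.c_def G0.c_def G.\<nu>_def G0.\<nu>_def)
    have b: "\<And>t. \<bar>t\<bar> \<le> 1 \<Longrightarrow> \<bar>poly G.y t\<bar> \<le> 1" using bd by (simp add: G.y_def poly_gegenbauer)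
    have lr: "real l \<ge> 1" "real l \<ge> C1 / c1" using l by (auto simp: l0_def)
    then have LL: "G.L \<ge> C1 / c1" using G.L_ge(3) by linarith
    define P where "P = (1 / G.L) ^ (m - 1)"
    have P0: "P > 0" using G.L_ge(2) by (simp add: P_def)
    have Nlow: "P \<le> D * G.N 2"
    proof -
      have "c1 / (4 + 4 * c) * P \<le> G.N 2" using G.N2_lower[OF b] LL unfolding eqs P_def by blast
      then have "D * (c1 / (4 + 4 * c) * P) \<le> D * G.N 2" using D by (intro mult_left_mono) auto
      moreover have "D * (c1 / (4 + 4 * c) * P) = P" using c1 c by (simp add: D_def add_nonneg_eq_0_iff)
      ultimately show ?thesis by simp
    qed
    have N0: "G.N 2 > 0"
      using P0 Nlow D by (metis less_le_trans zero_less_mult_pos)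
    have Hk: "gegenbauer_moment l m k = G.N k" for k
      by (simp add: gegenbauer_moment_def G.N_def G.H_def G.y_def poly_gegenbauer)
    have "G.N 2 \<le> C / real l"
    proof -
      have "P \<le> (1 / G.L) ^ 1" unfolding P_def using G.L_ge(1) assms by (intro power_decreasing) auto
      also have "\<dots> \<le> 1 / real l" using G.L_ge(3) lr by (simp add: frac_le)
      finally have "P \<le> 1 / real l" .
      then have "pi * C1 * P \<le> pi * C1 * (1 / real l)" using C1 by (intro mult_left_mono) auto
      then have "G.N 2 \<le> pi * C1 / real l" using G.N2_upper[OF b] by (simp add: eqs P_def)
      also have "\<dots> \<le> C / real l" unfolding C_def using C1 D lr by (intro divide_right_mono) auto
      finally show ?thesis .
    qed
    moreover have "G.N 3 \<le> C / sqrt (real l) * G.N 2"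
    proof -
      have "G.N 3 \<le> 16 * C1 * sqrt (2 * C1) * P / sqrt (real l)" using G.N3_upper[OF b] by (simp add: eqs P_def)
      also have "\<dots> \<le> 16 * C1 * sqrt (2 * C1) * (D * G.N 2) / sqrt (real l)"
        using C1 by (intro divide_right_mono mult_left_mono Nlow) auto
      also have "\<dots> = (16 * C1 * sqrt (2 * C1) * D) / sqrt (real l) * G.N 2" by simp
      also have "\<dots> \<le> C / sqrt (real l) * G.N 2"
        unfolding C_def using C1 D lr N0 by (intro mult_right_mono divide_right_mono) auto
      finally show ?thesis .
    qed
    moreover have "G.N 5 \<le> C / real l * G.N 2"
    proof -
      have "G.N 5 \<le> 8 * C1 * sqrt (2 * C1) ^ 3 * P / real l" using G.N5_upper[OF b] by (simp add: eqs P_def)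
      also have "\<dots> \<le> 8 * C1 * sqrt (2 * C1) ^ 3 * (D * G.N 2) / real l"
        using C1 by (intro divide_right_mono mult_left_mono Nlow) auto
      also have "\<dots> = (8 * C1 * sqrt (2 * C1) ^ 3 * D) / real l * G.N 2" by simp
      also have "\<dots> \<le> C / real l * G.N 2"
        unfolding C_def using C1 D lr N0 by (intro mult_right_mono divide_right_mono) auto
      finally show ?thesis .
    qed
    ultimately show "0 < gegenbauer_moment l m 2 \<and>
       gegenbauer_moment l m 2 \<le> C / real l \<and>
       gegenbauer_moment l m 3
         \<le> C / sqrt (real l) * gegenbauer_moment l m 2 \<and>
       gegenbauer_moment l m 5
         \<le> C / real l * gegenbauer_moment l m 2"
      unfolding Hk using N0 by blast
  qed
qed

section \<open>Invariance of the surface measure\<close>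

text \<open>By Vitali's theorem an open set is, up to a null set, a countable disjoint union of
  balls, and preimages of balls are balls of equal radius. This gives one inequality for every
  orthogonal map; the inverse map gives the other.\<close>

lemma lborel_distr_orthogonal_transformation:
  fixes T :: "'a::euclidean_space \<Rightarrow> 'a"
  assumes T: "orthogonal_transformation T"
  shows "distr lborel borel T = lborel"
proof -
  have lin: "linear T" using T by (rule orthogonal_transformation_linear)
  have cT: "continuous_on UNIV T" by (rule linear_continuous_on[OF linear_conv_bounded_linear[THEN iffD1, OF lin]])
  have Tm [measurable]: "T \<in> borel_measurable borel" by (rule borel_measurable_continuous_onI[OF cT])
  have super: "emeasure lborel U \<le> emeasure lborel (S -` U)"
    if S: "orthogonal_transformation S" and U: "open U" for S :: "'a \<Rightarrow> 'a" and U
  proof -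
    have linS: "linear S" using S by (rule orthogonal_transformation_linear)
    have cS: "continuous_on UNIV S" by (rule linear_continuous_on[OF linear_conv_bounded_linear[THEN iffD1, OF linS]])
    have Sm [measurable]: "S \<in> borel_measurable borel" by (rule borel_measurable_continuous_onI[OF cS])
    define K where "K = {p :: 'a \<times> real. 0 < snd p \<and> ball (fst p) (snd p) \<subseteq> U}"
    have cov: "\<exists>i. i \<in> K \<and> x \<in> ball (fst i) (snd i) \<and> snd i < d" if x: "x \<in> U" and d: "0 < d" for x d
    proof -
      obtain e where e: "e > 0" "ball x e \<subseteq> U" using U x open_contains_ball by blast
      define r where "r = min e (d / 2)"
      have "ball x r \<subseteq> U" using e(2) by (auto simp: r_def)
      then have "(x, r) \<in> K" using e(1) d by (auto simp: K_def r_def)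
      moreover have "x \<in> ball x r" "r < d" using e(1) d by (auto simp: r_def)
      ultimately show ?thesis by (intro exI[of _ "(x, r)"]) auto
    qed
    obtain C where C: "countable C" "C \<subseteq> K"
      "pairwise (\<lambda>i j. disjnt (ball (fst i) (snd i)) (ball (fst j) (snd j))) C"
      and neg: "negligible (U - (\<Union>i\<in>C. ball (fst i) (snd i)))"
      using Vitali_covering_theorem_balls[of U K fst snd] cov by blast
    define V where "V = (\<Union>i\<in>C. ball (fst i) (snd i))"
    have Vo: "open V" unfolding V_def by auto
    have VU: "V \<subseteq> U" unfolding V_def using C(2) by (auto simp: K_def)
    have bS: "emeasure lborel (S -` ball x r) = emeasure lborel (ball x r)" if "r > 0" for x r
    proof -
      obtain z where z: "S z = x" using orthogonal_transformation_surj[OF S] by (metis surjD)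
      have "S -` ball x r = ball z r"
      proof (rule set_eqI)
        fix y
        have "dist x (S y) = dist z y"
          unfolding dist_norm z[symmetric] linear_diff[OF linS, symmetric] by (rule orthogonal_transformation_norm[OF S])
        then show "y \<in> S -` ball x r \<longleftrightarrow> y \<in> ball z r" by simp
      qed
      then show ?thesis using that by (simp add: emeasure_ball)
    qed
    have dis: "disjoint_family_on (\<lambda>i. ball (fst i) (snd i)) C"
      using C(3) by (auto simp: disjoint_family_on_def pairwise_def disjnt_def)
    have null: "U - V \<in> null_sets lborel"
      using neg U Vo by (auto simp: V_def negligible_iff_null_sets null_sets_completion_iff)
    have "emeasure lborel U = emeasure lborel V"
    proof -
      have "U = V \<union> (U - V)" using VU by blast
      then show ?thesis using emeasure_Un_null_set[of V lborel "U - V"] null Vo by auto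
    qed
    also have "\<dots> = (\<integral>\<^sup>+i. emeasure lborel (ball (fst i) (snd i)) \<partial>count_space C)"
      unfolding V_def by (rule emeasure_UN_countable[OF _ C(1) dis]) auto
    also have "\<dots> = (\<integral>\<^sup>+i. emeasure lborel (S -` ball (fst i) (snd i)) \<partial>count_space C)"
      by (rule nn_integral_cong) (use C(2) bS in \<open>auto simp: K_def\<close>)
    also have "\<dots> = emeasure lborel (\<Union>i\<in>C. S -` ball (fst i) (snd i))"
    proof (rule emeasure_UN_countable[symmetric, OF _ C(1)])
      show "S -` ball (fst i) (snd i) \<in> sets lborel" for i
        using measurable_sets[OF Sm, of "ball (fst i) (snd i)"] by simp
      show "disjoint_family_on (\<lambda>i. S -` ball (fst i) (snd i)) C"
        using dis unfolding disjoint_family_on_def by blast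
    qed
    also have "\<dots> = emeasure lborel (S -` V)" by (simp add: V_def vimage_UN)
    also have "\<dots> \<le> emeasure lborel (S -` U)"
      using measurable_sets[OF Sm, of U] U VU by (intro emeasure_mono) auto
    finally show ?thesis .
  qed
  have eq: "emeasure lborel (T -` U) = emeasure lborel U" if U: "open U" for U
  proof (rule antisym)
    have "open (T -` U)" using cT U by (simp add: continuous_on_open_vimage)
    then have "emeasure lborel (T -` U) \<le> emeasure lborel (inv T -` (T -` U))"
      by (rule super[OF orthogonal_transformation_inv[OF T]])
    also have "inv T -` (T -` U) = U"
      using orthogonal_transformation_surj[OF T] by (auto simp: surj_f_inv_f)
    finally show "emeasure lborel (T -` U) \<le> emeasure lborel U" .
  qed (rule super[OF T U])
  show ?thesis
  proof (rule measure_eqI_generator_eq[where E = "{U. open U}" and \<Omega> = UNIV and A = "\<lambda>i. ball 0 (real i)"])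
    show "Int_stable {U :: 'a set. open U}" by (auto simp: Int_stable_def)
    show "sets (distr lborel borel T) = sigma_sets UNIV {U. open U}" "sets lborel = sigma_sets UNIV {U :: 'a set. open U}"
      by (simp_all add: borel_def)
    show "emeasure (distr lborel borel T) U = emeasure lborel U" if "U \<in> {U. open U}" for U
      using that eq[of U] by (simp add: emeasure_distr)
    show "(\<Union>i. ball 0 (real i)) = (UNIV :: 'a set)"
      by (auto simp: reals_Archimedean2)
    show "emeasure (distr lborel borel T) (ball 0 (real i)) \<noteq> \<infinity>" for i
      using eq[of "ball 0 (real i)"] by (simp add: emeasure_distr emeasure_ball)
  qed auto
qed

lemma sphere_measure_space [simp]: "space (sphere_measure :: 'a::euclidean_space measure) = sphere 0 1"
  by (simp add: sphere_measure_def space_scale_measure space_restrict_space)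

lemma sphere_measure_sets: "sets (sphere_measure :: 'a::euclidean_space measure) = sets (restrict_space borel (sphere 0 1))"
  by (simp add: sphere_measure_def)

lemma sphere_measure_sets_iff: "A \<in> sets (sphere_measure :: 'a::euclidean_space measure) \<longleftrightarrow> A \<in> sets borel \<and> A \<subseteq> sphere 0 1"
  unfolding sphere_measure_sets by (auto simp: sets_restrict_space_iff)

lemma sphere_measure_measurable:
  fixes f :: "'a::euclidean_space \<Rightarrow> 'b::topological_space"
  shows "continuous_on UNIV f \<Longrightarrow> f \<in> borel_measurable sphere_measure"
  unfolding measurable_cong_sets[OF sphere_measure_sets refl]
  by (intro measurable_restrict_space1 borel_measurable_continuous_onI)

lemma sphere_measure_total: "emeasure (sphere_measure :: 'a::euclidean_space measure) (sphere 0 1) = ennreal (real DIM('a) * unit_ball_vol (real DIM('a)))"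
proof -
  have "emeasure (sphere_measure :: 'a measure) (sphere 0 1) = ennreal (real DIM('a)) * emeasure lborel {x::'a \<in> ball 0 1 - {0}. x /\<^sub>R norm x \<in> sphere 0 1}"
    by (rule emeasure_sphere_measure) auto
  also have "{x::'a \<in> ball 0 1 - {0}. x /\<^sub>R norm x \<in> sphere 0 1} = ball 0 1 - {0}" by auto
  also have "emeasure lborel (ball 0 1 - {0::'a}) = emeasure lborel (ball (0::'a) 1)"
    by (rule emeasure_Diff_null_set) auto
  finally show ?thesis by (simp add: emeasure_ball ennreal_mult)
qed

lemma finite_measure_sphere: "finite_measure (sphere_measure :: 'a::euclidean_space measure)"
  by (rule finite_measureI) (simp add: sphere_measure_total)

lemma measure_sphere_pos: "measure (sphere_measure :: 'a::euclidean_space measure) (sphere 0 1) > 0"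
  unfolding measure_def sphere_measure_total by simp

text \<open>Orthogonal maps commute with radial projection, so the truncated cone over a preimage is
  the preimage of the truncated cone, and Lebesgue invariance applies.\<close>

lemma sphere_measure_orthogonal_transformation:
  fixes T :: "'a::euclidean_space \<Rightarrow> 'a"
  assumes T: "orthogonal_transformation T"
  shows "T \<in> measurable sphere_measure sphere_measure" "distr sphere_measure sphere_measure T = sphere_measure"
proof -
  have lin: "linear T" using T by (rule orthogonal_transformation_linear)
  have cT: "continuous_on UNIV T" by (rule linear_continuous_on[OF linear_conv_bounded_linear[THEN iffD1, OF lin]])
  have Tm [measurable]: "T \<in> borel_measurable borel" by (rule borel_measurable_continuous_onI[OF cT])
  show m: "T \<in> measurable sphere_measure sphere_measure"
    unfolding measurable_cong_sets[OF sphere_measure_sets sphere_measure_sets]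
    by (intro measurable_restrict_space3) (auto simp: orthogonal_transformation_norm[OF T])
  show "distr sphere_measure sphere_measure T = sphere_measure"
  proof (rule measure_eqI)
    fix A assume "A \<in> sets (distr sphere_measure sphere_measure T)"
    then have A: "A \<in> sets sphere_measure" "A \<in> sets borel" "A \<subseteq> sphere 0 1" by (auto simp: sphere_measure_sets_iff)
    define B where "B = T -` A \<inter> space (sphere_measure :: 'a measure)"
    have B: "B \<in> sets sphere_measure" unfolding B_def by (rule measurable_sets[OF m A(1)])
    define A' where "A' = {x \<in> ball 0 1 - {0}. x /\<^sub>R norm x \<in> A}"
    have A'm: "A' \<in> sets borel"
    proof -
      have "(\<lambda>x::'a. x /\<^sub>R norm x) \<in> borel_measurable borel" by measurable
      from measurable_sets[OF this A(2)] have "(\<lambda>x::'a. x /\<^sub>R norm x) -` A \<inter> (ball 0 1 - {0}) \<in> sets borel" by auto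
      moreover have "A' = (\<lambda>x::'a. x /\<^sub>R norm x) -` A \<inter> (ball 0 1 - {0})" by (auto simp: A'_def)
      ultimately show ?thesis by simp
    qed
    have "{x \<in> ball 0 1 - {0}. x /\<^sub>R norm x \<in> B} = T -` A'"
    proof -
      have "T x = 0 \<longleftrightarrow> x = 0" for x using orthogonal_transformation_norm[OF T, of x] by auto
      moreover have "T (x /\<^sub>R norm x) = T x /\<^sub>R norm (T x)" for x
        by (simp add: linear_scale[OF lin] orthogonal_transformation_norm[OF T])
      moreover have "norm (T x) = norm x" for x by (rule orthogonal_transformation_norm[OF T])
      moreover have "x \<noteq> 0 \<Longrightarrow> norm (x /\<^sub>R norm x) = 1" for x :: 'a by simp
      ultimately show ?thesis
        unfolding A'_def B_def sphere_measure_space by (intro set_eqI) (simp del: norm_scaleR, blast)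
    qed
    then have "emeasure lborel {x \<in> ball 0 1 - {0}. x /\<^sub>R norm x \<in> B} = emeasure (distr lborel borel T) A'"
      using A'm by (simp add: emeasure_distr)
    also have "\<dots> = emeasure lborel A'" by (simp add: lborel_distr_orthogonal_transformation[OF T])
    finally have "emeasure sphere_measure B = emeasure sphere_measure A"
      using B A by (simp add: emeasure_sphere_measure sphere_measure_sets_iff A'_def)
    then show "emeasure (distr sphere_measure sphere_measure T) A = emeasure sphere_measure A"
      using A(1) by (simp add: emeasure_distr[OF m] B_def)
  qed simp
qed

lemma sphere_integral_orthogonal_transformation:
  fixes T :: "'a::euclidean_space \<Rightarrow> 'a" and f :: "'a \<Rightarrow> real"
  assumes T: "orthogonal_transformation T" and f: "f \<in> borel_measurable sphere_measure"
  shows "(\<integral>x. f (T x) \<partial>sphere_measure) = (\<integral>x. f x \<partial>sphere_measure)"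
  using integral_distr[OF sphere_measure_orthogonal_transformation(1)[OF T] f]
  by (simp add: sphere_measure_orthogonal_transformation(2)[OF T])

section \<open>Reflections, rotations and differentiation under the integral\<close>

lemma orthogonal_transformationI_norm:
  fixes T :: "'a::euclidean_space \<Rightarrow> 'a"
  assumes "linear T" "\<And>x. T x \<bullet> T x = x \<bullet> x"
  shows "orthogonal_transformation T"
  unfolding orthogonal_transformation using assms by (auto simp: norm_eq_sqrt_inner)

text \<open>For \<open>v = 0\<close> the quotient is 0 and the map is the identity, which covers
  equal vectors in \<open>reflection_swap\<close>.\<close>

definition reflection :: "'a::euclidean_space \<Rightarrow> 'a \<Rightarrow> 'a" where
  "reflection v x = x - (2 * (x \<bullet> v) / (v \<bullet> v)) *\<^sub>R v"

lemma reflection_orthogonal: "orthogonal_transformation (reflection v)"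
proof (rule orthogonal_transformationI_norm)
  show "linear (reflection v)"
    by (rule linearI) (auto simp: reflection_def inner_add_left algebra_simps add_divide_distrib)
  show "reflection v x \<bullet> reflection v x = x \<bullet> x" for x
    by (cases "v = 0") (auto simp: reflection_def inner_diff_left inner_diff_right inner_commute field_simps)
qed

lemma reflection_swap:
  assumes "a \<bullet> a = b \<bullet> b"
  shows "reflection (a - b) a = b"
proof (cases "a = b")
  case False
  have "(a - b) \<bullet> (a - b) = 2 * (a \<bullet> (a - b))"
    using assms by (simp add: inner_diff_left inner_diff_right inner_commute)
  moreover have "(a - b) \<bullet> (a - b) \<noteq> 0" using False by simp
  ultimately show ?thesis by (simp add: reflection_def)
qed (simp add: reflection_def)

lemma reflection_fixes: "x \<bullet> v = 0 \<Longrightarrow> reflection v x = x"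
  by (simp add: reflection_def)

text \<open>Two reflections. The first takes \<open>x\<close> to \<open>x'\<close>; the second takes
  the image of \<open>z\<close> to \<open>z'\<close> and fixes \<open>x'\<close>, which is
  orthogonal to their difference because the inner products agree.\<close>

lemma orthogonal_transformation_pair:
  fixes x z x' z' :: "'a::euclidean_space"
  assumes "norm x = 1" "norm x' = 1" "norm z = 1" "norm z' = 1" "x \<bullet> z = x' \<bullet> z'"
  obtains T where "orthogonal_transformation T" "T x = x'" "T z = z'"
proof -
  define T1 where "T1 = reflection (x - x')"
  have T1: "orthogonal_transformation T1" "T1 x = x'"
    unfolding T1_def using assms by (auto intro!: reflection_orthogonal reflection_swap simp: dot_square_norm)
  define T2 where "T2 = reflection (T1 z - z')"
  have "x' \<bullet> T1 z = x' \<bullet> z'" using T1 assms(5) unfolding orthogonal_transformation_def by metis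
  then have "T2 x' = x'" unfolding T2_def by (intro reflection_fixes) (simp add: inner_diff_right)
  moreover have "T2 (T1 z) = z'" unfolding T2_def
    using assms orthogonal_transformation_norm[OF T1(1), of z] by (intro reflection_swap) (simp add: dot_square_norm)
  ultimately show ?thesis
    using that[of "T2 \<circ> T1"] T1 orthogonal_transformation_compose[OF reflection_orthogonal T1(1), of "T1 z - z'"]
    by (simp add: T2_def)
qed

text \<open>For an orthonormal pair \<open>e\<close>, \<open>w\<close>: rotation by the angle
  \<open>s\<close> in their plane, identity on the orthogonal complement.\<close>

definition plane_rotation :: "real \<Rightarrow> 'a::euclidean_space \<Rightarrow> 'a \<Rightarrow> 'a \<Rightarrow> 'a" where
  "plane_rotation s e w x = x + ((cos s - 1) * (x \<bullet> e) + sin s * (x \<bullet> w)) *\<^sub>R e + ((cos s - 1) * (x \<bullet> w) - sin s * (x \<bullet> e)) *\<^sub>R w"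

lemma plane_rotation:
  fixes e w :: "'a::euclidean_space"
  assumes "norm e = 1" "norm w = 1" "e \<bullet> w = 0"
  shows "orthogonal_transformation (plane_rotation s e w)"
    "plane_rotation s e w x \<bullet> e = cos s * (x \<bullet> e) + sin s * (x \<bullet> w)"
proof -
  have ee: "e \<bullet> e = 1" "w \<bullet> w = 1" "w \<bullet> e = 0" using assms by (auto simp: dot_square_norm inner_commute)
  show "orthogonal_transformation (plane_rotation s e w)"
  proof (rule orthogonal_transformationI_norm)
    show "linear (plane_rotation s e w)"
      by (rule linearI) (auto simp: plane_rotation_def inner_add_left algebra_simps)
    fix x :: 'a
    define a b C S where "a = x \<bullet> e" and "b = x \<bullet> w" and "C = cos s" and "S = sin s"
    have CS: "C * C = 1 - S * S" using sin_cos_squared_add[of s] by (simp add: C_def S_def power2_eq_square)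
    define p r where "p = (C - 1) * a + S * b" and "r = (C - 1) * b - S * a"
    have "plane_rotation s e w x \<bullet> plane_rotation s e w x = x \<bullet> x + 2 * p * a + 2 * r * b + p * p + r * r"
      unfolding plane_rotation_def a_def[symmetric] b_def[symmetric] C_def[symmetric] S_def[symmetric] p_def[symmetric] r_def[symmetric]
      using ee assms(3) by (simp add: inner_add_left inner_add_right inner_commute a_def b_def algebra_simps)
    also have "\<dots> = x \<bullet> x"
    proof -
      have "2 * p * a + 2 * r * b + p * p + r * r = (C * C + S * S - 1) * (a * a + b * b)"
        unfolding p_def r_def by (simp add: algebra_simps)
      then show ?thesis using CS by simp
    qed
    finally show "plane_rotation s e w x \<bullet> plane_rotation s e w x = x \<bullet> x" .
  qed
  show "plane_rotation s e w x \<bullet> e = cos s * (x \<bullet> e) + sin s * (x \<bullet> w)"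
    using ee by (simp add: plane_rotation_def inner_add_left algebra_simps)
qed

text \<open>The mean value theorem bounds the difference quotients by \<open>B\<close>, so dominated
  convergence applies along sequences.\<close>

lemma DERIV_integral_bounded:
  fixes g g' :: "real \<Rightarrow> 'x \<Rightarrow> real"
  assumes fin: "finite_measure \<sigma>"
    and m [measurable]: "\<And>s. g s \<in> borel_measurable \<sigma>" "\<And>s. g' s \<in> borel_measurable \<sigma>"
    and d: "\<And>s x. x \<in> space \<sigma> \<Longrightarrow> ((\<lambda>s. g s x) has_real_derivative g' s x) (at s)"
    and b0: "\<And>s x. x \<in> space \<sigma> \<Longrightarrow> \<bar>g s x\<bar> \<le> B"
    and b: "\<And>s x. x \<in> space \<sigma> \<Longrightarrow> \<bar>g' s x\<bar> \<le> B"
  shows "((\<lambda>s. \<integral>x. g s x \<partial>\<sigma>) has_real_derivative (\<integral>x. g' t x \<partial>\<sigma>)) (at t)"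
proof -
  interpret finite_measure \<sigma> by fact
  have ig: "integrable \<sigma> (g s)" for s by (rule integrable_const_bound[where B = B]) (use b0 in auto)
  have lip: "\<bar>(g (t + h) x - g t x) / h\<bar> \<le> B" if x: "x \<in> space \<sigma>" and h: "h \<noteq> 0" for h x
  proof -
    have "\<bar>g (t + h) x - g t x\<bar> \<le> B * \<bar>h\<bar>"
    proof (cases "h > 0")
      case True
      then obtain z where "g (t + h) x - g t x = (t + h - t) * g' z x"
        using MVT2[of t "t + h" "\<lambda>s. g s x" "\<lambda>s. g' s x"] d[OF x] by auto
      then show ?thesis using mult_left_mono[OF b[OF x, of z], of "\<bar>h\<bar>"] by (simp add: abs_mult mult.commute)
    next
      case False
      then obtain z where "g t x - g (t + h) x = (t - (t + h)) * g' z x"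
        using MVT2[of "t + h" t "\<lambda>s. g s x" "\<lambda>s. g' s x"] d[OF x] h by auto
      then have "\<bar>g (t + h) x - g t x\<bar> = \<bar>h\<bar> * \<bar>g' z x\<bar>" by (simp add: abs_minus_commute abs_mult)
      then show ?thesis using mult_left_mono[OF b[OF x, of z], of "\<bar>h\<bar>"] by (simp add: mult.commute)
    qed
    then show ?thesis using h by (simp add: abs_divide pos_divide_le_eq)
  qed
  show ?thesis unfolding DERIV_def
  proof (subst tendsto_at_iff_sequentially, intro allI impI)
    fix X :: "nat \<Rightarrow> real" assume X0: "\<forall>i. X i \<in> UNIV - {0}" and X: "X \<longlonglongrightarrow> 0"
    have "(\<lambda>i. \<integral>x. (g (t + X i) x - g t x) / X i \<partial>\<sigma>) \<longlonglongrightarrow> (\<integral>x. g' t x \<partial>\<sigma>)"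
    proof (rule integral_dominated_convergence[where w = "\<lambda>_. B"])
      show "AE x in \<sigma>. (\<lambda>i. (g (t + X i) x - g t x) / X i) \<longlonglongrightarrow> g' t x"
      proof (rule AE_I2)
        fix x assume "x \<in> space \<sigma>"
        from d[OF this, of t] show "(\<lambda>i. (g (t + X i) x - g t x) / X i) \<longlonglongrightarrow> g' t x"
          unfolding DERIV_def tendsto_at_iff_sequentially using X0 X by (auto simp: o_def)
      qed
      show "AE x in \<sigma>. norm ((g (t + X i) x - g t x) / X i) \<le> B" for i
        using lip X0 by (intro AE_I2) auto
    qed auto
    moreover have "(\<integral>x. (g (t + h) x - g t x) / h \<partial>\<sigma>) = ((\<integral>x. g (t + h) x \<partial>\<sigma>) - (\<integral>x. g t x \<partial>\<sigma>)) / h" for h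
      using ig by simp
    ultimately show "((\<lambda>h. ((\<integral>x. g (t + h) x \<partial>\<sigma>) - (\<integral>x. g t x \<partial>\<sigma>)) / h) \<circ> X) \<longlonglongrightarrow> (\<integral>x. g' t x \<partial>\<sigma>)"
      unfolding o_def by (simp only:)
  qed
qed

section \<open>Zonal functions\<close>

lemma poly_bounded_on:
  fixes p :: "real poly"
  obtains B where "\<And>t. \<bar>t\<bar> \<le> R \<Longrightarrow> \<bar>poly p t\<bar> \<le> B"
proof -
  have "compact (poly p ` {-R..R})" by (intro compact_continuous_image continuous_intros) simp
  then obtain B where "\<forall>t\<in>{-R..R}. norm (poly p t) \<le> B" by (auto dest!: compact_imp_bounded simp: bounded_iff)
  then have "\<bar>poly p t\<bar> \<le> B" if "\<bar>t\<bar> \<le> R" for t using that by (auto simp: abs_le_iff)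
  then show ?thesis by (rule that)
qed

text \<open>For \<open>u\<close> and \<open>v\<close> the inner products with an orthonormal pair,
  the argument of \<open>p\<close> runs along a great circle. Summed over an orthonormal frame of
  directions, the second derivative at 0 becomes the spherical Laplacian of a zonal
  function.\<close>

lemma great_circle_derivatives:
  fixes u v w :: "'x \<Rightarrow> real" and p :: "real poly"
  assumes fin: "finite_measure \<sigma>" and u: "bounded_meas \<sigma> u" and v: "bounded_meas \<sigma> v" and w: "bounded_meas \<sigma> w"
  defines "J \<equiv> \<lambda>s. \<integral>x. poly p (cos s * u x + sin s * v x) * w x \<partial>\<sigma>"
    and "J1 \<equiv> \<lambda>s. \<integral>x. poly (pderiv p) (cos s * u x + sin s * v x) * (cos s * v x - sin s * u x) * w x \<partial>\<sigma>"
  shows "(J has_real_derivative J1 t) (at t)"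
    "(J1 has_real_derivative (\<integral>x. (poly (pderiv (pderiv p)) (u x) * (v x)\<^sup>2 - poly (pderiv p) (u x) * u x) * w x \<partial>\<sigma>)) (at 0)"
proof -
  have [measurable]: "u \<in> borel_measurable \<sigma>" "v \<in> borel_measurable \<sigma>" "w \<in> borel_measurable \<sigma>"
    using u v w by (auto simp: bounded_meas_def)
  have [measurable]: "(\<lambda>t. poly q t) \<in> borel_measurable borel" for q :: "real poly"
    by (intro borel_measurable_continuous_onI continuous_intros)
  obtain U V W where UVW: "\<And>x. x \<in> space \<sigma> \<Longrightarrow> \<bar>u x\<bar> \<le> U" "\<And>x. x \<in> space \<sigma> \<Longrightarrow> \<bar>v x\<bar> \<le> V" "\<And>x. x \<in> space \<sigma> \<Longrightarrow> \<bar>w x\<bar> \<le> W"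
    using u v w unfolding bounded_meas_def by meson
  have rot: "\<bar>cos s * a + sin s * b\<bar> \<le> U + V" if "\<bar>a\<bar> \<le> U" "\<bar>b\<bar> \<le> V" for s a b
  proof -
    have "\<bar>cos s * a + sin s * b\<bar> \<le> \<bar>cos s\<bar> * \<bar>a\<bar> + \<bar>sin s\<bar> * \<bar>b\<bar>" by (metis abs_mult abs_triangle_ineq)
    also have "\<dots> \<le> 1 * U + 1 * V" using that by (intro add_mono mult_mono) auto
    finally show ?thesis by simp
  qed
  have rot2: "\<bar>cos s * b - sin s * a\<bar> \<le> U + V" if "\<bar>a\<bar> \<le> U" "\<bar>b\<bar> \<le> V" for s a b
  proof -
    have "\<bar>cos s * b - sin s * a\<bar> \<le> \<bar>cos s\<bar> * \<bar>b\<bar> + \<bar>sin s\<bar> * \<bar>a\<bar>" by (metis abs_mult abs_triangle_ineq4)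
    also have "\<dots> \<le> 1 * V + 1 * U" using that by (intro add_mono mult_mono) auto
    finally show ?thesis by simp
  qed
  obtain B0 where B0: "\<And>t. \<bar>t\<bar> \<le> U + V \<Longrightarrow> \<bar>poly p t\<bar> \<le> B0" using poly_bounded_on by blast
  obtain B1 where B1: "\<And>t. \<bar>t\<bar> \<le> U + V \<Longrightarrow> \<bar>poly (pderiv p) t\<bar> \<le> B1" using poly_bounded_on by blast
  obtain B2 where B2: "\<And>t. \<bar>t\<bar> \<le> U + V \<Longrightarrow> \<bar>poly (pderiv (pderiv p)) t\<bar> \<le> B2" using poly_bounded_on by blast
  define c where "c s x = cos s * u x + sin s * v x" for s x
  define e where "e s x = cos s * v x - sin s * u x" for s x
  have [measurable]: "c s \<in> borel_measurable \<sigma>" "e s \<in> borel_measurable \<sigma>" for s unfolding c_def e_def by measurable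
  have cb: "\<bar>c s x\<bar> \<le> U + V" "\<bar>e s x\<bar> \<le> U + V" if "x \<in> space \<sigma>" for s x
    unfolding c_def e_def using rot rot2 UVW that by auto
  have dc: "((\<lambda>s. c s x) has_real_derivative e s x) (at s)" for s x
    unfolding c_def e_def by (auto intro!: derivative_eq_intros simp: algebra_simps)
  have de: "((\<lambda>s. e s x) has_real_derivative - c s x) (at s)" for s x
    unfolding c_def e_def by (auto intro!: derivative_eq_intros simp: algebra_simps)
  define M where "M = \<bar>B0\<bar> * \<bar>W\<bar> + \<bar>B1\<bar> * (U + V) * \<bar>W\<bar> + (\<bar>B2\<bar> * (U + V) * (U + V) + \<bar>B1\<bar> * (U + V)) * \<bar>W\<bar>"
  have Wb: "\<bar>w x\<bar> \<le> \<bar>W\<bar>" if "x \<in> space \<sigma>" for x using UVW(3)[OF that] by linarith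
  have b0: "\<bar>poly p (c s x) * w x\<bar> \<le> M \<and> \<bar>poly (pderiv p) (c s x) * e s x * w x\<bar> \<le> M
      \<and> \<bar>(poly (pderiv (pderiv p)) (c s x) * e s x * e s x + (- c s x) * poly (pderiv p) (c s x)) * w x\<bar> \<le> M" if x: "x \<in> space \<sigma>" for s x
  proof -
    have UV: "0 \<le> U + V" using cb[OF x, of s] by linarith
    have 0: "\<bar>poly p (c s x)\<bar> \<le> \<bar>B0\<bar>" "\<bar>poly (pderiv p) (c s x)\<bar> \<le> \<bar>B1\<bar>" "\<bar>poly (pderiv (pderiv p)) (c s x)\<bar> \<le> \<bar>B2\<bar>"
      using B0[OF cb(1)[OF x, of s]] B1[OF cb(1)[OF x, of s]] B2[OF cb(1)[OF x, of s]] by linarith+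
    have 1: "\<bar>poly p (c s x) * w x\<bar> \<le> \<bar>B0\<bar> * \<bar>W\<bar>" unfolding abs_mult by (intro mult_mono 0 Wb x) auto
    have 2: "\<bar>poly (pderiv p) (c s x) * e s x * w x\<bar> \<le> \<bar>B1\<bar> * (U + V) * \<bar>W\<bar>"
      unfolding abs_mult using UV by (intro mult_mono 0 Wb x cb) auto
    have "\<bar>poly (pderiv (pderiv p)) (c s x) * e s x * e s x + (- c s x) * poly (pderiv p) (c s x)\<bar>
        \<le> \<bar>poly (pderiv (pderiv p)) (c s x) * e s x * e s x\<bar> + \<bar>poly (pderiv p) (c s x) * c s x\<bar>"
      by (rule order_trans[OF abs_triangle_ineq]) (simp add: abs_mult mult.commute)
    also have "\<dots> \<le> \<bar>B2\<bar> * (U + V) * (U + V) + \<bar>B1\<bar> * (U + V)"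
      unfolding abs_mult using UV by (intro add_mono mult_mono 0 cb x) auto
    finally have 3: "\<bar>(poly (pderiv (pderiv p)) (c s x) * e s x * e s x + (- c s x) * poly (pderiv p) (c s x)) * w x\<bar>
        \<le> (\<bar>B2\<bar> * (U + V) * (U + V) + \<bar>B1\<bar> * (U + V)) * \<bar>W\<bar>"
      unfolding abs_mult[of _ "w x"] using UV by (intro mult_mono Wb x) auto
    have "0 \<le> \<bar>B0\<bar> * \<bar>W\<bar>" "0 \<le> \<bar>B1\<bar> * (U + V) * \<bar>W\<bar>" "0 \<le> (\<bar>B2\<bar> * (U + V) * (U + V) + \<bar>B1\<bar> * (U + V)) * \<bar>W\<bar>"
      using UV by auto
    moreover have comb: "a \<le> X + Y + Z \<and> b \<le> X + Y + Z \<and> c \<le> X + Y + Z"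
      if "0 \<le> X" "0 \<le> Y" "0 \<le> Z" "a \<le> X" "b \<le> Y" "c \<le> Z" for a b c X Y Z :: real using that by linarith
    ultimately show ?thesis unfolding M_def using 1 2 3 by - (rule comb)
  qed
  show "(J has_real_derivative J1 t) (at t)"
    unfolding J_def J1_def c_def[symmetric] e_def[symmetric]
  proof (rule DERIV_integral_bounded[OF fin, where B = M])
    show "((\<lambda>s. poly p (c s x) * w x) has_real_derivative poly (pderiv p) (c s x) * e s x * w x) (at s)" for s x
      by (rule DERIV_cmult_right[OF DERIV_chain2[OF poly_DERIV dc]])
  qed (use b0 in auto)
  have "(J1 has_real_derivative (\<integral>x. (poly (pderiv (pderiv p)) (c 0 x) * e 0 x * e 0 x + (- c 0 x) * poly (pderiv p) (c 0 x)) * w x \<partial>\<sigma>)) (at 0)"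
    unfolding J1_def c_def[symmetric] e_def[symmetric]
  proof (rule DERIV_integral_bounded[OF fin, where B = M])
    show "((\<lambda>s. poly (pderiv p) (c s x) * e s x * w x) has_real_derivative
       (poly (pderiv (pderiv p)) (c s x) * e s x * e s x + (- c s x) * poly (pderiv p) (c s x)) * w x) (at s)" for s x
      by (rule DERIV_cmult_right[OF DERIV_mult[OF DERIV_chain2[OF poly_DERIV dc] de]])
  qed (use b0 in auto)
  then show "(J1 has_real_derivative (\<integral>x. (poly (pderiv (pderiv p)) (u x) * (v x)\<^sup>2 - poly (pderiv p) (u x) * u x) * w x \<partial>\<sigma>)) (at 0)"
    by (simp add: c_def e_def power2_eq_square mult_ac)
qed

text \<open>Parseval's identity in an orthonormal basis containing \<open>z\<close>, with the term
  of \<open>z\<close> moved to the right.\<close>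

lemma orthonormal_frame:
  fixes z :: "'a::euclidean_space"
  assumes "norm z = 1"
  obtains S where "finite S" "card S = DIM('a) - 1" "\<And>w. w \<in> S \<Longrightarrow> norm w = 1 \<and> z \<bullet> w = 0"
    "\<And>x. (\<Sum>w\<in>S. (x \<bullet> w)\<^sup>2) = x \<bullet> x - (x \<bullet> z)\<^sup>2"
proof -
  obtain B where B: "z \<in> B" "pairwise orthogonal B" "\<And>x. x \<in> B \<Longrightarrow> norm x = 1"
    "independent B" "card B = DIM('a)" "span B = UNIV"
    using vector_in_orthonormal_basis[OF assms] by metis
  have fB: "finite B" using B(4) by (rule finiteI_independent)
  have "x \<bullet> x = (\<Sum>w\<in>B. (x \<bullet> w)\<^sup>2)" for x
  proof -
    have "x \<bullet> x = x \<bullet> (\<Sum>w\<in>B. (x \<bullet> w) *\<^sub>R w)"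
      using orthonormal_basis_expand[OF B(2,3) _ fB, of x] B(6) by simp
    then show ?thesis by (simp add: inner_sum_right power2_eq_square)
  qed
  moreover have "(\<Sum>w\<in>B. (x \<bullet> w)\<^sup>2) = (x \<bullet> z)\<^sup>2 + (\<Sum>w\<in>B - {z}. (x \<bullet> w)\<^sup>2)" for x
    by (rule sum.remove[OF fB B(1)])
  ultimately have "(\<Sum>w\<in>B - {z}. (x \<bullet> w)\<^sup>2) = x \<bullet> x - (x \<bullet> z)\<^sup>2" for x by (metis add_diff_cancel_left')
  moreover have "norm w = 1 \<and> z \<bullet> w = 0" if "w \<in> B - {z}" for w
    using B(1,2,3) that by (auto simp: pairwise_def orthogonal_def)
  ultimately show ?thesis using that[of "B - {z}"] fB B(1,5) by (auto simp: card_Diff_singleton)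
qed

lemma unit_vector_with_inner:
  fixes z :: "'a::euclidean_space"
  assumes z: "norm z = 1" and d: "DIM('a) \<ge> 2" and t: "\<bar>t\<bar> \<le> 1"
  obtains x where "norm x = 1" "x \<bullet> z = t"
proof -
  obtain S where S: "card S = DIM('a) - 1" "\<And>w. w \<in> S \<Longrightarrow> norm w = 1 \<and> z \<bullet> w = 0"
    using orthonormal_frame[OF z] by metis
  have "S \<noteq> {}" using S(1) d by auto
  then obtain w where w: "norm w = 1" "z \<bullet> w = 0" using S(2) by blast
  define x where "x = t *\<^sub>R z + sqrt (1 - t\<^sup>2) *\<^sub>R w"
  have sq: "(sqrt (1 - t\<^sup>2))\<^sup>2 = 1 - t\<^sup>2" using t by (simp add: abs_square_le_1)
  have zz: "z \<bullet> z = 1" "w \<bullet> w = 1" "w \<bullet> z = 0" using w z by (auto simp: dot_square_norm inner_commute)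
  have "x \<bullet> x = t\<^sup>2 + (sqrt (1 - t\<^sup>2))\<^sup>2" unfolding x_def using zz w
    by (simp add: inner_add_left inner_add_right flip: power2_eq_square)
  then have "norm x = 1" unfolding sq by (simp add: norm_eq_sqrt_inner)
  moreover have "x \<bullet> z = t" unfolding x_def using zz by (simp add: inner_add_left)
  ultimately show ?thesis by (rule that)
qed

lemma bounded_meas_inner: "bounded_meas sphere_measure (\<lambda>x. x \<bullet> e)" for e :: "'a::euclidean_space"
proof -
  have "(\<lambda>x. x \<bullet> e) \<in> borel_measurable (sphere_measure :: 'a measure)"
    by (intro sphere_measure_measurable continuous_intros)
  moreover have "\<bar>x \<bullet> e\<bar> \<le> norm e" if "norm x = 1" for x :: 'a
    using Cauchy_Schwarz_ineq2[of x e] that by simp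
  ultimately show ?thesis unfolding bounded_meas_def by (auto intro!: exI[of _ "norm e"])
qed

text \<open>A Laplacian has integral 0: rotations leave \<open>J\<close> constant, so its second
  derivative at 0 vanishes for each direction \<open>w\<close>, and the frame identity turns the sum
  of \<open>(x \<bullet> w)^2\<close> into \<open>1 - (x \<bullet> e)^2\<close>.\<close>

lemma sphere_laplacian_integral:
  fixes e :: "'a::euclidean_space"
  assumes e: "norm e = 1"
  shows "(\<integral>x. (1 - (x \<bullet> e)\<^sup>2) * poly (pderiv (pderiv p)) (x \<bullet> e) - real (DIM('a) - 1) * (x \<bullet> e) * poly (pderiv p) (x \<bullet> e) \<partial>sphere_measure) = 0"
proof -
  let ?\<sigma> = "sphere_measure :: 'a measure"
  obtain S where S: "finite S" "card S = DIM('a) - 1" "\<And>w. w \<in> S \<Longrightarrow> norm w = 1 \<and> e \<bullet> w = 0"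
    "\<And>x. (\<Sum>w\<in>S. (x \<bullet> w)\<^sup>2) = x \<bullet> x - (x \<bullet> e)\<^sup>2"
    using orthonormal_frame[OF e] by metis
  have z: "(\<integral>x. (poly (pderiv (pderiv p)) (x \<bullet> e) * (x \<bullet> w)\<^sup>2 - poly (pderiv p) (x \<bullet> e) * (x \<bullet> e)) * 1 \<partial>?\<sigma>) = 0" if w: "w \<in> S" for w
  proof -
    define J where "J s = (\<integral>x. poly p (cos s * (x \<bullet> e) + sin s * (x \<bullet> w)) * 1 \<partial>?\<sigma>)" for s
    define J1 where "J1 s = (\<integral>x. poly (pderiv p) (cos s * (x \<bullet> e) + sin s * (x \<bullet> w)) * (cos s * (x \<bullet> w) - sin s * (x \<bullet> e)) * 1 \<partial>?\<sigma>)" for s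
    note gd = great_circle_derivatives[OF finite_measure_sphere bounded_meas_inner[of e] bounded_meas_inner[of w] bounded_meas_const[of _ 1], of p,
        folded J_def J1_def]
    have ew: "norm e = 1" "norm w = 1" "e \<bullet> w = 0" using S(3)[OF w] e by auto
    have "J s = (\<integral>x. poly p (x \<bullet> e) \<partial>?\<sigma>)" for s
    proof -
      have m: "(\<lambda>x. poly p (x \<bullet> e)) \<in> borel_measurable ?\<sigma>" by (intro sphere_measure_measurable continuous_intros)
      have "J s = (\<integral>x. poly p (plane_rotation s e w x \<bullet> e) \<partial>?\<sigma>)"
        unfolding J_def plane_rotation(2)[OF ew] by simp
      also have "\<dots> = (\<integral>x. poly p (x \<bullet> e) \<partial>?\<sigma>)"
        by (rule sphere_integral_orthogonal_transformation[OF plane_rotation(1)[OF ew] m])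
      finally show ?thesis .
    qed
    then have "J = (\<lambda>_. \<integral>x. poly p (x \<bullet> e) \<partial>?\<sigma>)" by auto
    then have "(J has_real_derivative 0) (at s)" for s by simp
    then have "J1 s = 0" for s using DERIV_unique[OF gd(1)] by blast
    then have "J1 = (\<lambda>_. 0)" by auto
    then have "(J1 has_real_derivative 0) (at 0)" by simp
    then show ?thesis using DERIV_unique[OF gd(2)] by blast
  qed
  have i: "integrable ?\<sigma> (\<lambda>x. (poly (pderiv (pderiv p)) (x \<bullet> e) * (x \<bullet> w)\<^sup>2 - poly (pderiv p) (x \<bullet> e) * (x \<bullet> e)) * 1)" for w
  proof (rule bounded_meas_integrable[OF finite_measure_sphere])
    have "bounded_meas ?\<sigma> (\<lambda>x. (poly (pderiv (pderiv p)) (x \<bullet> e) * ((x \<bullet> w) * (x \<bullet> w)) + (- 1) * (poly (pderiv p) (x \<bullet> e) * (x \<bullet> e))) * 1)"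
      by (intro bounded_meas_mult bounded_meas_add bounded_meas_poly bounded_meas_const bounded_meas_inner)
    then show "bounded_meas ?\<sigma> (\<lambda>x. (poly (pderiv (pderiv p)) (x \<bullet> e) * (x \<bullet> w)\<^sup>2 - poly (pderiv p) (x \<bullet> e) * (x \<bullet> e)) * 1)"
      by (simp add: power2_eq_square)
  qed
  have "0 = (\<Sum>w\<in>S. (\<integral>x. (poly (pderiv (pderiv p)) (x \<bullet> e) * (x \<bullet> w)\<^sup>2 - poly (pderiv p) (x \<bullet> e) * (x \<bullet> e)) * 1 \<partial>?\<sigma>))"
    using z by simp
  also have "\<dots> = (\<integral>x. (\<Sum>w\<in>S. (poly (pderiv (pderiv p)) (x \<bullet> e) * (x \<bullet> w)\<^sup>2 - poly (pderiv p) (x \<bullet> e) * (x \<bullet> e)) * 1) \<partial>?\<sigma>)"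
    by (rule Bochner_Integration.integral_sum[symmetric]) (rule i)
  also have "\<dots> = (\<integral>x. (1 - (x \<bullet> e)\<^sup>2) * poly (pderiv (pderiv p)) (x \<bullet> e) - real (DIM('a) - 1) * (x \<bullet> e) * poly (pderiv p) (x \<bullet> e) \<partial>?\<sigma>)"
  proof (rule Bochner_Integration.integral_cong[OF refl])
    fix x :: 'a assume "x \<in> space ?\<sigma>"
    then have "x \<bullet> x = 1" by (simp add: dot_square_norm)
    then have "(\<Sum>w\<in>S. poly (pderiv (pderiv p)) (x \<bullet> e) * (x \<bullet> w)\<^sup>2) = (1 - (x \<bullet> e)\<^sup>2) * poly (pderiv (pderiv p)) (x \<bullet> e)"
      unfolding sum_distrib_left[symmetric] S(4) by simp
    then show "(\<Sum>w\<in>S. (poly (pderiv (pderiv p)) (x \<bullet> e) * (x \<bullet> w)\<^sup>2 - poly (pderiv p) (x \<bullet> e) * (x \<bullet> e)) * 1)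
      = (1 - (x \<bullet> e)\<^sup>2) * poly (pderiv (pderiv p)) (x \<bullet> e) - real (DIM('a) - 1) * (x \<bullet> e) * poly (pderiv p) (x \<bullet> e)"
      using S(1,2) by (simp add: sum_subtractf)
  qed
  finally show ?thesis by simp
qed

text \<open>On monomials the annihilation condition is a two-term recursion, so it determines all moments.\<close>

lemma gegenbauer_functional_unique:
  fixes A B :: "real poly \<Rightarrow> real" and m :: real
  assumes addA: "\<And>p q. A (p + q) = A p + A q" and smA: "\<And>c p. A (smult c p) = c * A p"
    and addB: "\<And>p q. B (p + q) = B p + B q" and smB: "\<And>c p. B (smult c p) = c * B p"
    and one: "A 1 = B 1" and m: "m > 0"
    and LA: "\<And>p. A ([:1, 0, -1:] * pderiv (pderiv p) - smult m ([:0, 1:] * pderiv p)) = 0"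
    and LB: "\<And>p. B ([:1, 0, -1:] * pderiv (pderiv p) - smult m ([:0, 1:] * pderiv p)) = 0"
  shows "A p = B p"
proof -
  have rec: "(real (j + 2) * real (j + 1) + m * real (j + 2)) * F (monom 1 (j + 2)) = (real (j + 2) * real (j + 1)) * F (monom 1 j)"
    "m * F (monom 1 1) = 0"
    if ad: "\<And>p q. F (p + q) = F p + F q" and sm: "\<And>c p. F (smult c p) = c * F p"
      and LF: "\<And>p. F ([:1, 0, -1:] * pderiv (pderiv p) - smult m ([:0, 1:] * pderiv p)) = 0" for F :: "real poly \<Rightarrow> real" and j
  proof -
    have X: "[:0, 1::real:] = monom 1 1" "[:1, 0, -1::real:] = monom 1 0 + smult (-1) (monom 1 2)"
      by (simp_all add: monom_altdef numeral_2_eq_2)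
    have "[:1, 0, -1:] * pderiv (pderiv (monom 1 (j + 2))) - smult m ([:0, 1:] * pderiv (monom 1 (j + 2)))
       = smult (real (j + 2) * real (j + 1)) (monom 1 j) + smult (- (real (j + 2) * real (j + 1) + m * real (j + 2))) (monom 1 (j + 2))"
      unfolding X by (simp add: pderiv_monom mult_monom algebra_simps smult_monom flip: monom_eq_iff)
         (simp add: poly_eq_iff algebra_simps)
    then have "F (smult (real (j + 2) * real (j + 1)) (monom 1 j) + smult (- (real (j + 2) * real (j + 1) + m * real (j + 2))) (monom 1 (j + 2))) = 0"
      using LF[of "monom 1 (j + 2)"] by simp
    then show "(real (j + 2) * real (j + 1) + m * real (j + 2)) * F (monom 1 (j + 2)) = (real (j + 2) * real (j + 1)) * F (monom 1 j)"
      unfolding ad sm by (simp add: algebra_simps)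
    have "[:1, 0, -1:] * pderiv (pderiv (monom 1 1)) - smult m ([:0, 1:] * pderiv (monom 1 1)) = smult (- m) (monom 1 1)"
      unfolding X by (simp add: pderiv_monom mult_monom)
    then have "F (smult (- m) (monom 1 1)) = 0" using LF[of "monom 1 1"] by simp
    then show "m * F (monom 1 1) = 0" unfolding sm by simp
  qed
  have mon: "A (monom 1 j) = B (monom 1 j)" for j
  proof (induction j rule: less_induct)
    case (less j)
    consider "j = 0" | "j = 1" | k where "j = k + 2" by (metis One_nat_def add_2_eq_Suc' not0_implies_Suc)
    then show ?case
    proof cases
      case 1 then show ?thesis using one by (simp add: monom_0 flip: one_pCons)
    next
      case 2 then show ?thesis using rec(2)[of A, OF addA smA LA] rec(2)[of B, OF addB smB LB] m by simp
    next
      case 3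
      have c: "real (k + 2) * real (k + 1) + m * real (k + 2) > 0" using m by (intro add_pos_pos) auto
      have "(real (k + 2) * real (k + 1) + m * real (k + 2)) * A (monom 1 (k + 2)) = (real (k + 2) * real (k + 1) + m * real (k + 2)) * B (monom 1 (k + 2))"
        unfolding rec(1)[of A, OF addA smA LA] rec(1)[of B, OF addB smB LB] using less.IH[of k] 3 by simp
      then show ?thesis using c 3 by (simp only: mult_cancel_left) auto
    qed
  qed
  have A0: "A 0 = 0" "B 0 = 0" using smA[of 0 0] smB[of 0 0] by auto
  have sA: "A (\<Sum>i\<in>I. f i) = (\<Sum>i\<in>I. A (f i))" "B (\<Sum>i\<in>I. f i) = (\<Sum>i\<in>I. B (f i))" for f and I :: "nat set"
    by (induction I rule: infinite_finite_induct) (auto simp: A0 addA addB)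
  have "A p = A (\<Sum>i\<le>degree p. smult (coeff p i) (monom 1 i))"
    by (simp add: smult_monom poly_as_sum_of_monoms)
  also have "\<dots> = B (\<Sum>i\<le>degree p. smult (coeff p i) (monom 1 i))"
    unfolding sA smA smB mon ..
  also have "\<dots> = B p" by (simp add: smult_monom poly_as_sum_of_monoms)
  finally show ?thesis .
qed

section \<open>Integration of zonal functions\<close>

text \<open>This is the area of the equatorial sphere, of one dimension less. Defining it through
  the constant function makes the normalisation in \<open>zonal_integral_poly\<close> immediate. The
  argument only carries the dimension.\<close>

definition zonal_constant :: "'a::euclidean_space itself \<Rightarrow> real" where
  "zonal_constant _ = measure (sphere_measure :: 'a measure) (sphere 0 1) / integral {0..pi} (\<lambda>\<theta>. sin \<theta> ^ (DIM('a) - 2))"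

lemma integral_sin_power_pos: "integral {0..pi} (\<lambda>\<theta>. sin \<theta> ^ k) > 0"
proof -
  have "integral {0..pi} (\<lambda>\<theta>. sin \<theta> ^ k) \<ge> integral {pi / 4..3 * pi / 4} (\<lambda>\<theta>. sin \<theta> ^ k)"
    by (rule integral_subset_le) (auto intro!: integrable_continuous_interval continuous_intros sin_ge_zero zero_le_power)
  moreover have "integral {pi / 4..3 * pi / 4} (\<lambda>\<theta>. (1 / 4) ^ k) \<le> integral {pi / 4..3 * pi / 4} (\<lambda>\<theta>. sin \<theta> ^ k)"
  proof (rule integral_le)
    fix t assume t: "t \<in> {pi / 4..3 * pi / 4}"
    define u where "u = (if t \<le> pi / 2 then t else pi - t)"
    have u: "pi / 4 \<le> u" "u \<le> pi / 2" "sin u = sin t" using t by (auto simp: u_def)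
    have "u / 2 \<le> sin u" by (rule sin_ge_half) (use u pi_gt_zero in \<open>auto simp del: pi_gt_zero\<close>)
    then have "1 / 4 \<le> sin t" using u pi_gt3 by simp
    then show "(1 / 4) ^ k \<le> sin t ^ k" by (rule power_mono) simp
  qed (auto intro!: integrable_continuous_interval continuous_intros)
  moreover have "integral {pi / 4..3 * pi / 4} (\<lambda>\<theta>. (1 / 4 :: real) ^ k) > 0"
    by (simp add: content_real)
  ultimately show ?thesis by linarith
qed

lemma zonal_constant_pos: "zonal_constant TYPE('a::euclidean_space) > 0"
  unfolding zonal_constant_def using measure_sphere_pos integral_sin_power_pos by (rule divide_pos_pos)

text \<open>Both functionals annihilate \<open>(1 - t^2) * p'' - m * t * p'\<close>: the left one by
  \<open>sphere_laplacian_integral\<close>, the right one because the integrand is the derivative of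
  \<open>- sin^m * p' (cos)\<close>. They agree on the constant 1, and
  \<open>gegenbauer_functional_unique\<close> applies.\<close>

lemma zonal_integral_poly:
  fixes e :: "'a::euclidean_space"
  assumes e: "norm e = 1" and d: "DIM('a) \<ge> 2"
  shows "(\<integral>x. poly p (x \<bullet> e) \<partial>sphere_measure) = zonal_constant TYPE('a) * integral {0..pi} (\<lambda>\<theta>. poly p (cos \<theta>) * sin \<theta> ^ (DIM('a) - 2))"
proof -
  let ?\<sigma> = "sphere_measure :: 'a measure"
  define m where "m = DIM('a) - 1"
  have m: "DIM('a) - 2 = m - 1" "m \<ge> 1" "DIM('a) - 1 = m" using d by (auto simp: m_def)
  interpret finite_measure ?\<sigma> by (rule finite_measure_sphere)
  have ip: "integrable ?\<sigma> (\<lambda>x. poly p (x \<bullet> e))" for p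
    by (intro bounded_meas_integrable[OF finite_measure_sphere] bounded_meas_poly bounded_meas_inner)
  have hp: "(\<lambda>\<theta>. poly p (cos \<theta>) * sin \<theta> ^ (m - 1)) integrable_on {0..pi}" for p :: "real poly"
    by (intro integrable_continuous_interval continuous_intros)
  show ?thesis
  proof (rule gegenbauer_functional_unique[where m = "real m" and A = "\<lambda>p. \<integral>x. poly p (x \<bullet> e) \<partial>?\<sigma>"
      and B = "\<lambda>p. zonal_constant TYPE('a) * integral {0..pi} (\<lambda>\<theta>. poly p (cos \<theta>) * sin \<theta> ^ (DIM('a) - 2))"])
    fix p q :: "real poly" and c :: real
    show "(\<integral>x. poly (p + q) (x \<bullet> e) \<partial>?\<sigma>) = (\<integral>x. poly p (x \<bullet> e) \<partial>?\<sigma>) + (\<integral>x. poly q (x \<bullet> e) \<partial>?\<sigma>)"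
      using ip by simp
    show "(\<integral>x. poly (smult c p) (x \<bullet> e) \<partial>?\<sigma>) = c * (\<integral>x. poly p (x \<bullet> e) \<partial>?\<sigma>)" by simp
    show "zonal_constant TYPE('a) * integral {0..pi} (\<lambda>\<theta>. poly (p + q) (cos \<theta>) * sin \<theta> ^ (DIM('a) - 2))
       = zonal_constant TYPE('a) * integral {0..pi} (\<lambda>\<theta>. poly p (cos \<theta>) * sin \<theta> ^ (DIM('a) - 2))
         + zonal_constant TYPE('a) * integral {0..pi} (\<lambda>\<theta>. poly q (cos \<theta>) * sin \<theta> ^ (DIM('a) - 2))"
      unfolding m distrib_left[symmetric] using Henstock_Kurzweil_Integration.integral_add[OF hp hp, of p q] by (simp add: distrib_right)
    show "zonal_constant TYPE('a) * integral {0..pi} (\<lambda>\<theta>. poly (smult c p) (cos \<theta>) * sin \<theta> ^ (DIM('a) - 2))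
       = c * (zonal_constant TYPE('a) * integral {0..pi} (\<lambda>\<theta>. poly p (cos \<theta>) * sin \<theta> ^ (DIM('a) - 2)))"
      by (simp add: mult.assoc)
    show "(\<integral>x. poly 1 (x \<bullet> e) \<partial>?\<sigma>) = zonal_constant TYPE('a) * integral {0..pi} (\<lambda>\<theta>. poly 1 (cos \<theta>) * sin \<theta> ^ (DIM('a) - 2))"
      using integral_sin_power_pos[of "DIM('a) - 2"] by (simp add: zonal_constant_def)
    show "(\<integral>x. poly ([:1, 0, -1:] * pderiv (pderiv p) - smult (real m) ([:0, 1:] * pderiv p)) (x \<bullet> e) \<partial>?\<sigma>) = 0"
    proof -
      have "poly ([:1, 0, -1:] * pderiv (pderiv p) - smult (real m) ([:0, 1:] * pderiv p)) t
        = (1 - t\<^sup>2) * poly (pderiv (pderiv p)) t - real m * t * poly (pderiv p) t" for t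
        by (simp add: algebra_simps power2_eq_square)
      then show ?thesis using sphere_laplacian_integral[OF e, of p] unfolding m by presburger
    qed
    have "((\<lambda>\<theta>. poly ([:1, 0, -1:] * pderiv (pderiv p) - smult (real m) ([:0, 1:] * pderiv p)) (cos \<theta>) * sin \<theta> ^ (m - 1))
        has_integral (- (sin pi ^ m * poly (pderiv p) (cos pi)) - - (sin 0 ^ m * poly (pderiv p) (cos 0)))) {0..pi}"
    proof (rule fundamental_theorem_of_calculus)
      fix t :: real
      obtain k where k: "m = Suc k" using m(2) by (cases m) auto
      have "((\<lambda>t. - (sin t ^ m * poly (pderiv p) (cos t))) has_real_derivative
         - (real m * (cos t * sin t ^ (m - Suc 0)) * poly (pderiv p) (cos t) + (poly (pderiv (pderiv p)) (cos t) * - sin t) * sin t ^ m)) (at t within {0..pi})"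
      proof (rule has_field_derivative_at_within)
        have "((\<lambda>t. sin t ^ m) has_real_derivative real m * (cos t * sin t ^ (m - Suc 0))) (at t)"
          using DERIV_power[OF DERIV_sin[of t], of m] by simp
        from DERIV_minus[OF DERIV_mult[OF this DERIV_chain2[OF poly_DERIV DERIV_cos]]]
        show "((\<lambda>t. - (sin t ^ m * poly (pderiv p) (cos t))) has_real_derivative
         - (real m * (cos t * sin t ^ (m - Suc 0)) * poly (pderiv p) (cos t) + (poly (pderiv (pderiv p)) (cos t) * - sin t) * sin t ^ m)) (at t)" .
      qed
      moreover have "- (real m * (cos t * sin t ^ (m - Suc 0)) * poly (pderiv p) (cos t) + (poly (pderiv (pderiv p)) (cos t) * - sin t) * sin t ^ m)
         = poly ([:1, 0, -1:] * pderiv (pderiv p) - smult (real m) ([:0, 1:] * pderiv p)) (cos t) * sin t ^ (m - 1)"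
      proof -
        have "poly [:1, 0, -1:] (cos t) = sin t * sin t" using sin_squared_eq[of t] by (simp add: power2_eq_square)
        then show ?thesis by (simp only: poly_mult poly_diff poly_smult) (simp add: k algebra_simps)
      qed
      ultimately show "((\<lambda>t. - (sin t ^ m * poly (pderiv p) (cos t))) has_vector_derivative
        poly ([:1, 0, -1:] * pderiv (pderiv p) - smult (real m) ([:0, 1:] * pderiv p)) (cos t) * sin t ^ (m - 1)) (at t within {0..pi})"
        by (simp only: has_real_derivative_iff_has_vector_derivative)
    qed simp
    then show "zonal_constant TYPE('a) * integral {0..pi} (\<lambda>\<theta>. poly ([:1, 0, -1:] * pderiv (pderiv p) - smult (real m) ([:0, 1:] * pderiv p)) (cos \<theta>) * sin \<theta> ^ (DIM('a) - 2)) = 0"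
      unfolding m using m(2) by (auto dest!: integral_unique simp: power_0_left)
  qed (use m in auto)
qed

text \<open>Stone-Weierstrass on \<open>[-1, 1]\<close>. Continuous integrands beyond polynomials
  occur as odd powers of the absolute value of \<open>gegenbauer\<close>.\<close>

lemma zonal_integral:
  fixes e :: "'a::euclidean_space" and f :: "real \<Rightarrow> real"
  assumes e: "norm e = 1" and d: "DIM('a) \<ge> 2" and f: "continuous_on UNIV f"
  shows "(\<integral>x. f (x \<bullet> e) \<partial>sphere_measure) = zonal_constant TYPE('a) * integral {0..pi} (\<lambda>\<theta>. f (cos \<theta>) * sin \<theta> ^ (DIM('a) - 2))"
proof -
  let ?\<sigma> = "sphere_measure :: 'a measure"
  let ?A = "\<integral>x. f (x \<bullet> e) \<partial>?\<sigma>" and ?B = "zonal_constant TYPE('a) * integral {0..pi} (\<lambda>\<theta>. f (cos \<theta>) * sin \<theta> ^ (DIM('a) - 2))"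
  let ?V = "measure ?\<sigma> (sphere 0 1)"
  interpret finite_measure ?\<sigma> by (rule finite_measure_sphere)
  have range: "\<bar>x \<bullet> e\<bar> \<le> 1" if "x \<in> space ?\<sigma>" for x using Cauchy_Schwarz_ineq2[of x e] that e by simp
  have fm: "(\<lambda>x. f (x \<bullet> e)) \<in> borel_measurable ?\<sigma>"
    by (intro sphere_measure_measurable continuous_on_compose2[OF f] continuous_intros) auto
  have "compact (f ` {-1..1})" by (intro compact_continuous_image continuous_on_subset[OF f]) auto
  then obtain Bf where Bf: "\<forall>t\<in>{-1..1}. norm (f t) \<le> Bf" by (auto dest!: compact_imp_bounded simp: bounded_iff)
  have fi: "integrable ?\<sigma> (\<lambda>x. f (x \<bullet> e))"
  proof (rule integrable_const_bound[where B = Bf, OF _ fm])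
    show "AE x in ?\<sigma>. norm (f (x \<bullet> e)) \<le> Bf" using Bf range by (intro AE_I2) (auto simp: abs_le_iff)
  qed
  have "\<bar>?A - ?B\<bar> \<le> \<epsilon>" if eps: "\<epsilon> > 0" for \<epsilon>
  proof -
    \<comment> \<open>Both functionals have total mass \<open>?V\<close>, so each side changes by at
      most \<open>\<epsilon> / 2\<close>.\<close>
    define \<eta> where "\<eta> = \<epsilon> / (2 * ?V)"
    have eta: "\<eta> > 0" using eps measure_sphere_pos[where 'a = 'a] by (simp add: \<eta>_def)
    obtain g where g: "real_polynomial_function g" "\<And>t. t \<in> {-1..1} \<Longrightarrow> \<bar>f t - g t\<bar> < \<eta>"
      using Stone_Weierstrass_real_polynomial_function[of "{-1..1::real}" f \<eta>] eta continuous_on_subset[OF f] by auto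
    obtain a n where g': "g = (\<lambda>t. \<Sum>i\<le>n. a i * t ^ i)" using g(1) by (auto simp: real_polynomial_function_iff_sum)
    define p where "p = (\<Sum>i\<le>n. monom (a i) i)"
    have p: "poly p t = g t" for t by (simp add: p_def g' poly_sum poly_monom)
    have pf: "\<bar>f t - poly p t\<bar> \<le> \<eta>" if "\<bar>t\<bar> \<le> 1" for t using g(2)[of t] that by (auto simp: p abs_le_iff)
    have ip: "integrable ?\<sigma> (\<lambda>x. poly p (x \<bullet> e))"
      by (intro bounded_meas_integrable[OF finite_measure_sphere] bounded_meas_poly bounded_meas_inner)
    have "\<bar>?A - (\<integral>x. poly p (x \<bullet> e) \<partial>?\<sigma>)\<bar> = \<bar>\<integral>x. f (x \<bullet> e) - poly p (x \<bullet> e) \<partial>?\<sigma>\<bar>" using fi ip by simp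
    also have "\<dots> \<le> (\<integral>x. \<bar>f (x \<bullet> e) - poly p (x \<bullet> e)\<bar> \<partial>?\<sigma>)" by (rule integral_abs_bound)
    also have "\<dots> \<le> (\<integral>x. \<eta> \<partial>?\<sigma>)" by (rule integral_mono) (use fi ip pf range in auto)
    also have "\<dots> = \<epsilon> / 2" using measure_sphere_pos[where 'a = 'a] by (simp add: \<eta>_def)
    finally have 1: "\<bar>?A - (\<integral>x. poly p (x \<bullet> e) \<partial>?\<sigma>)\<bar> \<le> \<epsilon> / 2" .
    let ?s = "\<lambda>\<theta>. sin \<theta> ^ (DIM('a) - 2)"
    have c1: "(\<lambda>\<theta>. f (cos \<theta>) * ?s \<theta>) integrable_on {0..pi}" "(\<lambda>\<theta>. poly p (cos \<theta>) * ?s \<theta>) integrable_on {0..pi}" "?s integrable_on {0..pi}"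
      by (intro integrable_continuous_interval continuous_intros continuous_on_compose2[OF f]; simp)+
    have "\<bar>integral {0..pi} (\<lambda>\<theta>. f (cos \<theta>) * ?s \<theta>) - integral {0..pi} (\<lambda>\<theta>. poly p (cos \<theta>) * ?s \<theta>)\<bar>
       = \<bar>integral {0..pi} (\<lambda>\<theta>. f (cos \<theta>) * ?s \<theta> - poly p (cos \<theta>) * ?s \<theta>)\<bar>"
      using Henstock_Kurzweil_Integration.integral_diff[OF c1(1,2)] by simp
    also have "\<dots> \<le> integral {0..pi} (\<lambda>\<theta>. \<eta> * ?s \<theta>)"
    proof -
      have "norm (integral {0..pi} (\<lambda>\<theta>. f (cos \<theta>) * ?s \<theta> - poly p (cos \<theta>) * ?s \<theta>)) \<le> integral {0..pi} (\<lambda>\<theta>. \<eta> * ?s \<theta>)"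
      proof (rule integral_norm_bound_integral)
        show "(\<lambda>\<theta>. f (cos \<theta>) * ?s \<theta> - poly p (cos \<theta>) * ?s \<theta>) integrable_on {0..pi}" using c1 by (intro integrable_diff)
        show "(\<lambda>\<theta>. \<eta> * ?s \<theta>) integrable_on {0..pi}" using c1 by (intro integrable_on_mult_right)
        fix t assume t: "t \<in> {0..pi}"
        have "\<bar>f (cos t) - poly p (cos t)\<bar> * ?s t \<le> \<eta> * ?s t"
          using pf[of "cos t"] t by (intro mult_right_mono) (auto simp: sin_ge_zero)
        then show "norm (f (cos t) * ?s t - poly p (cos t) * ?s t) \<le> \<eta> * ?s t"
          using t by (simp add: left_diff_distrib[symmetric] abs_mult sin_ge_zero)
      qed
      then show ?thesis by simp
    qed
    also have "\<dots> = \<eta> * integral {0..pi} ?s" by simp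
    finally have 2: "\<bar>integral {0..pi} (\<lambda>\<theta>. f (cos \<theta>) * ?s \<theta>) - integral {0..pi} (\<lambda>\<theta>. poly p (cos \<theta>) * ?s \<theta>)\<bar> \<le> \<eta> * integral {0..pi} ?s" .
    have "\<bar>?B - zonal_constant TYPE('a) * integral {0..pi} (\<lambda>\<theta>. poly p (cos \<theta>) * ?s \<theta>)\<bar> \<le> zonal_constant TYPE('a) * (\<eta> * integral {0..pi} ?s)"
      unfolding right_diff_distrib[symmetric] abs_mult using 2 zonal_constant_pos[where 'a = 'a] by (simp add: mult_left_mono)
    also have "\<dots> = \<epsilon> / 2"
      using integral_sin_power_pos[of "DIM('a) - 2"] measure_sphere_pos[where 'a = 'a] by (simp add: zonal_constant_def \<eta>_def)
    finally show ?thesis using 1 unfolding zonal_integral_poly[OF e d] by linarith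
  qed
  then have "\<bar>?A - ?B\<bar> \<le> 0" using field_le_epsilon[of "\<bar>?A - ?B\<bar>" 0] by simp
  then show ?thesis by linarith
qed

text \<open>At \<open>t = 1\<close> the equation degenerates and forces \<open>D' 1 = 0\<close>, and \<open>D'\<close> solves an equation of the same type.\<close>

lemma gegenbauer_ode_unique:
  fixes D :: "real poly"
  assumes "\<And>t. (1 - t\<^sup>2) * poly (pderiv (pderiv D)) t - M * t * poly (pderiv D) t + \<mu> * poly D t = 0"
    and "M > 0" "poly D 1 = 0"
  shows "D = 0"
  using assms
proof (induction "degree D" arbitrary: D M \<mu>)
  case 0
  then obtain c where "D = [:c:]" by (metis degree_eq_zeroE)
  then show ?case using 0 by simp
next
  case (Suc n)
  have ode: "(1 - t\<^sup>2) * poly (pderiv (pderiv (pderiv D))) t - (M + 2) * t * poly (pderiv (pderiv D)) t + (\<mu> - M) * poly (pderiv D) t = 0" for t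
  proof -
    have "((\<lambda>t. (1 - t\<^sup>2) * poly (pderiv (pderiv D)) t - M * t * poly (pderiv D) t + \<mu> * poly D t) has_real_derivative
      ((1 - t\<^sup>2) * poly (pderiv (pderiv (pderiv D))) t - (M + 2) * t * poly (pderiv (pderiv D)) t + (\<mu> - M) * poly (pderiv D) t)) (at t)"
      by (auto intro!: derivative_eq_intros poly_DERIV[THEN DERIV_chain2] simp: algebra_simps power2_eq_square)
    moreover have "((\<lambda>t. (1 - t\<^sup>2) * poly (pderiv (pderiv D)) t - M * t * poly (pderiv D) t + \<mu> * poly D t) has_real_derivative 0) (at t)"
      using Suc.prems(1) by simp
    ultimately show ?thesis by (rule DERIV_unique)
  qed
  have "poly (pderiv D) 1 = 0" using Suc.prems(1)[of 1] Suc.prems(2,3) by simp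
  moreover have "n = degree (pderiv D)" using Suc.hyps(2) by (simp add: degree_pderiv)
  ultimately have "pderiv D = 0" using Suc.hyps(1)[of "pderiv D" "M + 2" "\<mu> - M"] ode Suc.prems(2) by simp
  then have "degree D = 0" by (simp add: pderiv_eq_0_iff)
  then show ?case using Suc.hyps(2) by simp
qed

section \<open>Convolution and the reproducing property\<close>

text \<open>The reflection along \<open>e\<close> fixes \<open>x\<close> and changes the sign of
  \<open>y \<bullet> e\<close>.\<close>

lemma sphere_integral_odd:
  fixes x e :: "'a::euclidean_space"
  assumes "x \<bullet> e = 0" "e \<noteq> 0" "odd k"
  shows "(\<integral>y. poly p (y \<bullet> x) * (y \<bullet> e) ^ k \<partial>sphere_measure) = 0"
proof -
  let ?\<sigma> = "sphere_measure :: 'a measure"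
  have m: "(\<lambda>y. poly p (y \<bullet> x) * (y \<bullet> e) ^ k) \<in> borel_measurable ?\<sigma>"
    by (intro sphere_measure_measurable continuous_intros)
  have r: "reflection e y \<bullet> x = y \<bullet> x" "reflection e y \<bullet> e = - (y \<bullet> e)" for y
  proof -
    have "e \<bullet> x = 0" using assms(1) by (simp add: inner_commute)
    then show "reflection e y \<bullet> x = y \<bullet> x" "reflection e y \<bullet> e = - (y \<bullet> e)"
      using assms(2) by (simp_all add: reflection_def inner_diff_left)
  qed
  have "(\<integral>y. poly p (y \<bullet> x) * (y \<bullet> e) ^ k \<partial>?\<sigma>) = (\<integral>y. poly p (reflection e y \<bullet> x) * (reflection e y \<bullet> e) ^ k \<partial>?\<sigma>)"
    by (rule sphere_integral_orthogonal_transformation[OF reflection_orthogonal m, symmetric])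
  also have "\<dots> = - (\<integral>y. poly p (y \<bullet> x) * (y \<bullet> e) ^ k \<partial>?\<sigma>)"
    unfolding r using assms(3) by simp
  finally show ?thesis by simp
qed

text \<open>Rotate so that \<open>x\<close> becomes \<open>x0\<close> and \<open>z\<close> becomes
  \<open>\<tau> *\<^sub>R x0 + s *\<^sub>R e\<close> with \<open>s = sqrt (1 - \<tau>^2)\<close>,
  and expand \<open>q\<close> binomially. Odd powers of \<open>y \<bullet> e\<close> integrate to 0,
  so only even powers of \<open>s\<close> survive, and these are polynomials in \<tau>.\<close>

lemma zonal_convolution:
  fixes p q :: "real poly"
  assumes d: "DIM('a) \<ge> 2"
  obtains F where "\<And>x z :: 'a::euclidean_space. norm x = 1 \<Longrightarrow> norm z = 1 \<Longrightarrow>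
    (\<integral>y. poly p (y \<bullet> x) * poly q (y \<bullet> z) \<partial>sphere_measure) = poly F (x \<bullet> z)"
proof -
  let ?\<sigma> = "sphere_measure :: 'a measure"
  obtain x0 :: 'a where x0: "norm x0 = 1" using norm_Basis nonempty_Basis by blast
  obtain S where S: "finite S" "card S = DIM('a) - 1" "\<And>w. w \<in> S \<Longrightarrow> norm w = 1 \<and> x0 \<bullet> w = 0"
    using orthonormal_frame[OF x0] by metis
  have "S \<noteq> {}" using S(2) d by auto
  then obtain e where e: "norm e = 1" "x0 \<bullet> e = 0" using S(3) by blast
  define A where "A k i = (\<integral>y. poly p (y \<bullet> x0) * ((y \<bullet> x0) ^ i * (y \<bullet> e) ^ k) \<partial>?\<sigma>)" for k i
  have Aodd: "A k i = 0" if "odd k" for k i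
    using sphere_integral_odd[of x0 e k "p * monom 1 i"] e that by (force simp: A_def poly_monom mult.assoc)
  define F where "F = (\<Sum>j\<le>degree q. \<Sum>k\<le>j. smult (coeff q j * (of_nat (j choose k) * A k (j - k))) ([:1, 0, -1:] ^ (k div 2) * [:0, 1:] ^ (j - k)))"
  have int: "integrable ?\<sigma> (\<lambda>y. poly p (y \<bullet> x0) * ((y \<bullet> x0) ^ i * (y \<bullet> e) ^ k))" for i k
  proof -
    have "bounded_meas ?\<sigma> (\<lambda>y. poly p (y \<bullet> x0) * (poly (monom 1 i) (y \<bullet> x0) * poly (monom 1 k) (y \<bullet> e)))"
      by (intro bounded_meas_mult bounded_meas_poly bounded_meas_inner)
    then show ?thesis by (intro bounded_meas_integrable[OF finite_measure_sphere]) (simp add: poly_monom)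
  qed
  have "(\<integral>y. poly p (y \<bullet> x) * poly q (y \<bullet> z) \<partial>?\<sigma>) = poly F (x \<bullet> z)" if xz: "norm x = 1" "norm z = 1" for x z :: 'a
  proof -
    define \<tau> where "\<tau> = x \<bullet> z"
    define s where "s = sqrt (1 - \<tau>\<^sup>2)"
    have "\<bar>\<tau>\<bar> \<le> 1" using Cauchy_Schwarz_ineq2[of x z] xz by (simp add: \<tau>_def)
    then have s2: "s\<^sup>2 = 1 - \<tau>\<^sup>2" unfolding s_def by (simp add: abs_square_le_1)
    define z' where "z' = \<tau> *\<^sub>R x0 + s *\<^sub>R e"
    have e0: "x0 \<bullet> x0 = 1" "e \<bullet> e = 1" "e \<bullet> x0 = 0" using x0 e by (auto simp: dot_square_norm inner_commute)
    have "z' \<bullet> z' = \<tau>\<^sup>2 + s\<^sup>2" unfolding z'_def using e0 e(2)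
      by (simp add: inner_add_left inner_add_right power2_eq_square)
    then have z': "norm z' = 1" using s2 by (simp add: norm_eq_sqrt_inner)
    have "x0 \<bullet> z' = x \<bullet> z" unfolding z'_def using e0 e(2) by (simp add: inner_add_right \<tau>_def)
    then obtain R where R: "orthogonal_transformation R" "R x0 = x" "R z' = z"
      using orthogonal_transformation_pair[of x0 x z' z] x0 xz z' by metis
    have inn: "R y \<bullet> x = y \<bullet> x0" "R y \<bullet> z = y \<bullet> z'" for y
      using R(1) unfolding R(2,3)[symmetric] by (simp_all add: orthogonal_transformation_def)
    have m: "(\<lambda>y. poly p (y \<bullet> x) * poly q (y \<bullet> z)) \<in> borel_measurable ?\<sigma>"
      by (intro sphere_measure_measurable continuous_intros)
    have "(\<integral>y. poly p (y \<bullet> x) * poly q (y \<bullet> z) \<partial>?\<sigma>) = (\<integral>y. poly p (y \<bullet> x0) * poly q (y \<bullet> z') \<partial>?\<sigma>)"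
      using sphere_integral_orthogonal_transformation[OF R(1) m] by (simp add: inn)
    also have "\<dots> = (\<integral>y. (\<Sum>j\<le>degree q. \<Sum>k\<le>j. coeff q j * (of_nat (j choose k) * s ^ k * \<tau> ^ (j - k)) * (poly p (y \<bullet> x0) * ((y \<bullet> x0) ^ (j - k) * (y \<bullet> e) ^ k))) \<partial>?\<sigma>)"
    proof (rule Bochner_Integration.integral_cong[OF refl])
      fix y :: 'a
      have "y \<bullet> z' = s * (y \<bullet> e) + \<tau> * (y \<bullet> x0)" by (simp add: z'_def inner_add_right)
      then show "poly p (y \<bullet> x0) * poly q (y \<bullet> z') = (\<Sum>j\<le>degree q. \<Sum>k\<le>j. coeff q j * (of_nat (j choose k) * s ^ k * \<tau> ^ (j - k)) * (poly p (y \<bullet> x0) * ((y \<bullet> x0) ^ (j - k) * (y \<bullet> e) ^ k)))"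
        by (simp add: poly_altdef binomial_ring sum_distrib_left power_mult_distrib mult_ac)
    qed
    also have "\<dots> = (\<Sum>j\<le>degree q. \<Sum>k\<le>j. coeff q j * (of_nat (j choose k) * s ^ k * \<tau> ^ (j - k)) * A k (j - k))"
      using int by (simp add: A_def)
    also have "\<dots> = poly F \<tau>"
      unfolding F_def poly_sum
    proof (intro sum.cong refl)
      fix j k
      show "coeff q j * (of_nat (j choose k) * s ^ k * \<tau> ^ (j - k)) * A k (j - k)
        = poly (smult (coeff q j * (of_nat (j choose k) * A k (j - k))) ([:1, 0, -1:] ^ (k div 2) * [:0, 1:] ^ (j - k))) \<tau>"
      proof (cases "even k")
        case True
        then have "s ^ k = (s\<^sup>2) ^ (k div 2)" by (simp flip: power_mult)
        also have "\<dots> = poly [:1, 0, -1:] \<tau> ^ (k div 2)" unfolding s2 by (simp add: power2_eq_square)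
        finally show ?thesis by (simp add: poly_power)
      next
        case False then show ?thesis using Aodd by simp
      qed
    qed
    finally show ?thesis unfolding \<tau>_def .
  qed
  then show ?thesis by (rule that)
qed

text \<open>By the differential equation the zonal Laplacian multiplies the integrand by
  \<open>- lam\<close>; a Laplacian has integral 0, and \<open>lam > 0\<close> for
  \<open>l >= 1\<close>.\<close>

lemma gegenbauer_sphere_mean:
  fixes e :: "'a::euclidean_space"
  assumes "norm e = 1" "DIM('a) = m + 1" "m \<ge> 1" "l \<ge> 1"
  shows "(\<integral>x. gegenbauer l m (x \<bullet> e) \<partial>sphere_measure) = 0"
proof -
  let ?\<sigma> = "sphere_measure :: 'a measure"
  define lam where "lam = real l * (real l + real m - 1)"
  have "lam > 0" using assms unfolding lam_def by (intro mult_pos_pos) auto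
  have ode: "(1 - t\<^sup>2) * poly (pderiv (pderiv (gegenbauer_poly l m))) t - real m * t * poly (pderiv (gegenbauer_poly l m)) t = - lam * poly (gegenbauer_poly l m) t" for t
    using gegenbauer_ode[of t l m, folded lam_def] by linarith
  have "- lam * (\<integral>x. gegenbauer l m (x \<bullet> e) \<partial>?\<sigma>) = 0"
    using sphere_laplacian_integral[OF assms(1), of "gegenbauer_poly l m"]
    unfolding assms(2) add_diff_cancel_right' ode poly_gegenbauer by simp
  then show ?thesis using \<open>lam > 0\<close> by simp
qed

text \<open>The convolution is \<open>poly F (x \<bullet> z)\<close>. Applying the Laplacian in
  \<open>z\<close> under the integral shows that \<open>F\<close> solves the same equation as
  \<open>G\<close>; polynomial solutions are determined by their value at 1, and that of
  \<open>F\<close> is the integral of \<open>G^2\<close>.\<close>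

lemma gegenbauer_reproducing:
  fixes x z :: "'a::euclidean_space"
  assumes xz: "norm x = 1" "norm z = 1" and d: "DIM('a) = m + 1" and m: "m \<ge> 2"
  shows "(\<integral>y. gegenbauer l m (y \<bullet> x) * gegenbauer l m (y \<bullet> z) \<partial>sphere_measure)
    = zonal_constant TYPE('a) * gegenbauer_moment l m 2 * gegenbauer l m (x \<bullet> z)"
proof -
  let ?\<sigma> = "sphere_measure :: 'a measure"
  define G where "G = gegenbauer_poly l m"
  define lam where "lam = real l * (real l + real m - 1)"
  have ode: "(1 - t\<^sup>2) * poly (pderiv (pderiv G)) t - real m * t * poly (pderiv G) t = - lam * poly G t" for t
    using gegenbauer_ode[of t l m, folded lam_def] unfolding G_def by linarith
  have "DIM('a) \<ge> 2" using d m by simp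
  then obtain F where F: "\<And>x z :: 'a. norm x = 1 \<Longrightarrow> norm z = 1 \<Longrightarrow>
    (\<integral>y. poly G (y \<bullet> x) * poly G (y \<bullet> z) \<partial>?\<sigma>) = poly F (x \<bullet> z)"
    using zonal_convolution[where p = G and q = G] by blast
  have Fode: "(1 - (x \<bullet> z)\<^sup>2) * poly (pderiv (pderiv F)) (x \<bullet> z) - real m * (x \<bullet> z) * poly (pderiv F) (x \<bullet> z) = - lam * poly F (x \<bullet> z)"
    if xz: "norm x = 1" "norm z = 1" for x z :: 'a
  proof -
    define g where "g w y = (poly (pderiv (pderiv G)) (y \<bullet> z) * (y \<bullet> w)\<^sup>2 - poly (pderiv G) (y \<bullet> z) * (y \<bullet> z)) * poly G (y \<bullet> x)" for w y
    obtain S where S: "finite S" "card S = DIM('a) - 1" "\<And>w. w \<in> S \<Longrightarrow> norm w = 1 \<and> z \<bullet> w = 0"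
      "\<And>x. (\<Sum>w\<in>S. (x \<bullet> w)\<^sup>2) = x \<bullet> x - (x \<bullet> z)\<^sup>2"
      using orthonormal_frame[OF xz(2)] by metis
    have eq: "(\<integral>y. g w y \<partial>?\<sigma>) = poly (pderiv (pderiv F)) (x \<bullet> z) * (x \<bullet> w)\<^sup>2 - poly (pderiv F) (x \<bullet> z) * (x \<bullet> z)" if w: "w \<in> S" for w
    proof -
      define J where "J s = (\<integral>y. poly G (cos s * (y \<bullet> z) + sin s * (y \<bullet> w)) * poly G (y \<bullet> x) \<partial>?\<sigma>)" for s
      define J1 where "J1 s = (\<integral>y. poly (pderiv G) (cos s * (y \<bullet> z) + sin s * (y \<bullet> w)) * (cos s * (y \<bullet> w) - sin s * (y \<bullet> z)) * poly G (y \<bullet> x) \<partial>?\<sigma>)" for s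
      note gd = great_circle_derivatives[OF finite_measure_sphere bounded_meas_inner[of z] bounded_meas_inner[of w] bounded_meas_poly[OF bounded_meas_inner[of x]], of G G,
          folded J_def J1_def g_def]
      have ww: "norm w = 1" "z \<bullet> w = 0" using S(3)[OF w] by auto
      have JF: "J s = poly F (cos s * (x \<bullet> z) + sin s * (x \<bullet> w))" for s
      proof -
        have "z \<bullet> z = 1" "w \<bullet> w = 1" "w \<bullet> z = 0" using ww xz by (auto simp: dot_square_norm inner_commute)
        then have "(cos s *\<^sub>R z + sin s *\<^sub>R w) \<bullet> (cos s *\<^sub>R z + sin s *\<^sub>R w) = (cos s)\<^sup>2 + (sin s)\<^sup>2"
          using ww by (simp add: inner_add_left inner_add_right power2_eq_square)
        then have "norm (cos s *\<^sub>R z + sin s *\<^sub>R w) = 1" by (simp add: norm_eq_sqrt_inner)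
        from F[OF xz(1) this] show ?thesis unfolding J_def by (simp add: inner_add_right mult.commute)
      qed
      \<comment> \<open>On a one-point measure space \<open>great_circle_derivatives\<close> is the
        chain rule for \<open>F\<close> itself, which makes the two second derivatives directly
        comparable.\<close>
      have fin: "finite_measure (count_space {()})" by (rule finite_measure_count_space) simp
      have bm: "bounded_meas (count_space {()}) (\<lambda>_. c)" for c by simp
      note gF = great_circle_derivatives[OF fin bm[of "x \<bullet> z"] bm[of "x \<bullet> w"] bm[of 1], of F,
          unfolded lebesgue_integral_count_space_finite[OF finite.insertI[OF finite.emptyI]], simplified, folded JF]
      define K1 where "K1 s = poly (pderiv F) (cos s * (x \<bullet> z) + sin s * (x \<bullet> w)) * (cos s * (x \<bullet> w) - sin s * (x \<bullet> z))" for s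
      have "J1 s = K1 s" for s using DERIV_unique[OF gd(1) gF(1)] unfolding K1_def by simp
      then have "J1 = K1" by auto
      with gd(2) gF(2) show ?thesis unfolding K1_def[symmetric] by (metis DERIV_unique)
    qed
    have i: "integrable ?\<sigma> (g w)" for w
    proof (rule bounded_meas_integrable[OF finite_measure_sphere])
      have "bounded_meas ?\<sigma> (\<lambda>y. (poly (pderiv (pderiv G)) (y \<bullet> z) * ((y \<bullet> w) * (y \<bullet> w)) + (- 1) * (poly (pderiv G) (y \<bullet> z) * (y \<bullet> z))) * poly G (y \<bullet> x))"
        by (intro bounded_meas_mult bounded_meas_add bounded_meas_poly bounded_meas_const bounded_meas_inner)
      then show "bounded_meas ?\<sigma> (g w)" by (simp add: power2_eq_square g_def[abs_def])
    qed
    have cm: "real (card S) = real m" using S(2) d by simp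
    have "(\<Sum>w\<in>S. \<integral>y. g w y \<partial>?\<sigma>) = (\<integral>y. (\<Sum>w\<in>S. g w y) \<partial>?\<sigma>)"
      by (rule Bochner_Integration.integral_sum[symmetric]) (rule i)
    also have "\<dots> = (\<integral>y. - lam * (poly G (y \<bullet> x) * poly G (y \<bullet> z)) \<partial>?\<sigma>)"
    proof (rule Bochner_Integration.integral_cong[OF refl])
      fix y :: 'a assume "y \<in> space ?\<sigma>"
      then have "y \<bullet> y = 1" by (simp add: dot_square_norm)
      then have "(\<Sum>w\<in>S. poly (pderiv (pderiv G)) (y \<bullet> z) * (y \<bullet> w)\<^sup>2) = (1 - (y \<bullet> z)\<^sup>2) * poly (pderiv (pderiv G)) (y \<bullet> z)"
        unfolding sum_distrib_left[symmetric] S(4) by simp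
      then have "(\<Sum>w\<in>S. g w y) = ((1 - (y \<bullet> z)\<^sup>2) * poly (pderiv (pderiv G)) (y \<bullet> z) - real m * (y \<bullet> z) * poly (pderiv G) (y \<bullet> z)) * poly G (y \<bullet> x)"
        unfolding g_def sum_distrib_right[symmetric] using cm by (simp add: sum_subtractf)
      then show "(\<Sum>w\<in>S. g w y) = - lam * (poly G (y \<bullet> x) * poly G (y \<bullet> z))" unfolding ode by simp
    qed
    also have "\<dots> = - lam * poly F (x \<bullet> z)" using F[OF xz] by simp
    also have "(\<Sum>w\<in>S. \<integral>y. g w y \<partial>?\<sigma>) = (\<Sum>w\<in>S. poly (pderiv (pderiv F)) (x \<bullet> z) * (x \<bullet> w)\<^sup>2 - poly (pderiv F) (x \<bullet> z) * (x \<bullet> z))"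
      by (rule sum.cong[OF refl eq])
    also have "\<dots> = (1 - (x \<bullet> z)\<^sup>2) * poly (pderiv (pderiv F)) (x \<bullet> z) - real m * (x \<bullet> z) * poly (pderiv F) (x \<bullet> z)"
    proof -
      have "x \<bullet> x = 1" using xz by (simp add: dot_square_norm)
      then have "(\<Sum>w\<in>S. poly (pderiv (pderiv F)) (x \<bullet> z) * (x \<bullet> w)\<^sup>2) = (1 - (x \<bullet> z)\<^sup>2) * poly (pderiv (pderiv F)) (x \<bullet> z)"
        unfolding sum_distrib_left[symmetric] S(4) by simp
      then show ?thesis using cm by (simp add: sum_subtractf)
    qed
    finally show ?thesis .
  qed
  have Fode': "(1 - t\<^sup>2) * poly (pderiv (pderiv F)) t - real m * t * poly (pderiv F) t = - lam * poly F t" if t: "\<bar>t\<bar> \<le> 1" for t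
  proof -
    obtain x' :: 'a where "norm x' = 1" "x' \<bullet> z = t" using unit_vector_with_inner[OF xz(2) _ t] d m by auto
    then show ?thesis using Fode[of x' z] xz by simp
  qed
  define H where "H = [:1, 0, -1:] * pderiv (pderiv F) - smult (real m) ([:0, 1:] * pderiv F) + smult lam F"
  have H: "poly H t = (1 - t\<^sup>2) * poly (pderiv (pderiv F)) t - real m * t * poly (pderiv F) t + lam * poly F t" for t
    by (simp add: H_def algebra_simps power2_eq_square)
  \<comment> \<open>Inner products only reach \<open>[-1, 1]\<close>, but infinitely many roots
    force the equation for all \<open>t\<close>, as \<open>gegenbauer_ode_unique\<close>
    demands.\<close>
  have "{-1..1} \<subseteq> {t. poly H t = 0}" using Fode' by (auto simp: H abs_le_iff)
  then have "infinite {t. poly H t = 0}" using infinite_super[of "{-1..1::real}"] by (simp add: infinite_Icc)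
  then have H0: "H = 0" using poly_roots_finite by blast
  define D where "D = F - smult (poly F 1) G"
  have G1: "poly G 1 = 1" unfolding G_def poly_gegenbauer using gegenbauer_at_1[OF m] .
  have "D = 0"
  proof (rule gegenbauer_ode_unique[where M = "real m" and \<mu> = lam])
    fix t
    have "(1 - t\<^sup>2) * poly (pderiv (pderiv D)) t - real m * t * poly (pderiv D) t + lam * poly D t
      = poly H t - poly F 1 * ((1 - t\<^sup>2) * poly (pderiv (pderiv G)) t - real m * t * poly (pderiv G) t + lam * poly G t)"
      unfolding H by (simp add: D_def pderiv_diff pderiv_smult algebra_simps)
    then show "(1 - t\<^sup>2) * poly (pderiv (pderiv D)) t - real m * t * poly (pderiv D) t + lam * poly D t = 0"
      unfolding ode H0 by simp
  qed (use m G1 in \<open>auto simp: D_def\<close>)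
  then have FG: "F = smult (poly F 1) G" by (simp add: D_def)
  have "poly F 1 = (\<integral>y. poly (G * G) (y \<bullet> z) \<partial>?\<sigma>)"
    using F[OF xz(2,2)] xz(2) by (simp add: dot_square_norm)
  also have "\<dots> = zonal_constant TYPE('a) * integral {0..pi} (\<lambda>\<theta>. poly (G * G) (cos \<theta>) * sin \<theta> ^ (DIM('a) - 2))"
    by (rule zonal_integral_poly[OF xz(2)]) (use d m in simp)
  also have "\<dots> = zonal_constant TYPE('a) * gegenbauer_moment l m 2"
    using d by (simp add: gegenbauer_moment_def G_def poly_gegenbauer flip: power2_eq_square)
  finally have F1: "poly F 1 = zonal_constant TYPE('a) * gegenbauer_moment l m 2" .
  have "(\<integral>y. gegenbauer l m (y \<bullet> x) * gegenbauer l m (y \<bullet> z) \<partial>?\<sigma>) = poly F (x \<bullet> z)"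
    using F[OF xz] by (simp add: G_def poly_gegenbauer)
  also have "\<dots> = poly F 1 * gegenbauer l m (x \<bullet> z)" by (subst FG) (simp add: G_def poly_gegenbauer)
  finally show ?thesis unfolding F1 .
qed

section \<open>Karhunen--Loeve expansion\<close>

lemma std_normal_cos_sin:
  "(\<integral>x. cos (t * x) \<partial>std_normal_distribution) = exp (- t\<^sup>2 / 2)"
  "(\<integral>x. sin (t * x) \<partial>std_normal_distribution) = 0"
proof -
  interpret S: prob_space std_normal_distribution by (rule prob_space_std_normal)
  have ic: "integrable std_normal_distribution (\<lambda>x. complex_of_real (cos (t * x)))"
    "integrable std_normal_distribution (\<lambda>x. complex_of_real (sin (t * x)))"
    by (intro integrable_of_real S.integrable_const_bound[where B = 1]; force intro!: AE_I2)+
  have "complex_of_real (\<integral>x. cos (t * x) \<partial>std_normal_distribution) + \<i> * complex_of_real (\<integral>x. sin (t * x) \<partial>std_normal_distribution)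
      = (\<integral>x. complex_of_real (cos (t * x)) + \<i> * complex_of_real (sin (t * x)) \<partial>std_normal_distribution)"
    using ic by simp
  also have "\<dots> = char std_normal_distribution t"
    unfolding char_def by (intro Bochner_Integration.integral_cong) (auto simp: complex_eq_iff Re_exp Im_exp)
  also have "\<dots> = complex_of_real (exp (- t\<^sup>2 / 2))" by (simp add: char_std_normal_distribution)
  finally show "(\<integral>x. cos (t * x) \<partial>std_normal_distribution) = exp (- t\<^sup>2 / 2)"
    "(\<integral>x. sin (t * x) \<partial>std_normal_distribution) = 0"
    by (auto simp: complex_eq_iff)
qed

lemma std_normal_second_moment: "(\<integral>x. x\<^sup>2 \<partial>std_normal_distribution) = 1"
  using std_normal_distribution_even_moments(1)[of 1] by (simp add: fact_numeral)

text \<open>In both cases of the definition \<open>X\<close> has the law of \<open>s * Z\<close>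
  with \<open>Z\<close> standard normal, \<open>s = 0\<close> being the degenerate one.\<close>

lemma centered_gaussian_char:
  assumes P: "prob_space P" and X: "centered_gaussian P X"
  shows "X \<in> borel_measurable P" "integrable P (\<lambda>\<omega>. (X \<omega>)\<^sup>2)"
    "(\<integral>\<omega>. cos (X \<omega>) \<partial>P) = exp (- (\<integral>\<omega>. (X \<omega>)\<^sup>2 \<partial>P) / 2)" "(\<integral>\<omega>. sin (X \<omega>) \<partial>P) = 0"
proof -
  interpret prob_space P by fact
  show Xm [measurable]: "X \<in> borel_measurable P" using X by (simp add: centered_gaussian_def)
  have "\<exists>s. distr P borel X = distr std_normal_distribution borel (\<lambda>x. s * x)"
  proof (cases "distr P borel X = return borel 0")
    case True
    interpret S: prob_space std_normal_distribution by (rule prob_space_std_normal)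
    have "distr std_normal_distribution borel (\<lambda>x. 0 * x) = return borel (0::real)"
      using S.distr_const[of 0 borel] by simp
    then show ?thesis using True by metis
  next
    case False
    then obtain s where s: "s > 0" "distributed P lborel X (\<lambda>x. ennreal (normal_density 0 s x))"
      using X unfolding centered_gaussian_def by blast
    have "distributed P lborel (\<lambda>\<omega>. (X \<omega> - 0) / s) std_normal_density"
      using normal_standard_normal_convert[OF s(1)] s(2) by blast
    then have "distr P lborel (\<lambda>\<omega>. X \<omega> / s) = std_normal_distribution" by (simp add: distributed_def)
    moreover have "distr P lborel (\<lambda>\<omega>. X \<omega> / s) = distr P borel (\<lambda>\<omega>. X \<omega> / s)" by (rule distr_cong) auto
    ultimately have "distr std_normal_distribution borel (\<lambda>x. s * x) = distr (distr P borel (\<lambda>\<omega>. X \<omega> / s)) borel (\<lambda>x. s * x)"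
      by simp
    also have "\<dots> = distr P borel X" using s(1) by (simp add: distr_distr o_def)
    finally show ?thesis by metis
  qed
  then obtain s where s: "distr P borel X = distr std_normal_distribution borel (\<lambda>x. s * x)" by blast
  have tr: "(\<integral>\<omega>. f (X \<omega>) \<partial>P) = (\<integral>x. f (s * x) \<partial>std_normal_distribution)" if [measurable]: "f \<in> borel_measurable borel" for f :: "real \<Rightarrow> real"
    using integral_distr[of X P borel f] integral_distr[of "\<lambda>x. s * x" std_normal_distribution borel f] unfolding s by simp
  have "integrable (distr std_normal_distribution borel (\<lambda>x. s * x)) (\<lambda>x. x\<^sup>2)"
    using integrable_std_normal_distribution_moment[of 2] by (subst integrable_distr_eq) (auto simp: power_mult_distrib)
  then show "integrable P (\<lambda>\<omega>. (X \<omega>)\<^sup>2)" unfolding s[symmetric] by (subst (asm) integrable_distr_eq) auto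
  have "(\<integral>\<omega>. (X \<omega>)\<^sup>2 \<partial>P) = s\<^sup>2" by (subst tr) (auto simp: power_mult_distrib std_normal_second_moment)
  then show "(\<integral>\<omega>. cos (X \<omega>) \<partial>P) = exp (- (\<integral>\<omega>. (X \<omega>)\<^sup>2 \<partial>P) / 2)" "(\<integral>\<omega>. sin (X \<omega>) \<partial>P) = 0"
    by (simp_all add: tr std_normal_cos_sin)
qed

locale sphere_eigenfield =
  fixes m l :: nat and P :: "'w measure" and T :: "'a::euclidean_space \<Rightarrow> 'w \<Rightarrow> real"
  assumes field: "gaussian_eigenfunction m l P T" and dim: "DIM('a) = m + 1" and m2: "m \<ge> 2" and l1: "l \<ge> 1"
begin

sublocale prob_space P using field by (simp add: gaussian_eigenfunction_def)

text \<open>The span is taken without L2 closure: modulo null sets it is finite-dimensional, as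
  follows from \<open>maximal_ON\<close>.\<close>

definition H :: "('w \<Rightarrow> real) set" where
  "H = {(\<lambda>\<omega>. \<Sum>x\<in>I. c x * T x \<omega>) | I c. finite I \<and> I \<subseteq> sphere 0 1}"

lemma H_scale: assumes "f \<in> H" shows "(\<lambda>\<omega>. a * f \<omega>) \<in> H"
proof -
  obtain I c where f: "f = (\<lambda>\<omega>. \<Sum>x\<in>I. c x * T x \<omega>)" and I: "finite I" "I \<subseteq> sphere 0 1" using assms unfolding H_def by blast
  have "(\<lambda>\<omega>. a * f \<omega>) = (\<lambda>\<omega>. \<Sum>x\<in>I. (a * c x) * T x \<omega>)" by (simp add: f sum_distrib_left mult.assoc)
  then show ?thesis using I unfolding H_def by (intro CollectI exI conjI)
qed

lemma H_add: assumes "f \<in> H" "g \<in> H" shows "(\<lambda>\<omega>. f \<omega> + g \<omega>) \<in> H"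
proof -
  obtain I c where f: "f = (\<lambda>\<omega>. \<Sum>x\<in>I. c x * T x \<omega>)" and I: "finite I" "I \<subseteq> sphere 0 1" using assms(1) unfolding H_def by blast
  obtain J d where g: "g = (\<lambda>\<omega>. \<Sum>x\<in>J. d x * T x \<omega>)" and J: "finite J" "J \<subseteq> sphere 0 1" using assms(2) unfolding H_def by blast
  define e where "e x = (if x \<in> I then c x else 0) + (if x \<in> J then d x else 0)" for x
  have "f \<omega> + g \<omega> = (\<Sum>x\<in>I \<union> J. e x * T x \<omega>)" for \<omega>
  proof -
    have "(\<Sum>x\<in>I \<union> J. e x * T x \<omega>) = (\<Sum>x\<in>I \<union> J. (if x \<in> I then c x * T x \<omega> else 0)) + (\<Sum>x\<in>I \<union> J. (if x \<in> J then d x * T x \<omega> else 0))"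
      unfolding sum.distrib[symmetric] by (intro sum.cong) (auto simp: e_def algebra_simps)
    also have "\<dots> = f \<omega> + g \<omega>"
      using I J by (simp add: f g sum.If_cases Int_absorb1)
    finally show ?thesis by simp
  qed
  then have "(\<lambda>\<omega>. f \<omega> + g \<omega>) = (\<lambda>\<omega>. \<Sum>x\<in>I \<union> J. e x * T x \<omega>)" by auto
  then show ?thesis using I J unfolding H_def by (auto intro!: exI[of _ "I \<union> J"])
qed

lemma H_zero: "(\<lambda>_. 0) \<in> H"
  unfolding H_def by (auto intro!: exI[of _ "{}"])

lemma H_sum: "(\<And>k. k \<in> K \<Longrightarrow> f k \<in> H) \<Longrightarrow> (\<lambda>\<omega>. \<Sum>k\<in>K. a k * f k \<omega>) \<in> H"
proof (induction K rule: infinite_finite_induct)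
  case (insert k K)
  then show ?case using H_add[OF H_scale[of "f k" "a k"], of "\<lambda>\<omega>. \<Sum>k\<in>K. a k * f k \<omega>"] by simp
qed (simp_all add: H_zero)

lemma T_in_H: assumes "norm x = 1" shows "T x \<in> H"
proof -
  have "T x = (\<lambda>\<omega>. \<Sum>y\<in>{x}. 1 * T y \<omega>)" by simp
  then show ?thesis using assms unfolding H_def by (intro CollectI exI[of _ "{x}"] exI[of _ "\<lambda>_. 1"]) auto
qed

lemma H_gaussian: "f \<in> H \<Longrightarrow> centered_gaussian P f"
  using field unfolding gaussian_eigenfunction_def centered_gaussian_field_def H_def by auto

lemmas H_char = centered_gaussian_char[OF prob_space_axioms H_gaussian]

lemma H_integrable_mult: "f \<in> H \<Longrightarrow> g \<in> H \<Longrightarrow> integrable P (\<lambda>\<omega>. f \<omega> * g \<omega>)"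
  by (intro integrable_mult_L2 H_char)

lemma T_cov: assumes "norm x = 1" "norm y = 1" shows "(\<integral>\<omega>. T x \<omega> * T y \<omega> \<partial>P) = gegenbauer l m (x \<bullet> y)"
proof -
  have "\<bar>x \<bullet> y\<bar> \<le> 1" using Cauchy_Schwarz_ineq2[of x y] assms by simp
  then have "cos (geodesic_dist x y) = x \<bullet> y" by (simp add: geodesic_dist_def cos_arccos_abs)
  then show ?thesis using field assms unfolding gaussian_eigenfunction_def by simp
qed

text \<open>\<open>gegenbauer l m t\<close> is the covariance of two variables of variance
  1.\<close>

lemma gegenbauer_abs_le_1: assumes "\<bar>t\<bar> \<le> 1" shows "\<bar>gegenbauer l m t\<bar> \<le> 1"
proof -
  obtain z :: 'a where z: "norm z = 1" using norm_Basis nonempty_Basis by blast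
  obtain x :: 'a where x: "norm x = 1" and xz: "x \<bullet> z = t" using unit_vector_with_inner[OF z _ assms] dim m2 by auto
  have E1: "(\<integral>\<omega>. (T y \<omega>)\<^sup>2 \<partial>P) = 1" if y: "norm y = 1" for y
    using T_cov[OF y y] y gegenbauer_at_1[OF m2] by (simp add: dot_square_norm power2_eq_square)
  have i: "integrable P (\<lambda>\<omega>. (T x \<omega>)\<^sup>2)" "integrable P (\<lambda>\<omega>. (T z \<omega>)\<^sup>2)" "integrable P (\<lambda>\<omega>. T x \<omega> * T z \<omega>)"
    using H_char(2)[OF T_in_H[OF x]] H_char(2)[OF T_in_H[OF z]] H_integrable_mult[OF T_in_H[OF x] T_in_H[OF z]] by auto
  have "\<bar>\<integral>\<omega>. T x \<omega> * T z \<omega> \<partial>P\<bar> \<le> (\<integral>\<omega>. ((T x \<omega>)\<^sup>2 + (T z \<omega>)\<^sup>2) / 2 \<partial>P)"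
  proof (rule order_trans[OF integral_abs_bound], rule integral_mono)
    fix \<omega>
    have "0 \<le> (\<bar>T x \<omega>\<bar> - \<bar>T z \<omega>\<bar>)\<^sup>2" by simp
    then show "\<bar>T x \<omega> * T z \<omega>\<bar> \<le> ((T x \<omega>)\<^sup>2 + (T z \<omega>)\<^sup>2) / 2" by (simp add: power2_diff abs_mult)
  qed (use i in auto)
  also have "\<dots> = 1" using i E1[OF x] E1[OF z] by simp
  finally show ?thesis unfolding T_cov[OF x z] xz .
qed

end

section \<open>Orthonormal systems in the first chaos\<close>

text \<open>\<kappa> is the constant of \<open>gegenbauer_reproducing\<close>, thus the eigenvalue
  of the covariance kernel; the moment bounds establish its positivity for large
  \<open>l\<close>.\<close>

locale sphere_eigenfield_basis = sphere_eigenfield m l P T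
  for m l :: nat and P :: "'w measure" and T :: "'a::euclidean_space \<Rightarrow> 'w \<Rightarrow> real" +
  fixes \<kappa> :: real
  assumes kappa_pos: "\<kappa> > 0"
    and kappa: "\<kappa> = zonal_constant TYPE('a) * gegenbauer_moment l m 2"
begin

text \<open>The canonical map from the Gaussian space to the reproducing kernel space of the
  covariance; \<open>T x\<close> goes to the zonal function around \<open>x\<close>.\<close>

definition proj :: "('w \<Rightarrow> real) \<Rightarrow> 'a \<Rightarrow> real" where "proj f y = (\<integral>\<omega>. f \<omega> * T y \<omega> \<partial>P)"

lemma proj_eq:
  assumes I: "finite I" "I \<subseteq> sphere 0 1" and y: "norm y = 1"
  shows "proj (\<lambda>\<omega>. \<Sum>x\<in>I. c x * T x \<omega>) y = (\<Sum>x\<in>I. c x * gegenbauer l m (y \<bullet> x))"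
proof -
  have xi: "norm x = 1" if "x \<in> I" for x using I that by auto
  have "proj (\<lambda>\<omega>. \<Sum>x\<in>I. c x * T x \<omega>) y = (\<integral>\<omega>. (\<Sum>x\<in>I. c x * (T x \<omega> * T y \<omega>)) \<partial>P)"
    unfolding proj_def by (simp add: sum_distrib_right mult.assoc)
  also have "\<dots> = (\<Sum>x\<in>I. \<integral>\<omega>. c x * (T x \<omega> * T y \<omega>) \<partial>P)"
    by (intro Bochner_Integration.integral_sum integrable_mult_right H_integrable_mult T_in_H xi y)
  also have "\<dots> = (\<Sum>x\<in>I. c x * gegenbauer l m (y \<bullet> x))"
    using xi y by (intro sum.cong refl) (simp add: T_cov inner_commute)
  finally show ?thesis .
qed

lemma continuous_gegenbauer_inner: "continuous_on A (\<lambda>y. gegenbauer l m (y \<bullet> x))"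
  unfolding poly_gegenbauer[symmetric] by (intro continuous_intros)

lemma proj_continuous: assumes "f \<in> H" shows "continuous_on (sphere 0 1) (proj f)"
proof -
  obtain I c where f: "f = (\<lambda>\<omega>. \<Sum>x\<in>I. c x * T x \<omega>)" and I: "finite I" "I \<subseteq> sphere 0 1" using assms unfolding H_def by blast
  have "continuous_on (sphere 0 1) (\<lambda>y. \<Sum>x\<in>I. c x * gegenbauer l m (y \<bullet> x))"
    by (intro continuous_intros continuous_gegenbauer_inner)
  then show ?thesis by (rule continuous_on_eq) (simp add: f proj_eq[OF I])
qed

lemma proj_measurable: assumes "f \<in> H" shows "proj f \<in> borel_measurable sphere_measure"
proof -
  have "proj f \<in> borel_measurable (restrict_space borel (sphere 0 1))"
    by (rule borel_measurable_continuous_on_restrict[OF proj_continuous[OF assms]])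
  then show ?thesis unfolding measurable_cong_sets[OF sphere_measure_sets refl] .
qed

lemma gegenbauer_integrable: "integrable sphere_measure (\<lambda>y. gegenbauer l m (y \<bullet> x) * gegenbauer l m (y \<bullet> (z::'a)))"
  "integrable sphere_measure (\<lambda>y. gegenbauer l m (y \<bullet> (x::'a)))"
  unfolding poly_gegenbauer[symmetric]
  by (intro bounded_meas_integrable[OF finite_measure_sphere] bounded_meas_mult bounded_meas_poly bounded_meas_inner)+

lemma proj_mean: assumes "f \<in> H" shows "(\<integral>y. proj f y \<partial>sphere_measure) = 0"
proof -
  obtain I c where f: "f = (\<lambda>\<omega>. \<Sum>x\<in>I. c x * T x \<omega>)" and I: "finite I" "I \<subseteq> sphere 0 1" using assms unfolding H_def by blast
  have "(\<integral>y. proj f y \<partial>sphere_measure) = (\<integral>y. (\<Sum>x\<in>I. c x * gegenbauer l m (y \<bullet> x)) \<partial>sphere_measure)"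
    by (rule Bochner_Integration.integral_cong[OF refl]) (simp add: f proj_eq[OF I])
  also have "\<dots> = (\<Sum>x\<in>I. c x * (\<integral>y. gegenbauer l m (y \<bullet> x) \<partial>sphere_measure))"
    using gegenbauer_integrable(2) by simp
  also have "\<dots> = 0"
  proof (rule sum.neutral, rule ballI)
    fix x assume "x \<in> I"
    then have "norm x = 1" using I by auto
    then show "c x * (\<integral>y. gegenbauer l m (y \<bullet> x) \<partial>sphere_measure) = 0"
      using gegenbauer_sphere_mean[OF _ dim _ l1] m2 by simp
  qed
  finally show ?thesis .
qed

text \<open>On the generators \<open>T x\<close> this is the reproducing formula, and bilinearity
  extends it. Orthonormal variables are thus sent to orthogonal functions of squared norm
  \<kappa>.\<close>

lemma proj_isometry: assumes "f \<in> H" "g \<in> H"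
  shows "(\<integral>y. proj f y * proj g y \<partial>sphere_measure) = \<kappa> * (\<integral>\<omega>. f \<omega> * g \<omega> \<partial>P)"
    "integrable sphere_measure (\<lambda>y. proj f y * proj g y)"
proof -
  obtain I c where f: "f = (\<lambda>\<omega>. \<Sum>x\<in>I. c x * T x \<omega>)" and I: "finite I" "I \<subseteq> sphere 0 1" using assms(1) unfolding H_def by blast
  obtain J d where g: "g = (\<lambda>\<omega>. \<Sum>x\<in>J. d x * T x \<omega>)" and J: "finite J" "J \<subseteq> sphere 0 1" using assms(2) unfolding H_def by blast
  have nI: "norm x = 1" if "x \<in> I" for x using I that by auto
  have nJ: "norm x = 1" if "x \<in> J" for x using J that by auto
  have eq: "proj f y * proj g y = (\<Sum>x\<in>I. \<Sum>z\<in>J. c x * d z * (gegenbauer l m (y \<bullet> x) * gegenbauer l m (y \<bullet> z)))" if "y \<in> space sphere_measure" for y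
    using that by (simp add: f g proj_eq[OF I] proj_eq[OF J] sum_product mult_ac)
  have "integrable sphere_measure (\<lambda>y. \<Sum>x\<in>I. \<Sum>z\<in>J. c x * d z * (gegenbauer l m (y \<bullet> x) * gegenbauer l m (y \<bullet> z)))"
    by (intro Bochner_Integration.integrable_sum integrable_mult_right gegenbauer_integrable)
  then show "integrable sphere_measure (\<lambda>y. proj f y * proj g y)"
    by (subst Bochner_Integration.integrable_cong[OF refl eq])
  have "(\<integral>y. proj f y * proj g y \<partial>sphere_measure) = (\<integral>y. (\<Sum>x\<in>I. \<Sum>z\<in>J. c x * d z * (gegenbauer l m (y \<bullet> x) * gegenbauer l m (y \<bullet> z))) \<partial>sphere_measure)"
    by (rule Bochner_Integration.integral_cong[OF refl eq])
  also have "\<dots> = (\<Sum>x\<in>I. \<Sum>z\<in>J. c x * d z * (\<integral>y. gegenbauer l m (y \<bullet> x) * gegenbauer l m (y \<bullet> z) \<partial>sphere_measure))"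
    using gegenbauer_integrable(1) by simp
  also have "\<dots> = (\<Sum>x\<in>I. \<Sum>z\<in>J. c x * d z * (\<kappa> * gegenbauer l m (x \<bullet> z)))"
    using gegenbauer_reproducing[OF nI nJ dim m2] by (intro sum.cong refl) (simp add: kappa)
  also have "\<dots> = \<kappa> * (\<Sum>x\<in>I. \<Sum>z\<in>J. \<integral>\<omega>. c x * d z * (T x \<omega> * T z \<omega>) \<partial>P)"
    using T_cov[OF nI nJ] by (simp add: sum_distrib_left mult_ac)
  also have "(\<Sum>x\<in>I. \<Sum>z\<in>J. \<integral>\<omega>. c x * d z * (T x \<omega> * T z \<omega>) \<partial>P) = (\<Sum>x\<in>I. \<integral>\<omega>. (\<Sum>z\<in>J. c x * d z * (T x \<omega> * T z \<omega>)) \<partial>P)"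
    by (intro sum.cong[OF refl] Bochner_Integration.integral_sum[symmetric] integrable_mult_right H_integrable_mult T_in_H nI nJ)
  also have "\<dots> = (\<integral>\<omega>. (\<Sum>x\<in>I. \<Sum>z\<in>J. c x * d z * (T x \<omega> * T z \<omega>)) \<partial>P)"
    by (intro Bochner_Integration.integral_sum[symmetric] Bochner_Integration.integrable_sum integrable_mult_right H_integrable_mult T_in_H nI nJ)
  also have "\<dots> = (\<integral>\<omega>. f \<omega> * g \<omega> \<partial>P)"
    by (simp add: f g sum_product mult_ac)
  finally show "(\<integral>y. proj f y * proj g y \<partial>sphere_measure) = \<kappa> * (\<integral>\<omega>. f \<omega> * g \<omega> \<partial>P)" .
qed

text \<open>Membership in \<open>H\<close> is required at all indices, also from \<open>n\<close>
  on, so that measurability needs no index condition.\<close>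

definition ON :: "nat \<Rightarrow> (nat \<Rightarrow> 'w \<Rightarrow> real) \<Rightarrow> bool" where
  "ON n b \<longleftrightarrow> (\<forall>k. b k \<in> H) \<and> (\<forall>j<n. \<forall>k<n. (\<integral>\<omega>. b j \<omega> * b k \<omega> \<partial>P) = (if j = k then 1 else 0))"

definition res :: "nat \<Rightarrow> (nat \<Rightarrow> 'w \<Rightarrow> real) \<Rightarrow> 'a \<Rightarrow> 'w \<Rightarrow> real" where
  "res n b y \<omega> = T y \<omega> - (\<Sum>k<n. proj (b k) y * b k \<omega>)"

lemma res_in_H: assumes "ON n b" "norm y = 1" shows "res n b y \<in> H"
proof -
  have "(\<lambda>\<omega>. T y \<omega> + (- 1) * (\<Sum>k<n. proj (b k) y * b k \<omega>)) \<in> H"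
    using assms by (intro H_add H_scale H_sum T_in_H) (auto simp: ON_def)
  then show ?thesis by (simp add: res_def[abs_def])
qed

lemma res_mult:
  assumes b: "ON n b" and y: "norm y = 1" and g: "g \<in> H"
  shows "(\<integral>\<omega>. res n b y \<omega> * g \<omega> \<partial>P) = proj g y - (\<Sum>k<n. proj (b k) y * (\<integral>\<omega>. b k \<omega> * g \<omega> \<partial>P))"
proof -
  have bH: "b k \<in> H" for k using b by (simp add: ON_def)
  have "(\<integral>\<omega>. res n b y \<omega> * g \<omega> \<partial>P) = (\<integral>\<omega>. g \<omega> * T y \<omega> - (\<Sum>k<n. proj (b k) y * (b k \<omega> * g \<omega>)) \<partial>P)"
    by (rule Bochner_Integration.integral_cong[OF refl]) (simp add: res_def algebra_simps sum_distrib_left)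
  also have "\<dots> = (\<integral>\<omega>. g \<omega> * T y \<omega> \<partial>P) - (\<integral>\<omega>. (\<Sum>k<n. proj (b k) y * (b k \<omega> * g \<omega>)) \<partial>P)"
    by (intro Bochner_Integration.integral_diff Bochner_Integration.integrable_sum integrable_mult_right H_integrable_mult g bH T_in_H y)
  also have "(\<integral>\<omega>. (\<Sum>k<n. proj (b k) y * (b k \<omega> * g \<omega>)) \<partial>P) = (\<Sum>k<n. \<integral>\<omega>. proj (b k) y * (b k \<omega> * g \<omega>) \<partial>P)"
    by (intro Bochner_Integration.integral_sum integrable_mult_right H_integrable_mult g bH)
  finally show ?thesis by (simp add: proj_def)
qed

lemma res_orth: assumes b: "ON n b" and y: "norm y = 1" and j: "j < n"
  shows "(\<integral>\<omega>. res n b y \<omega> * b j \<omega> \<partial>P) = 0"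
proof -
  have "(\<Sum>k<n. proj (b k) y * (\<integral>\<omega>. b k \<omega> * b j \<omega> \<partial>P)) = (\<Sum>k<n. if k = j then proj (b k) y else 0)"
    using b j by (intro sum.cong) (auto simp: ON_def)
  then show ?thesis using res_mult[OF b y, of "b j"] b j by (simp add: ON_def)
qed

text \<open>The residual is orthogonal to the system, so its square pairs only with
  \<open>T y\<close>, which has variance 1.\<close>

lemma res_sq: assumes b: "ON n b" and y: "norm y = 1"
  shows "(\<integral>\<omega>. (res n b y \<omega>)\<^sup>2 \<partial>P) = 1 - (\<Sum>k<n. (proj (b k) y)\<^sup>2)"
proof -
  have rH: "res n b y \<in> H" by (rule res_in_H[OF b y])
  have "y \<bullet> y = 1" using y by (simp add: dot_square_norm)
  then have pT: "proj (T y) y = 1" using T_cov[OF y y] gegenbauer_at_1[OF m2] by (simp add: proj_def)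
  have "proj (res n b y) y = (\<integral>\<omega>. res n b y \<omega> * T y \<omega> \<partial>P)" by (simp add: proj_def)
  also have "\<dots> = 1 - (\<Sum>k<n. (proj (b k) y)\<^sup>2)"
    using res_mult[OF b y T_in_H[OF y]] pT by (simp add: power2_eq_square flip: proj_def)
  finally have 1: "proj (res n b y) y = 1 - (\<Sum>k<n. (proj (b k) y)\<^sup>2)" .
  have "(\<integral>\<omega>. b k \<omega> * res n b y \<omega> \<partial>P) = 0" if "k < n" for k using res_orth[OF b y that] by (simp add: mult.commute)
  then show ?thesis using res_mult[OF b y rH] 1 by (simp add: power2_eq_square)
qed

text \<open>Bessel's inequality, integrated over the sphere, bounds the length of orthonormal systems.\<close>

lemma ON_bound: assumes b: "ON n b" shows "real n * \<kappa> \<le> measure (sphere_measure :: 'a measure) (sphere 0 1)"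
proof -
  interpret finite_measure "sphere_measure :: 'a measure" by (rule finite_measure_sphere)
  have bH: "b k \<in> H" for k using b by (simp add: ON_def)
  have "real n * \<kappa> = (\<Sum>k<n. \<integral>y. proj (b k) y * proj (b k) y \<partial>sphere_measure)"
    using b by (simp add: proj_isometry(1)[OF bH bH] ON_def)
  also have "\<dots> = (\<integral>y. (\<Sum>k<n. proj (b k) y * proj (b k) y) \<partial>sphere_measure)"
    by (rule Bochner_Integration.integral_sum[symmetric]) (rule proj_isometry(2)[OF bH bH])
  also have "\<dots> \<le> (\<integral>y. 1 \<partial>(sphere_measure :: 'a measure))"
  proof (rule integral_mono)
    show "integrable sphere_measure (\<lambda>y. \<Sum>k<n. proj (b k) y * proj (b k) y)"
      by (intro Bochner_Integration.integrable_sum proj_isometry(2)[OF bH bH])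
    fix y :: 'a assume "y \<in> space sphere_measure"
    then have y: "norm y = 1" by simp
    have "0 \<le> (\<integral>\<omega>. (res n b y \<omega>)\<^sup>2 \<partial>P)" by simp
    then show "(\<Sum>k<n. proj (b k) y * proj (b k) y) \<le> 1" unfolding res_sq[OF b y] by (simp add: power2_eq_square)
  qed simp
  finally show ?thesis by simp
qed

text \<open>\<open>ON_bound\<close> limits the length, so a longest system exists. If some residual
  had positive norm, its normalisation would extend the system.\<close>

lemma maximal_ON: obtains n b where "ON n b" "\<And>y. norm y = 1 \<Longrightarrow> (\<Sum>k<n. (proj (b k) y)\<^sup>2) = 1"
proof -
  let ?Q = "\<lambda>n. \<exists>b. ON n b"
  have bd: "n \<le> nat \<lceil>measure (sphere_measure :: 'a measure) (sphere 0 1) / \<kappa>\<rceil>" if "?Q n" for n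
  proof -
    have "real n \<le> measure (sphere_measure :: 'a measure) (sphere 0 1) / \<kappa>"
      using that ON_bound kappa_pos by (auto simp: field_simps)
    then show ?thesis by linarith
  qed
  have "ON 0 (\<lambda>_ _. 0)" by (simp add: ON_def H_zero)
  then have Q0: "?Q 0" by blast
  define n where "n = (GREATEST n. ?Q n)"
  have "?Q n" unfolding n_def using GreatestI_nat[of ?Q 0, OF Q0] bd by blast
  then obtain b where b: "ON n b" by blast
  have "(\<Sum>k<n. (proj (b k) y)\<^sup>2) = 1" if y: "norm y = 1" for y
  proof (rule ccontr)
    assume ne: "(\<Sum>k<n. (proj (b k) y)\<^sup>2) \<noteq> 1"
    define v where "v = (\<integral>\<omega>. (res n b y \<omega>)\<^sup>2 \<partial>P)"
    have "0 \<le> v" unfolding v_def by simp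
    moreover have "v \<noteq> 0" unfolding v_def res_sq[OF b y] using ne by simp
    ultimately have v: "v > 0" by simp
    define b' where "b' = b(n := \<lambda>\<omega>. (1 / sqrt v) * res n b y \<omega>)"
    have "(\<integral>\<omega>. b' j \<omega> * b' k \<omega> \<partial>P) = (if j = k then 1 else 0)" if jk: "j < Suc n" "k < Suc n" for j k
    proof -
      consider "j < n" "k < n" | "j = n" "k < n" | "j < n" "k = n" | "j = n" "k = n" using jk by linarith
      then show ?thesis
      proof cases
        case 1 then show ?thesis using b by (simp add: b'_def ON_def)
      next
        case 2 then show ?thesis using res_orth[OF b y, of k] by (simp add: b'_def)
      next
        case 3 then show ?thesis using res_orth[OF b y, of j] by (simp add: b'_def mult.commute)
      next
        case 4
        have "(\<integral>\<omega>. b' j \<omega> * b' k \<omega> \<partial>P) = (\<integral>\<omega>. (1 / v) * (res n b y \<omega>)\<^sup>2 \<partial>P)"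
          using 4 v by (intro Bochner_Integration.integral_cong refl) (simp add: b'_def power2_eq_square)
        also have "\<dots> = (1 / v) * v" unfolding v_def by (rule integral_mult_right_zero)
        finally show ?thesis using 4 v by simp
      qed
    qed
    moreover have "b' k \<in> H" for k
      using b res_in_H[OF b y] unfolding b'_def by (auto simp: ON_def intro: H_scale[of _ "1 / sqrt v", simplified])
    ultimately have "ON (Suc n) b'" unfolding ON_def by blast
    then have "Suc n \<le> n" unfolding n_def using Greatest_le_nat[of ?Q "Suc n"] bd by (metis n_def)
    then show False by simp
  qed
  then show ?thesis using that b by blast
qed

text \<open>Residuals of a maximal system have second moment 0. The law of the coefficients follows
  because all their linear combinations lie in \<open>H\<close>, hence are Gaussian, with variance
  the sum of the squared coefficients.\<close>

theorem karhunen_loeve: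
  obtains n b where "gaussian_expansion (sphere_measure :: 'a measure) n (\<lambda>k. proj (b k)) \<kappa>"
    "\<And>x y. norm x = 1 \<Longrightarrow> norm y = 1 \<Longrightarrow> (\<Sum>k<n. proj (b k) x * proj (b k) y) = gegenbauer l m (x \<bullet> y)"
    "(\<lambda>\<omega>. \<lambda>k\<in>{..<n}. b k \<omega>) \<in> measurable P (std_gaussian n)"
    "distr P (std_gaussian n) (\<lambda>\<omega>. \<lambda>k\<in>{..<n}. b k \<omega>) = std_gaussian n"
    "AE \<omega> in P. \<forall>x. norm x = 1 \<longrightarrow> T x \<omega> = (\<Sum>k<n. proj (b k) x * b k \<omega>)"
proof -
  obtain n b where b: "ON n b" and one: "\<And>y. norm y = 1 \<Longrightarrow> (\<Sum>k<n. (proj (b k) y)\<^sup>2) = 1" using maximal_ON by blast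
  have bH: "b k \<in> H" for k using b by (simp add: ON_def)
  have [measurable]: "b k \<in> borel_measurable P" for k by (rule H_char(1)[OF bH])
  have r0: "AE \<omega> in P. res n b y \<omega> = 0" if y: "norm y = 1" for y
  proof -
    have "(\<integral>\<omega>. (res n b y \<omega>)\<^sup>2 \<partial>P) = 0" using res_sq[OF b y] one[OF y] by simp
    then have "AE \<omega> in P. (res n b y \<omega>)\<^sup>2 = 0"
      using integral_nonneg_eq_0_iff_AE[OF H_char(2)[OF res_in_H[OF b y]]] by simp
    then show ?thesis by simp
  qed
  have "gaussian_expansion (sphere_measure :: 'a measure) n (\<lambda>k. proj (b k)) \<kappa>"
  proof (rule gaussian_expansion.intro)
    show "finite_measure (sphere_measure :: 'a measure)" by (rule finite_measure_sphere)
    show "proj (b k) \<in> borel_measurable sphere_measure" for k by (rule proj_measurable[OF bH])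
    show "(\<Sum>k<n. (proj (b k) x)\<^sup>2) = 1" if "x \<in> space sphere_measure" for x using one that by simp
    show "(\<integral>x. proj (b j) x * proj (b k) x \<partial>sphere_measure) = (if j = k then \<kappa> else 0)" if "j < n" "k < n" for j k
      using b that by (simp add: proj_isometry(1)[OF bH bH] ON_def)
    show "(\<integral>x. proj (b k) x \<partial>sphere_measure) = 0" if "k < n" for k by (rule proj_mean[OF bH])
    show "\<kappa> > 0" by (rule kappa_pos)
  qed
  moreover have "(\<Sum>k<n. proj (b k) x * proj (b k) y) = gegenbauer l m (x \<bullet> y)" if xy: "norm x = 1" "norm y = 1" for x y
  proof -
    have "(\<integral>\<omega>. res n b x \<omega> * T y \<omega> \<partial>P) = (\<integral>\<omega>. 0 \<partial>P)"
      by (rule integral_cong_AE) (use r0[OF xy(1)] H_char(1)[OF res_in_H[OF b xy(1)]] H_char(1)[OF T_in_H[OF xy(2)]] in auto)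
    then have "proj (T y) x = (\<Sum>k<n. proj (b k) x * proj (b k) y)"
      using res_mult[OF b xy(1) T_in_H[OF xy(2)]] by (simp flip: proj_def)
    then show ?thesis using T_cov[OF xy] by (simp add: proj_def mult.commute)
  qed
  moreover have meas: "(\<lambda>\<omega>. \<lambda>k\<in>{..<n}. b k \<omega>) \<in> measurable P (std_gaussian n)"
    by (rule measurable_restrict) simp
  moreover have "distr P (std_gaussian n) (\<lambda>\<omega>. \<lambda>k\<in>{..<n}. b k \<omega>) = std_gaussian n"
  proof (rule char_std_normal_imp_PiM[OF prob_space_axioms])
    fix c :: "nat \<Rightarrow> real"
    have sH: "(\<lambda>\<omega>. \<Sum>k<n. c k * b k \<omega>) \<in> H" by (rule H_sum) (rule bH)
    have "(\<integral>\<omega>. (\<Sum>k<n. c k * b k \<omega>)\<^sup>2 \<partial>P) = (\<integral>\<omega>. (\<Sum>j<n. \<Sum>k<n. c j * c k * (b j \<omega> * b k \<omega>)) \<partial>P)"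
      by (simp add: power2_eq_square sum_product mult_ac)
    also have "\<dots> = (\<Sum>j<n. \<Sum>k<n. c j * c k * (\<integral>\<omega>. b j \<omega> * b k \<omega> \<partial>P))"
      using H_integrable_mult[OF bH bH] by simp
    also have "\<dots> = (\<Sum>j<n. \<Sum>k<n. if k = j then (c j)\<^sup>2 else 0)"
      using b by (intro sum.cong refl) (auto simp: ON_def power2_eq_square)
    also have "\<dots> = (\<Sum>j<n. (c j)\<^sup>2)" by simp
    finally have v: "(\<integral>\<omega>. (\<Sum>k<n. c k * b k \<omega>)\<^sup>2 \<partial>P) = (\<Sum>j<n. (c j)\<^sup>2)" .
    show "(\<integral>\<omega>. cos (\<Sum>k<n. c k * b k \<omega>) \<partial>P) = exp (- (\<Sum>k<n. (c k)\<^sup>2) / 2)"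
      using H_char(3)[OF sH] unfolding v .
    show "(\<integral>\<omega>. sin (\<Sum>k<n. c k * b k \<omega>) \<partial>P) = 0" using H_char(4)[OF sH] .
  qed simp
  \<comment> \<open>Each point has its own null set; a countable dense set unites them, and
    continuity of the paths and of \<open>proj\<close> extends the identity to all points.\<close>
  moreover have "AE \<omega> in P. \<forall>x. norm x = 1 \<longrightarrow> T x \<omega> = (\<Sum>k<n. proj (b k) x * b k \<omega>)"
  proof -
    obtain D :: "'a set" where D: "countable D" "D \<subseteq> sphere 0 1" "sphere 0 1 \<subseteq> closure D"
      using separable[of "sphere (0::'a) 1"] by blast
    have "AE \<omega> in P. \<forall>x\<in>D. res n b x \<omega> = 0"
      using D(2) r0 by (subst AE_ball_countable[OF D(1)]) auto
    moreover have "AE \<omega> in P. \<omega> \<in> space P" by simp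
    ultimately show ?thesis
    proof eventually_elim
      fix \<omega> assume z: "\<forall>x\<in>D. res n b x \<omega> = 0" and w: "\<omega> \<in> space P"
      have "continuous_on (sphere 0 1) (\<lambda>x. T x \<omega>)" using field w by (simp add: gaussian_eigenfunction_def)
      then have c: "continuous_on (sphere 0 1) (\<lambda>x. res n b x \<omega>)"
        unfolding res_def by (intro continuous_intros proj_continuous[OF bH])
      have "closed {x \<in> sphere 0 1. res n b x \<omega> = 0}"
        by (rule continuous_closed_preimage_constant[OF c closed_sphere])
      then have "closure D \<subseteq> {x \<in> sphere 0 1. res n b x \<omega> = 0}" using z D(2) by (intro closure_minimal) auto
      then have "res n b x \<omega> = 0" if "norm x = 1" for x using D(3) that by auto
      then show "\<forall>x. norm x = 1 \<longrightarrow> T x \<omega> = (\<Sum>k<n. proj (b k) x * b k \<omega>)" by (simp add: res_def)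
    qed
  qed
  ultimately show ?thesis by (rule that)
qed

end

section \<open>Joint measurability and transfer to the field\<close>

context sphere_eigenfield
begin

text \<open>The definition gives measurability in \<omega> at each point and continuity in the
  point. The field is the limit of its values at the first member of a dense sequence within
  distance \<open>1 / (n + 1)\<close>.\<close>

lemma T_joint_measurable: "(\<lambda>p. T (snd p) (fst p)) \<in> borel_measurable (P \<Otimes>\<^sub>M sphere_measure)"
proof -
  obtain D :: "'a set" where D: "countable D" "D \<subseteq> sphere 0 1" "sphere 0 1 \<subseteq> closure D"
    using separable[of "sphere (0::'a) 1"] by blast
  obtain z :: 'a where z: "norm z = 1" using norm_Basis nonempty_Basis by blast
  then have Dne: "D \<noteq> {}" using D(3) by auto
  define d where "d = from_nat_into D"
  have rd: "range d = D" unfolding d_def by (rule range_from_nat_into[OF Dne D(1)])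
  have dn: "norm (d i) = 1" for i using rd D(2) by (metis rangeI mem_sphere_0 subsetD)
  define g where "g n x = (LEAST i. dist (d i) x < inverse (real (Suc n)))" for n :: nat and x
  have dm: "(\<lambda>x. dist (d i) x) \<in> borel_measurable sphere_measure" for i
    by (intro sphere_measure_measurable continuous_intros)
  have gm: "g n \<in> measurable sphere_measure (count_space UNIV)" for n
    unfolding g_def
  proof (rule measurable_Least)
    fix i
    show "(\<lambda>x. dist (d i) x < inverse (real (Suc n))) \<in> measurable sphere_measure (count_space UNIV)"
      using dm[of i] by measurable
  qed
  have Tm: "T (d i) \<in> borel_measurable P" for i by (rule H_char(1)[OF T_in_H[OF dn]])
  show ?thesis
  proof (rule borel_measurable_LIMSEQ_metric)
    fix n
    show "(\<lambda>p. T (d (g n (snd p))) (fst p)) \<in> borel_measurable (P \<Otimes>\<^sub>M sphere_measure)"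
      by (rule measurable_compose_countable[where f = "\<lambda>i p. T (d i) (fst p)" and g = "\<lambda>p. g n (snd p)"])
         (rule measurable_compose[OF measurable_fst Tm], rule measurable_compose[OF measurable_snd gm])
  next
    fix p assume "p \<in> space (P \<Otimes>\<^sub>M (sphere_measure :: 'a measure))"
    then have w: "fst p \<in> space P" and x: "norm (snd p) = 1" by (auto simp: space_pair_measure)
    have close: "dist (d (g n (snd p))) (snd p) < inverse (real (Suc n))" for n
    proof -
      have "snd p \<in> closure D" using D(3) x by auto
      then obtain y where "y \<in> D" "dist y (snd p) < inverse (real (Suc n))"
        unfolding closure_approachable by (meson inverse_positive_iff_positive of_nat_0_less_iff zero_less_Suc)
      then have "\<exists>i. dist (d i) (snd p) < inverse (real (Suc n))" using rd by auto
      then show ?thesis unfolding g_def by (rule LeastI_ex)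
    qed
    have lim: "(\<lambda>n. d (g n (snd p))) \<longlonglongrightarrow> snd p"
      by (rule tendsto_dist_iff[THEN iffD2], rule tendsto_sandwich[OF _ _ tendsto_const LIMSEQ_inverse_real_of_nat])
         (use close in \<open>auto intro!: always_eventually less_imp_le\<close>)
    have c: "continuous_on (sphere 0 1) (\<lambda>x. T x (fst p))" using field w by (simp add: gaussian_eigenfunction_def)
    show "(\<lambda>n. T (d (g n (snd p))) (fst p)) \<longlonglongrightarrow> T (snd p) (fst p)"
      by (rule continuous_on_tendsto_compose[OF c lim]) (use x dn in auto)
  qed
qed

lemma sphere_functional_measurable:
  assumes [measurable]: "M \<in> borel_measurable borel"
  shows "sphere_functional M T \<in> borel_measurable P"
proof -
  interpret s: finite_measure "sphere_measure :: 'a measure" by (rule finite_measure_sphere)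
  have "(\<lambda>p. M (T (snd p) (fst p))) \<in> borel_measurable (P \<Otimes>\<^sub>M sphere_measure)"
    by (rule measurable_compose[OF T_joint_measurable assms])
  then have "(\<lambda>\<omega>. \<integral>x. M (T x \<omega>) \<partial>sphere_measure) \<in> borel_measurable P"
    by (intro s.borel_measurable_lebesgue_integral) (simp add: case_prod_beta')
  then show ?thesis unfolding sphere_functional_def[abs_def] .
qed

end

context sphere_eigenfield_basis
begin

abbreviation N :: "nat \<Rightarrow> real" where "N \<equiv> gegenbauer_moment l m"

text \<open>The inner integral is that of a zonal function and does not depend on its
  centre.\<close>

lemma covariance_power_integral:
  assumes ge: "gaussian_expansion (sphere_measure :: 'a measure) n (\<lambda>k. proj (b k)) \<kappa>"
    and cov: "\<And>x y. norm x = 1 \<Longrightarrow> norm y = 1 \<Longrightarrow> (\<Sum>k<n. proj (b k) x * proj (b k) y) = gegenbauer l m (x \<bullet> y)"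
  shows "gaussian_expansion.I (sphere_measure :: 'a measure) n (\<lambda>k. proj (b k)) j
    = measure (sphere_measure :: 'a measure) (sphere 0 1) * (zonal_constant TYPE('a) * N j)"
proof -
  interpret GE: gaussian_expansion "sphere_measure :: 'a measure" n "\<lambda>k. proj (b k)" \<kappa> by (rule ge)
  have "GE.I j = (\<integral>x. \<integral>y. \<bar>GE.cov x y\<bar> ^ j \<partial>sphere_measure \<partial>sphere_measure)"
    unfolding GE.I_def using GE.ss.integral_fst'[OF GE.cov_power_integrable, of j] by simp
  also have "\<dots> = (\<integral>x. zonal_constant TYPE('a) * N j \<partial>(sphere_measure :: 'a measure))"
  proof (rule Bochner_Integration.integral_cong[OF refl])
    fix x :: 'a assume "x \<in> space sphere_measure"
    then have x: "norm x = 1" by simp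
    have "(\<integral>y. \<bar>GE.cov x y\<bar> ^ j \<partial>sphere_measure) = (\<integral>y. \<bar>gegenbauer l m (y \<bullet> x)\<bar> ^ j \<partial>sphere_measure)"
      using cov[OF x] by (intro Bochner_Integration.integral_cong refl) (simp add: GE.cov_def inner_commute)
    also have "\<dots> = zonal_constant TYPE('a) * integral {0..pi} (\<lambda>\<theta>. \<bar>gegenbauer l m (cos \<theta>)\<bar> ^ j * sin \<theta> ^ (DIM('a) - 2))"
    proof (rule zonal_integral[OF x])
      show "DIM('a) \<ge> 2" using dim m2 by simp
      show "continuous_on UNIV (\<lambda>t. \<bar>gegenbauer l m t\<bar> ^ j)"
        unfolding poly_gegenbauer[symmetric] by (intro continuous_intros)
    qed
    finally show "(\<integral>y. \<bar>GE.cov x y\<bar> ^ j \<partial>sphere_measure) = zonal_constant TYPE('a) * N j" by (simp add: gegenbauer_moment_def dim)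
  qed
  finally show ?thesis by simp
qed

text \<open>Almost surely \<open>S\<close> is \<open>S'\<close> of the coefficient vector, whose law
  is standard Gaussian, so mean, variance and test function carry over. In
  \<open>I j / (\<kappa> * V)\<close> the mass and the zonal constant cancel and
  \<open>N j / N 2\<close> is left.\<close>

theorem sphere_functional_normal_approximation:
  fixes M \<psi> h :: "real \<Rightarrow> real"
  assumes c2: "c2 \<noteq> 0"
    and cb: "corr_bound (\<lambda>t. t\<^sup>2 - 1) 2 K" "corr_bound (\<lambda>t. t ^ 3 - 3 * t) 2 K" "corr_bound (\<lambda>t. t ^ 4 - 3 * t\<^sup>2) 2 K"
    and cb5: "corr_bound \<psi> 5 K" and psi0: "(\<integral>t. \<psi> t \<partial>std_normal_distribution) = 0"
    and M: "\<And>t. M t = m0 + m1 * t + poly (Phi_poly c2 c3 c4) t + \<psi> t"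
    and h: "1-lipschitz_on UNIV h"
  defines "S \<equiv> sphere_functional M T"
    and "V \<equiv> measure (sphere_measure :: 'a measure) (sphere 0 1)"
  shows "\<bar>expectation (\<lambda>\<omega>. h ((S \<omega> - expectation S) / sqrt (variance S))) - (\<integral>x. h x \<partial>std_normal_distribution)\<bar>
    \<le> 14 * (sqrt (K * (zonal_constant TYPE('a) * N 2) / V) * (1 + 6 * (\<bar>c3\<bar> + \<bar>c4\<bar>) / \<bar>c2\<bar>)
          + 4 * K * (c3\<^sup>2 + \<bar>c3 * c4\<bar> + c4\<^sup>2) / c2\<^sup>2 * (N 3 / N 2))
      + 2 * sqrt (K / (2 * c2\<^sup>2) * (N 5 / N 2))"
proof -
  obtain n b where ge: "gaussian_expansion (sphere_measure :: 'a measure) n (\<lambda>k. proj (b k)) \<kappa>"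
    and cov: "\<And>x y. norm x = 1 \<Longrightarrow> norm y = 1 \<Longrightarrow> (\<Sum>k<n. proj (b k) x * proj (b k) y) = gegenbauer l m (x \<bullet> y)"
    and bm: "(\<lambda>\<omega>. \<lambda>k\<in>{..<n}. b k \<omega>) \<in> measurable P (std_gaussian n)"
    and bd: "distr P (std_gaussian n) (\<lambda>\<omega>. \<lambda>k\<in>{..<n}. b k \<omega>) = std_gaussian n"
    and TA: "AE \<omega> in P. \<forall>x. norm x = 1 \<longrightarrow> T x \<omega> = (\<Sum>k<n. proj (b k) x * b k \<omega>)"
    by (rule karhunen_loeve) (rule that, assumption+)
  interpret GE: gaussian_expansion "sphere_measure :: 'a measure" n "\<lambda>k. proj (b k)" \<kappa> by (rule ge)
  define B where "B \<omega> = (\<lambda>k\<in>{..<n}. b k \<omega>)" for \<omega>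
  define S' where "S' a = (\<integral>x. M (GE.\<tau> a x) \<partial>sphere_measure)" for a
  have [measurable]: "\<psi> \<in> borel_measurable borel" using cb5 unfolding corr_bound_def by blast
  have [measurable]: "(\<lambda>t. poly q t) \<in> borel_measurable borel" for q :: "real poly"
    by (intro borel_measurable_continuous_onI continuous_intros)
  have Mm [measurable]: "M \<in> borel_measurable borel" unfolding M[abs_def] by measurable
  have [measurable]: "h \<in> borel_measurable borel"
    by (intro borel_measurable_continuous_onI lipschitz_on_continuous_on[OF h])
  have Sm [measurable]: "S \<in> borel_measurable P" unfolding S_def by (rule sphere_functional_measurable[OF Mm])
  have Bm [measurable]: "B \<in> measurable P (std_gaussian n)" using bm by (simp add: B_def[abs_def])
  have Bd: "distr P (std_gaussian n) B = std_gaussian n" using bd by (simp add: B_def[abs_def])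
  have S'm [measurable]: "S' \<in> borel_measurable (std_gaussian n)"
    unfolding S'_def using measurable_compose[OF GE.tau_measurable' Mm]
    by (intro GE.s.borel_measurable_lebesgue_integral) (simp add: case_prod_beta')
  have SS': "AE \<omega> in P. S \<omega> = S' (B \<omega>)"
    using TA
  proof eventually_elim
    fix \<omega> assume w: "\<forall>x. norm x = 1 \<longrightarrow> T x \<omega> = (\<Sum>k<n. proj (b k) x * b k \<omega>)"
    show "S \<omega> = S' (B \<omega>)" unfolding S_def S'_def sphere_functional_def
    proof (rule Bochner_Integration.integral_cong[OF refl])
      fix x :: 'a assume "x \<in> space sphere_measure"
      then have "T x \<omega> = (\<Sum>k<n. proj (b k) x * b k \<omega>)" using w by simp
      also have "\<dots> = GE.\<tau> (B \<omega>) x" unfolding GE.\<tau>_def B_def by (intro sum.cong) auto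
      finally show "M (T x \<omega>) = M (GE.\<tau> (B \<omega>) x)" by simp
    qed
  qed
  have tr: "expectation (\<lambda>\<omega>. f (S \<omega>)) = (\<integral>a. f (S' a) \<partial>std_gaussian n)" if [measurable]: "f \<in> borel_measurable borel" for f :: "real \<Rightarrow> real"
  proof -
    have "expectation (\<lambda>\<omega>. f (S \<omega>)) = expectation (\<lambda>\<omega>. f (S' (B \<omega>)))"
      by (rule integral_cong_AE) (use SS' in auto)
    also have "\<dots> = (\<integral>a. f (S' a) \<partial>distr P (std_gaussian n) B)" by (rule integral_distr[symmetric]) auto
    finally show ?thesis unfolding Bd .
  qed
  have ES: "expectation S = (\<integral>a. S' a \<partial>std_gaussian n)" using tr[of "\<lambda>x. x"] by simp
  have VS: "variance S = (\<integral>a. (S' a - (\<integral>a. S' a \<partial>std_gaussian n))\<^sup>2 \<partial>std_gaussian n)"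
    unfolding ES by (rule tr) simp
  have mass: "0 < measure (sphere_measure :: 'a measure) (space sphere_measure)" using measure_sphere_pos by simp
  have V: "V > 0" unfolding V_def by (rule measure_sphere_pos)
  have zc: "zonal_constant TYPE('a) > 0" by (rule zonal_constant_pos)
  have N2: "N 2 > 0" using kappa_pos zc unfolding kappa by (simp add: zero_less_mult_iff)
  have vol: "GE.vol = V" using GE.vol_def[OF mass c2 cb] by (simp add: V_def)
  have I: "GE.I j = V * (zonal_constant TYPE('a) * N j)" for j
    unfolding V_def by (rule covariance_power_integral[OF ge cov])
  have R: "GE.I j / (\<kappa> * V) = N j / N 2" for j unfolding I kappa using V zc N2 by (simp add: field_simps)
  have del: "GE.\<delta> c2 c3 c4 K = sqrt (K * (zonal_constant TYPE('a) * N 2) / V) * (1 + 6 * (\<bar>c3\<bar> + \<bar>c4\<bar>) / \<bar>c2\<bar>)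
          + 4 * K * (c3\<^sup>2 + \<bar>c3 * c4\<bar> + c4\<^sup>2) / c2\<^sup>2 * (N 3 / N 2)"
    unfolding GE.\<delta>_def[OF mass c2 cb] vol R by (simp add: kappa)
  have last: "K * GE.I 5 / (2 * c2\<^sup>2 * \<kappa> * GE.vol) = K / (2 * c2\<^sup>2) * (N 5 / N 2)"
    unfolding R[symmetric] vol by simp
  have "expectation (\<lambda>\<omega>. h ((S \<omega> - expectation S) / sqrt (variance S)))
    = (\<integral>a. h ((S' a - (\<integral>a. S' a \<partial>std_gaussian n)) / sqrt (\<integral>a. (S' a - (\<integral>a. S' a \<partial>std_gaussian n))\<^sup>2 \<partial>std_gaussian n)) \<partial>std_gaussian n)"
    unfolding VS unfolding ES by (rule tr) simp
  then show ?thesis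
    using GE.functional_normal_approximation[OF mass c2 cb cb5 psi0 M h] unfolding S'_def[symmetric] del last by simp
qed

end

section \<open>Reduction to Hermite coefficients\<close>

definition gaussian_moment :: "nat \<Rightarrow> real" where
  "gaussian_moment k = (\<integral>x. x ^ k \<partial>std_normal_distribution)"

lemma gaussian_moment_values:
  "gaussian_moment 0 = 1" "gaussian_moment (Suc 0) = 0" "gaussian_moment 2 = 1" "gaussian_moment 3 = 0"
  "gaussian_moment 4 = 3" "gaussian_moment 5 = 0" "gaussian_moment 6 = 15" "gaussian_moment 7 = 0"
  "gaussian_moment 8 = 105"
  using std_normal_distribution_even_moments(1)[of 0] std_normal_distribution_even_moments(1)[of 1]
    std_normal_distribution_even_moments(1)[of 2] std_normal_distribution_even_moments(1)[of 3]
    std_normal_distribution_even_moments(1)[of 4]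
    integral_std_normal_distribution_moment_odd[of 1] integral_std_normal_distribution_moment_odd[of 3]
    integral_std_normal_distribution_moment_odd[of 5] integral_std_normal_distribution_moment_odd[of 7]
  unfolding gaussian_moment_def by (simp_all add: fact_numeral)

lemma integrable_poly_std_normal: "integrable std_normal_distribution (\<lambda>x. poly p x)"
  unfolding poly_altdef by (intro Bochner_Integration.integrable_sum integrable_mult_right integrable_std_normal_distribution_moment)

lemma integral_quartic_std_normal:
  "(\<integral>x. poly [:a0, a1, a2, a3, a4:] x * x ^ j \<partial>std_normal_distribution)
    = a0 * gaussian_moment j + a1 * gaussian_moment (j + 1) + a2 * gaussian_moment (j + 2)
      + a3 * gaussian_moment (j + 3) + a4 * gaussian_moment (j + 4)"
proof -
  have "poly [:a0, a1, a2, a3, a4:] x * x ^ j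
      = a0 * x ^ j + a1 * x ^ (j + 1) + a2 * x ^ (j + 2) + a3 * x ^ (j + 3) + a4 * x ^ (j + 4)" for x
    by (simp add: algebra_simps power_add power2_eq_square power3_eq_cube power4_eq_xxxx)
  then show ?thesis
    using integrable_std_normal_distribution_moment[of j] integrable_std_normal_distribution_moment[of "j + 1"]
      integrable_std_normal_distribution_moment[of "j + 2"] integrable_std_normal_distribution_moment[of "j + 3"]
      integrable_std_normal_distribution_moment[of "j + 4"]
    by (simp del: poly_pCons add: gaussian_moment_def)
qed

lemma corr_bound_poly:
  assumes "\<And>j. j < k \<Longrightarrow> (\<integral>x. poly p x * x ^ j \<partial>std_normal_distribution) = 0"
  obtains K where "corr_bound (poly p) k K"
proof (rule corr_bound_exists[OF _ _ assms])
  show "poly p \<in> borel_measurable borel" by (intro borel_measurable_continuous_onI continuous_intros)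
  show "integrable std_normal_distribution (\<lambda>x. (poly p x)\<^sup>2)"
    using integrable_poly_std_normal[of "p * p"] by (simp add: power2_eq_square)
qed

text \<open>Trailing zeros put all three polynomials into the form of
  \<open>integral_quartic_std_normal\<close>; orthogonality to 1 and \<open>t\<close> is then a
  check of Gaussian moments.\<close>

lemma corr_bound_hermite:
  obtains K where "corr_bound (\<lambda>t. t\<^sup>2 - 1) 2 K" "corr_bound (\<lambda>t. t ^ 3 - 3 * t) 2 K" "corr_bound (\<lambda>t. t ^ 4 - 3 * t\<^sup>2) 2 K"
proof -
  have two: "j = 0 \<or> j = 1" if "j < 2" for j :: nat using that by linarith
  have "(\<integral>x. poly [:-1, 0, 1, 0, 0:] x * x ^ j \<partial>std_normal_distribution) = 0" if "j < 2" for j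
    using two[OF that] unfolding integral_quartic_std_normal by (auto simp: gaussian_moment_values numeral_2_eq_2[symmetric] numeral_3_eq_3[symmetric])
  then obtain K1 where K1: "corr_bound (poly [:-1, 0, 1, 0, 0:]) 2 K1" using corr_bound_poly by blast
  have "(\<integral>x. poly [:0, -3, 0, 1, 0:] x * x ^ j \<partial>std_normal_distribution) = 0" if "j < 2" for j
    using two[OF that] unfolding integral_quartic_std_normal by (auto simp: gaussian_moment_values numeral_2_eq_2[symmetric] numeral_3_eq_3[symmetric])
  then obtain K2 where K2: "corr_bound (poly [:0, -3, 0, 1, 0:]) 2 K2" using corr_bound_poly by blast
  have "(\<integral>x. poly [:0, 0, -3, 0, 1:] x * x ^ j \<partial>std_normal_distribution) = 0" if "j < 2" for j
    using two[OF that] unfolding integral_quartic_std_normal by (auto simp: gaussian_moment_values numeral_2_eq_2[symmetric] numeral_3_eq_3[symmetric])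
  then obtain K3 where K3: "corr_bound (poly [:0, 0, -3, 0, 1:]) 2 K3" using corr_bound_poly by blast
  have p: "poly [:-1, 0, 1, 0, 0:] = (\<lambda>t::real. t\<^sup>2 - 1)" "poly [:0, -3, 0, 1, 0:] = (\<lambda>t::real. t ^ 3 - 3 * t)"
    "poly [:0, 0, -3, 0, 1:] = (\<lambda>t::real. t ^ 4 - 3 * t\<^sup>2)"
    by (auto simp: fun_eq_iff algebra_simps power2_eq_square power3_eq_cube power4_eq_xxxx)
  show ?thesis
    by (rule that[of "max K1 (max K2 K3)"])
       (use K1[unfolded p] K2[unfolded p] K3[unfolded p] in \<open>auto intro: corr_bound_mono\<close>)
qed

text \<open>\<psi> is \<open>M\<close> minus its L2 projection onto the polynomials of degree at
  most 4, with coefficients \<open>E (M H_k) / k!\<close>. Orthogonality is verified against the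
  powers, where it becomes a linear identity between Gaussian moments up to order 8.\<close>

lemma hermite_remainder:
  fixes M :: "real \<Rightarrow> real"
  assumes Mm [measurable]: "M \<in> borel_measurable borel" and M2: "integrable std_normal_distribution (\<lambda>x. (M x)\<^sup>2)"
    and c2: "c2 = (\<integral>x. M x * (x\<^sup>2 - 1) \<partial>std_normal_distribution) / 2"
  obtains c3 c4 m0 m1 \<psi> K where
    "\<And>t. M t = m0 + m1 * t + poly (Phi_poly c2 c3 c4) t + \<psi> t"
    "corr_bound \<psi> 5 K" "(\<integral>t. \<psi> t \<partial>std_normal_distribution) = 0"
proof -
  have Mi: "integrable std_normal_distribution (\<lambda>x. M x * x ^ j)" for j
    by (rule integrable_mult_L2) (use M2 integrable_std_normal_distribution_moment[of "j * 2"] in \<open>auto simp: power_mult\<close>)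
  define J where "J j = (\<integral>x. M x * x ^ j \<partial>std_normal_distribution)" for j
  define c3 c4 where "c3 = (J 3 - 3 * J 1) / 6" and "c4 = (J 4 - 6 * J 2 + 3 * J 0) / 24"
  have c2_def: "c2 = (J 2 - J 0) / 2"
    unfolding c2 J_def using Mi[of 2] Mi[of 0] by (simp add: algebra_simps)
  \<comment> \<open>The projection \<open>J 0 + J 1 * t + c2 * H_2 + c3 * H_3 + c4 * H_4\<close>,
    sorted by powers of \<open>t\<close>.\<close>
  define q where "q = [:J 0 - c2 + 3 * c4, J 1 - 3 * c3, c2 - 6 * c4, c3, c4:]"
  define \<psi> where "\<psi> t = M t - poly q t" for t
  have M: "M t = J 0 + J 1 * t + poly (Phi_poly c2 c3 c4) t + \<psi> t" for t
    unfolding \<psi>_def q_def poly_Phi by (simp add: algebra_simps power2_eq_square power3_eq_cube power4_eq_xxxx)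
  have pm [measurable]: "poly q \<in> borel_measurable borel" by (intro borel_measurable_continuous_onI continuous_intros)
  have psim [measurable]: "\<psi> \<in> borel_measurable borel" unfolding \<psi>_def[abs_def] by measurable
  have q2: "integrable std_normal_distribution (\<lambda>x. (poly q x)\<^sup>2)"
    using integrable_poly_std_normal[of "q * q"] by (simp add: power2_eq_square)
  have psi2: "integrable std_normal_distribution (\<lambda>x. (\<psi> x)\<^sup>2)"
  proof -
    have "integrable std_normal_distribution (\<lambda>x. (M x)\<^sup>2 - 2 * (M x * poly q x) + (poly q x)\<^sup>2)"
      by (intro Bochner_Integration.integrable_add Bochner_Integration.integrable_diff integrable_mult_right integrable_mult_L2 M2 q2) auto
    then show ?thesis unfolding \<psi>_def by (simp add: power2_diff algebra_simps)
  qed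
  have qi: "integrable std_normal_distribution (\<lambda>x. poly q x * x ^ j)" for j
    using integrable_poly_std_normal[of "q * monom 1 j"] by (simp add: poly_monom)
  have orth: "(\<integral>x. \<psi> x * x ^ j \<partial>std_normal_distribution) = 0" if "j < 5" for j
  proof -
    have "(\<integral>x. poly q x * x ^ j \<partial>std_normal_distribution) = J j"
    proof -
      consider "j = 0" | "j = 1" | "j = 2" | "j = 3" | "j = 4" using \<open>j < 5\<close> by linarith
      then show ?thesis unfolding q_def integral_quartic_std_normal
        by cases (simp_all add: gaussian_moment_values numeral_2_eq_2[symmetric] numeral_3_eq_3[symmetric] c2_def c3_def c4_def field_simps)
    qed
    then show ?thesis
      unfolding \<psi>_def left_diff_distrib Bochner_Integration.integral_diff[OF Mi qi] by (simp add: J_def)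
  qed
  obtain K where K: "corr_bound \<psi> 5 K" using corr_bound_exists[OF psim psi2 orth] by blast
  have "(\<integral>t. \<psi> t \<partial>std_normal_distribution) = 0" using orth[of 0] by simp
  then show ?thesis using that[of "J 0" "J 1" c3 c4 \<psi> K] M K by blast
qed

theorem theorem0p0p5:
  fixes m :: nat
    and P :: "nat \<Rightarrow> 'w measure"
    and T :: "nat \<Rightarrow> 'a::euclidean_space \<Rightarrow> 'w \<Rightarrow> real"
    and N :: "'z measure"
    and Z :: "'z \<Rightarrow> real"
    and M :: "real \<Rightarrow> real"
    and S :: "nat \<Rightarrow> 'w \<Rightarrow> real"
  assumes "m \<ge> 2" and "DIM('a) = m + 1"
    and "\<And>l. gaussian_eigenfunction m l (P l) (T l)"
    and "prob_space N" and "distributed N lborel Z (\<lambda>x. ennreal (std_normal_density x))"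
    and "M \<in> borel_measurable borel"
    and "integrable N (\<lambda>\<omega>. (M (Z \<omega>))\<^sup>2)"
    and "prob_space.expectation N (\<lambda>\<omega>. M (Z \<omega>) * ((Z \<omega>)\<^sup>2 - 1)) \<noteq> 0"
  defines "S \<equiv> \<lambda>l. sphere_functional M (T l)"
  shows "\<exists>C::real. \<forall>\<^sub>F l in sequentially \<sqinter> principal {l. even l}.
           wasserstein (P l)
             (\<lambda>\<omega>. (S l \<omega> - prob_space.expectation (P l) (S l)) / sqrt (prob_space.variance (P l) (S l)))
             N Z
           \<le> ennreal (C * real l powr (- 1 / 2))"
proof -
  have [measurable]: "M \<in> borel_measurable borel" by fact
  have Zm [measurable]: "Z \<in> borel_measurable N" using assms(5) by (simp add: distributed_def)
  have Zd: "distr N borel Z = std_normal_distribution"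
  proof -
    have "distr N borel Z = distr N lborel Z" by (rule distr_cong) auto
    then show ?thesis using assms(5) by (simp add: distributed_def)
  qed
  have EZ: "(\<integral>\<omega>. f (Z \<omega>) \<partial>N) = (\<integral>x. f x \<partial>std_normal_distribution)" if "f \<in> borel_measurable borel" for f :: "real \<Rightarrow> real"
    using integral_distr[OF Zm that] unfolding Zd by simp
  have M2: "integrable std_normal_distribution (\<lambda>x. (M x)\<^sup>2)"
    using assms(7) integrable_distr_eq[OF Zm, of "\<lambda>x. (M x)\<^sup>2"] unfolding Zd by simp
  \<comment> \<open>The second Hermite coefficient of \<open>M\<close>, hence the division by
    \<open>2!\<close>; that it is non-zero keeps the leading variance non-degenerate.\<close>
  define c2 where "c2 = (\<integral>x. M x * (x\<^sup>2 - 1) \<partial>std_normal_distribution) / 2"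
  have c2: "c2 \<noteq> 0" unfolding c2_def using assms(8) by (subst (asm) EZ) auto
  obtain c3 c4 m0 m1 \<psi> K1 where M: "\<And>t. M t = m0 + m1 * t + poly (Phi_poly c2 c3 c4) t + \<psi> t"
    and K1: "corr_bound \<psi> 5 K1" and psi0: "(\<integral>t. \<psi> t \<partial>std_normal_distribution) = 0"
    by (rule hermite_remainder[OF assms(6) M2 c2_def]) (rule that, assumption+)
  obtain K2 where K2: "corr_bound (\<lambda>t. t\<^sup>2 - 1) 2 K2" "corr_bound (\<lambda>t. t ^ 3 - 3 * t) 2 K2" "corr_bound (\<lambda>t. t ^ 4 - 3 * t\<^sup>2) 2 K2"
    by (rule corr_bound_hermite)
  define K where "K = max K1 K2"
  have cb: "corr_bound (\<lambda>t. t\<^sup>2 - 1) 2 K" "corr_bound (\<lambda>t. t ^ 3 - 3 * t) 2 K" "corr_bound (\<lambda>t. t ^ 4 - 3 * t\<^sup>2) 2 K" "corr_bound \<psi> 5 K"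
    using K1 K2 by (auto simp: K_def intro: corr_bound_mono)
  have K0: "K \<ge> 0" using cb(4) unfolding corr_bound_def by blast
  obtain C l0 where C: "C > 0" and l0: "l0 \<ge> (1::nat)" and gb:
    "\<And>l. l \<ge> l0 \<Longrightarrow> (\<And>t. \<bar>t\<bar> \<le> 1 \<Longrightarrow> \<bar>gegenbauer l m t\<bar> \<le> 1) \<Longrightarrow>
       0 < gegenbauer_moment l m 2 \<and>
       gegenbauer_moment l m 2 \<le> C / real l \<and>
       gegenbauer_moment l m 3
         \<le> C / sqrt (real l) * gegenbauer_moment l m 2 \<and>
       gegenbauer_moment l m 5
         \<le> C / real l * gegenbauer_moment l m 2"
    by (rule gegenbauer_integral_bounds[OF assms(1)]) (rule that, assumption, assumption, blast)
  define V where "V = measure (sphere_measure :: 'a measure) (sphere 0 1)"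
  define zc where "zc = zonal_constant TYPE('a)"
  have V: "V > 0" unfolding V_def by (rule measure_sphere_pos)
  have zc: "zc > 0" unfolding zc_def by (rule zonal_constant_pos)
  define A where "A = 1 + 6 * (\<bar>c3\<bar> + \<bar>c4\<bar>) / \<bar>c2\<bar>"
  define B where "B = 4 * K * (c3\<^sup>2 + \<bar>c3 * c4\<bar> + c4\<^sup>2) / c2\<^sup>2"
  have A: "A \<ge> 0" and B: "B \<ge> 0" using K0 by (auto simp: A_def B_def)
  \<comment> \<open>The bound of \<open>sphere_functional_normal_approximation\<close> with each
    moment or quotient of moments replaced by its constant \<open>C\<close>. The test function
    \<open>h\<close> does not enter, so the supremum over all of them is covered.\<close>
  define E where "E = 14 * (sqrt (K * (zc * C) / V) * A + B * C) + 2 * sqrt (K / (2 * c2\<^sup>2) * C)"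
  have bound: "wasserstein (P l) (\<lambda>\<omega>. (S l \<omega> - prob_space.expectation (P l) (S l)) / sqrt (prob_space.variance (P l) (S l))) N Z
       \<le> ennreal (E * real l powr (- 1 / 2))" if l: "l \<ge> l0" for l
  proof -
    interpret F: sphere_eigenfield m l "P l" "T l"
      by unfold_locales (use assms l l0 in auto)
    define n where "n = gegenbauer_moment l m"
    note g = gb[OF l F.gegenbauer_abs_le_1, folded n_def]
    have n2: "0 < n 2" "n 2 \<le> C / real l" and n3: "n 3 \<le> C / sqrt (real l) * n 2" and n5: "n 5 \<le> C / real l * n 2" using g by auto
    \<comment> \<open>\<open>n 2 > 0\<close>, available from \<open>l0\<close> on, provides the
      positivity of the eigenvalue.\<close>
    interpret FB: sphere_eigenfield_basis m l "P l" "T l" "zc * n 2"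
      by unfold_locales (use zc n2 in \<open>auto simp: zc_def n_def\<close>)
    have lpos: "real l > 0" using l l0 by simp
    have r3: "n 3 / n 2 \<le> C / sqrt (real l)" and r5: "n 5 / n 2 \<le> C / real l"
      using n2 n3 n5 by (auto simp: pos_divide_le_eq)
    have t1: "sqrt (K * (zc * n 2) / V) \<le> sqrt (K * (zc * C) / V) / sqrt (real l)"
    proof -
      have "K * (zc * n 2) / V \<le> K * (zc * (C / real l)) / V"
        using n2 K0 zc V by (intro divide_right_mono mult_left_mono) auto
      then show ?thesis unfolding real_sqrt_divide[symmetric] by (intro real_sqrt_le_mono) (simp add: field_simps)
    qed
    have t3: "sqrt (K / (2 * c2\<^sup>2) * (n 5 / n 2)) \<le> sqrt (K / (2 * c2\<^sup>2) * C) / sqrt (real l)"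
    proof -
      have "K / (2 * c2\<^sup>2) * (n 5 / n 2) \<le> K / (2 * c2\<^sup>2) * (C / real l)"
        using r5 K0 by (intro mult_left_mono) auto
      then show ?thesis unfolding real_sqrt_divide[symmetric] by (intro real_sqrt_le_mono) simp
    qed
    have tot: "14 * (sqrt (K * (zc * n 2) / V) * A + B * (n 3 / n 2)) + 2 * sqrt (K / (2 * c2\<^sup>2) * (n 5 / n 2)) \<le> E / sqrt (real l)"
    proof -
      have "14 * (sqrt (K * (zc * n 2) / V) * A + B * (n 3 / n 2)) + 2 * sqrt (K / (2 * c2\<^sup>2) * (n 5 / n 2))
        \<le> 14 * (sqrt (K * (zc * C) / V) / sqrt (real l) * A + B * (C / sqrt (real l))) + 2 * (sqrt (K / (2 * c2\<^sup>2) * C) / sqrt (real l))"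
        by (intro add_mono mult_left_mono mult_right_mono t1 t3 r3 A B) auto
      also have "\<dots> = E / sqrt (real l)" by (simp add: E_def add_divide_distrib distrib_left)
      finally show ?thesis .
    qed
    have powr: "real l powr (- 1 / 2) = 1 / sqrt (real l)"
      using lpos by (simp add: powr_minus_divide powr_half_sqrt)
    show ?thesis
      unfolding wasserstein_def
    proof (rule SUP_least)
      fix h :: "real \<Rightarrow> real" assume "h \<in> {h. 1-lipschitz_on UNIV h}"
      then have h: "1-lipschitz_on UNIV h" by simp
      have hm: "h \<in> borel_measurable borel"
        by (intro borel_measurable_continuous_onI lipschitz_on_continuous_on[OF h])
      have "\<bar>prob_space.expectation (P l) (\<lambda>\<omega>. h ((S l \<omega> - prob_space.expectation (P l) (S l)) / sqrt (prob_space.variance (P l) (S l))))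
          - prob_space.expectation N (\<lambda>\<omega>. h (Z \<omega>))\<bar> \<le> E / sqrt (real l)"
        using order_trans[OF FB.sphere_functional_normal_approximation[OF c2 cb(1,2,3,4) psi0 M h, folded V_def n_def zc_def A_def B_def] tot]
        unfolding S_def EZ[OF hm] .
      then show "ennreal \<bar>prob_space.expectation (P l) (\<lambda>\<omega>. h ((S l \<omega> - prob_space.expectation (P l) (S l)) / sqrt (prob_space.variance (P l) (S l))))
          - prob_space.expectation N (\<lambda>\<omega>. h (Z \<omega>))\<bar> \<le> ennreal (E * real l powr (- 1 / 2))"
        unfolding powr by (intro ennreal_leI) simp
    qed
  qed
  show ?thesis
    by (rule exI[of _ E], rule filter_leD[OF inf_le1], rule eventually_sequentiallyI[of l0], rule bound)
qed

end
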